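(* Let $t_0>0$, $v_1>0$ and $x_1<0$ be given. Assume $G^*$ is on a negative excursion at time $t_0$, and define $\tau^{t_0}_{\mathcal V^*}=\inf\{t\ge t_0:\mathcal V^*(t)=0\}$ and $\tau^{t_0}_{\mathcal X^*}=\inf\{t\ge t_0:\mathcal X^*(t)=0\}$. Set $$\alpha:=\arctan\Big(-\frac{\sqrt{1-\rho^2}}{\rho}\Big)\in(0,\pi/2),\qquad \theta_0:=\arctan\Big(\frac{\sigma_+\sqrt{1-\rho^2}\,|x_1|}{\sigma_-v_1+\sigma_+\rho x_1}\Big).$$ Then $$\mathbb P\{\tau^{t_0}_{\mathcal V^*}<\tau^{t_0}_{\mathcal X^*}\mid\mathcal V^*(t_0)=v_1,\mathcal X^*(t_0)=x_1\}=\frac{\theta_0}{\alpha},$$ $$\mathbb P\{\tau^{t_0}_{\mathcal X^*}<\tau^{t_0}_{\mathcal V^*}\mid\mathcal V^*(t_0)=v_1,\mathcal X^*(t_0)=x_1\}=\frac{\alpha-\theta_0}{\alpha}.$$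
   Context: Parameters. $a>1$, $b>1$ satisfy $a+b>ab$, and $\lambda_0,\lambda_1,\lambda_2,\mu_0,\mu_1,\mu_2>0$ satisfy $a\lambda_0=b\mu_0$, $\lambda_1=(a-1)\lambda_0$, $\lambda_2=(a+b-ab)\lambda_0$, $\mu_1=(b-1)\mu_0$, $\mu_2=(a+b-ab)\mu_0$; also $\theta_b>0$. Put $\sigma_+=\sqrt{2(\lambda_0+b\lambda_1)}$, $\sigma_-=\sqrt{2(\mu_0+a\mu_1)}$, $\rho=-\frac{2(\lambda_1+\mu_1)}{\sigma_+\sigma_-}\in(-1,0)$, $\kappa_L=\frac{\lambda_2\mu_1}{\theta_b\lambda_1}>0$. Limit processes. Let $B$ be a standard Brownian motion, $P^B_\pm(t)=\int_0^t1_{\{\pm B(s)>0\}}ds$, $\Theta=\sigma_+^{-2}P_+^B+\sigma_-^{-2}P_-^B$ and $G^*=B\circ\Theta^{-1}$ (two-speed Brownian motion with speeds $\sigma_\pm^2$). Put $\mathcal X^*=\min\{G^*,0\}$. Let $\{(\Lambda_{k,-},R_{k,-})\}_{k\ge1}$ be an enumeration (a function of the path of $G^*$) of the intervals of negative excursions of $G^*$ away from $0$, and let $E_{k,-}(t)=G^*((\Lambda_{k,-}+t)\wedge R_{k,-})$. Let $\widetilde C_{k,-}$ ($k\ge1$) be independent Brownian motions started at $0$, independent of $G^*$, with quadratic variation rate $(1-\rho^2)\sigma_+^2$, and $C_{k,-}(t)=\widetilde C_{k,-}(t\wedge(R_{k,-}-\Lambda_{k,-}))$. For $t\ge0$, $\mathcal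 V^*(t)=\kappa_L+C_{k,-}(t-\Lambda_{k,-})-\frac{\rho\sigma_+}{\sigma_-}E_{k,-}(t-\Lambda_{k,-})$ if $t\in[\Lambda_{k,-},R_{k,-})$ for some $k$, and $\mathcal V^*(t)=\kappa_L$ otherwise. Conditioning on $\{\mathcal V^*(t_0)=v_1,\mathcal X^*(t_0)=x_1\}$ is in the sense of regular conditional distributions; since $x_1<0$ it entails $G^*(t_0)=x_1<0$. *)

theory Defs
  imports "HOL-Probability.Probability"
begin

text \<open>
  A process \<open>W\<close> is a function of time and outcome, written \<open>W t \<omega>\<close>; only the times \<open>t \<ge> 0\<close>
  are relevant.
\<close>

definition sample_path :: "(real \<Rightarrow> 'a \<Rightarrow> real) \<Rightarrow> 'a \<Rightarrow> real \<Rightarrow> real" where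
  "sample_path W \<omega> = (\<lambda>t\<in>{0..}. W t \<omega>)"

abbreviation path_space :: "(real \<Rightarrow> real) measure" where
  "path_space \<equiv> PiM {0..} (\<lambda>_. borel)"

text \<open>
  Driftless Brownian motion started at \<open>0\<close> with quadratic variation \<open>c t\<close>, where \<open>c > 0\<close>; the
  standard case is \<open>c = 1\<close>.
\<close>

definition brownian_motion :: "'a measure \<Rightarrow> real \<Rightarrow> (real \<Rightarrow> 'a \<Rightarrow> real) \<Rightarrow> bool" where
  "brownian_motion M c W \<longleftrightarrow>
     (\<forall>t\<ge>0. W t \<in> borel_measurable M) \<and>
     (\<forall>\<omega>\<in>space M. W 0 \<omega> = 0) \<and>
     (\<forall>\<omega>\<in>space M. continuous_on {0..} (\<lambda>t. W t \<omega>)) \<and>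
     (\<forall>s t. 0 \<le> s \<longrightarrow> s < t \<longrightarrow>
        distributed M lborel (\<lambda>\<omega>. W t \<omega> - W s \<omega>) (normal_density 0 (sqrt (c * (t - s))))) \<and>
     (\<forall>u :: nat \<Rightarrow> real. 0 \<le> u 0 \<longrightarrow> mono u \<longrightarrow>
        prob_space.indep_vars M (\<lambda>_. borel) (\<lambda>i \<omega>. W (u (Suc i)) \<omega> - W (u i) \<omega>) UNIV)"

definition occ_pos :: "(real \<Rightarrow> real) \<Rightarrow> real \<Rightarrow> real" where
  "occ_pos w t = (LBINT s:{0..t}. indicator {s. w s > 0} s)"

definition occ_neg :: "(real \<Rightarrow> real) \<Rightarrow> real \<Rightarrow> real" where
  "occ_neg w t = (LBINT s:{0..t}. indicator {s. w s < 0} s)"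

definition clock :: "real \<Rightarrow> real \<Rightarrow> (real \<Rightarrow> real) \<Rightarrow> real \<Rightarrow> real" where
  "clock \<sigma>p \<sigma>m w t = occ_pos w t / \<sigma>p\<^sup>2 + occ_neg w t / \<sigma>m\<^sup>2"

text \<open>
  For almost every Brownian path the clock is a bijection of the half-line, so the inverse exists.
  On the exceptional null set the process is put equal to \<open>0\<close>, which makes every path
  continuous.
\<close>

definition two_speed :: "real \<Rightarrow> real \<Rightarrow> (real \<Rightarrow> 'a \<Rightarrow> real) \<Rightarrow> real \<Rightarrow> 'a \<Rightarrow> real" where
  "two_speed \<sigma>p \<sigma>m B t \<omega> =
     (let w = (\<lambda>s. B s \<omega>) in
      if bij_betw (clock \<sigma>p \<sigma>m w) {0..} {0..} then w (inv_into {0..} (clock \<sigma>p \<sigma>m w) t) else 0)"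

text \<open>
  The interval \<open>(l, r)\<close> is a maximal interval of negativity: both end points are zeros. An
  unbounded last excursion is not covered; it has probability \<open>0\<close>.
\<close>

definition neg_excursion :: "(real \<Rightarrow> real) \<Rightarrow> real \<Rightarrow> real \<Rightarrow> bool" where
  "neg_excursion g l r \<longleftrightarrow>
     0 \<le> l \<and> l < r \<and> g l = 0 \<and> g r = 0 \<and> (\<forall>t\<in>{l<..<r}. g t < 0)"

text \<open>
  Measurability with respect to the \<open>\<sigma>\<close>-algebra pulled back along the path map says that
  \<open>L k\<close> and \<open>R k\<close> are measurable functions of the path of \<open>G\<close>. The bijection is required almost
  surely since exceptional paths need not have infinitely many excursions.
\<close>

definition neg_excursion_enumeration ::
    "'a measure \<Rightarrow> (real \<Rightarrow> 'a \<Rightarrow> real) \<Rightarrow> (nat \<Rightarrow> 'a \<Rightarrow> real) \<Rightarrow> (nat \<Rightarrow> 'a \<Rightarrow> real) \<Rightarrow> bool" where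
  "neg_excursion_enumeration M G L R \<longleftrightarrow>
     (\<forall>k. L k \<in> borel_measurable (vimage_algebra (space M) (sample_path G) path_space)) \<and>
     (\<forall>k. R k \<in> borel_measurable (vimage_algebra (space M) (sample_path G) path_space)) \<and>
     (AE \<omega> in M. bij_betw (\<lambda>k. (L k \<omega>, R k \<omega>)) UNIV
                    {(l, r). neg_excursion (\<lambda>t. G t \<omega>) l r})"

definition excursion ::
    "(real \<Rightarrow> 'a \<Rightarrow> real) \<Rightarrow> (nat \<Rightarrow> 'a \<Rightarrow> real) \<Rightarrow> (nat \<Rightarrow> 'a \<Rightarrow> real) \<Rightarrow> nat \<Rightarrow> real \<Rightarrow> 'a \<Rightarrow> real" where
  "excursion G L R k t \<omega> = G (min (L k \<omega> + t) (R k \<omega>)) \<omega>"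

definition stopped_bm ::
    "(nat \<Rightarrow> real \<Rightarrow> 'a \<Rightarrow> real) \<Rightarrow> (nat \<Rightarrow> 'a \<Rightarrow> real) \<Rightarrow> (nat \<Rightarrow> 'a \<Rightarrow> real) \<Rightarrow> nat \<Rightarrow> real \<Rightarrow> 'a \<Rightarrow> real" where
  "stopped_bm C L R k t \<omega> = C k (min t (R k \<omega> - L k \<omega>)) \<omega>"

text \<open>
  The argument \<open>c\<close> is the coefficient \<open>\<rho> \<sigma>p / \<sigma>m\<close>. Almost surely the intervals are disjoint, so
  at most one index \<open>k\<close> qualifies and \<open>LEAST\<close> just selects it.
\<close>

definition bid_process ::
    "real \<Rightarrow> real \<Rightarrow> (real \<Rightarrow> 'a \<Rightarrow> real) \<Rightarrow> (nat \<Rightarrow> 'a \<Rightarrow> real) \<Rightarrow> (nat \<Rightarrow> 'a \<Rightarrow> real)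
       \<Rightarrow> (nat \<Rightarrow> real \<Rightarrow> 'a \<Rightarrow> real) \<Rightarrow> real \<Rightarrow> 'a \<Rightarrow> real" where
  "bid_process \<kappa> c G L R C t \<omega> =
     (if \<exists>k. t \<in> {L k \<omega>..<R k \<omega>}
      then let k = (LEAST k. t \<in> {L k \<omega>..<R k \<omega>})
           in \<kappa> + stopped_bm C L R k (t - L k \<omega>) \<omega> - c * excursion G L R k (t - L k \<omega>) \<omega>
      else \<kappa>)"

text \<open>The infimum is taken in the extended reals, so that it is \<open>\<infinity>\<close> if there is no zero.\<close>

definition hit_zero :: "real \<Rightarrow> (real \<Rightarrow> 'a \<Rightarrow> real) \<Rightarrow> 'a \<Rightarrow> ereal" where
  "hit_zero t0 W \<omega> = Inf {ereal t | t. t0 \<le> t \<and> W t \<omega> = 0}"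

text \<open>\<open>K\<close> is a regular conditional distribution of \<open>Z\<close> given \<open>Y\<close>.\<close>

definition regular_cond_distr ::
    "'a measure \<Rightarrow> 'b measure \<Rightarrow> ('a \<Rightarrow> 'b) \<Rightarrow> 'c measure \<Rightarrow> ('a \<Rightarrow> 'c) \<Rightarrow> ('b \<Rightarrow> 'c measure) \<Rightarrow> bool" where
  "regular_cond_distr M N Y S Z K \<longleftrightarrow>
     Y \<in> measurable M N \<and> Z \<in> measurable M S \<and> K \<in> measurable N (prob_algebra S) \<and>
     (\<forall>A\<in>sets N. \<forall>B\<in>sets S.
        emeasure M {\<omega>\<in>space M. Y \<omega> \<in> A \<and> Z \<omega> \<in> B}
          = (\<integral>\<^sup>+y\<in>A. emeasure (K y) B \<partial>distr M N Y))"

end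

theory Submission
  imports Defs
begin

text \<open>
  On the negative excursion straddling \<open>t0\<close>, the pair \<open>(V, X)\<close> is a linear image of a planar
  Brownian motion, and the two hitting times compare the two sides through which this motion
  leaves a wedge of opening angle \<open>\<alpha>\<close> with apex \<open>0\<close>. The argument of the position is harmonic,
  vanishes on the side \<open>X = 0\<close> and equals \<open>\<alpha>\<close> on the side \<open>V = 0\<close>, so the probability of leaving
  through the latter is the initial argument \<open>\<theta>0\<close> divided by \<open>\<alpha>\<close>.

  The planar path is sampled at the times \<open>\<theta> + i \<delta>\<close>, \<open>\<delta> = 2\<^sup>-\<^sup>m\<close>; one
  Gaussian step changes the mean of a harmonic function by \<open>O(\<delta> \<surd>\<delta>)\<close> away from the apex, which
  is negligible after \<open>O(1 / \<delta>)\<close> steps. Applied to the positive harmonic function \<open>Re (1 / w)\<close>, the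
  same estimate shows that the apex is not hit. Since \<open>t0\<close> is a time of \<open>G\<close> and not of \<open>B\<close>, the
  sampling starts at the first dyadic time of \<open>B\<close> whose clock exceeds \<open>t0\<close>, a discrete stopping time.
  The path of \<open>C\<close> is moved to a second copy of the probability space by independence. Finally, \<open>V\<close>
  has no zeros accumulating at the end of the excursion from the right: by the maximal inequality and
  Borel-Cantelli only finitely many of the stopped Brownian motions on \<open>[0, T]\<close> are large.
\<close>

section \<open>Stopped Gaussian random walks\<close>

definition gauss :: "real \<Rightarrow> real measure" where
  "gauss \<sigma> = density lborel (\<lambda>x. ennreal (normal_density 0 \<sigma> x))"

definition noise :: "real \<Rightarrow> (nat \<Rightarrow> real) measure" where
  "noise \<sigma> = PiM UNIV (\<lambda>_. gauss \<sigma>)"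

lemma sets_gauss [simp, measurable_cong]: "sets (gauss \<sigma>) = sets borel"
  and space_gauss [simp]: "space (gauss \<sigma>) = UNIV"
  by (auto simp: gauss_def)

lemma prob_space_gauss: "\<sigma> > 0 \<Longrightarrow> prob_space (gauss \<sigma>)"
  unfolding gauss_def by (rule prob_space_normal_density)

lemma prob_space_noise: "\<sigma> > 0 \<Longrightarrow> prob_space (noise \<sigma>)"
  unfolding noise_def by (intro prob_space_PiM prob_space_gauss)

lemma sets_noise [simp, measurable_cong]: "sets (noise \<sigma>) = sets (PiM UNIV (\<lambda>_. borel))"
  unfolding noise_def by (intro sets_PiM_cong) auto

lemma space_noise [simp]: "space (noise \<sigma>) = UNIV"
  unfolding noise_def by (auto simp: space_PiM)

lemma distr_noise_shift:
  assumes "\<sigma> > 0"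
  shows "distr (gauss \<sigma> \<Otimes>\<^sub>M noise \<sigma>) (noise \<sigma>) (\<lambda>(s, z). case_nat s z) = noise \<sigma>"
proof -
  interpret prob_space "gauss \<sigma>" by (rule prob_space_gauss[OF assms])
  interpret sequence_space "gauss \<sigma>" by unfold_locales
  show ?thesis unfolding noise_def by (rule PiM_iter)
qed

definition step :: "(nat \<Rightarrow> real) \<times> (nat \<Rightarrow> real) \<Rightarrow> nat \<Rightarrow> complex" where
  "step z i = Complex (fst z i) (snd z i)"

definition walk :: "complex \<Rightarrow> (nat \<Rightarrow> real) \<times> (nat \<Rightarrow> real) \<Rightarrow> nat \<Rightarrow> complex" where
  "walk w z i = w + (\<Sum>j<i. step z j)"

definition exit_value :: "complex set \<Rightarrow> nat \<Rightarrow> (nat \<Rightarrow> complex) \<Rightarrow> complex" where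
  "exit_value D n x = x (LEAST i. i = n \<or> x i \<notin> D)"

lemma exit_value_0 [simp]: "exit_value D 0 x = x 0"
  unfolding exit_value_def by (rule arg_cong[of _ _ x]) (rule Least_equality, auto)

lemma exit_value_Suc:
  "exit_value D (Suc n) x = (if x 0 \<in> D then exit_value D n (\<lambda>i. x (Suc i)) else x 0)"
proof (cases "x 0 \<in> D")
  case True
  have "(LEAST i. i = Suc n \<or> x i \<notin> D) = Suc (LEAST i. Suc i = Suc n \<or> x (Suc i) \<notin> D)"
    by (rule Least_Suc[of _ "Suc n"]) (use True in auto)
  then show ?thesis using True by (simp add: exit_value_def)
next
  case False
  have "(LEAST i. i = Suc n \<or> x i \<notin> D) = 0"
    by (rule Least_equality) (use False in auto)
  then show ?thesis using False by (simp add: exit_value_def)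
qed

lemma walk_0 [simp]: "walk w z 0 = w"
  by (simp add: walk_def)

lemma walk_case_nat_Suc:
  "walk w (case_nat a x, case_nat b y) (Suc i) = walk (w + Complex a b) (x, y) i"
  unfolding walk_def step_def by (simp add: sum.lessThan_Suc_shift del: sum.lessThan_Suc)

lemma exit_value_walk_Suc:
  "exit_value D (Suc n) (walk w (case_nat a x, case_nat b y)) =
     (if w \<in> D then exit_value D n (walk (w + Complex a b) (x, y)) else w)"
  by (simp add: exit_value_Suc walk_case_nat_Suc)

lemma measurable_Complex [measurable (raw)]:
  assumes "f \<in> borel_measurable M" "g \<in> borel_measurable M"
  shows "(\<lambda>x. Complex (f x) (g x)) \<in> borel_measurable M"
  unfolding Complex_eq using assms by measurable

lemma measurable_exit_value:
  assumes "D \<in> sets borel" and "\<And>i. (\<lambda>p. x p i) \<in> borel_measurable M"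
  shows "(\<lambda>p. exit_value D n (x p)) \<in> borel_measurable M"
  using assms(2)
proof (induction n arbitrary: x)
  case (Suc n)
  note [measurable] = assms(1) Suc.prems Suc.IH[of "\<lambda>p i. x p (Suc i)", OF Suc.prems]
  show ?case unfolding exit_value_Suc by measurable
qed simp

lemma measurable_walk [measurable (raw)]:
  assumes [measurable]: "f \<in> borel_measurable M"
    "g \<in> measurable M (PiM UNIV (\<lambda>_. borel) \<Otimes>\<^sub>M PiM UNIV (\<lambda>_. borel))"
  shows "(\<lambda>p. walk (f p) (g p) i) \<in> borel_measurable M"
proof -
  have [measurable]: "(\<lambda>p. fst (g p) j) \<in> borel_measurable M"
      "(\<lambda>p. snd (g p) j) \<in> borel_measurable M" for j
    using measurable_compose[OF assms(2) measurable_fst] measurable_compose[OF assms(2)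
        measurable_snd]
    by (auto intro: measurable_compose[OF _ measurable_component_singleton])
  show ?thesis unfolding walk_def step_def by measurable
qed

lemma nn_integral_noise_pair:
  assumes \<sigma>: "\<sigma> > 0"
    and [measurable]: "g \<in> borel_measurable (PiM UNIV (\<lambda>_. borel) \<Otimes>\<^sub>M PiM UNIV (\<lambda>_. borel))"
  shows "(\<integral>\<^sup>+z. g z \<partial>(noise \<sigma> \<Otimes>\<^sub>M noise \<sigma>)) =
    (\<integral>\<^sup>+a. (\<integral>\<^sup>+b. (\<integral>\<^sup>+z. g (case_nat a (fst z), case_nat b (snd z)) \<partial>(noise \<sigma> \<Otimes>\<^sub>M noise \<sigma>)) \<partial>gauss
        \<sigma>) \<partial>gauss \<sigma>)"
proof -
  let ?N = "gauss \<sigma>" and ?S = "noise \<sigma>"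
  interpret N: prob_space ?N by (rule prob_space_gauss[OF \<sigma>])
  interpret S: prob_space ?S by (rule prob_space_noise[OF \<sigma>])
  interpret SS: pair_prob_space ?S ?S ..
  interpret NS: pair_prob_space ?N ?S ..
  interpret SN: pair_prob_space ?S ?N ..
  have shift: "(\<integral>\<^sup>+x. h x \<partial>?S) = (\<integral>\<^sup>+a. (\<integral>\<^sup>+x. h (case_nat a x) \<partial>?S) \<partial>?N)"
    if [measurable]: "h \<in> borel_measurable (PiM UNIV (\<lambda>_. borel))" for h :: "_ \<Rightarrow> ennreal"
  proof -
    have "(\<integral>\<^sup>+x. h x \<partial>?S) = (\<integral>\<^sup>+x. h x \<partial>distr (?N \<Otimes>\<^sub>M ?S) ?S (\<lambda>(s, z). case_nat s z))"
      using distr_noise_shift[OF \<sigma>] by simp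
    also have "\<dots> = (\<integral>\<^sup>+p. h (case_nat (fst p) (snd p)) \<partial>(?N \<Otimes>\<^sub>M ?S))"
      by (subst nn_integral_distr) (auto simp: split_beta')
    also have "\<dots> = (\<integral>\<^sup>+a. (\<integral>\<^sup>+x. h (case_nat a x) \<partial>?S) \<partial>?N)"
      by (subst S.nn_integral_fst[symmetric]) auto
    finally show ?thesis .
  qed
  have "(\<integral>\<^sup>+z. g z \<partial>(?S \<Otimes>\<^sub>M ?S)) = (\<integral>\<^sup>+x. (\<integral>\<^sup>+y. g (x, y) \<partial>?S) \<partial>?S)"
    by (subst S.nn_integral_fst[symmetric]) auto
  also have "\<dots> = (\<integral>\<^sup>+a. (\<integral>\<^sup>+x. (\<integral>\<^sup>+y. g (case_nat a x, y) \<partial>?S) \<partial>?S) \<partial>?N)"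
    by (subst shift) auto
  also have "\<dots> = (\<integral>\<^sup>+a. (\<integral>\<^sup>+x. (\<integral>\<^sup>+b. (\<integral>\<^sup>+y. g (case_nat a x, case_nat b y) \<partial>?S) \<partial>?N) \<partial>?S) \<partial>?N)"
  proof (intro nn_integral_cong)
    fix a x
    have [measurable]: "(\<lambda>y. g (case_nat a x, y)) \<in> borel_measurable (PiM UNIV (\<lambda>_. borel))"
      by (rule measurable_compose[OF _ assms(2)]) (auto simp: space_PiM)
    show "(\<integral>\<^sup>+y. g (case_nat a x, y) \<partial>?S) = (\<integral>\<^sup>+b. (\<integral>\<^sup>+y. g (case_nat a x, case_nat b y) \<partial>?S) \<partial>?N)"
      by (subst shift) auto
  qed
  also have "\<dots> = (\<integral>\<^sup>+a. (\<integral>\<^sup>+b. (\<integral>\<^sup>+x. (\<integral>\<^sup>+y. g (case_nat a x, case_nat b y) \<partial>?S) \<partial>?S) \<partial>?N) \<partial>?N)"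
  proof (intro nn_integral_cong)
    fix a
    show "(\<integral>\<^sup>+x. (\<integral>\<^sup>+b. (\<integral>\<^sup>+y. g (case_nat a x, case_nat b y) \<partial>?S) \<partial>?N) \<partial>?S) =
      (\<integral>\<^sup>+b. (\<integral>\<^sup>+x. (\<integral>\<^sup>+y. g (case_nat a x, case_nat b y) \<partial>?S) \<partial>?S) \<partial>?N)"
      by (rule NS.Fubini') measurable
  qed
  also have "\<dots> = (\<integral>\<^sup>+a. (\<integral>\<^sup>+b. (\<integral>\<^sup>+z. g (case_nat a (fst z), case_nat b (snd z)) \<partial>(?S \<Otimes>\<^sub>M ?S)) \<partial>?N)
      \<partial>?N)"
    by (subst S.nn_integral_fst[symmetric]) (auto intro!: nn_integral_cong)
  finally show ?thesis .
qed

lemma nn_integral_exit_value_le: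
  fixes f :: "complex \<Rightarrow> ennreal"
  assumes \<sigma>: "\<sigma> > 0" and [measurable]: "f \<in> borel_measurable borel" "D \<in> sets borel"
    and step: "\<And>w. w \<in> D \<Longrightarrow> (\<integral>\<^sup>+a. (\<integral>\<^sup>+b. f (w + Complex a b) \<partial>gauss \<sigma>) \<partial>gauss \<sigma>) \<le> f w + e"
  shows "(\<integral>\<^sup>+z. f (exit_value D n (walk w z)) \<partial>(noise \<sigma> \<Otimes>\<^sub>M noise \<sigma>)) \<le> f w + of_nat n * e"
proof (induction n arbitrary: w)
  interpret N: prob_space "gauss \<sigma>" by (rule prob_space_gauss[OF \<sigma>])
  interpret S: prob_space "noise \<sigma>" by (rule prob_space_noise[OF \<sigma>])
  interpret SS: pair_prob_space "noise \<sigma>" "noise \<sigma>" ..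
  note [measurable] = measurable_exit_value
  case 0 then show ?case by (simp add: SS.emeasure_space_1)
  case (Suc n)
  show ?case
  proof (cases "w \<in> D")
    case False
    then show ?thesis by (simp add: exit_value_Suc SS.emeasure_space_1)
  next
    case True
    have "(\<integral>\<^sup>+z. f (exit_value D (Suc n) (walk w z)) \<partial>(noise \<sigma> \<Otimes>\<^sub>M noise \<sigma>)) =
      (\<integral>\<^sup>+a. (\<integral>\<^sup>+b. (\<integral>\<^sup>+z. f (exit_value D n (walk (w +
          Complex a b) z)) \<partial>(noise \<sigma> \<Otimes>\<^sub>M noise \<sigma>)) \<partial>gauss \<sigma>) \<partial>gauss \<sigma>)"
      by (subst nn_integral_noise_pair[OF \<sigma>]) (simp_all add: exit_value_walk_Suc True)
    also have "\<dots> \<le> (\<integral>\<^sup>+a. (\<integral>\<^sup>+b. f (w + Complex a b) + of_nat n * e \<partial>gauss \<sigma>) \<partial>gauss \<sigma>)"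
      by (intro nn_integral_mono Suc.IH)
    also have "\<dots> = (\<integral>\<^sup>+a. (\<integral>\<^sup>+b. f (w + Complex a b) \<partial>gauss \<sigma>) \<partial>gauss \<sigma>) + of_nat n * e"
      by (simp add: nn_integral_add N.emeasure_space_1[simplified])
    also have "\<dots> \<le> f w + e + of_nat n * e" by (intro add_right_mono step True)
    finally show ?thesis by (simp add: algebra_simps distrib_right)
  qed
qed

lemma integral_exit_value_approx:
  fixes f :: "complex \<Rightarrow> real"
  assumes \<sigma>: "\<sigma> > 0" and [measurable]: "f \<in> borel_measurable borel" "D \<in> sets borel"
    and bnd: "\<And>w. \<bar>f w\<bar> \<le> K" and e: "e \<ge> 0"
    and step: "\<And>w. w \<in> D \<Longrightarrow> \<bar>(\<integral>x. f (w + Complex (fst x) (snd x)) \<partial>(gauss \<sigma> \<Otimes>\<^sub>M gauss \<sigma>)) - f w\<bar> \<le> e"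
  shows "\<bar>(\<integral>z. f (exit_value D n (walk w z)) \<partial>(noise \<sigma> \<Otimes>\<^sub>M noise \<sigma>)) - f w\<bar> \<le> n * e"
proof -
  interpret N: prob_space "gauss \<sigma>" by (rule prob_space_gauss[OF \<sigma>])
  interpret S: prob_space "noise \<sigma>" by (rule prob_space_noise[OF \<sigma>])
  interpret SS: pair_prob_space "noise \<sigma>" "noise \<sigma>" ..
  interpret NN: pair_prob_space "gauss \<sigma>" "gauss \<sigma>" ..
  note [measurable] = measurable_exit_value
  have upper: "(\<integral>z. g (exit_value D n (walk w z)) \<partial>(noise \<sigma> \<Otimes>\<^sub>M noise \<sigma>)) \<le> g w + n * e"
    if [measurable]: "g \<in> borel_measurable borel" and gb: "\<And>w. \<bar>g w\<bar> \<le> K"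
      and gs: "\<And>w. w \<in> D \<Longrightarrow> (\<integral>x. g (w + Complex (fst x) (snd x)) \<partial>(gauss \<sigma> \<Otimes>\<^sub>M gauss \<sigma>)) \<le> g w + e"
    for g :: "complex \<Rightarrow> real"
  proof -
    have pos: "0 \<le> g w + K" for w using gb[of w] by linarith
    have int: "integrable (gauss \<sigma> \<Otimes>\<^sub>M gauss \<sigma>) (\<lambda>x. g (w + Complex (fst x) (snd x)))" for w
      by (rule NN.integrable_const_bound[where B = K]) (auto simp: gb)
    have int2: "integrable (noise \<sigma> \<Otimes>\<^sub>M noise \<sigma>) (\<lambda>z. g (exit_value D n (walk w z)))"
      by (rule SS.integrable_const_bound[where B = K]) (auto simp: gb)
    have "ennreal ((\<integral>z. g (exit_value D n (walk w z)) \<partial>(noise \<sigma> \<Otimes>\<^sub>M noise \<sigma>)) + K) =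
      (\<integral>\<^sup>+z. ennreal (g (exit_value D n (walk w z)) + K) \<partial>(noise \<sigma> \<Otimes>\<^sub>M noise \<sigma>))"
      by (subst nn_integral_eq_integral)
         (use int2 in \<open>auto simp: SS.prob_space intro!: pos\<close>)
    also have "\<dots> \<le> ennreal (g w + K) + of_nat n * ennreal e"
    proof (rule nn_integral_exit_value_le[OF \<sigma>, where f = "\<lambda>w. ennreal (g w + K)"])
      fix w assume w: "w \<in> D"
      have "(\<integral>\<^sup>+a. (\<integral>\<^sup>+b. ennreal (g (w + Complex a b) + K) \<partial>gauss \<sigma>) \<partial>gauss \<sigma>) =
        (\<integral>\<^sup>+x. ennreal (g (w + Complex (fst x) (snd x)) + K) \<partial>(gauss \<sigma> \<Otimes>\<^sub>M gauss \<sigma>))"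
        by (subst N.nn_integral_fst[symmetric]) auto
      also have "\<dots> = ennreal ((\<integral>x. g (w + Complex (fst x) (snd x)) \<partial>(gauss \<sigma> \<Otimes>\<^sub>M gauss \<sigma>)) + K)"
        by (subst nn_integral_eq_integral) (use int in \<open>auto simp: NN.prob_space intro!: pos\<close>)
      also have "\<dots> \<le> ennreal (g w + K + e)" using gs[OF w] by (intro ennreal_leI) linarith
      also have "\<dots> = ennreal (g w + K) + ennreal e" using pos e by (rule ennreal_plus)
      finally show "(\<integral>\<^sup>+a. (\<integral>\<^sup>+b. ennreal (g (w + Complex a b) + K) \<partial>gauss \<sigma>) \<partial>gauss \<sigma>)
        \<le> ennreal (g w + K) + ennreal e" .
    qed auto
    also have "\<dots> = ennreal (g w + K + n * e)"
      using pos e by (simp add: ennreal_plus ennreal_mult ennreal_of_nat_eq_real_of_nat)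
    finally show ?thesis using pos e by (subst (asm) ennreal_le_iff) auto
  qed
  have 1: "(\<integral>z. f (exit_value D n (walk w z)) \<partial>(noise \<sigma> \<Otimes>\<^sub>M noise \<sigma>)) \<le> f w + n * e"
    by (rule upper) (use bnd step in \<open>auto simp: abs_le_iff algebra_simps\<close>)
  have 2: "(\<integral>z. - f (exit_value D n (walk w z)) \<partial>(noise \<sigma> \<Otimes>\<^sub>M noise \<sigma>)) \<le> - f w + n * e"
  proof (rule upper)
    fix w assume "w \<in> D"
    from step[OF this] show "(\<integral>x. - f (w +
        Complex (fst x) (snd x)) \<partial>(gauss \<sigma> \<Otimes>\<^sub>M gauss \<sigma>)) \<le> - f w + e"
      by (simp add: abs_le_iff)
  qed (use bnd in auto)
  show ?thesis using 1 2 by (simp add: abs_le_iff)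
qed

section \<open>Harmonic functions under a Gaussian step\<close>

lemma integral_gauss:
  fixes f :: "real \<Rightarrow> real"
  assumes [measurable]: "f \<in> borel_measurable borel" and "\<sigma> > 0"
  shows "integrable (gauss \<sigma>) f \<longleftrightarrow> integrable lborel (\<lambda>x. normal_density 0 \<sigma> x * f x)"
    and "integral\<^sup>L (gauss \<sigma>) f = (\<integral>x. normal_density 0 \<sigma> x * f x \<partial>lborel)"
  unfolding gauss_def using assms
  by (simp_all add: integrable_density integral_density normal_density_nonneg)

lemma gauss_moments:
  assumes \<sigma>: "\<sigma> > 0"
  shows "integrable (gauss \<sigma>) (\<lambda>x. x)" "(\<integral>x. x \<partial>gauss \<sigma>) = 0"
    "integrable (gauss \<sigma>) (\<lambda>x. x\<^sup>2)" "(\<integral>x. x\<^sup>2 \<partial>gauss \<sigma>) = \<sigma>\<^sup>2"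
    "integrable (gauss \<sigma>) (\<lambda>x. \<bar>x\<bar>^3)" "(\<integral>x. \<bar>x\<bar>^3 \<partial>gauss \<sigma>) = 2 * sqrt (2 / pi) * \<sigma>^3"
proof -
  note e = normal_moment_even[OF \<sigma>, of 0 1] and o = normal_moment_odd[OF \<sigma>, of 0 0]
    and a = normal_moment_abs_odd[OF \<sigma>, of 0 1]
  show "integrable (gauss \<sigma>) (\<lambda>x. x)" "(\<integral>x. x \<partial>gauss \<sigma>) = 0"
    using o \<sigma> by (auto simp: integral_gauss has_bochner_integral_iff)
  show "integrable (gauss \<sigma>) (\<lambda>x. x\<^sup>2)" "(\<integral>x. x\<^sup>2 \<partial>gauss \<sigma>) = \<sigma>\<^sup>2"
    using e \<sigma> by (auto simp: integral_gauss has_bochner_integral_iff)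
  show "integrable (gauss \<sigma>) (\<lambda>x. \<bar>x\<bar>^3)" "(\<integral>x. \<bar>x\<bar>^3 \<partial>gauss \<sigma>) = 2 * sqrt (2 / pi) * \<sigma>^3"
    using a \<sigma> by (auto simp: integral_gauss has_bochner_integral_iff field_simps eval_nat_numeral)
qed

lemma gauss_pair_moments:
  assumes \<sigma>: "\<sigma> > 0"
  defines "NN \<equiv> gauss \<sigma> \<Otimes>\<^sub>M gauss \<sigma>"
  shows "has_bochner_integral NN (\<lambda>x. p * fst x + q * snd x + r * ((fst x)\<^sup>2 - (snd x)\<^sup>2) +
      t * (fst x * snd x)) 0"
    and "has_bochner_integral NN (\<lambda>x. \<bar>fst x\<bar>^3 + \<bar>snd x\<bar>^3) (4 * sqrt (2 / pi) * \<sigma>^3)"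
proof -
  interpret N: prob_space "gauss \<sigma>" by (rule prob_space_gauss[OF \<sigma>])
  interpret NN: pair_prob_space "gauss \<sigma>" "gauss \<sigma>" ..
  note m = gauss_moments[OF \<sigma>]
  have mult: "has_bochner_integral NN (\<lambda>x. f (fst x) * g (snd x)) (integral\<^sup>L (gauss \<sigma>) f *
      integral\<^sup>L (gauss \<sigma>) g)"
    if "integrable (gauss \<sigma>) f" "integrable (gauss \<sigma>) g" for f g :: "real \<Rightarrow> real"
  proof -
    have [measurable]: "f \<in> borel_measurable borel" "g \<in> borel_measurable borel"
      using borel_measurable_integrable[OF that(1)] borel_measurable_integrable[OF that(2)] by auto
    have i: "integrable NN (\<lambda>x. f (fst x) * g (snd x))"
      unfolding NN_def
    proof (rule NN.Fubini_integrable)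
      show "integrable (gauss \<sigma>) (\<lambda>x. LINT y|gauss \<sigma>. norm (f (fst (x, y)) * g (snd (x, y))))"
        using that by (simp add: abs_mult)
    qed (use that in auto)
    have "integral\<^sup>L NN (\<lambda>x. f (fst x) * g (snd x)) =
        integral\<^sup>L (gauss \<sigma>) f * integral\<^sup>L (gauss \<sigma>) g"
      using i unfolding NN_def by (subst NN.integral_fst'[symmetric]) auto
    then show ?thesis using i by (simp add: has_bochner_integral_iff)
  qed
  have fs: "has_bochner_integral NN (\<lambda>x. f (fst x)) (integral\<^sup>L (gauss \<sigma>) f)"
    "has_bochner_integral NN (\<lambda>x. f (snd x)) (integral\<^sup>L (gauss \<sigma>) f)"
    if "integrable (gauss \<sigma>) f" for f :: "real \<Rightarrow> real"
    using mult[OF that, of "\<lambda>_. 1"] mult[OF _ that, of "\<lambda>_. 1"]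
      by (auto simp: N.prob_space[simplified])
  have "has_bochner_integral NN (\<lambda>x. p * fst x + q * snd x + r * ((fst x)\<^sup>2 - (snd x)\<^sup>2) +
      t * (fst x * snd x))
      (p * 0 + q * 0 + r * (\<sigma>\<^sup>2 - \<sigma>\<^sup>2) + t * (0 * 0))"
    using fs[OF m(1)] fs[OF m(3)] mult[OF m(1) m(1)] unfolding m
    by (intro has_bochner_integral_add has_bochner_integral_diff has_bochner_integral_mult_right)
        auto
  then show "has_bochner_integral NN (\<lambda>x. p * fst x + q * snd x + r * ((fst x)\<^sup>2 - (snd x)\<^sup>2) +
      t * (fst x * snd x)) 0"
    by simp
  have "has_bochner_integral NN (\<lambda>x. \<bar>fst x\<bar>^3 + \<bar>snd x\<bar>^3)
     (2 * sqrt (2 / pi) * \<sigma>^3 + 2 * sqrt (2 / pi) * \<sigma>^3)"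
    using fs[OF m(5)] unfolding m by (intro has_bochner_integral_add)
  then show "has_bochner_integral NN (\<lambda>x. \<bar>fst x\<bar>^3 + \<bar>snd x\<bar>^3) (4 * sqrt (2 / pi) * \<sigma>^3)"
    by (simp add: algebra_simps)
qed

lemma gauss_step_approx:
  fixes f :: "complex \<Rightarrow> real"
  assumes \<sigma>: "\<sigma> > 0" and [measurable]: "f \<in> borel_measurable borel" and bnd: "\<And>w. \<bar>f w\<bar> \<le> B"
    and taylor: "\<And>z. \<bar>f (w + z) - f w - (p * Re z + q * Im z + r * ((Re z)\<^sup>2 - (Im z)\<^sup>2) +
        t * (Re z * Im z))\<bar>
      \<le> K * (\<bar>Re z\<bar>^3 + \<bar>Im z\<bar>^3)"
  shows "\<bar>(\<integral>x. f (w + Complex (fst x) (snd x)) \<partial>(gauss \<sigma> \<Otimes>\<^sub>M gauss \<sigma>)) - f w\<bar> \<le>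
      K * (4 * sqrt (2 / pi)) * \<sigma>^3"
proof -
  let ?NN = "gauss \<sigma> \<Otimes>\<^sub>M gauss \<sigma>"
  interpret N: prob_space "gauss \<sigma>" by (rule prob_space_gauss[OF \<sigma>])
  interpret NN: pair_prob_space "gauss \<sigma>" "gauss \<sigma>" ..
  define g where "g x = p * fst x + q * snd x + r * ((fst x)\<^sup>2 - (snd x)\<^sup>2) + t * (fst x * snd x)"
      for x :: "real \<times> real"
  have g: "integrable ?NN g" "integral\<^sup>L ?NN g = 0"
    and h: "integrable ?NN (\<lambda>x. \<bar>fst x\<bar>^3 + \<bar>snd x\<bar>^3)"
      "(\<integral>x. \<bar>fst x\<bar>^3 + \<bar>snd x\<bar>^3 \<partial>?NN) = 4 * sqrt (2 / pi) * \<sigma>^3"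
    using gauss_pair_moments[OF \<sigma>] unfolding g_def[abs_def] has_bochner_integral_iff by auto
  have i: "integrable ?NN (\<lambda>x. f (w + Complex (fst x) (snd x)))"
    by (rule NN.integrable_const_bound[where B = B]) (auto simp: bnd)
  have "(\<integral>x. f (w + Complex (fst x) (snd x)) \<partial>?NN) - f w = (\<integral>x. f (w +
      Complex (fst x) (snd x)) - f w - g x \<partial>?NN)"
    using i g by (simp add: NN.prob_space)
  also have "\<bar>\<dots>\<bar> \<le> (\<integral>x. K * (\<bar>fst x\<bar>^3 + \<bar>snd x\<bar>^3) \<partial>?NN)"
  proof (rule order_trans[OF integral_abs_bound], rule integral_mono)
    show "integrable ?NN (\<lambda>x. \<bar>f (w + Complex (fst x) (snd x)) - f w - g x\<bar>)"
      using i g by auto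
    show "\<bar>f (w + Complex (fst x) (snd x)) - f w - g x\<bar> \<le> K * (\<bar>fst x\<bar>^3 + \<bar>snd x\<bar>^3)" for x
      using taylor[of "Complex (fst x) (snd x)"] by (simp add: g_def)
  qed (use h in auto)
  also have "\<dots> = K * (4 * sqrt (2 / pi)) * \<sigma>^3" using h by simp
  finally show ?thesis .
qed

lemma cmod_cube_le: "(cmod z)^3 \<le> 4 * (\<bar>Re z\<bar>^3 + \<bar>Im z\<bar>^3)"
proof -
  have "(cmod z)^3 \<le> (\<bar>Re z\<bar> + \<bar>Im z\<bar>)^3"
    by (intro power_mono cmod_le) auto
  also have "\<dots> \<le> 4 * (\<bar>Re z\<bar>^3 + \<bar>Im z\<bar>^3)"
  proof -
    have "4 * (x^3 + y^3) - (x + y)^3 = 3 * (x + y) * (x - y)\<^sup>2" for x y :: real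
      by algebra
    moreover have "3 * (\<bar>Re z\<bar> + \<bar>Im z\<bar>) * (\<bar>Re z\<bar> - \<bar>Im z\<bar>)\<^sup>2 \<ge> 0" by auto
    ultimately show ?thesis by (smt (verit))
  qed
  finally show ?thesis .
qed

lemma harmonic_step:
  fixes F :: "nat \<Rightarrow> complex \<Rightarrow> complex" and l :: "complex \<Rightarrow> real"
  assumes \<epsilon>: "\<epsilon> > 0"
    and F: "\<And>i v. Re v > 0 \<Longrightarrow> i \<le> 2 \<Longrightarrow> (F i has_field_derivative F (Suc i) v) (at v)"
    and B: "B \<ge> 0" "\<And>i v. Re v > \<epsilon> / 2 \<Longrightarrow> 1 \<le> i \<Longrightarrow> i \<le> 3 \<Longrightarrow> cmod (F i v) \<le> B"
      "\<And>v. Re v > \<epsilon> / 2 \<Longrightarrow> \<bar>l (F 0 v)\<bar> \<le> B"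
    and l: "l = (\<lambda>z. c * Re z + d * Im z)" "\<bar>c\<bar> + \<bar>d\<bar> \<le> 1"
    and meas: "(\<lambda>v. l (F 0 v)) \<in> borel_measurable (restrict_space borel {v. Re v > \<epsilon> / 2})"
  shows "\<exists>K\<ge>0. \<forall>\<sigma>>0. \<forall>w. Re w \<ge> \<epsilon> \<longrightarrow>
    \<bar>(\<integral>x. (if Re (w + Complex (fst x) (snd x)) > \<epsilon> / 2 then l (F 0 (w +
        Complex (fst x) (snd x))) else 0)
        \<partial>(gauss \<sigma> \<Otimes>\<^sub>M gauss \<sigma>)) - l (F 0 w)\<bar> \<le> K * \<sigma>^3"
proof -
  define f where "f v = (if Re v > \<epsilon> / 2 then l (F 0 v) else 0)" for v
  have [measurable]: "f \<in> borel_measurable borel"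
  proof -
    have "{v. Re v > \<epsilon> / 2} \<in> sets (borel :: complex measure)" by measurable
    then have "(\<lambda>v. if v \<in> {v. Re v > \<epsilon> / 2} then l (F 0 v) else 0) \<in> borel_measurable borel"
      using meas by (subst (asm) measurable_restrict_space_iff[where c = 0]) auto
    then show ?thesis by (simp add: f_def[abs_def])
  qed
  have lle: "\<bar>l z\<bar> \<le> cmod z" for z
  proof -
    have "\<bar>l z\<bar> \<le> \<bar>c\<bar> * \<bar>Re z\<bar> + \<bar>d\<bar> * \<bar>Im z\<bar>"
      unfolding l by (intro order_trans[OF abs_triangle_ineq]) (simp add: abs_mult)
    also have "\<dots> \<le> \<bar>c\<bar> * cmod z + \<bar>d\<bar> * cmod z"
      by (intro add_mono mult_left_mono abs_Re_le_cmod abs_Im_le_cmod) auto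
    also have "\<dots> = (\<bar>c\<bar> + \<bar>d\<bar>) * cmod z" by (simp add: algebra_simps)
    also have "\<dots> \<le> 1 * cmod z" using l(2) by (intro mult_right_mono) auto
    finally show ?thesis by simp
  qed
  have ladd: "l (x + y) = l x + l y" "l (x - y) = l x - l y" for x y by (auto simp: l algebra_simps)
  define K where "K = B + 8 * B / \<epsilon>^3 + 4 * B / \<epsilon>\<^sup>2 + B / \<epsilon>"
  have K: "K \<ge> 0" using B(1) \<epsilon> by (auto simp: K_def)
  have T: "\<bar>f (w + z) - f w - l (F 1 w * z + F 2 w * z\<^sup>2 / 2)\<bar> \<le> K * (cmod z)^3" if w: "Re w \<ge> \<epsilon>"
      for w z
  proof (cases "Re (w + z) > \<epsilon> / 2")
    case True
    have "cmod (F 0 (w + z) - (\<Sum>i\<le>2. F i w * ((w + z) - w) ^ i / (fact i))) \<le> B * cmod ((w +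
        z) - w)^(Suc 2) / fact 2"
    proof (rule complex_Taylor[where S = "{v. Re v > \<epsilon> / 2}"])
      show "convex {v. Re v > \<epsilon> / 2}" by (rule convex_halfspace_Re_gt)
      show "(F i has_field_derivative F (Suc i) v) (at v within {v. Re v > \<epsilon> / 2})"
        if "v \<in> {v. Re v > \<epsilon> / 2}" "i \<le> 2" for i v
        by (rule has_field_derivative_at_within[OF F]) (use that \<epsilon> in auto)
      show "cmod (F (Suc 2) v) \<le> B" if "v \<in> {v. Re v > \<epsilon> / 2}" for v using that B(2)[of v 3]
        by (simp add: eval_nat_numeral)
    qed (use w \<epsilon> True in auto)
    then have "cmod (F 0 (w + z) - F 0 w - (F 1 w * z + F 2 w * z\<^sup>2 / 2)) \<le> B * (cmod z)^3 / 2"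
      by (simp add: eval_nat_numeral atMost_Suc algebra_simps)
    also have "\<dots> \<le> K * (cmod z)^3"
    proof -
      have "B / 2 \<le> K" using B(1) \<epsilon> by (simp add: K_def add_increasing2)
      from mult_right_mono[OF this, of "(cmod z)^3"] show ?thesis by simp
    qed
    finally have "\<bar>l (F 0 (w + z) - F 0 w - (F 1 w * z + F 2 w * z\<^sup>2 / 2))\<bar> \<le> K * (cmod z)^3"
      using lle order_trans by blast
    then show ?thesis using True w \<epsilon> by (simp add: f_def ladd)
  next
    case False
    have "\<epsilon> / 2 \<le> \<bar>Re z\<bar>" using False w by simp
    then have z: "\<epsilon> / 2 \<le> cmod z" using abs_Re_le_cmod order_trans by blast
    define q where "q = cmod z / (\<epsilon> / 2)"
    have q: "q \<ge> 1" using z \<epsilon> by (simp add: q_def field_simps)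
    have zq: "cmod z = q * (\<epsilon> / 2)" using \<epsilon> by (simp add: q_def)
    have "\<bar>f (w + z) - f w - l (F 1 w * z + F 2 w * z\<^sup>2 / 2)\<bar> \<le> \<bar>l (F 0 w)\<bar> + cmod (F 1 w * z +
        F 2 w * z\<^sup>2 / 2)"
      using False w \<epsilon> lle[of "F 1 w * z + F 2 w * z\<^sup>2 / 2"] by (simp add: f_def)
    also have "\<dots> \<le> B + (B * cmod z + B * (cmod z)\<^sup>2 / 2)"
    proof (intro add_mono order_trans[OF norm_triangle_ineq])
      show "\<bar>l (F 0 w)\<bar> \<le> B" using w \<epsilon> by (intro B) auto
      show "cmod (F 1 w * z) \<le> B * cmod z" unfolding norm_mult using w \<epsilon>
        by (intro mult_right_mono B) auto
      show "cmod (F 2 w * z\<^sup>2 / 2) \<le> B * (cmod z)\<^sup>2 / 2"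
        unfolding norm_mult norm_divide norm_power using w \<epsilon>
          by (auto intro!: divide_right_mono mult_right_mono B)
    qed
    also have "\<dots> \<le> B * q^3 + (B * (q^3 * (\<epsilon> / 2)) + B * (q^3 * (\<epsilon> / 2)\<^sup>2) / 2)"
    proof -
      have q1: "1 \<le> q^3" "q \<le> q^3" "q\<^sup>2 \<le> q^3"
        using q by (auto intro: self_le_power power_increasing one_le_power)
      show ?thesis unfolding zq power_mult_distrib using q1 B(1) \<epsilon>
        by (intro add_mono divide_right_mono mult_left_mono mult_right_mono)
           (auto simp: mult_le_cancel_left1)
    qed
    also have "\<dots> \<le> (8 * B / \<epsilon>^3 + 4 * B / \<epsilon>\<^sup>2 + B / \<epsilon>) * (q * (\<epsilon> / 2))^3"
      using \<epsilon> by (simp add: field_simps eval_nat_numeral)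
    also have "\<dots> \<le> K * (cmod z)^3"
      unfolding zq using B(1) by (intro mult_right_mono) (auto simp: K_def q_def)
    finally show ?thesis .
  qed
  show ?thesis
  proof (intro exI[of _ "4 * K * (4 * sqrt (2 / pi))"] conjI allI impI)
    fix \<sigma> :: real and w assume \<sigma>: "\<sigma> > 0" and w: "\<epsilon> \<le> Re w"
    let ?p = "c * Re (F 1 w) + d * Im (F 1 w)" and ?q = "d * Re (F 1 w) - c * Im (F 1 w)"
      and ?r = "(c * Re (F 2 w) + d * Im (F 2 w)) / 2" and ?t = "d * Re (F 2 w) - c * Im (F 2 w)"
    have poly: "l (F 1 w * z + F 2 w * z\<^sup>2 / 2) =
       ?p * Re z + ?q * Im z + ?r * ((Re z)\<^sup>2 - (Im z)\<^sup>2) + ?t * (Re z * Im z)" for z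
      by (simp add: l power2_eq_square field_simps)
    have "\<bar>(\<integral>x. f (w + Complex (fst x) (snd x)) \<partial>(gauss \<sigma> \<Otimes>\<^sub>M gauss \<sigma>)) - f w\<bar> \<le>
        4 * K * (4 * sqrt (2 / pi)) * \<sigma>^3"
    proof (rule gauss_step_approx[OF \<sigma>, where B = B and p = ?p and q = ?q and r = ?r and t = ?t])
      fix z
      have "\<bar>f (w + z) - f w - l (F 1 w * z + F 2 w * z\<^sup>2 / 2)\<bar> \<le> K * (cmod z)^3" by (rule T[OF w])
      also have "\<dots> \<le> K * (4 * (\<bar>Re z\<bar>^3 + \<bar>Im z\<bar>^3))" by (intro mult_left_mono cmod_cube_le K)
      finally show "\<bar>f (w + z) - f w - (?p * Re z + ?q * Im z + ?r * ((Re z)\<^sup>2 - (Im z)\<^sup>2) +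
          ?t * (Re z * Im z))\<bar>
        \<le> 4 * K * (\<bar>Re z\<bar>^3 + \<bar>Im z\<bar>^3)" unfolding poly by (simp add: mult.assoc mult.left_commute)
    next
      show "\<bar>f v\<bar> \<le> B" for v using B by (auto simp: f_def)
    qed simp
    then show "\<bar>(\<integral>x. (if Re (w + Complex (fst x) (snd x)) > \<epsilon> / 2 then l (F 0 (w +
        Complex (fst x) (snd x))) else 0)
        \<partial>(gauss \<sigma> \<Otimes>\<^sub>M gauss \<sigma>)) - l (F 0 w)\<bar> \<le> 4 * K * (4 * sqrt (2 / pi)) * \<sigma>^3"
      using w \<epsilon> by (simp add: f_def[abs_def])
  qed (use K in auto)
qed

text \<open>Extending by \<open>0\<close> left of the half-plane is harmless: by Markov's inequality a Gaussian step from
  \<open>Re w \<ge> \<epsilon>\<close> reaches it only with probability \<open>O(\<sigma>\<^sup>3)\<close>.\<close>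

definition arg_ext :: "real \<Rightarrow> complex \<Rightarrow> real" where
  "arg_ext \<epsilon> w = (if Re w > \<epsilon> / 2 then Im (Ln w) else 0)"

definition inv_ext :: "real \<Rightarrow> complex \<Rightarrow> real" where
  "inv_ext \<epsilon> w = (if Re w > \<epsilon> / 2 then Re (inverse w) else 0)"

lemma cmod_inverse_power_le:
  assumes "Re v > \<epsilon> / 2" "\<epsilon> > 0"
  shows "cmod (inverse v ^ k) \<le> (2 / \<epsilon>) ^ k"
proof -
  have "\<epsilon> / 2 \<le> cmod v" using assms complex_Re_le_cmod[of v] by linarith
  then have "inverse (cmod v) \<le> inverse (\<epsilon> / 2)" using assms by (intro le_imp_inverse_le) auto
  then show ?thesis by (auto simp: norm_power norm_inverse intro!: power_mono)
qed

lemma arg_ext_step: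
  assumes \<epsilon>: "\<epsilon> > 0"
  shows "\<exists>K\<ge>0. \<forall>\<sigma>>0. \<forall>w. Re w \<ge> \<epsilon> \<longrightarrow>
    \<bar>(\<integral>x. arg_ext \<epsilon> (w + Complex (fst x) (snd x)) \<partial>(gauss \<sigma> \<Otimes>\<^sub>M gauss \<sigma>)) - arg_ext \<epsilon> w\<bar> \<le> K * \<sigma>^3"
proof -
  define F where "F = rec_nat Ln (\<lambda>i _ v. (- 1)^i * fact i * inverse v ^ Suc i)"
  have F: "F 0 = Ln" "F (Suc i) = (\<lambda>v. (- 1)^i * fact i * inverse v ^ Suc i)" for i
    by (auto simp: F_def)
  define q where "q = max 1 (2 / \<epsilon>)"
  have q1: "1 \<le> q" "2 / \<epsilon> \<le> q" by (auto simp: q_def)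
  have "\<exists>K\<ge>0. \<forall>\<sigma>>0. \<forall>w. Re w \<ge> \<epsilon> \<longrightarrow>
    \<bar>(\<integral>x. (if Re (w + Complex (fst x) (snd x)) > \<epsilon> / 2 then Im (F 0 (w +
        Complex (fst x) (snd x))) else 0)
        \<partial>(gauss \<sigma> \<Otimes>\<^sub>M gauss \<sigma>)) - Im (F 0 w)\<bar> \<le> K * \<sigma>^3"
  proof (rule harmonic_step[OF \<epsilon>, where B = "pi + 2 * q^3" and c = 0 and d = 1])
    fix i :: nat and v :: complex assume v: "Re v > 0" and i: "i \<le> 2"
    have vn: "v \<notin> \<real>\<^sub>\<le>\<^sub>0" "v \<noteq> 0" using v by (auto simp: complex_nonpos_Reals_iff)
    show "(F i has_field_derivative F (Suc i) v) (at v)"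
    proof (cases i)
      case 0 then show ?thesis using vn by (auto simp: F intro!: derivative_eq_intros)
    next
      case (Suc j)
      show ?thesis unfolding Suc F
        by (rule derivative_eq_intros refl vn(2))+ (simp add: algebra_simps)
    qed
  next
    fix i :: nat and v :: complex assume v: "Re v > \<epsilon> / 2" and i: "1 \<le> i" "i \<le> 3"
    obtain j where j: "i = Suc j" "j \<le> 2" using i by (cases i) auto
    have "cmod (F i v) = fact j * cmod (inverse v ^ i)" unfolding j F norm_mult norm_power by simp
    also have "\<dots> \<le> 2 * q ^ 3"
    proof (intro mult_mono)
      show "fact j \<le> (2::real)" using fact_mono[OF j(2), where 'a = real]
        by (simp add: eval_nat_numeral)
      have "cmod (inverse v ^ i) \<le> (2 / \<epsilon>)^i" by (rule cmod_inverse_power_le[OF v \<epsilon>])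
      also have "\<dots> \<le> q^i" using q1 \<epsilon> by (intro power_mono) auto
      also have "\<dots> \<le> q^3" using q1 i by (intro power_increasing) auto
      finally show "cmod (inverse v ^ i) \<le> q^3" .
    qed auto
    finally show "cmod (F i v) \<le> pi + 2 * q^3" using pi_gt_zero by linarith
  next
    fix v assume v: "Re v > \<epsilon> / 2"
    then have "v \<noteq> 0" using \<epsilon> by auto
    from mpi_less_Im_Ln[OF this] Im_Ln_le_pi[OF this] have "\<bar>Im (Ln v)\<bar> \<le> pi" by linarith
    moreover have "0 \<le> q^3" using q1 by simp
    ultimately show "\<bar>Im (F 0 v)\<bar> \<le> pi + 2 * q^3" unfolding F by linarith
  next
    show "(\<lambda>v. Im (F 0 v)) \<in> borel_measurable (restrict_space borel {v. \<epsilon> / 2 < Re v})"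
      unfolding F using \<epsilon>
      by (intro borel_measurable_continuous_on_restrict continuous_intros)
         (auto simp: complex_nonpos_Reals_iff)
  qed (use q1 in auto)
  moreover have "arg_ext \<epsilon> w = Im (Ln w)" if "Re w \<ge> \<epsilon>" for w using that \<epsilon>
    by (simp add: arg_ext_def)
  ultimately show ?thesis unfolding F arg_ext_def using \<epsilon> by simp
qed

lemma inv_ext_step:
  assumes \<epsilon>: "\<epsilon> > 0"
  shows "\<exists>K\<ge>0. \<forall>\<sigma>>0. \<forall>w. Re w \<ge> \<epsilon> \<longrightarrow>
    \<bar>(\<integral>x. inv_ext \<epsilon> (w + Complex (fst x) (snd x)) \<partial>(gauss \<sigma> \<Otimes>\<^sub>M gauss \<sigma>)) - inv_ext \<epsilon> w\<bar> \<le> K * \<sigma>^3"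
proof -
  define F :: "nat \<Rightarrow> complex \<Rightarrow> complex" where "F i v = (- 1)^i * fact i * inverse v ^ Suc i" for i v
  define q where "q = max 1 (2 / \<epsilon>)"
  have q1: "1 \<le> q" "2 / \<epsilon> \<le> q" by (auto simp: q_def)
  have Fle: "cmod (F i v) \<le> 6 * q^4" if v: "Re v > \<epsilon> / 2" and i: "i \<le> 3" for i v
  proof -
    have "cmod (F i v) = fact i * cmod (inverse v ^ Suc i)" unfolding F_def norm_mult norm_power
      by simp
    also have "\<dots> \<le> 6 * q ^ 4"
    proof (intro mult_mono)
      show "fact i \<le> (6::real)" using fact_mono[OF i, where 'a = real]
        by (simp add: eval_nat_numeral)
      have "cmod (inverse v ^ Suc i) \<le> (2 / \<epsilon>)^Suc i" by (rule cmod_inverse_power_le[OF v \<epsilon>])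
      also have "\<dots> \<le> q^Suc i" using q1 \<epsilon> by (intro power_mono) auto
      also have "\<dots> \<le> q^4" using q1 i by (intro power_increasing) auto
      finally show "cmod (inverse v ^ Suc i) \<le> q^4" .
    qed auto
    finally show ?thesis .
  qed
  have "\<exists>K\<ge>0. \<forall>\<sigma>>0. \<forall>w. Re w \<ge> \<epsilon> \<longrightarrow>
    \<bar>(\<integral>x. (if Re (w + Complex (fst x) (snd x)) > \<epsilon> / 2 then Re (F 0 (w +
        Complex (fst x) (snd x))) else 0)
        \<partial>(gauss \<sigma> \<Otimes>\<^sub>M gauss \<sigma>)) - Re (F 0 w)\<bar> \<le> K * \<sigma>^3"
  proof (rule harmonic_step[OF \<epsilon>, where B = "6 * q^4" and c = 1 and d = 0])
    fix i :: nat and v :: complex assume v: "Re v > 0" and i: "i \<le> 2"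
    have vn: "v \<noteq> 0" using v by auto
    show "(F i has_field_derivative F (Suc i) v) (at v)" unfolding F_def
      by (rule derivative_eq_intros refl vn)+ (simp add: algebra_simps)
  next
    show "\<bar>Re (F 0 v)\<bar> \<le> 6 * q^4" if "Re v > \<epsilon> / 2" for v
      using Fle[OF that, of 0] abs_Re_le_cmod[of "F 0 v"] by linarith
    show "(\<lambda>v. Re (F 0 v)) \<in> borel_measurable (restrict_space borel {v. \<epsilon> / 2 < Re v})"
      unfolding F_def by (intro measurable_restrict_space1) measurable
  qed (use q1 Fle in auto)
  moreover have F0: "Re (F 0 v) = Re (inverse v)" for v by (simp add: F_def)
  moreover have "inv_ext \<epsilon> w = Re (inverse w)" if "Re w \<ge> \<epsilon>" for w using that \<epsilon>
    by (simp add: inv_ext_def)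
  ultimately show ?thesis unfolding inv_ext_def F0 using \<epsilon> by auto
qed

lemma measurable_arg_ext [measurable]: "\<epsilon> > 0 \<Longrightarrow> arg_ext \<epsilon> \<in> borel_measurable borel"
proof -
  assume \<epsilon>: "\<epsilon> > 0"
  have "(\<lambda>v. if v \<in> {v. Re v > \<epsilon> / 2} then Im (Ln v) else 0) \<in> borel_measurable borel"
    using \<epsilon> by (intro borel_measurable_continuous_on_if continuous_intros continuous_on_const)
      (auto simp: complex_nonpos_Reals_iff)
  then show ?thesis by (simp add: arg_ext_def[abs_def])
qed

lemma measurable_inv_ext [measurable]: "inv_ext \<epsilon> \<in> borel_measurable borel"
  unfolding inv_ext_def[abs_def] by measurable

section \<open>Independence of the past and the increments\<close>

text \<open>Unlike the library's \<open>indep_var\<close>, this allows random variables of different types.\<close>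

definition indep_rv :: "'a measure \<Rightarrow> 'b measure \<Rightarrow> ('a \<Rightarrow> 'b) \<Rightarrow> 'c measure \<Rightarrow> ('a \<Rightarrow> 'c) \<Rightarrow> bool" where
  "indep_rv M S X T Y \<longleftrightarrow> X \<in> measurable M S \<and> Y \<in> measurable M T \<and>
     (\<forall>A\<in>sets S. \<forall>B\<in>sets T. measure M ((X -` A \<inter> space M) \<inter> (Y -` B \<inter> space M)) =
        measure M (X -` A \<inter> space M) * measure M (Y -` B \<inter> space M))"

lemma (in prob_space) indep_rv_nn_integral:
  assumes ind: "indep_rv M S X T Y" and f [measurable]: "f \<in> borel_measurable (S \<Otimes>\<^sub>M T)"
  shows "(\<integral>\<^sup>+\<omega>. f (X \<omega>, Y \<omega>) \<partial>M) = (\<integral>\<^sup>+\<omega>. (\<integral>\<^sup>+\<omega>'. f (X \<omega>, Y \<omega>') \<partial>M) \<partial>M)"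
proof -
  have X [measurable]: "X \<in> measurable M S" and Y [measurable]: "Y \<in> measurable M T"
    using ind by (auto simp: indep_rv_def)
  interpret X: prob_space "distr M S X" by (rule prob_space_distr[OF X])
  interpret Y: prob_space "distr M T Y" by (rule prob_space_distr[OF Y])
  have eq: "distr M S X \<Otimes>\<^sub>M distr M T Y = distr M (S \<Otimes>\<^sub>M T) (\<lambda>x. (X x, Y x))"
  proof (rule pair_measure_eqI)
    fix A B assume "A \<in> sets (distr M S X)" "B \<in> sets (distr M T Y)"
    then have AB [measurable]: "A \<in> sets S" "B \<in> sets T" by auto
    have "(\<lambda>x. (X x, Y x)) -` (A \<times> B) \<inter> space M = (X -` A \<inter> space M) \<inter> (Y -` B \<inter> space M)" by auto
    then show "emeasure (distr M S X) A * emeasure (distr M T Y) B =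
        emeasure (distr M (S \<Otimes>\<^sub>M T) (\<lambda>x. (X x, Y x))) (A \<times> B)"
      using ind AB by (simp add: emeasure_distr emeasure_eq_measure indep_rv_def ennreal_mult)
  qed (auto simp: X.sigma_finite_measure_axioms Y.sigma_finite_measure_axioms cong:
      sets_pair_measure_cong)
  have "(\<integral>\<^sup>+\<omega>. f (X \<omega>, Y \<omega>) \<partial>M) = (\<integral>\<^sup>+p. f p \<partial>distr M (S \<Otimes>\<^sub>M T) (\<lambda>x. (X x, Y x)))"
    by (subst nn_integral_distr) auto
  also have "\<dots> = (\<integral>\<^sup>+x. (\<integral>\<^sup>+y. f (x, y) \<partial>distr M T Y) \<partial>distr M S X)"
    unfolding eq[symmetric] by (subst Y.nn_integral_fst[symmetric]) auto
  also have "\<dots> = (\<integral>\<^sup>+x. (\<integral>\<^sup>+\<omega>'. f (x, Y \<omega>') \<partial>M) \<partial>distr M S X)"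
    by (intro nn_integral_cong) (subst nn_integral_distr, auto)
  also have "\<dots> = (\<integral>\<^sup>+\<omega>. (\<integral>\<^sup>+\<omega>'. f (X \<omega>, Y \<omega>') \<partial>M) \<partial>M)"
    by (subst nn_integral_distr) auto
  finally show ?thesis .
qed

lemma indep_rv_vimage_algebra:
  assumes "indep_rv M S X T Y"
  shows "indep_rv M (vimage_algebra (space M) X S) (\<lambda>\<omega>. \<omega>) T Y"
proof -
  have X: "X \<in> measurable M S" using assms by (auto simp: indep_rv_def)
  then have XS: "X \<in> space M \<rightarrow> space S" using measurable_space by auto
  let ?V = "vimage_algebra (space M) X S"
  have V: "sets ?V = {X -` A \<inter> space M | A. A \<in> sets S}"
    using sets_vimage_algebra2[OF XS] by simp
  have "(\<lambda>\<omega>. \<omega>) \<in> measurable M ?V" using X unfolding measurable_def V by auto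
  then show ?thesis using assms unfolding indep_rv_def V by (auto simp: Int_assoc)
qed

lemma indep_rv_sym: "indep_rv M S X T Y \<Longrightarrow> indep_rv M T Y S X"
  unfolding indep_rv_def by (auto simp: Int_commute mult.commute)

lemma nn_integral_split_nat:
  fixes J :: "'a \<Rightarrow> nat"
  assumes [measurable]: "f \<in> borel_measurable M" "J \<in> measurable M (count_space UNIV)"
  shows "(\<integral>\<^sup>+\<omega>. f \<omega> \<partial>M) = (\<Sum>j. \<integral>\<^sup>+\<omega>. indicator {\<omega>. J \<omega> = j} \<omega> * f \<omega> \<partial>M)"
proof -
  have "(\<Sum>j. indicator {\<omega>. J \<omega> = j} \<omega> * f \<omega>) = f \<omega>" for \<omega>
  proof -
    have "(\<Sum>j. indicator {\<omega>. J \<omega> = j} \<omega> * f \<omega>) = (\<Sum>j\<in>{J \<omega>}. indicator {\<omega>. J \<omega> = j} \<omega> * f \<omega>)"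
      by (rule suminf_finite) auto
    then show ?thesis by simp
  qed
  then show ?thesis by (subst nn_integral_suminf[symmetric]) auto
qed

text \<open>A discrete strong Markov property: \<open>N j\<close> is the past of time \<open>j\<close> and \<open>Z j\<close> the noise
  after time \<open>j\<close>.\<close>

lemma (in prob_space) random_index_indep:
  fixes J :: "'a \<Rightarrow> nat"
  assumes ind: "\<And>j. indep_rv M (N j) (\<lambda>\<omega>. \<omega>) T (Z j)"
    and J: "\<And>j. {\<omega> \<in> space M. J \<omega> = j} \<in> sets (N j)"
    and X: "\<And>j. X j \<in> measurable (N j) S"
    and \<mu>: "\<And>j. distr M T (Z j) = \<mu>"
    and f [measurable]: "f \<in> borel_measurable (S \<Otimes>\<^sub>M T)"
  shows "(\<integral>\<^sup>+\<omega>. f (X (J \<omega>) \<omega>, Z (J \<omega>) \<omega>) \<partial>M) = (\<integral>\<^sup>+\<omega>. (\<integral>\<^sup>+z. f (X (J \<omega>) \<omega>, z) \<partial>\<mu>) \<partial>M)"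
proof -
  have id [measurable]: "(\<lambda>\<omega>. \<omega>) \<in> measurable M (N j)" and Z [measurable]: "Z j \<in> measurable M T"
      for j
    using ind by (auto simp: indep_rv_def)
  have XM [measurable]: "X j \<in> measurable M S" for j
    using measurable_compose[OF id X] by simp
  have JM: "{\<omega> \<in> space M. J \<omega> = j} \<in> sets M" for j
  proof -
    have "(\<lambda>\<omega>. \<omega>) -` {\<omega> \<in> space M. J \<omega> = j} \<inter> space M = {\<omega> \<in> space M. J \<omega> = j}" by auto
    with measurable_sets[OF id J, of j] show ?thesis by simp
  qed
  have JM' [measurable]: "J \<in> measurable M (count_space UNIV)"
    using JM by (auto simp: measurable_count_space_eq2_countable vimage_def Int_def conj_commute)
  have \<mu>s [measurable_cong]: "sets \<mu> = sets T" using \<mu>[of 0] by auto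
  interpret \<mu>: prob_space \<mu> using prob_space_distr[OF Z[of 0]] \<mu>[of 0] by simp
  have XJ [measurable]: "(\<lambda>\<omega>. X (J \<omega>) \<omega>) \<in> measurable M S"
      and [measurable]: "(\<lambda>\<omega>. Z (J \<omega>) \<omega>) \<in> measurable M T"
    using measurable_compose_countable[where f = X, OF XM JM'] measurable_compose_countable[where f
        = Z, OF Z JM'] by auto
  have "(\<integral>\<^sup>+\<omega>. f (X (J \<omega>) \<omega>, Z (J \<omega>) \<omega>) \<partial>M) =
    (\<Sum>j. \<integral>\<^sup>+\<omega>. indicator {\<omega>. J \<omega> = j} \<omega> * f (X (J \<omega>) \<omega>, Z (J \<omega>) \<omega>) \<partial>M)"
    by (rule nn_integral_split_nat) measurable
  also have "\<dots> = (\<Sum>j. \<integral>\<^sup>+\<omega>. indicator {\<omega>. J \<omega> = j} \<omega> * (\<integral>\<^sup>+z. f (X (J \<omega>) \<omega>, z) \<partial>\<mu>) \<partial>M)"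
  proof (intro suminf_cong)
    fix j
    define A where "A = {\<omega> \<in> space M. J \<omega> = j}"
    have [measurable]: "A \<in> sets (N j)" "X j \<in> measurable (N j) S" using J X by (auto simp: A_def)
    define h where "h p = indicator A (fst p) * f (X j (fst p), snd p)" for p
    have [measurable]: "h \<in> borel_measurable (N j \<Otimes>\<^sub>M T)" unfolding h_def by measurable
    have "(\<integral>\<^sup>+\<omega>. indicator {\<omega>. J \<omega> = j} \<omega> * f (X (J \<omega>) \<omega>, Z (J \<omega>) \<omega>) \<partial>M) = (\<integral>\<^sup>+\<omega>. h (\<omega>, Z j \<omega>) \<partial>M)"
      by (intro nn_integral_cong) (auto simp: h_def A_def indicator_def)
    also have "\<dots> = (\<integral>\<^sup>+\<omega>. (\<integral>\<^sup>+\<omega>'. h (\<omega>, Z j \<omega>') \<partial>M) \<partial>M)"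
      by (rule indep_rv_nn_integral[OF ind]) measurable
    also have "\<dots> = (\<integral>\<^sup>+\<omega>. (\<integral>\<^sup>+z. h (\<omega>, z) \<partial>\<mu>) \<partial>M)"
    proof (intro nn_integral_cong)
      fix \<omega> assume \<omega>: "\<omega> \<in> space M"
      have "(\<lambda>z. h (\<omega>, z)) \<in> borel_measurable T"
        by (rule measurable_compose[OF _ \<open>h \<in> _\<close>]) (use measurable_space[OF id \<omega>] in auto)
      then show "(\<integral>\<^sup>+\<omega>'. h (\<omega>, Z j \<omega>') \<partial>M) = (\<integral>\<^sup>+z. h (\<omega>, z) \<partial>\<mu>)"
        unfolding \<mu>[of j, symmetric] by (subst nn_integral_distr) auto
    qed
    also have "\<dots> = (\<integral>\<^sup>+\<omega>. indicator {\<omega>. J \<omega> = j} \<omega> * (\<integral>\<^sup>+z. f (X (J \<omega>) \<omega>, z) \<partial>\<mu>) \<partial>M)"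
      by (intro nn_integral_cong) (auto simp: h_def A_def indicator_def)
    finally show "(\<integral>\<^sup>+\<omega>. indicator {\<omega>. J \<omega> = j} \<omega> * f (X (J \<omega>) \<omega>, Z (J \<omega>) \<omega>) \<partial>M) = \<dots>" .
  qed
  also have "\<dots> = (\<integral>\<^sup>+\<omega>. (\<integral>\<^sup>+z. f (X (J \<omega>) \<omega>, z) \<partial>\<mu>) \<partial>M)"
    by (rule nn_integral_split_nat[symmetric]) measurable
  finally show ?thesis .
qed

definition past_algebra :: "'a measure \<Rightarrow> (real \<Rightarrow> 'a \<Rightarrow> real) \<Rightarrow> real \<Rightarrow> 'a measure" where
  "past_algebra M W t = vimage_algebra (space M) (\<lambda>\<omega>. \<lambda>u\<in>{0..t}. W u \<omega>) (PiM {0..t} (\<lambda>_. borel))"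

definition increments :: "(real \<Rightarrow> 'a \<Rightarrow> real) \<Rightarrow> real \<Rightarrow> real \<Rightarrow> 'a \<Rightarrow> nat \<Rightarrow> real" where
  "increments W t \<delta> \<omega> i = W (t + (real i + 1) * \<delta>) \<omega> - W (t + real i * \<delta>) \<omega>"

lemma space_past_algebra [simp]: "space (past_algebra M W t) = space M"
  by (simp add: past_algebra_def)

lemma measurable_past_algebra:
  assumes "0 \<le> u" "u \<le> t"
  shows "W u \<in> borel_measurable (past_algebra M W t)"
proof -
  have "(\<lambda>\<omega>. \<lambda>u\<in>{0..t}. W u \<omega>) \<in> measurable (past_algebra M W t) (PiM {0..t} (\<lambda>_. borel))"
    unfolding past_algebra_def by (rule measurable_vimage_algebra1) (auto simp: space_PiM)
  from measurable_compose[OF this measurable_component_singleton[of u]] assms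
  show ?thesis by simp
qed

lemma (in prob_space) distr_increments:
  fixes W :: "real \<Rightarrow> 'a \<Rightarrow> real" and t \<delta> :: real
  assumes W: "brownian_motion M 1 W" and t: "0 \<le> t" and \<delta>: "\<delta> > 0"
  shows "distr M (PiM UNIV (\<lambda>_. borel)) (increments W t \<delta>) = noise (sqrt \<delta>)"
proof -
  define u where "u i = t + real i * \<delta>" for i
  define X where "X i \<omega> = W (u (Suc i)) \<omega> - W (u i) \<omega>" for i \<omega>
  have Xinc: "(\<lambda>\<omega>. \<lambda>i\<in>UNIV. X i \<omega>) = increments W t \<delta>"
    by (auto simp: X_def u_def increments_def fun_eq_iff algebra_simps)
  have "mono u" using \<delta> by (auto simp: u_def mono_def mult_right_mono)
  then have ind: "indep_vars (\<lambda>_. borel) X UNIV"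
  proof -
    have "\<And>u::nat \<Rightarrow> real. 0 \<le> u 0 \<Longrightarrow> mono u \<Longrightarrow>
        indep_vars (\<lambda>_. borel) (\<lambda>i \<omega>. W (u (Suc i)) \<omega> - W (u i) \<omega>) UNIV"
      using W unfolding brownian_motion_def by blast
    from this[OF _ \<open>mono u\<close>] t show ?thesis unfolding X_def[abs_def] by (simp add: u_def)
  qed
  have rv: "random_variable borel (X i)" for i using ind unfolding indep_vars_def by auto
  have law: "distr M borel (X i) = gauss (sqrt \<delta>)" for i
  proof -
    have "distributed M lborel (X i) (normal_density 0 (sqrt (1 * (u (Suc i) - u i))))"
    proof -
      have "\<And>s t. 0 \<le> s \<Longrightarrow> s < t \<Longrightarrow>
          distributed M lborel (\<lambda>\<omega>. W t \<omega> - W s \<omega>) (normal_density 0 (sqrt (1 * (t - s))))"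
        using W unfolding brownian_motion_def by blast
      from this[of "u i" "u (Suc i)"] show ?thesis using t \<delta>
        by (simp add: u_def X_def[abs_def] algebra_simps)
    qed
    then have "distr M lborel (X i) = gauss (sqrt \<delta>)"
      by (auto dest!: distributed_distr_eq_density simp: gauss_def u_def algebra_simps)
    moreover have "distr M borel (X i) = distr M lborel (X i)" by (rule distr_cong) auto
    ultimately show ?thesis by simp
  qed
  show ?thesis
    using ind rv unfolding Xinc[symmetric] noise_def
    by (subst (asm) indep_vars_iff_distr_eq_PiM) (auto simp: law)
qed

lemma (in prob_space) indep_rv_past_increments:
  fixes W :: "real \<Rightarrow> 'a \<Rightarrow> real" and t \<delta> :: real
  assumes W: "brownian_motion M 1 W" and t: "0 \<le> t" and \<delta>: "\<delta> > 0"
  shows "indep_rv M (PiM {0..t} (\<lambda>_. borel)) (\<lambda>\<omega>. \<lambda>u::real\<in>{0..t}. W u \<omega>) (PiM UNIV (\<lambda>_. borel))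
      (increments W t \<delta>)"
proof -
  have Wm [measurable]: "W u \<in> borel_measurable M" if "u \<ge> 0" for u
    using W that by (auto simp: brownian_motion_def)
  let ?X = "\<lambda>\<omega>. \<lambda>u\<in>{0..t}. W u \<omega>" and ?Y = "increments W t \<delta>"
  let ?S = "PiM {0..t} (\<lambda>_. borel :: real measure)"
      and ?T = "PiM (UNIV :: nat set) (\<lambda>_. borel :: real measure)"
  have X: "?X \<in> measurable M ?S" by (intro measurable_restrict) auto
  have Y: "?Y \<in> measurable M ?T"
  proof -
    have "(\<lambda>\<omega>. \<lambda>i\<in>UNIV. increments W t \<delta> \<omega> i) \<in> measurable M ?T"
      using t \<delta> by (intro measurable_restrict) (auto simp: increments_def intro!:
          borel_measurable_diff Wm)
    then show ?thesis by (simp add: restrict_def)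
  qed
  let ?A = "{?X -` A \<inter> space M | A. A \<in> prod_algebra {0..t} (\<lambda>_. borel)}"
  let ?B = "{?Y -` A \<inter> space M | A. A \<in> sets ?T}"
  have "{?X -` A \<inter> space M | A. A \<in> sets ?S} = sigma_sets (space M) ?A"
    unfolding sets_PiM by (rule sigma_sets_vimage_commute) (auto simp: space_PiM)
  then have SA: "sigma_sets (space M) {?X -` A \<inter> space M | A. A \<in> sets ?S} =
      sigma_sets (space M) ?A"
    using sigma_sets_sigma_sets_eq[of ?A "space M"] by auto
  have "indep_set ?A ?B"
  proof (rule indep_setI)
    have "prod_algebra {0..t} (\<lambda>_. borel) \<subseteq> sets ?S" unfolding sets_PiM
      by (auto intro: sigma_sets.Basic)
    then show "?A \<subseteq> events" using measurable_sets[OF X] by blast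
    show "?B \<subseteq> events" using measurable_sets[OF Y] by blast
  next
    fix a b assume "a \<in> ?A" "b \<in> ?B"
    then obtain A B where a: "a = ?X -` A \<inter> space M" and A: "A \<in> prod_algebra {0..t} (\<lambda>_. borel)"
      and b: "b = ?Y -` B \<inter> space M" and B: "B \<in> sets ?T" by auto
    obtain F E where AF: "A = prod_emb {0..t} (\<lambda>_. borel) F (\<Pi>\<^sub>E j\<in>F. E j)"
        and F: "finite F" "F \<subseteq> {0..t}"
      and E: "\<And>j. j \<in> F \<Longrightarrow> E j \<in> sets borel"
      using prod_algebraE[OF A] by metis
    define l where "l = sorted_list_of_set (insert 0 (insert t F))"
    define n where "n = length l - 1"
    have l: "set l = insert 0 (insert t F)" "sorted l" "length l = Suc n" "distinct l"
      using F by (auto simp: l_def n_def card_gt_0_iff Suc_le_eq simp del: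
          sorted_list_of_set_insert_remove)
    define u where "u i = (if i \<le> n then l ! i else t + real (i - n) * \<delta>)" for i
    have lr: "0 \<le> l ! i \<and> l ! i \<le> t" if "i \<le> n" for i
      using nth_mem[of i l] l that F t by auto
    have l0: "l ! 0 = 0"
    proof -
      obtain i where i: "i < length l" "l ! i = 0" using l by (metis in_set_conv_nth insertI1)
      have "l ! 0 \<le> l ! i" using i l by (intro sorted_nth_mono) auto
      then show ?thesis using i lr[of 0] by auto
    qed
    have ln: "l ! n = t"
    proof -
      obtain i where i: "i < length l" "l ! i = t" using l
        by (metis in_set_conv_nth insertI1 insertI2)
      have "l ! i \<le> l ! n" using i l by (intro sorted_nth_mono) auto
      then show ?thesis using i lr[of n] by auto
    qed
    have u0: "u 0 = 0" and un: "u (n + i) = t + real i * \<delta>" for i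
      using l0 ln by (auto simp: u_def)
    have "mono u"
    proof (rule incseq_SucI)
      fix i show "u i \<le> u (Suc i)"
      proof (cases "Suc i \<le> n")
        case True then show ?thesis using l by (auto simp: u_def intro: sorted_nth_mono)
      next
        case False
        then obtain k where "i = n + k" by (metis le_Suc_ex not_less_eq_eq)
        then show ?thesis using un[of k] un[of "Suc k"] \<delta> by (simp add: algebra_simps)
      qed
    qed
    define D where "D i \<omega> = W (u (Suc i)) \<omega> - W (u i) \<omega>" for i \<omega>
    have ind: "indep_vars (\<lambda>_. borel) D UNIV"
      using W \<open>mono u\<close> u0 unfolding brownian_motion_def D_def[abs_def] by simp
    have Wu: "W (u i) \<omega> = (\<Sum>k<i. D k \<omega>)" if "\<omega> \<in> space M" for i \<omega>
      using W that u0 by (induction i) (auto simp: brownian_motion_def D_def)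
    have Y': "?Y \<omega> = (\<lambda>i. D (n + i) \<omega>)" for \<omega>
    proof
      fix i
      show "?Y \<omega> i = D (n + i) \<omega>"
        using un[of i] un[of "Suc i"] by (simp add: increments_def D_def algebra_simps)
    qed
    define PA where "PA = {d \<in> space (PiM {..<n} (\<lambda>_. borel :: real measure)). \<forall>i\<in>{..n}. l ! i \<in> F \<longrightarrow>
        (\<Sum>k<i. d k) \<in> E (l ! i)}"
    define PB where "PB = (\<lambda>d i. d (n + i)) -` B \<inter> space (PiM {n..} (\<lambda>_. borel :: real measure))"
    have PA: "PA \<in> sets (PiM {..<n} (\<lambda>_. borel))"
      unfolding PA_def
    proof (rule sets.sets_Collect_finite_All)
      fix i assume i: "i \<in> {..n}"
      show "{x \<in> space (PiM {..<n} (\<lambda>_. borel)). l ! i \<in> F \<longrightarrow>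
          (\<Sum>k<i. x k) \<in> E (l ! i)} \<in> sets (PiM {..<n} (\<lambda>_. borel))"
      proof (cases "l ! i \<in> F")
        case True
        have "(\<lambda>x. \<Sum>k<i. x k) \<in> borel_measurable (PiM {..<n} (\<lambda>_. borel :: real measure))"
          using i by (intro borel_measurable_sum measurable_component_singleton) auto
        from measurable_sets[OF this E[OF True]] True show ?thesis
          by (simp add: vimage_def Int_def conj_commute)
      qed auto
    qed auto
    have PB: "PB \<in> sets (PiM {n..} (\<lambda>_. borel))"
    proof -
      have "(\<lambda>d. \<lambda>i\<in>UNIV. d (n + i)) \<in> measurable (PiM {n..} (\<lambda>_. borel :: real measure)) ?T"
        by (intro measurable_restrict measurable_component_singleton) auto
      from measurable_sets[OF this B] show ?thesis by (simp add: PB_def restrict_def)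
    qed
    have a': "a = (\<lambda>\<omega>. \<lambda>i\<in>{..<n}. D i \<omega>) -` PA \<inter> space M"
    proof -
      have "\<omega> \<in> a \<longleftrightarrow> (\<forall>j\<in>F. W j \<omega> \<in> E j)" if "\<omega> \<in> space M" for \<omega>
        using F that unfolding a AF
          by (auto simp: prod_emb_iff restrict_def PiE_iff extensional_def subset_iff)
      also have "(\<forall>j\<in>F. W j \<omega> \<in> E j) \<longleftrightarrow> (\<forall>i\<in>{..n}. l ! i \<in> F \<longrightarrow> W (l ! i) \<omega> \<in> E (l ! i))" for \<omega>
        using l by (metis (no_types, lifting) atMost_iff in_set_conv_nth insertI2 less_Suc_eq_le)
      also have "\<dots> \<omega> \<longleftrightarrow> (\<forall>i\<in>{..n}. l ! i \<in> F \<longrightarrow> (\<Sum>k<i. D k \<omega>) \<in> E (l ! i))" if "\<omega> \<in> space M" for \<omega>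
      proof -
        have "W (l ! i) \<omega> = (\<Sum>k<i. D k \<omega>)" if "i \<le> n" for i
          using Wu[OF \<open>\<omega> \<in> space M\<close>, of i] that by (simp add: u_def)
        then show ?thesis by auto
      qed
      finally have "\<omega> \<in> a \<longleftrightarrow> (\<forall>i\<in>{..n}. l ! i \<in> F \<longrightarrow> (\<Sum>k<i. D k \<omega>) \<in> E (l ! i))" if "\<omega> \<in> space M"
          for \<omega>
        using that by blast
      moreover have "(\<Sum>k<i. (\<lambda>i\<in>{..<n}. D i \<omega>) k) = (\<Sum>k<i. D k \<omega>)" if "i \<le> n" for i \<omega>
        using that by (intro sum.cong) auto
      moreover have "a \<subseteq> space M" by (auto simp: a)
      ultimately show ?thesis by (auto simp: PA_def space_PiM)
    qed
    have b': "b = (\<lambda>\<omega>. \<lambda>i\<in>{n..}. D i \<omega>) -` PB \<inter> space M"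
      unfolding b PB_def by (auto simp: Y' space_PiM)
    have "indep_var (PiM {..<n} (\<lambda>_. borel)) (\<lambda>\<omega>. \<lambda>i\<in>{..<n}. D i \<omega>) (PiM {n..} (\<lambda>_. borel)) (\<lambda>\<omega>.
        \<lambda>i\<in>{n..}. D i \<omega>)"
      by (rule indep_var_restrict[OF ind]) auto
    from indep_varD[OF this PA PB]
    show "prob (a \<inter> b) = prob a * prob b"
      unfolding a' b' by (simp add: vimage_def Int_def conj_ac)
  qed
  then have "indep_set (sigma_sets (space M) ?A) (sigma_sets (space M) ?B)"
  proof (rule indep_set_sigma_sets)
    show "Int_stable ?A"
    proof (rule Int_stableI)
      fix a b assume "a \<in> ?A" "b \<in> ?A"
      then obtain A B where "a = ?X -` A \<inter> space M" "A \<in> prod_algebra {0..t} (\<lambda>_. borel)"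
        "b = ?X -` B \<inter> space M" "B \<in> prod_algebra {0..t} (\<lambda>_. borel)" by auto
      moreover from this have "A \<inter> B \<in> prod_algebra {0..t} (\<lambda>_. borel)"
        using Int_stable_prod_algebra[of "{0..t}" "\<lambda>_. borel :: real measure"]
          by (auto simp: Int_stable_def)
      ultimately show "a \<inter> b \<in> ?A" by (auto intro!: exI[of _ "A \<inter> B"])
    qed
    show "Int_stable ?B"
    proof (rule Int_stableI)
      fix a b assume "a \<in> ?B" "b \<in> ?B"
      then obtain A B where "a = ?Y -` A \<inter> space M" "A \<in> sets ?T" "b =
          ?Y -` B \<inter> space M" "B \<in> sets ?T" by auto
      then show "a \<inter> b \<in> ?B" by (auto intro!: exI[of _ "A \<inter> B"])
    qed
  qed
  then have "indep_set (sigma_sets (space M) {?X -` A \<inter> space M | A. A \<in> sets ?S}) (sigma_sets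
      (space M) ?B)"
    unfolding SA .
  then show ?thesis unfolding indep_rv_def using X Y by (auto intro!: indep_setD sigma_sets.Basic)
qed

lemma measurable_continuous_process:
  fixes W :: "real \<Rightarrow> 'a \<Rightarrow> real"
  assumes W: "\<And>u. u \<ge> 0 \<Longrightarrow> W u \<in> borel_measurable N"
    and cont: "\<And>\<omega>. \<omega> \<in> space N \<Longrightarrow> continuous_on {0..} (\<lambda>u. W u \<omega>)"
    and f [measurable]: "f \<in> borel_measurable K" and g [measurable]: "g \<in> measurable K N"
    and pos: "\<And>x. x \<in> space K \<Longrightarrow> f x \<ge> 0"
  shows "(\<lambda>x. W (f x) (g x)) \<in> borel_measurable K"
proof (rule borel_measurable_LIMSEQ_metric)
  fix n :: nat
  have "(\<lambda>x. W (real (nat \<lfloor>f x * 2^n\<rfloor>) / 2^n) (g x)) \<in> borel_measurable K"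
    by (rule measurable_compose_countable[where g = "\<lambda>x. nat \<lfloor>f x * 2^n\<rfloor>"
        and f = "\<lambda>i x. W (real i / 2^n) (g x)"])
       (auto intro!: measurable_compose[OF g] W)
  then show "(\<lambda>x. W (real (nat \<lfloor>f x * 2^n\<rfloor>) / 2^n) (g x)) \<in> borel_measurable K" .
next
  fix x assume x: "x \<in> space K"
  have eq: "real (nat \<lfloor>f x * 2^n\<rfloor>) = of_int \<lfloor>f x * 2^n\<rfloor>" for n :: nat
    using pos[OF x] by (auto simp: of_nat_nat)
  have "(\<lambda>n. real (nat \<lfloor>f x * 2^n\<rfloor>) / 2^n) \<longlonglongrightarrow> f x"
  proof (rule tendsto_sandwich)
    show "\<forall>\<^sub>F n in sequentially. f x - (1/2)^n \<le> real (nat \<lfloor>f x * 2^n\<rfloor>) / 2^n"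
    proof (intro always_eventually allI)
      fix n :: nat
      have "f x * 2^n - 1 \<le> of_int \<lfloor>f x * 2^n\<rfloor>" by linarith
      then show "f x - (1/2)^n \<le> real (nat \<lfloor>f x * 2^n\<rfloor>) / 2^n"
        unfolding eq by (simp add: pos_le_divide_eq power_divide left_diff_distrib)
    qed
    show "\<forall>\<^sub>F n in sequentially. real (nat \<lfloor>f x * 2^n\<rfloor>) / 2^n \<le> f x"
      unfolding eq by (intro always_eventually allI) (simp add: field_simps)
    have "(\<lambda>n. f x - (1/2)^n) \<longlonglongrightarrow> f x - 0"
      by (intro tendsto_diff tendsto_const LIMSEQ_power_zero) auto
    then show "(\<lambda>n. f x - (1/2)^n) \<longlonglongrightarrow> f x" by simp
  qed auto
  then show "(\<lambda>n. W (real (nat \<lfloor>f x * 2^n\<rfloor>) / 2^n) (g x)) \<longlonglongrightarrow> W (f x) (g x)"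
    using cont[OF measurable_space[OF g x]] pos[OF x]
    by (auto simp: continuous_on_sequentially comp_def)
qed

section \<open>Brownian paths\<close>

lemma brownian_motionD:
  assumes "brownian_motion M c W"
  shows "t \<ge> 0 \<Longrightarrow> W t \<in> borel_measurable M"
    and "\<omega> \<in> space M \<Longrightarrow> W 0 \<omega> = 0"
    and "\<omega> \<in> space M \<Longrightarrow> continuous_on {0..} (\<lambda>t. W t \<omega>)"
    and "0 \<le> s \<Longrightarrow> s < t \<Longrightarrow> distributed M lborel (\<lambda>\<omega>. W t \<omega> - W s \<omega>) (normal_density 0 (sqrt (c *
        (t - s))))"
    and "0 \<le> (u :: nat \<Rightarrow> real) 0 \<Longrightarrow> mono u \<Longrightarrow>
        prob_space.indep_vars M (\<lambda>_. borel) (\<lambda>i \<omega>. W (u (Suc i)) \<omega> - W (u i) \<omega>) UNIV"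
  using assms unfolding brownian_motion_def by blast+

lemma (in prob_space) brownian_motion_scale:
  assumes W: "brownian_motion M c W" and pq: "p \<noteq> 0" "q > 0" and pcq: "p\<^sup>2 * c * q = 1"
  shows "brownian_motion M 1 (\<lambda>u \<omega>. p * W (q * u) \<omega>)"
  unfolding brownian_motion_def
proof (intro conjI allI impI ballI)
  note D = brownian_motionD[OF W]
  show "(\<lambda>\<omega>. p * W (q * t) \<omega>) \<in> borel_measurable M" if "0 \<le> t" for t
    using D(1)[of "q * t"] that pq by auto
  show "p * W (q * 0) \<omega> = 0" if "\<omega> \<in> space M" for \<omega> using D(2)[OF that] by simp
  show "continuous_on {0..} (\<lambda>t. p * W (q * t) \<omega>)" if "\<omega> \<in> space M" for \<omega>
    by (intro continuous_on_mult continuous_on_const continuous_on_compose2[OF D(3)[OF that]])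
       (use pq in \<open>auto intro!: continuous_intros\<close>)
  show "distributed M lborel (\<lambda>\<omega>. p * W (q * t) \<omega> - p * W (q * s) \<omega>) (normal_density 0 (sqrt (1 *
      (t - s))))"
    if st: "0 \<le> s" "s < t" for s t
  proof -
    have c: "c > 0"
    proof -
      have "0 < p\<^sup>2 * q" using pq by simp
      moreover have "(p\<^sup>2 * q) * c = 1" using pcq by (simp add: mult_ac)
      ultimately show ?thesis by (metis zero_less_mult_pos zero_less_one)
    qed
    have "distributed M lborel (\<lambda>\<omega>. W (q * t) \<omega> - W (q * s) \<omega>) (normal_density 0 (sqrt (c * (q *
        t - q * s))))"
      using st pq by (intro D(4)) auto
    then have "distributed M lborel (\<lambda>\<omega>. 0 + p * (W (q * t) \<omega> - W (q * s) \<omega>)) (normal_density (0 +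
        p * 0) (\<bar>p\<bar> * sqrt (c * (q * t - q * s))))"
      using st pq c by (intro normal_density_affine) auto
    moreover have "\<bar>p\<bar> * sqrt (c * (q * t - q * s)) = sqrt (t - s)"
    proof -
      have "\<bar>p\<bar> * sqrt (c * (q * t - q * s)) = sqrt (p\<^sup>2 * c * q * (t - s))"
        by (simp add: real_sqrt_mult[symmetric] algebra_simps flip: real_sqrt_abs)
      then show ?thesis using pcq by simp
    qed
    ultimately show ?thesis by (simp add: algebra_simps)
  qed
  show "indep_vars (\<lambda>_. borel) (\<lambda>i \<omega>. p * W (q * u (Suc i)) \<omega> - p * W (q * u i) \<omega>) UNIV"
    if u: "0 \<le> u 0" "mono u" for u :: "nat \<Rightarrow> real"
  proof -
    have "indep_vars (\<lambda>_. borel) (\<lambda>i \<omega>. W (q * u (Suc i)) \<omega> - W (q * u i) \<omega>) UNIV"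
      using D(5)[of "\<lambda>i. q * u i"] u pq by (auto simp: mono_def)
    from indep_vars_compose2[OF this, of "\<lambda>_ x. p * x" "\<lambda>_. borel"]
    show ?thesis by (simp add: right_diff_distrib)
  qed
qed

lemma sets_partial_sum_exceeds:
  "{\<xi>. \<exists>i\<le>n. \<bar>\<Sum>j<i. \<xi> j\<bar> > a} \<in> sets (PiM UNIV (\<lambda>_::nat. borel :: real measure))"
proof -
  have "(\<lambda>x. \<Sum>j<i. x j) \<in> borel_measurable (PiM UNIV (\<lambda>_::nat. borel :: real measure))" for i
    by (intro borel_measurable_sum measurable_component_singleton) auto
  then have "{\<xi> \<in> space (PiM UNIV (\<lambda>_::nat. borel :: real measure)). \<exists>i\<in>{..n}. a < \<bar>\<Sum>j<i. \<xi> j\<bar>}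
      \<in> sets (PiM UNIV (\<lambda>_. borel))"
    by (intro sets.sets_Collect_finite_Ex borel_measurable_less borel_measurable_abs) auto
  then show ?thesis by (simp add: space_PiM Bex_def)
qed

lemma exit_value_notin:
  assumes "i \<le> n" "x i \<notin> D"
  shows "exit_value D n x \<notin> D"
proof -
  define k where "k = (LEAST i. i = n \<or> x i \<notin> D)"
  have "k = n \<or> x k \<notin> D" unfolding k_def by (rule LeastI[of _ n]) simp
  moreover have "k \<le> i" unfolding k_def by (rule Least_le) (use assms in auto)
  ultimately show ?thesis using assms unfolding exit_value_def k_def[symmetric]
    by (cases "k = n") auto
qed

lemma noise_maximal:
  fixes n :: nat and \<sigma> a :: real
  assumes \<sigma>: "\<sigma> > 0" and a: "a > 0"
  shows "measure (noise \<sigma>) {\<xi>. \<exists>i\<le>n. \<bar>\<Sum>j<i. \<xi> j\<bar> > a} \<le> n * \<sigma>\<^sup>2 / a\<^sup>2"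
proof -
  let ?N = "gauss \<sigma>" and ?S = "noise \<sigma>"
  interpret N: prob_space ?N by (rule prob_space_gauss[OF \<sigma>])
  interpret S: prob_space ?S by (rule prob_space_noise[OF \<sigma>])
  interpret SS: pair_prob_space ?S ?S ..
  define D where "D = {w. \<bar>Re w\<bar> \<le> a}"
  define H where "H = {\<xi> :: nat \<Rightarrow> real. \<exists>i\<le>n. \<bar>\<Sum>j<i. \<xi> j\<bar> > a}"
  have [measurable]: "D \<in> sets borel" unfolding D_def by measurable
  have [measurable]: "H \<in> sets (PiM UNIV (\<lambda>_. borel))"
    unfolding H_def by (rule sets_partial_sum_exceeds)
  note [measurable] = measurable_exit_value
  have U [measurable]: "UNIV \<in> sets (PiM UNIV (\<lambda>_::nat. borel :: real measure))"
    using sets.top[of ?S] by simp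
  define f where "f w = ennreal ((Re w)\<^sup>2)" for w
  have [measurable]: "f \<in> borel_measurable borel" unfolding f_def by measurable
  have step: "(\<integral>\<^sup>+x. (\<integral>\<^sup>+y. f (w + Complex x y) \<partial>?N) \<partial>?N) \<le> f w + ennreal (\<sigma>\<^sup>2)" for w
  proof -
    note m = gauss_moments[OF \<sigma>]
    have i: "integrable ?N (\<lambda>x. (Re w)\<^sup>2 + 2 * Re w * x + x\<^sup>2)" using m by auto
    have "(\<integral>\<^sup>+x. (\<integral>\<^sup>+y. f (w + Complex x y) \<partial>?N) \<partial>?N) = (\<integral>\<^sup>+x. ennreal ((Re w + x)\<^sup>2) \<partial>?N)"
      by (simp add: f_def N.emeasure_space_1[simplified])
    also have "\<dots> = (\<integral>\<^sup>+x. ennreal ((Re w)\<^sup>2 + 2 * Re w * x + x\<^sup>2) \<partial>?N)"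
      by (simp add: power2_sum algebra_simps)
    also have "\<dots> = ennreal (\<integral>x. (Re w)\<^sup>2 + 2 * Re w * x + x\<^sup>2 \<partial>?N)"
    proof (rule nn_integral_eq_integral[OF i], intro AE_I2)
      fix x
      have "(Re w)\<^sup>2 + 2 * Re w * x + x\<^sup>2 = (Re w + x)\<^sup>2" by (simp add: power2_sum)
      then show "0 \<le> (Re w)\<^sup>2 + 2 * Re w * x + x\<^sup>2" by simp
    qed
    also have "(\<integral>x. (Re w)\<^sup>2 + 2 * Re w * x + x\<^sup>2 \<partial>?N) = (Re w)\<^sup>2 + \<sigma>\<^sup>2"
      using m by (simp add: N.prob_space[simplified])
    finally show ?thesis by (simp add: f_def ennreal_plus)
  qed
  have "emeasure ?S H = emeasure (?S \<Otimes>\<^sub>M ?S) (H \<times> UNIV)"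
    using S.emeasure_space_1 U by (subst S.emeasure_pair_measure_Times) auto
  also have "\<dots> = (\<integral>\<^sup>+z. indicator (H \<times> UNIV) z \<partial>(?S \<Otimes>\<^sub>M ?S))"
    by (rule nn_integral_indicator[symmetric]) auto
  also have "\<dots> \<le> (\<integral>\<^sup>+z. ennreal (1 / a\<^sup>2) * f (exit_value D n (walk 0 z)) \<partial>(?S \<Otimes>\<^sub>M ?S))"
  proof (intro nn_integral_mono)
    fix z :: "(nat \<Rightarrow> real) \<times> (nat \<Rightarrow> real)"
    show "indicator (H \<times> UNIV) z \<le> ennreal (1 / a\<^sup>2) * f (exit_value D n (walk 0 z))"
    proof (cases "fst z \<in> H")
      case True
      then obtain i where i: "i \<le> n" "\<bar>\<Sum>j<i. fst z j\<bar> > a" by (auto simp: H_def)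
      have "Re (walk 0 z i) = (\<Sum>j<i. fst z j)" by (simp add: walk_def step_def)
      then have "exit_value D n (walk 0 z) \<notin> D" using i
        by (intro exit_value_notin[of i]) (auto simp: D_def)
      then have "a < \<bar>Re (exit_value D n (walk 0 z))\<bar>" by (simp add: D_def)
      then have "a\<^sup>2 \<le> (Re (exit_value D n (walk 0 z)))\<^sup>2"
        using a by (metis abs_le_square_iff abs_of_pos less_imp_le)
      then have "1 \<le> 1 / a\<^sup>2 * (Re (exit_value D n (walk 0 z)))\<^sup>2"
        using a by (simp add: field_simps)
      then have "ennreal 1 \<le> ennreal (1 / a\<^sup>2 * (Re (exit_value D n (walk 0 z)))\<^sup>2)"
        by (rule ennreal_leI)
      then show ?thesis by (simp add: f_def ennreal_mult[symmetric] indicator_def)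
    qed (auto simp: indicator_def)
  qed
  also have "\<dots> = ennreal (1 / a\<^sup>2) * (\<integral>\<^sup>+z. f (exit_value D n (walk 0 z)) \<partial>(?S \<Otimes>\<^sub>M ?S))"
    by (intro nn_integral_cmult) measurable
  also have "\<dots> \<le> ennreal (1 / a\<^sup>2) * (f 0 + of_nat n * ennreal (\<sigma>\<^sup>2))"
    by (intro mult_left_mono nn_integral_exit_value_le[OF \<sigma>] step) auto
  also have "\<dots> = ennreal (n * \<sigma>\<^sup>2 / a\<^sup>2)"
    by (simp add: f_def ennreal_of_nat_eq_real_of_nat ennreal_mult[symmetric])
  finally show ?thesis unfolding H_def
    by (subst (asm) S.emeasure_eq_measure) (simp add: ennreal_le_iff)
qed

lemma dyadic_approx:
  fixes t l :: real
  assumes "0 \<le> t" "t \<le> l" "l > 0"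
  shows "(\<lambda>p. real (nat \<lfloor>t / l * 2^p\<rfloor>) * l / 2^p) \<longlonglongrightarrow> t"
    and "nat \<lfloor>t / l * 2^p\<rfloor> \<le> 2^p"
proof -
  have eq: "real (nat \<lfloor>t / l * 2^p\<rfloor>) = of_int \<lfloor>t / l * 2^p\<rfloor>" for p :: nat
    using assms by (auto simp: of_nat_nat)
  show "(\<lambda>p. real (nat \<lfloor>t / l * 2^p\<rfloor>) * l / 2^p) \<longlonglongrightarrow> t"
  proof (rule tendsto_sandwich)
    show "\<forall>\<^sub>F p in sequentially. t - l * (1/2)^p \<le> real (nat \<lfloor>t / l * 2^p\<rfloor>) * l / 2^p"
    proof (intro always_eventually allI)
      fix p :: nat
      have "t / l * 2^p - 1 \<le> of_int \<lfloor>t / l * 2^p\<rfloor>" by linarith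
      then have "(t / l * 2^p - 1) * (l / 2^p) \<le> of_int \<lfloor>t / l * 2^p\<rfloor> * (l / 2^p)"
        using assms by (intro mult_right_mono) auto
      moreover have "(t / l * 2^p - 1) * (l / 2^p) = t - l * (1/2)^p"
        using assms by (simp add: field_simps power_divide)
      ultimately show "t - l * (1/2)^p \<le> real (nat \<lfloor>t / l * 2^p\<rfloor>) * l / 2^p"
        unfolding eq by simp
    qed
    show "\<forall>\<^sub>F p in sequentially. real (nat \<lfloor>t / l * 2^p\<rfloor>) * l / 2^p \<le> t"
    proof (intro always_eventually allI)
      fix p :: nat
      have "of_int \<lfloor>t / l * 2^p\<rfloor> * (l / 2^p) \<le> (t / l * 2^p) * (l / 2^p)"
        using assms by (intro mult_right_mono) auto
      then show "real (nat \<lfloor>t / l * 2^p\<rfloor>) * l / 2^p \<le> t" unfolding eq using assms by simp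
    qed
    have "(\<lambda>p. t - l * (1/2)^p) \<longlonglongrightarrow> t - l * 0"
      by (intro tendsto_diff tendsto_const tendsto_mult LIMSEQ_power_zero) auto
    then show "(\<lambda>p. t - l * (1/2)^p) \<longlonglongrightarrow> t" by simp
  qed auto
  have "t / l * 2^p \<le> 1 * 2^p" using assms by (intro mult_right_mono) auto
  then have "\<lfloor>t / l * 2^p\<rfloor> \<le> \<lfloor>2^p :: real\<rfloor>" by (intro floor_mono) simp
  then have "\<lfloor>t / l * 2^p\<rfloor> \<le> 2^p" by simp
  then show "nat \<lfloor>t / l * 2^p\<rfloor> \<le> 2^p" by (simp add: nat_le_iff)
qed

lemma (in prob_space) brownian_maximal:
  assumes W: "brownian_motion M 1 W" and l: "l \<ge> 0" and a: "a > 0"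
  shows "{\<omega> \<in> space M. \<exists>t\<in>{0..l}. \<bar>W t \<omega>\<bar> > a} \<in> events"
    and "prob {\<omega> \<in> space M. \<exists>t\<in>{0..l}. \<bar>W t \<omega>\<bar> > a} \<le> l / a\<^sup>2"
proof -
  note D = brownian_motionD[OF W]
  have "{\<omega> \<in> space M. \<exists>t\<in>{0..l}. \<bar>W t \<omega>\<bar> > a} \<in> events \<and>
    prob {\<omega> \<in> space M. \<exists>t\<in>{0..l}. \<bar>W t \<omega>\<bar> > a} \<le> l / a\<^sup>2"
  proof (cases "l = 0")
    case True
    then have empty: "{\<omega> \<in> space M. \<exists>t\<in>{0..l}. \<bar>W t \<omega>\<bar> > a} = {}" using D(2) a by auto
    show ?thesis unfolding empty using True by simp
  next
    case False
    with l have l: "l > 0" by simp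
    define A where "A p = {\<omega> \<in> space M. \<exists>i\<in>{..2^p}. a < \<bar>W (real i * (l / 2^p)) \<omega>\<bar>}" for p :: nat
    have A_ev: "A p \<in> events" for p
    proof -
      have Wm: "W (real i * (l / 2^p)) \<in> borel_measurable M" for i by (rule D(1)) (use l in auto)
      show ?thesis unfolding A_def
        by (intro sets.sets_Collect_finite_Ex borel_measurable_less borel_measurable_abs
            borel_measurable_const Wm) simp
    qed
    have A_prob: "prob (A p) \<le> l / a\<^sup>2" for p
    proof -
      define \<delta> where "\<delta> = l / 2^p"
      have \<delta>: "\<delta> > 0" using l by (simp add: \<delta>_def)
      define H where "H = {\<xi> :: nat \<Rightarrow> real. \<exists>i\<le>2^p. \<bar>\<Sum>j<i. \<xi> j\<bar> > a}"
      have H: "H \<in> sets (PiM UNIV (\<lambda>_. borel))"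
        unfolding H_def by (rule sets_partial_sum_exceeds)
      have Y: "increments W 0 \<delta> \<in> measurable M (PiM UNIV (\<lambda>_. borel))"
        using indep_rv_past_increments[OF W _ \<delta>, of 0] by (auto simp: indep_rv_def)
      have sum: "W (real i * \<delta>) \<omega> = (\<Sum>j<i. increments W 0 \<delta> \<omega> j)" if "\<omega> \<in> space M" for i \<omega>
        using D(2)[OF that] by (induction i) (auto simp: increments_def algebra_simps)
      have "A p = increments W 0 \<delta> -` H \<inter> space M"
        unfolding A_def \<delta>_def[symmetric] H_def by (auto simp: sum)
      then have "prob (A p) = measure (noise (sqrt \<delta>)) H"
        using distr_increments[OF W _ \<delta>, of 0] measure_distr[OF Y H] by simp
      also have "\<dots> \<le> (2^p::nat) * (sqrt \<delta>)\<^sup>2 / a\<^sup>2"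
        unfolding H_def by (rule noise_maximal) (use \<delta> a in auto)
      also have "\<dots> = l / a\<^sup>2" using \<delta> by (simp add: \<delta>_def)
      finally show ?thesis .
    qed
    have "incseq A"
    proof (rule incseq_SucI)
      fix p
      show "A p \<subseteq> A (Suc p)"
      proof
        fix \<omega> assume "\<omega> \<in> A p"
        then obtain i where i: "i \<le> 2^p" "\<bar>W (real i * (l / 2^p)) \<omega>\<bar> > a" "\<omega> \<in> space M"
          by (auto simp: A_def)
        have "real (2 * i) * (l / 2^Suc p) = real i * (l / 2^p)" by simp
        then show "\<omega> \<in> A (Suc p)" using i by (auto simp: A_def intro!: bexI[of _ "2 * i"])
      qed
    qed
    have U: "{\<omega> \<in> space M. \<exists>t\<in>{0..l}. \<bar>W t \<omega>\<bar> > a} = (\<Union>p. A p)"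
    proof (intro equalityI subsetI)
      fix \<omega> assume "\<omega> \<in> {\<omega> \<in> space M. \<exists>t\<in>{0..l}. \<bar>W t \<omega>\<bar> > a}"
      then obtain t where t: "\<omega> \<in> space M" "0 \<le> t" "t \<le> l" "\<bar>W t \<omega>\<bar> > a" by auto
      have "(\<lambda>p. W (real (nat \<lfloor>t / l * 2^p\<rfloor>) * l / 2^p) \<omega>) \<longlonglongrightarrow> W t \<omega>"
        using D(3)[OF t(1)] dyadic_approx(1)[OF t(2,3) l] t l
        by (auto simp: continuous_on_sequentially comp_def)
      then have "(\<lambda>p. \<bar>W (real (nat \<lfloor>t / l * 2^p\<rfloor>) * l / 2^p) \<omega>\<bar>) \<longlonglongrightarrow> \<bar>W t \<omega>\<bar>" by (rule tendsto_rabs)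
      from order_tendstoD(1)[OF this t(4)] obtain p
          where "a < \<bar>W (real (nat \<lfloor>t / l * 2^p\<rfloor>) * l / 2^p) \<omega>\<bar>"
        by (auto simp: eventually_sequentially)
      then have "\<omega> \<in> A p" using t(1) dyadic_approx(2)[OF t(2,3) l, of p] by (auto simp: A_def)
      then show "\<omega> \<in> (\<Union>p. A p)" by auto
    next
      fix \<omega> assume "\<omega> \<in> (\<Union>p. A p)"
      then obtain p i where "\<omega> \<in> space M" "i \<le> 2^p" "\<bar>W (real i * (l / 2^p)) \<omega>\<bar> > a"
        by (auto simp: A_def)
      moreover from this have "real i * (l / 2^p) \<le> l"
      proof -
        have "real i \<le> 2^p" using \<open>i \<le> 2^p\<close> by (metis of_nat_le_iff of_nat_numeral of_nat_power)
        then show ?thesis using l by (simp add: field_simps)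
      qed
      ultimately show "\<omega> \<in> {\<omega> \<in> space M. \<exists>t\<in>{0..l}. \<bar>W t \<omega>\<bar> > a}" using l by force
    qed
    have "(\<lambda>p. prob (A p)) \<longlonglongrightarrow> prob (\<Union>p. A p)"
      using A_ev \<open>incseq A\<close> by (intro finite_Lim_measure_incseq) auto
    then have "prob (\<Union>p. A p) \<le> l / a\<^sup>2" by (rule LIMSEQ_le_const2) (use A_prob in auto)
    then show ?thesis unfolding U using A_ev by auto
  qed
  then show "{\<omega> \<in> space M. \<exists>t\<in>{0..l}. \<bar>W t \<omega>\<bar> > a} \<in> events"
    and "prob {\<omega> \<in> space M. \<exists>t\<in>{0..l}. \<bar>W t \<omega>\<bar> > a} \<le> l / a\<^sup>2" by auto
qed

lemma (in prob_space) brownian_zero_set_null: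
  assumes W: "brownian_motion M 1 W"
  shows "AE \<omega> in M. AE u in lborel. u \<ge> 0 \<longrightarrow> W u \<omega> \<noteq> 0"
proof -
  note D = brownian_motionD[OF W]
  interpret P: pair_sigma_finite lborel M ..
  have [measurable]: "(\<lambda>p. W (max 0 (fst p)) (snd p)) \<in> borel_measurable (lborel \<Otimes>\<^sub>M M)"
    by (rule measurable_continuous_process[where N = M, OF D(1) D(3)]) auto
  define Z where "Z = {p \<in> space (lborel \<Otimes>\<^sub>M M). fst p > 0 \<and> W (max 0 (fst p)) (snd p) = 0}"
  have [measurable]: "Z \<in> sets (lborel \<Otimes>\<^sub>M M)" unfolding Z_def by measurable
  have null: "AE \<omega> in M. W u \<omega> \<noteq> 0" if u: "u > 0" for u
  proof -
    have Wu [measurable]: "W u \<in> borel_measurable M" using u by (intro D(1)) auto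
    have d: "distributed M lborel (\<lambda>\<omega>. W u \<omega> - W 0 \<omega>) (normal_density 0 (sqrt (1 * (u - 0))))"
      using u by (intro D(4)) auto
    have "AE x in distr M lborel (\<lambda>\<omega>. W u \<omega> - W 0 \<omega>). x \<noteq> 0"
      unfolding distributed_distr_eq_density[OF d]
      using AE_lborel_singleton[of "0::real"] by (subst AE_density) auto
    then have "AE \<omega> in M. W u \<omega> - W 0 \<omega> \<noteq> 0"
      using distributed_measurable[OF d] by (subst (asm) AE_distr_iff) auto
    with AE_space show ?thesis by eventually_elim (use D(2) in auto)
  qed
  have "(\<integral>\<^sup>+\<omega>. (\<integral>\<^sup>+u. indicator Z (u, \<omega>) \<partial>lborel) \<partial>M) =
      (\<integral>\<^sup>+u. (\<integral>\<^sup>+\<omega>. indicator Z (u, \<omega>) \<partial>M) \<partial>lborel)"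
    by (rule P.Fubini') (simp add: split_beta')
  also have "\<dots> = (\<integral>\<^sup>+u. 0 \<partial>(lborel :: real measure))"
  proof (intro nn_integral_cong)
    fix u :: real
    show "(\<integral>\<^sup>+\<omega>. indicator Z (u, \<omega>) \<partial>M) = 0"
    proof (cases "u > 0")
      case True
      have "AE \<omega> in M. indicator Z (u, \<omega>) = (0 :: ennreal)"
        using null[OF True] by eventually_elim (auto simp: Z_def indicator_def)
      then have "(\<integral>\<^sup>+\<omega>. indicator Z (u, \<omega>) \<partial>M) = (\<integral>\<^sup>+\<omega>. 0 \<partial>M)" by (rule nn_integral_cong_AE)
      then show ?thesis by simp
    qed (simp add: Z_def)
  qed
  finally have "(\<integral>\<^sup>+\<omega>. (\<integral>\<^sup>+u. indicator Z (u, \<omega>) \<partial>lborel) \<partial>M) = 0" by simp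
  then have "AE \<omega> in M. (\<integral>\<^sup>+u. indicator Z (u, \<omega>) \<partial>lborel) = 0"
    by (subst (asm) nn_integral_0_iff_AE) (auto intro!: lborel.borel_measurable_nn_integral simp:
        split_beta')
  then show ?thesis using AE_space
  proof eventually_elim
    case (elim \<omega>)
    have "AE u in lborel. indicator Z (u, \<omega>) = (0 :: ennreal)"
      using elim by (subst (asm) nn_integral_0_iff_AE) auto
    with AE_lborel_singleton[of "0::real"] show ?case
      by eventually_elim (use elim in \<open>auto simp: Z_def indicator_def space_pair_measure split:
          if_splits\<close>)
  qed
qed

lemma std_normal_tail_pos: "measure (density lborel (\<lambda>x. ennreal (std_normal_density x))) {1..} > 0"
proof (rule ccontr)
  let ?N = "density lborel (\<lambda>x. ennreal (std_normal_density x))"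
  interpret prob_space ?N by (rule prob_space_normal_density) simp
  assume "\<not> ?thesis"
  then have "emeasure ?N {1..} = 0" using measure_nonneg[of ?N "{1..}"]
    by (simp add: emeasure_eq_measure)
  then have "(\<integral>\<^sup>+x. ennreal (std_normal_density x) * indicator {1..} x \<partial>lborel) = 0"
    by (subst (asm) emeasure_density) auto
  then have "AE x in lborel. ennreal (std_normal_density x) * indicator {1..} x = 0"
    by (subst (asm) nn_integral_0_iff_AE) auto
  then have "AE x in lborel. x \<notin> {1::real..2}"
  proof eventually_elim
    case (elim x)
    have "std_normal_density x > 0" by (rule normal_density_pos) simp
    then show ?case using elim by (auto simp: indicator_def split: if_splits)
  qed
  then have "emeasure lborel {1::real..2} = 0" by (subst (asm) AE_iff_measurable[of "{1..2}"]) auto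
  then show False by simp
qed

lemma (in prob_space) brownian_recurrent:
  assumes W: "brownian_motion M 1 W"
  shows "AE \<omega> in M. \<forall>q. \<exists>u\<ge>q. W u \<omega> \<ge> 0"
proof -
  note D = brownian_motionD[OF W]
  define t :: "nat \<Rightarrow> real" where "t n = (fact (Suc n))\<^sup>2" for n
  have tS: "t (Suc n) = (real n + 2)\<^sup>2 * t n" for n
  proof -
    have "fact (Suc (Suc n)) = (real n + 2) * fact (Suc n)" by (subst fact_Suc) simp
    then show ?thesis by (simp only: t_def power_mult_distrib)
  qed
  have t1: "t n \<ge> 1" for n
  proof -
    have "(1::real) \<le> fact (Suc n)" by (rule fact_ge_1)
    then show ?thesis unfolding t_def by (metis one_le_power)
  qed
  have tge: "real n \<le> t n" for n
  proof -
    have "real n \<le> fact (Suc n)" using fact_ge_self[of "Suc n"]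
      by (metis Suc_leD of_nat_fact of_nat_le_iff)
    also have "\<dots> \<le> (fact (Suc n))\<^sup>2"
      by (rule self_le_power) (auto simp: fact_ge_1 simp del: fact_Suc)
    finally show ?thesis by (simp add: t_def)
  qed
  define d where "d n = t (Suc n) - t n" for n
  have d: "d n \<ge> (real n + 1)\<^sup>2 * t n" "d n > 0" for n
  proof -
    have "d n = ((real n + 2)\<^sup>2 - 1) * t n" by (simp add: d_def tS algebra_simps)
    also have "\<dots> \<ge> (real n + 1)\<^sup>2 * t n"
      using t1[of n] by (intro mult_right_mono) (auto simp: power2_eq_square algebra_simps)
    finally show "d n \<ge> (real n + 1)\<^sup>2 * t n" .
    moreover have "(real n + 1)\<^sup>2 * t n > 0" using t1[of n]
      by (intro mult_pos_pos) (auto simp: add_nonneg_pos)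
    ultimately show "d n > 0" by linarith
  qed
  define X where "X n \<omega> = W (t (Suc n)) \<omega> - W (t n) \<omega>" for n \<omega>
  have "mono t" by (rule incseq_SucI) (use d(2) in \<open>auto simp: d_def less_imp_le\<close>)
  then have ind: "indep_vars (\<lambda>_. borel) X UNIV"
    using D(5)[of t] t1[of 0] by (simp add: X_def[abs_def])
  have Xm [measurable]: "X n \<in> borel_measurable M" for n using ind by (auto simp: indep_vars_def)
  define E where "E n = {\<omega> \<in> space M. X n \<omega> / sqrt (d n) \<ge> 1}" for n
  have E_ev [measurable]: "E n \<in> events" for n unfolding E_def by measurable
  define p where "p = measure (density lborel (\<lambda>x. ennreal (std_normal_density x))) {1..}"
  have E_prob: "prob (E n) = p" for n
  proof -
    have "distributed M lborel (X n) (normal_density 0 (sqrt (1 * (t (Suc n) - t n))))"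
      unfolding X_def[abs_def] using t1[of n] d(2)[of n] by (intro D(4)) (auto simp: d_def)
    then have dd: "distributed M lborel (\<lambda>\<omega>. (X n \<omega> - 0) / sqrt (d n)) std_normal_density"
      using normal_standard_normal_convert[of "sqrt (d n)" "X n" 0] d(2)[of n] by (simp add: d_def)
    have "E n = (\<lambda>\<omega>. (X n \<omega> - 0) / sqrt (d n)) -` {1..} \<inter> space M" by (auto simp: E_def)
    then have "prob (E n) = measure (distr M lborel (\<lambda>\<omega>. (X n \<omega> - 0) / sqrt (d n))) {1..}"
      using distributed_measurable[OF dd] by (subst measure_distr) auto
    then show ?thesis unfolding distributed_distr_eq_density[OF dd] by (simp add: p_def)
  qed
  have p: "p > 0" unfolding p_def by (rule std_normal_tail_pos)
  have inf: "AE \<omega> in M. infinite {n. X n \<omega> / sqrt (d n) \<ge> 1}"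
  proof -
    have "indep_events (\<lambda>n. {\<omega> \<in> space M. X n \<omega> / sqrt (d n) \<ge> 1}) UNIV"
      using indep_eventsI_indep_vars[OF ind, of "\<lambda>n x. x / sqrt (d n) \<ge> 1"] by simp
    from borel_0_1_law_AE[OF this]
    show ?thesis
    proof
      assume fin: "AE \<omega> in M. finite {n. X n \<omega> / sqrt (d n) \<ge> 1}"
      have "(\<lambda>n. \<integral>\<omega>. indicator (E n) \<omega> \<partial>M) \<longlonglongrightarrow> (\<integral>\<omega>. (0::real) \<partial>M)"
      proof (rule integral_dominated_convergence[where w = "\<lambda>_. 1"])
        show "AE \<omega> in M. (\<lambda>n. indicator (E n) \<omega>) \<longlonglongrightarrow> (0::real)"
          using fin
        proof eventually_elim
          case (elim \<omega>)
          then obtain k where "\<forall>n\<in>{n. X n \<omega> / sqrt (d n) \<ge> 1}. n < k"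
            using finite_nat_set_iff_bounded by blast
          then have "\<forall>n\<ge>k. indicator (E n) \<omega> = (0::real)"
            by (auto simp: E_def indicator_def not_less[symmetric])
          then show ?case by (intro tendsto_eventually) (auto simp: eventually_sequentially)
        qed
      qed auto
      then have "(\<lambda>n. p) \<longlonglongrightarrow> 0" using E_prob by simp
      then have "p = 0" by (simp add: LIMSEQ_const_iff)
      with p show ?thesis by simp
    qed
  qed
  define F where "F n = {\<omega> \<in> space M. \<exists>s\<in>{0..t n}. \<bar>W s \<omega>\<bar> > (real n + 1) * sqrt (t n)}" for n
  have F: "F n \<in> events" "prob (F n) \<le> 1 / (real n + 1)\<^sup>2" for n
  proof -
    have t0: "0 \<le> t n" "0 < (real n + 1) * sqrt (t n)" using t1[of n] by auto
    show "F n \<in> events" unfolding F_def by (rule brownian_maximal[OF W t0])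
    have "prob (F n) \<le> t n / ((real n + 1) * sqrt (t n))\<^sup>2" unfolding F_def
      by (rule brownian_maximal[OF W t0])
    also have "\<dots> = 1 / (real n + 1)\<^sup>2" using t1[of n] by (simp add: power_mult_distrib)
    finally show "prob (F n) \<le> 1 / (real n + 1)\<^sup>2" .
  qed
  have "AE \<omega> in M. eventually (\<lambda>n. \<omega> \<in> space M - F n) sequentially"
  proof (rule borel_cantelli_AE1)
    show "summable (\<lambda>n. prob (F n))"
    proof (rule summable_comparison_test')
      have "summable (\<lambda>n. inverse ((real n)\<^sup>2))" by (rule inverse_power_summable) simp
      then have "summable (\<lambda>n. inverse ((real (Suc n))\<^sup>2))" by (subst summable_Suc_iff)
      then show "summable (\<lambda>n. 1 / (real n + 1)\<^sup>2)" by (simp add: inverse_eq_divide algebra_simps)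
      show "norm (prob (F n)) \<le> 1 / (real n + 1)\<^sup>2" if "0 \<le> n" for n using F(2)[of n] by simp
    qed
  qed (use F in \<open>auto simp: emeasure_eq_measure\<close>)
  with inf show ?thesis
  proof eventually_elim
    case (elim \<omega>)
    show ?case
    proof
      fix q :: real
      obtain k where k: "\<And>n. n \<ge> k \<Longrightarrow> \<omega> \<in> space M - F n" using elim(2)
        by (auto simp: eventually_sequentially)
      obtain n where n: "n \<ge> max k (nat \<lceil>q\<rceil>)" "X n \<omega> / sqrt (d n) \<ge> 1"
        using elim(1) unfolding infinite_nat_iff_unbounded_le by blast
      have "\<omega> \<in> space M" "\<omega> \<notin> F n" using k[of n] n by auto
      then have "\<bar>W (t n) \<omega>\<bar> \<le> (real n + 1) * sqrt (t n)" using t1[of n]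
        by (auto simp: F_def not_less dest!: bspec[of _ _ "t n"])
      also have "\<dots> \<le> sqrt (d n)"
        using d(1)[of n] by (intro real_le_rsqrt) (use t1[of n] in \<open>simp add: power_mult_distrib\<close>)
      also have "\<dots> \<le> X n \<omega>" using n(2) d(2)[of n] by (simp add: field_simps)
      finally have "0 \<le> W (t (Suc n)) \<omega>" by (simp add: X_def)
      moreover have "q \<le> t (Suc n)" using n(1) tge[of "Suc n"] by linarith
      ultimately show "\<exists>u\<ge>q. 0 \<le> W u \<omega>" by blast
    qed
  qed
qed

lemma continuous_zero_iff:
  fixes f :: "real \<Rightarrow> real"
  assumes f: "continuous_on {a..b} f" and ab: "a \<le> b"
  shows "(\<exists>x\<in>{a..b}. f x = 0) \<longleftrightarrow> (\<forall>n::nat. \<exists>q\<in>{0..1} \<inter> \<rat>. \<bar>f (a + (b - a) * q)\<bar> < 1 / (real n + 1))"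
proof
  assume "\<exists>x\<in>{a..b}. f x = 0"
  then obtain x where x: "x \<in> {a..b}" "f x = 0" by auto
  show "\<forall>n::nat. \<exists>q\<in>{0..1} \<inter> \<rat>. \<bar>f (a + (b - a) * q)\<bar> < 1 / (real n + 1)"
  proof
    fix n :: nat
    define g where "g q = f (a + (b - a) * q)" for q
    have maps: "a + (b - a) * q \<in> {a..b}" if "q \<in> {0..1}" for q
    proof -
      have "(b - a) * q \<le> (b - a) * 1" using that ab by (intro mult_left_mono) auto
      then show ?thesis using that ab by auto
    qed
    have g: "continuous_on {0..1} g" unfolding g_def
      by (rule continuous_on_compose2[OF f]) (use maps in \<open>auto intro!: continuous_intros\<close>)
    obtain y where y: "y \<in> {0..1}" "g y = 0"
    proof (cases "a = b")
      case True then show ?thesis using x that[of 0] by (simp add: g_def)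
    next
      case False
      then have "g ((x - a) / (b - a)) = 0" "(x - a) / (b - a) \<in> {0..1}" using x ab
        by (auto simp: g_def)
      then show ?thesis using that by blast
    qed
    obtain r where r: "r > 0" "\<And>q. q \<in> {0..1} \<Longrightarrow> dist q y < r \<Longrightarrow> dist (g q) (g y) < 1 / (real n + 1)"
      using g y(1) unfolding continuous_on_iff
        by (metis add_pos_nonneg of_nat_0_le_iff zero_less_divide_1_iff zero_less_one add.commute)
    have "max 0 (y - r) < min 1 (y + r)" using y r by auto
    from Rats_dense_in_real[OF this] obtain q where q: "q \<in> \<rat>" "max 0 (y - r) < q" "q < min 1 (y +
        r)" by auto
    then have "\<bar>g q\<bar> < 1 / (real n + 1)" using r(2)[of q] y by (auto simp: dist_real_def)
    then show "\<exists>q\<in>{0..1} \<inter> \<rat>. \<bar>f (a + (b - a) * q)\<bar> < 1 / (real n + 1)" using q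
      by (auto simp: g_def)
  qed
next
  assume h: "\<forall>n::nat. \<exists>q\<in>{0..1} \<inter> \<rat>. \<bar>f (a + (b - a) * q)\<bar> < 1 / (real n + 1)"
  obtain x where x: "x \<in> {a..b}" "\<And>y. y \<in> {a..b} \<Longrightarrow> \<bar>f x\<bar> \<le> \<bar>f y\<bar>"
    using continuous_attains_inf[of "{a..b}" "\<lambda>x. \<bar>f x\<bar>"] continuous_on_rabs[OF f] ab
    by (metis atLeastatMost_empty_iff2 compact_Icc not_less)
  have "\<bar>f x\<bar> < 1 / (real n + 1)" for n :: nat
  proof -
    obtain q where q: "q \<in> {0..1}" "\<bar>f (a + (b - a) * q)\<bar> < 1 / (real n + 1)" using h by blast
    have "(b - a) * q \<le> (b - a) * 1" using q ab by (intro mult_left_mono) auto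
    then have "a + (b - a) * q \<in> {a..b}" using q ab by auto
    from x(2)[OF this] q(2) show ?thesis by linarith
  qed
  then have "\<bar>f x\<bar> \<le> 0"
    using reals_Archimedean[of "\<bar>f x\<bar>"]
      by (metis inverse_eq_divide not_le less_asym of_nat_Suc add.commute)
  then show "\<exists>x\<in>{a..b}. f x = 0" using x by auto
qed

section \<open>Leaving a wedge\<close>

text \<open>The wedge \<open>{w. 0 < wedge_dist q w}\<close> has opening angle \<open>arctan (1 / q)\<close>.\<close>

definition wedge_dist :: "real \<Rightarrow> complex \<Rightarrow> real" where
  "wedge_dist q w = min (Re w - q * Im w) (Im w)"

abbreviation wedge :: "real \<Rightarrow> real \<Rightarrow> complex set" where
  "wedge q e \<equiv> {w. wedge_dist q w > e}"

lemma continuous_on_wedge_dist [continuous_intros]: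
  "continuous_on A f \<Longrightarrow> continuous_on A (\<lambda>x. wedge_dist q (f x))"
  unfolding wedge_dist_def by (intro continuous_intros)

lemma measurable_wedge_dist [measurable]: "wedge_dist q \<in> borel_measurable borel"
  unfolding wedge_dist_def[abs_def] by measurable

lemma Re_gt_wedge: "q > 0 \<Longrightarrow> e \<ge> 0 \<Longrightarrow> wedge_dist q w > e \<Longrightarrow> Re w > e"
  unfolding wedge_dist_def by (smt (verit) mult_nonneg_nonneg min_less_iff_conj)

lemma exit_value_path_tendsto:
  fixes w :: "real \<Rightarrow> complex"
  assumes w: "continuous_on {0..} w" and \<tau>: "\<tau> > 0" "wedge_dist q (w \<tau>) = 0"
    and pos: "\<And>u. 0 \<le> u \<Longrightarrow> u < \<tau> \<Longrightarrow> wedge_dist q (w u) > 0"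
    and W: "\<And>m. m \<ge> m1 \<Longrightarrow> 0 \<le> \<theta> m \<and> \<theta> m \<le> (1/2)^m \<and> (\<forall>i. W m i = w (\<theta> m + real i * (1/2)^m))"
    and \<eta>: "\<eta> > 0"
  shows "\<exists>p0. \<forall>p\<ge>p0. \<exists>m0. \<forall>m\<ge>m0. \<exists>u. \<tau> - \<eta> < u \<and> u < \<tau> \<and> 0 \<le> u \<and>
    exit_value (wedge q (1 / (real p + 1))) (p * 2^m) (W m) = w u \<and>
        wedge_dist q (w u) > 1 / (real p + 1) / 2"
proof -
  define g where "g u = wedge_dist q (w u)" for u
  have g: "continuous_on {0..} g" unfolding g_def by (intro continuous_intros w)
  define \<tau>' where "\<tau>' = max 0 (\<tau> - \<eta>)"
  have \<tau>': "0 \<le> \<tau>'" "\<tau>' < \<tau>" "\<tau> - \<eta> \<le> \<tau>'" using \<tau> \<eta> by (auto simp: \<tau>'_def)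
  obtain x where x: "x \<in> {0..\<tau>'}" "\<And>y. y \<in> {0..\<tau>'} \<Longrightarrow> g x \<le> g y"
    using continuous_attains_inf[of "{0..\<tau>'}" g] continuous_on_subset[OF g, of "{0..\<tau>'}"] \<tau>'
    by (metis atLeastatMost_empty_iff2 atLeastAtMost_iff atLeast_iff compact_Icc not_less subsetI)
  define c where "c = g x"
  have c: "c > 0" "\<And>y. 0 \<le> y \<Longrightarrow> y \<le> \<tau>' \<Longrightarrow> c \<le> g y"
    using x pos[of x] \<tau>' by (auto simp: c_def g_def)
  obtain p0 :: nat where p0: "real p0 > max (2 / c) (\<tau> + 1)" using reals_Archimedean2 by blast
  show ?thesis
  proof (rule exI[of _ p0], intro allI impI)
    fix p assume p: "p0 \<le> p"
    define \<epsilon> where "\<epsilon> = 1 / (real p + 1)"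
    have \<epsilon>: "\<epsilon> > 0" by (simp add: \<epsilon>_def)
    have "real p > 2 / c" "real p > \<tau> + 1" using p0 p by linarith+
    then have \<epsilon>c: "\<epsilon> < c / 2" and p\<tau>: "\<tau> + 1 < real p"
      using c(1) by (auto simp: \<epsilon>_def field_simps add_strict_increasing)
    have "uniformly_continuous_on {0..\<tau> + 2} g"
      by (rule compact_uniformly_continuous) (auto intro: continuous_on_subset[OF g])
    then obtain r where r: "r > 0" "\<And>u v. u \<in> {0..\<tau>+2} \<Longrightarrow> v \<in> {0..\<tau>+2} \<Longrightarrow> \<bar>u - v\<bar> < r \<Longrightarrow> \<bar>g u - g v\<bar> <
        \<epsilon> / 2"
      using \<epsilon> unfolding uniformly_continuous_on_def dist_real_def by (metis half_gt_zero)
    obtain m2 :: nat where m2: "(1/2)^m2 < min r 1" using real_arch_pow_inv[of "min r 1" "1/2"] r(1)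
      by auto
    show "\<exists>m0. \<forall>m\<ge>m0. \<exists>u. \<tau> - \<eta> < u \<and> u < \<tau> \<and> 0 \<le> u \<and>
      exit_value (wedge q (1 / (real p + 1))) (p * 2^m) (W m) = w u \<and>
          wedge_dist q (w u) > 1 / (real p + 1) / 2"
    proof (rule exI[of _ "max m1 m2"], intro allI impI)
      fix m assume m: "max m1 m2 \<le> m"
      define \<delta> :: real where "\<delta> = (1/2)^m"
      have "\<delta> \<le> (1/2)^m2" unfolding \<delta>_def using m by (intro power_decreasing) auto
      moreover have "0 < \<delta>" by (simp add: \<delta>_def)
      ultimately have \<delta>: "0 < \<delta>" "\<delta> < r" "\<delta> < 1" using m2 by linarith+
      have \<theta>: "0 \<le> \<theta> m" "\<theta> m \<le> \<delta>" and Wm: "\<And>i. W m i = w (\<theta> m + real i * \<delta>)" using W[of m] m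
        by (auto simp: \<delta>_def)
      define D where "D = wedge q \<epsilon>"
      define n where "n = p * 2^m"
      define u where "u i = \<theta> m + real i * \<delta>" for i
      have u0: "u i \<ge> 0" for i using \<theta> \<delta> by (simp add: u_def)
      have inD: "W m i \<in> D \<longleftrightarrow> g (u i) > \<epsilon>" for i by (simp add: D_def Wm g_def u_def)
      define I where "I = nat \<lceil>(\<tau> - \<theta> m) / \<delta>\<rceil>"
      have I1: "u I \<ge> \<tau>"
      proof -
        have "(\<tau> - \<theta> m) / \<delta> \<le> real I" unfolding I_def by linarith
        then show ?thesis using \<delta>(1) by (simp add: u_def field_simps)
      qed
      have I2: "u I \<le> \<tau> + \<delta>"
      proof (cases "(\<tau> - \<theta> m) / \<delta> > 0")
        case True
        then have "real I < (\<tau> - \<theta> m) / \<delta> + 1" unfolding I_def by linarith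
        then show ?thesis using \<delta>(1) by (simp add: u_def field_simps)
      next
        case False
        then have "I = 0" unfolding I_def by auto
        then show ?thesis using \<theta> \<tau> by (simp add: u_def)
      qed
      have I3: "j < I \<Longrightarrow> u j < \<tau>" for j
      proof -
        assume "j < I"
        then have "real j < (\<tau> - \<theta> m) / \<delta>" unfolding I_def by linarith
        then show ?thesis using \<delta>(1) by (simp add: u_def field_simps)
      qed
      have near: "\<tau> \<le> u i \<Longrightarrow> u i \<le> \<tau> + \<delta> \<Longrightarrow> g (u i) < \<epsilon> / 2" for i
        using r(2)[of "u i" \<tau>] \<delta> \<tau> u0[of i] by (auto simp: g_def)
      have InD: "W m I \<notin> D" using near[OF I1 I2] \<epsilon> inD[of I] by simp
      have In: "I \<le> n"
      proof -
        have "real I * \<delta> \<le> \<tau> + \<delta>" using I2 \<theta> by (simp add: u_def)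
        also have "\<dots> < real p" using p\<tau> \<delta> by simp
        finally have "real I < real p / \<delta>" using \<delta> by (simp add: field_simps)
        also have "\<dots> = real n" by (simp add: n_def \<delta>_def power_divide)
        finally show ?thesis by simp
      qed
      define N where "N = (LEAST i. i = n \<or> W m i \<notin> D)"
      have NI: "N \<le> I" unfolding N_def by (rule Least_le) (use InD in auto)
      have ev: "exit_value D n (W m) = w (u N)" by (simp add: exit_value_def N_def Wm u_def)
      have "exit_value D n (W m) \<notin> D" by (rule exit_value_notin[where x = "W m", OF In InD])
      then have gN: "g (u N) \<le> \<epsilon>" using inD[of N] by (simp add: exit_value_def N_def)
      have before: "j < N \<Longrightarrow> g (u j) > \<epsilon>" for j
        using not_less_Least[of j "\<lambda>i. i = n \<or> W m i \<notin> D"] inD[of j] unfolding N_def by auto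
      have "N \<noteq> 0"
      proof
        assume "N = 0"
        have "\<bar>g (u 0) - g 0\<bar> < \<epsilon> / 2" using r(2)[of "u 0" 0] \<theta> \<delta> \<tau> by (auto simp: u_def)
        then show False using gN c(2)[of 0] \<tau>' \<epsilon>c \<epsilon> \<open>N = 0\<close> by auto
      qed
      then obtain k where k: "N = Suc k" by (cases N) auto
      have uk: "u k < \<tau>" using I3[of k] NI k by simp
      have uS: "u N = u k + \<delta>" by (simp add: u_def k algebra_simps)
      have "\<bar>g (u N) - g (u k)\<bar> < \<epsilon> / 2"
        using r(2)[of "u N" "u k"] u0[of k] u0[of N] uk \<delta> unfolding uS by auto
      moreover have "g (u k) > \<epsilon>" using before[of k] k by simp
      ultimately have g2: "g (u N) > \<epsilon> / 2" by linarith
      have uN: "u N < \<tau>" using near[of N] g2 uk \<delta> unfolding uS by force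
      have "\<tau>' < u N" using c(2)[OF u0, of N] gN \<epsilon>c c(1) by force
      then show "\<exists>u. \<tau> - \<eta> < u \<and> u < \<tau> \<and> 0 \<le> u \<and>
        exit_value (wedge q (1 / (real p + 1))) (p * 2^m) (W m) = w u \<and>
            wedge_dist q (w u) > 1 / (real p + 1) / 2"
        using uN \<tau>' u0[of N] ev g2 unfolding D_def \<epsilon>_def n_def g_def by (intro exI[of _ "u N"]) auto
    qed
  qed
qed

text \<open>First \<open>m \<rightarrow> \<infinity>\<close> (refinement of the sampling), then \<open>p \<rightarrow> \<infinity>\<close> (the smaller wedges exhaust the wedge).\<close>

definition iterated_lim :: "(nat \<Rightarrow> nat \<Rightarrow> real) \<Rightarrow> real \<Rightarrow> bool" where
  "iterated_lim a A \<longleftrightarrow> (\<forall>\<eta>>0. \<exists>p0. \<forall>p\<ge>p0. \<exists>m0. \<forall>m\<ge>m0. \<bar>a p m - A\<bar> < \<eta>)"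

lemma iterated_lim_le:
  assumes "iterated_lim a A" "\<And>p m. \<bar>a p m\<bar> \<le> K"
  shows "\<bar>A\<bar> \<le> K"
proof (rule field_le_epsilon)
  fix e :: real assume "e > 0"
  then obtain p m where "\<bar>a p m - A\<bar> < e" using assms(1) unfolding iterated_lim_def by blast
  then show "\<bar>A\<bar> \<le> K + e" using assms(2)[of p m] by linarith
qed

lemma iterated_lim_liminf:
  assumes "iterated_lim a A"
  shows "liminf (\<lambda>p. liminf (\<lambda>m. ereal (a p m))) = ereal A"
proof (rule antisym)
  have bnd: "\<exists>p0. \<forall>p\<ge>p0. ereal (A - \<eta>) \<le> liminf (\<lambda>m. ereal (a p m)) \<and> liminf (\<lambda>m. ereal (a p m)) \<le>
      ereal (A + \<eta>)"
    if \<eta>: "\<eta> > 0" for \<eta>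
  proof -
    obtain p0 where p0: "\<And>p. p \<ge> p0 \<Longrightarrow> \<exists>m0. \<forall>m\<ge>m0. \<bar>a p m - A\<bar> < \<eta>"
      using assms \<eta> unfolding iterated_lim_def by blast
    show ?thesis
    proof (rule exI[of _ p0], intro allI impI conjI)
      fix p assume "p0 \<le> p"
      from p0[OF this] obtain m0 where m0: "\<And>m. m \<ge> m0 \<Longrightarrow> \<bar>a p m - A\<bar> < \<eta>" by blast
      show "ereal (A - \<eta>) \<le> liminf (\<lambda>m. ereal (a p m))"
      proof (rule Liminf_bounded)
        show "\<forall>\<^sub>F m in sequentially. ereal (A - \<eta>) \<le> ereal (a p m)"
          using m0 by (intro eventually_sequentiallyI[of m0]) (force simp: abs_less_iff)
      qed
      have "liminf (\<lambda>m. ereal (a p m)) \<le> limsup (\<lambda>m. ereal (a p m))"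
        by (rule Liminf_le_Limsup) simp
      also have "\<dots> \<le> ereal (A + \<eta>)"
      proof (rule Limsup_bounded)
        show "\<forall>\<^sub>F m in sequentially. ereal (a p m) \<le> ereal (A + \<eta>)"
          using m0 by (intro eventually_sequentiallyI[of m0]) (force simp: abs_less_iff)
      qed
      finally show "liminf (\<lambda>m. ereal (a p m)) \<le> ereal (A + \<eta>)" .
    qed
  qed
  show "liminf (\<lambda>p. liminf (\<lambda>m. ereal (a p m))) \<le> ereal A"
  proof (rule ereal_le_epsilon2)
    fix e :: real assume "0 < e"
    from bnd[OF this] obtain p0 where p0: "\<And>p. p \<ge> p0 \<Longrightarrow> liminf (\<lambda>m. ereal (a p m)) \<le> ereal (A + e)"
      by blast
    have "liminf (\<lambda>p. liminf (\<lambda>m. ereal (a p m))) \<le> limsup (\<lambda>p. liminf (\<lambda>m. ereal (a p m)))"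
      by (rule Liminf_le_Limsup) simp
    also have "\<dots> \<le> ereal (A + e)"
      by (rule Limsup_bounded, rule eventually_sequentiallyI[of p0], rule p0)
    finally show "liminf (\<lambda>p. liminf (\<lambda>m. ereal (a p m))) \<le> ereal A + ereal e" by simp
  qed
  show "ereal A \<le> liminf (\<lambda>p. liminf (\<lambda>m. ereal (a p m)))"
  proof (rule ereal_le_epsilon2)
    fix e :: real assume "0 < e"
    from bnd[OF this] obtain p0 where p0: "\<And>p. p \<ge> p0 \<Longrightarrow> ereal (A - e) \<le> liminf (\<lambda>m. ereal (a p m))"
      by blast
    have "ereal (A - e) \<le> liminf (\<lambda>p. liminf (\<lambda>m. ereal (a p m)))"
      by (rule Liminf_bounded, rule eventually_sequentiallyI[of p0], rule p0)
    then have "ereal (A - e) + ereal e \<le> liminf (\<lambda>p. liminf (\<lambda>m. ereal (a p m))) + ereal e"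
      by (rule add_right_mono)
    then show "ereal A \<le> liminf (\<lambda>p. liminf (\<lambda>m. ereal (a p m))) + ereal e" by simp
  qed
qed

lemma (in prob_space) iterated_lim_integral:
  assumes a [measurable]: "\<And>p m. a p m \<in> borel_measurable M"
    and bnd: "\<And>p m \<omega>. \<bar>a p m \<omega>\<bar> \<le> K"
    and lim: "AE \<omega> in M. iterated_lim (\<lambda>p m. a p m \<omega>) (A \<omega>)"
  shows "\<exists>A'\<in>borel_measurable M. (AE \<omega> in M. A' \<omega> = A \<omega>) \<and>
    iterated_lim (\<lambda>p m. \<integral>\<omega>. a p m \<omega> \<partial>M) (\<integral>\<omega>. A' \<omega> \<partial>M)"
proof -
  define A' where "A' \<omega> = real_of_ereal (liminf (\<lambda>p. liminf (\<lambda>m. ereal (a p m \<omega>))))" for \<omega>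
  have A' [measurable]: "A' \<in> borel_measurable M" unfolding A'_def by measurable
  have eq: "AE \<omega> in M. A' \<omega> = A \<omega>"
    using lim by eventually_elim (simp add: A'_def iterated_lim_liminf)
  have lim': "AE \<omega> in M. iterated_lim (\<lambda>p m. a p m \<omega>) (A' \<omega>)"
    using lim eq by eventually_elim simp
  have A'K: "AE \<omega> in M. \<bar>A' \<omega>\<bar> \<le> K"
    using lim' by eventually_elim (rule iterated_lim_le, auto simp: bnd)
  have int: "integrable M (a p m)" "integrable M A'" for p m
    using bnd A'K by (auto intro!: integrable_const_bound[where B = K])
  define b where "b p \<omega> = limsup (\<lambda>m. ennreal \<bar>a p m \<omega> - A' \<omega>\<bar>)" for p \<omega>
  have [measurable]: "b p \<in> borel_measurable M" for p unfolding b_def by measurable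
  have dK: "AE \<omega> in M. ennreal \<bar>a p m \<omega> - A' \<omega>\<bar> \<le> ennreal (2 * K)" for p m
    using A'K
  proof eventually_elim
    case (elim \<omega>)
    then show ?case using bnd[of p m \<omega>] by (intro ennreal_leI) linarith
  qed
  have dK': "AE \<omega> in M. \<forall>m. ennreal \<bar>a p m \<omega> - A' \<omega>\<bar> \<le> ennreal (2 * K)" for p
    using dK by (subst AE_all_countable) auto
  have "(\<lambda>p. \<integral>\<^sup>+\<omega>. b p \<omega> \<partial>M) \<longlonglongrightarrow> (\<integral>\<^sup>+\<omega>. 0 \<partial>M)"
  proof (rule nn_integral_dominated_convergence[where w = "\<lambda>_. ennreal (2 * K)"])
    show "AE \<omega> in M. b p \<omega> \<le> ennreal (2 * K)" for p
      using dK'[of p] by eventually_elim (auto simp: b_def intro!: Limsup_bounded)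
    show "(\<integral>\<^sup>+\<omega>. ennreal (2 * K) \<partial>M) < \<infinity>" by (simp add: emeasure_space_1 ennreal_mult_less_top)
    show "AE \<omega> in M. (\<lambda>p. b p \<omega>) \<longlonglongrightarrow> 0"
      using lim'
    proof eventually_elim
      case (elim \<omega>)
      show ?case
      proof (rule order_tendstoI)
        fix e :: ennreal assume "0 < e"
        then obtain e' where e': "e' > 0" "ennreal e' < e"
        proof -
          obtain z where z: "0 < z" "z < e" using dense[OF \<open>0 < e\<close>] by blast
          then have "z < top" by (metis less_top_ennreal order_less_le_trans top_greatest)
          then have "ennreal (enn2real z) = z" by simp
          then show ?thesis using z that[of "enn2real z"]
            by (metis ennreal_0 enn2real_nonneg less_le)
        qed
        obtain p0 where p0: "\<And>p. p \<ge> p0 \<Longrightarrow> \<exists>m0. \<forall>m\<ge>m0. \<bar>a p m \<omega> - A' \<omega>\<bar> < e'"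
          using elim e'(1) unfolding iterated_lim_def by blast
        show "\<forall>\<^sub>F p in sequentially. b p \<omega> < e"
        proof (rule eventually_sequentiallyI[of p0])
          fix p assume "p0 \<le> p"
          from p0[OF this] obtain m0 where m0: "\<And>m. m \<ge> m0 \<Longrightarrow> \<bar>a p m \<omega> - A' \<omega>\<bar> < e'" by blast
          have "b p \<omega> \<le> ennreal e'" unfolding b_def
            by (rule Limsup_bounded, rule eventually_sequentiallyI[of m0], rule ennreal_leI) (use m0
                in \<open>auto intro: less_imp_le\<close>)
          with e'(2) show "b p \<omega> < e" by order
        qed
      qed simp
    qed
  qed auto
  then have b0: "(\<lambda>p. \<integral>\<^sup>+\<omega>. b p \<omega> \<partial>M) \<longlonglongrightarrow> 0" by simp
  have "iterated_lim (\<lambda>p m. \<integral>\<omega>. a p m \<omega> \<partial>M) (\<integral>\<omega>. A' \<omega> \<partial>M)"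
    unfolding iterated_lim_def
  proof (intro allI impI)
    fix \<eta> :: real assume \<eta>: "\<eta> > 0"
    then have "\<forall>\<^sub>F p in sequentially. (\<integral>\<^sup>+\<omega>. b p \<omega> \<partial>M) < ennreal \<eta>"
      using order_tendstoD(2)[OF b0, of "ennreal \<eta>"] by simp
    then obtain p0 where p0: "\<And>p. p \<ge> p0 \<Longrightarrow> (\<integral>\<^sup>+\<omega>. b p \<omega> \<partial>M) < ennreal \<eta>"
      by (auto simp: eventually_sequentially)
    show "\<exists>p0. \<forall>p\<ge>p0. \<exists>m0. \<forall>m\<ge>m0. \<bar>(\<integral>\<omega>. a p m \<omega> \<partial>M) - (\<integral>\<omega>. A' \<omega> \<partial>M)\<bar> < \<eta>"
    proof (rule exI[of _ p0], intro allI impI)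
      fix p assume p: "p0 \<le> p"
      have "limsup (\<lambda>m. \<integral>\<^sup>+\<omega>. ennreal \<bar>a p m \<omega> - A' \<omega>\<bar> \<partial>M) \<le> (\<integral>\<^sup>+\<omega>. b p \<omega> \<partial>M)"
        unfolding b_def
        by (rule nn_integral_limsup[where w = "\<lambda>_. ennreal (2 * K)"])
           (use dK in \<open>auto simp: emeasure_space_1 ennreal_mult_less_top\<close>)
      also have "\<dots> < ennreal \<eta>" by (rule p0[OF p])
      finally have "\<forall>\<^sub>F m in sequentially. (\<integral>\<^sup>+\<omega>. ennreal \<bar>a p m \<omega> - A' \<omega>\<bar> \<partial>M) < ennreal \<eta>"
        by (rule Limsup_lessD)
      then obtain m0 where m0: "\<And>m. m \<ge> m0 \<Longrightarrow> (\<integral>\<^sup>+\<omega>. ennreal \<bar>a p m \<omega> - A' \<omega>\<bar> \<partial>M) < ennreal \<eta>"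
        by (auto simp: eventually_sequentially)
      show "\<exists>m0. \<forall>m\<ge>m0. \<bar>(\<integral>\<omega>. a p m \<omega> \<partial>M) - (\<integral>\<omega>. A' \<omega> \<partial>M)\<bar> < \<eta>"
      proof (rule exI[of _ m0], intro allI impI)
        fix m assume "m0 \<le> m"
        from m0[OF this] have "ennreal (\<integral>\<omega>. \<bar>a p m \<omega> - A' \<omega>\<bar> \<partial>M) < ennreal \<eta>"
          using int by (subst (asm) nn_integral_eq_integral) auto
        then have "(\<integral>\<omega>. \<bar>a p m \<omega> - A' \<omega>\<bar> \<partial>M) < \<eta>" by (subst (asm) ennreal_less_iff) auto
        moreover have "\<bar>(\<integral>\<omega>. a p m \<omega> \<partial>M) - (\<integral>\<omega>. A' \<omega> \<partial>M)\<bar> \<le> (\<integral>\<omega>. \<bar>a p m \<omega> - A' \<omega>\<bar> \<partial>M)"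
          using int integral_abs_bound[of M "\<lambda>\<omega>. a p m \<omega> - A' \<omega>"] by simp
        ultimately show "\<bar>(\<integral>\<omega>. a p m \<omega> \<partial>M) - (\<integral>\<omega>. A' \<omega> \<partial>M)\<bar> < \<eta>" by linarith
      qed
    qed
  qed
  with A' eq show ?thesis by blast
qed

text \<open>The processes \<open>W m\<close> are Gaussian random walks that converge to a planar path started at \<open>w0\<close>;
  \<open>wT\<close> is the point where this path leaves the wedge.\<close>

locale wedge_approx = prob_space M for M :: "'p measure" +
  fixes q :: real and W :: "nat \<Rightarrow> nat \<Rightarrow> 'p \<Rightarrow> complex" and w0 wT :: "'p \<Rightarrow> complex"
  assumes q: "q > 0"
    and W_meas [measurable]: "\<And>m i. W m i \<in> borel_measurable M"
    and w0_meas [measurable]: "w0 \<in> borel_measurable M"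
    and law: "\<And>m f. f \<in> borel_measurable (borel \<Otimes>\<^sub>M (PiM UNIV (\<lambda>_. borel) \<Otimes>\<^sub>M PiM UNIV (\<lambda>_. borel)))
        \<Longrightarrow>
      (\<integral>\<^sup>+\<omega>. f (W m 0 \<omega>, ((\<lambda>i. Re (W m (Suc i) \<omega> - W m i \<omega>)), (\<lambda>i. Im (W m (Suc i) \<omega> - W m i \<omega>))))
          \<partial>M) =
      (\<integral>\<^sup>+\<omega>. (\<integral>\<^sup>+z. f (W m 0 \<omega>, z) \<partial>(noise (sqrt ((1/2)^m)) \<Otimes>\<^sub>M noise (sqrt ((1/2)^m)))) \<partial>M)"
    and approx: "AE \<omega> in M. (wedge_dist q (w0 \<omega>) \<le> 0 \<and> (\<forall>e>0. \<exists>m0. \<forall>m\<ge>m0. wedge_dist q (W m 0 \<omega>) <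
        e)) \<or>
      (\<exists>w \<tau> \<theta> m1. continuous_on {0..} w \<and> w 0 = w0 \<omega> \<and> w \<tau> = wT \<omega> \<and> 0 < \<tau> \<and> wedge_dist q (w \<tau>) = 0 \<and>
         (\<forall>u. 0 \<le> u \<longrightarrow> u < \<tau> \<longrightarrow> wedge_dist q (w u) > 0) \<and>
         (\<forall>m\<ge>m1. 0 \<le> \<theta> m \<and> \<theta> m \<le> (1/2)^m \<and> (\<forall>i. W m i \<omega> = w (\<theta> m + real i * (1/2)^m))))"
begin

definition eps :: "nat \<Rightarrow> real" where "eps p = 1 / (real p + 1)"

lemma eps_pos: "eps p > 0" by (simp add: eps_def)

definition ex :: "nat \<Rightarrow> nat \<Rightarrow> 'p \<Rightarrow> complex" where
  "ex p m \<omega> = exit_value (wedge q (eps p)) (p * 2^m) (\<lambda>i. W m i \<omega>)"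

lemma ex_meas [measurable]: "ex p m \<in> borel_measurable M"
  unfolding ex_def[abs_def] by (rule measurable_exit_value) measurable

lemma integral_exit_error:
  fixes f \<phi> :: "complex \<Rightarrow> real"
  assumes [measurable]: "f \<in> borel_measurable borel" "\<phi> \<in> borel_measurable borel"
    and f: "\<And>x. \<bar>f x\<bar> \<le> B" and \<phi>: "\<And>x. 0 \<le> \<phi> x \<and> \<phi> x \<le> 1" and e: "e \<ge> 0"
    and step: "\<And>w. w \<in> wedge q (eps p) \<Longrightarrow> \<bar>(\<integral>x. f (w + Complex (fst x) (snd x))
        \<partial>(gauss (sqrt ((1/2)^m)) \<Otimes>\<^sub>M gauss (sqrt ((1/2)^m)))) - f w\<bar> \<le> e"
  shows "\<bar>(\<integral>\<omega>. \<phi> (W m 0 \<omega>) * f (ex p m \<omega>) \<partial>M) - (\<integral>\<omega>. \<phi> (W m 0 \<omega>) * f (W m 0 \<omega>) \<partial>M)\<bar> \<le>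
      real (p * 2^m) * e"
proof -
  define \<sigma> where "\<sigma> = sqrt ((1/2)^m)"
  have \<sigma>: "\<sigma> > 0" by (simp add: \<sigma>_def)
  let ?S = "noise \<sigma> \<Otimes>\<^sub>M noise \<sigma>"
  interpret S: prob_space "noise \<sigma>" by (rule prob_space_noise[OF \<sigma>])
  interpret SS: pair_prob_space "noise \<sigma>" "noise \<sigma>" ..
  note [measurable] = measurable_exit_value
  define D where "D = wedge q (eps p)"
  have [measurable]: "D \<in> sets borel" by (simp add: D_def)
  define n where "n = p * 2^m"
  define st where "st \<omega> = ((\<lambda>i. Re (W m (Suc i) \<omega> - W m i \<omega>)), (\<lambda>i. Im (W m (Suc i) \<omega> - W m i \<omega>)))"
      for \<omega>
  have walk: "walk (W m 0 \<omega>) (st \<omega>) i = W m i \<omega>" for \<omega> i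
    by (induction i) (simp_all add: walk_def step_def st_def complex_eq_iff)
  have ex: "ex p m \<omega> = exit_value D n (walk (W m 0 \<omega>) (st \<omega>))" for \<omega>
    unfolding ex_def D_def n_def walk[abs_def] by (simp add: walk)
  have B: "B \<ge> 0" using f[of 0] by linarith
  define g where "g x = \<phi> (fst x) * f (exit_value D n (walk (fst x) (snd x)))" for x
  have gm [measurable]: "g \<in> borel_measurable (borel \<Otimes>\<^sub>M (PiM UNIV (\<lambda>_. borel) \<Otimes>\<^sub>M PiM UNIV (\<lambda>_.
      borel)))"
    unfolding g_def by measurable
  have gB: "\<bar>g x\<bar> \<le> B" for x
  proof -
    have "\<bar>g x\<bar> \<le> 1 * B" unfolding g_def abs_mult using \<phi> f B by (intro mult_mono) auto
    then show ?thesis by simp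
  qed
  then have gpos: "0 \<le> g x + B" for x by (smt (verit) abs_le_iff)
  define G where "G \<omega> = (\<integral>z. g (W m 0 \<omega>, z) \<partial>?S)" for \<omega>
  have iS: "integrable ?S (\<lambda>z. g (x, z))" for x
    by (rule SS.integrable_const_bound[where B = B]) (auto simp: gB)
  have [measurable]: "G \<in> borel_measurable M" unfolding G_def by measurable
  have GB: "\<bar>G \<omega>\<bar> \<le> B" for \<omega>
  proof -
    have "\<bar>G \<omega>\<bar> \<le> (\<integral>z. \<bar>g (W m 0 \<omega>, z)\<bar> \<partial>?S)" unfolding G_def by (rule integral_abs_bound)
    also have "\<dots> \<le> (\<integral>z. B \<partial>?S)" using iS gB by (intro integral_mono integrable_abs) auto
    finally show ?thesis by (simp add: SS.prob_space)
  qed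
  have G_pos: "0 \<le> G \<omega> + B" for \<omega> using GB[of \<omega>] by linarith
  have meas_ex: "(\<lambda>\<omega>. g (W m 0 \<omega>, st \<omega>)) \<in> borel_measurable M"
    unfolding g_def fst_conv snd_conv ex[symmetric] by measurable
  have "ennreal ((\<integral>\<omega>. g (W m 0 \<omega>, st \<omega>) \<partial>M) + B) = (\<integral>\<^sup>+\<omega>. ennreal (g (W m 0 \<omega>, st \<omega>) + B) \<partial>M)"
  proof -
    have "integrable M (\<lambda>\<omega>. g (W m 0 \<omega>, st \<omega>))"
      by (rule integrable_const_bound[where B = B]) (auto simp: gB meas_ex)
    then show ?thesis by (subst nn_integral_eq_integral) (auto simp: gpos prob_space)
  qed
  also have "\<dots> = (\<integral>\<^sup>+\<omega>. (\<integral>\<^sup>+z. ennreal (g (W m 0 \<omega>, z) + B) \<partial>?S) \<partial>M)"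
    unfolding st_def \<sigma>_def by (rule law) measurable
  also have "\<dots> = (\<integral>\<^sup>+\<omega>. ennreal (G \<omega> + B) \<partial>M)"
    unfolding G_def using iS by (subst nn_integral_eq_integral) (auto simp: gpos SS.prob_space)
  also have "\<dots> = ennreal ((\<integral>\<omega>. G \<omega> \<partial>M) + B)"
  proof -
    have "integrable M G" by (rule integrable_const_bound[where B = B]) (auto simp: GB)
    then show ?thesis by (subst nn_integral_eq_integral) (auto simp: G_pos prob_space)
  qed
  finally have eq: "ennreal ((\<integral>\<omega>. g (W m 0 \<omega>, st \<omega>) \<partial>M) + B) = ennreal ((\<integral>\<omega>. G \<omega> \<partial>M) + B)" .
  have iG: "integrable M G" by (rule integrable_const_bound[where B = B]) (auto simp: GB)
  have ig: "integrable M (\<lambda>\<omega>. g (W m 0 \<omega>, st \<omega>))"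
    by (rule integrable_const_bound[where B = B]) (auto simp: gB meas_ex)
  have "0 \<le> (\<integral>\<omega>. g (W m 0 \<omega>, st \<omega>) + B \<partial>M)" "0 \<le> (\<integral>\<omega>. G \<omega> + B \<partial>M)"
    by (intro integral_nonneg_AE AE_I2 gpos G_pos)+
  with eq have eq: "(\<integral>\<omega>. g (W m 0 \<omega>, st \<omega>) \<partial>M) = (\<integral>\<omega>. G \<omega> \<partial>M)"
    using iG ig by (simp add: prob_space)
  have i0: "integrable M (\<lambda>\<omega>. \<phi> (W m 0 \<omega>) * f (W m 0 \<omega>))"
  proof (rule integrable_const_bound[where B = B])
    show "AE \<omega> in M. norm (\<phi> (W m 0 \<omega>) * f (W m 0 \<omega>)) \<le> B"
    proof (rule AE_I2)
      fix \<omega>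
      have "norm (\<phi> (W m 0 \<omega>) * f (W m 0 \<omega>)) \<le> 1 * B"
        unfolding real_norm_def abs_mult using \<phi> f B by (intro mult_mono) auto
      then show "norm (\<phi> (W m 0 \<omega>) * f (W m 0 \<omega>)) \<le> B" by simp
    qed
  qed measurable
  have main: "\<bar>G \<omega> - \<phi> (W m 0 \<omega>) * f (W m 0 \<omega>)\<bar> \<le> real n * e" for \<omega>
  proof -
    have "G \<omega> = \<phi> (W m 0 \<omega>) * (\<integral>z. f (exit_value D n (walk (W m 0 \<omega>) z)) \<partial>?S)"
      unfolding G_def g_def by simp
    then have "\<bar>G \<omega> - \<phi> (W m 0 \<omega>) * f (W m 0 \<omega>)\<bar> =
      \<phi> (W m 0 \<omega>) * \<bar>(\<integral>z. f (exit_value D n (walk (W m 0 \<omega>) z)) \<partial>?S) - f (W m 0 \<omega>)\<bar>"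
      using \<phi>[of "W m 0 \<omega>"] by (simp add: right_diff_distrib[symmetric] abs_mult)
    also have "\<dots> \<le> 1 * (real n * e)"
    proof (intro mult_mono)
      show "\<bar>(\<integral>z. f (exit_value D n (walk (W m 0 \<omega>) z)) \<partial>?S) - f (W m 0 \<omega>)\<bar> \<le> real n * e"
        by (rule integral_exit_value_approx[OF \<sigma>]) (use f e step in \<open>auto simp: D_def \<sigma>_def\<close>)
    qed (use \<phi> in auto)
    finally show ?thesis by simp
  qed
  have "(\<integral>\<omega>. \<phi> (W m 0 \<omega>) * f (ex p m \<omega>) \<partial>M) - (\<integral>\<omega>. \<phi> (W m 0 \<omega>) * f (W m 0 \<omega>) \<partial>M) =
    (\<integral>\<omega>. G \<omega> - \<phi> (W m 0 \<omega>) * f (W m 0 \<omega>) \<partial>M)"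
    using eq iG i0 by (simp add: g_def ex)
  also have "\<bar>\<dots>\<bar> \<le> (\<integral>\<omega>. real n * e \<partial>M)"
    by (rule order_trans[OF integral_abs_bound], rule integral_mono) (use iG i0 main in auto)
  finally show ?thesis by (simp add: prob_space n_def)
qed

lemma exit_error_tendsto:
  fixes f \<phi> :: "complex \<Rightarrow> real"
  assumes fm: "f \<in> borel_measurable borel" "\<phi> \<in> borel_measurable borel"
    and f: "\<And>x. \<bar>f x\<bar> \<le> B" and \<phi>: "\<And>x. 0 \<le> \<phi> x \<and> \<phi> x \<le> 1"
    and K: "K \<ge> 0" "\<And>\<sigma> w. \<sigma> > 0 \<Longrightarrow> Re w \<ge> eps p \<Longrightarrow>
      \<bar>(\<integral>x. f (w + Complex (fst x) (snd x)) \<partial>(gauss \<sigma> \<Otimes>\<^sub>M gauss \<sigma>)) - f w\<bar> \<le> K * \<sigma>^3"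
  shows "(\<lambda>m. (\<integral>\<omega>. \<phi> (W m 0 \<omega>) * f (ex p m \<omega>) \<partial>M) - (\<integral>\<omega>. \<phi> (W m 0 \<omega>) * f (W m 0 \<omega>) \<partial>M)) \<longlonglongrightarrow> 0"
proof (rule tendsto_rabs_zero_cancel, rule tendsto_sandwich)
  show "\<forall>\<^sub>F m in sequentially. 0 \<le>
      \<bar>(\<integral>\<omega>. \<phi> (W m 0 \<omega>) * f (ex p m \<omega>) \<partial>M) - (\<integral>\<omega>. \<phi> (W m 0 \<omega>) * f (W m 0 \<omega>) \<partial>M)\<bar>"
    by simp
  show "\<forall>\<^sub>F m in sequentially. \<bar>(\<integral>\<omega>. \<phi> (W m 0 \<omega>) * f (ex p m \<omega>) \<partial>M) - (\<integral>\<omega>. \<phi> (W m 0 \<omega>) * f (W m 0 \<omega>)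
      \<partial>M)\<bar>
    \<le> real p * K * sqrt (1/2) ^ m"
  proof (intro always_eventually allI)
    fix m
    define \<sigma> where "\<sigma> = sqrt ((1/2)^m)"
    have \<sigma>: "\<sigma> > 0" by (simp add: \<sigma>_def)
    have "\<bar>(\<integral>\<omega>. \<phi> (W m 0 \<omega>) * f (ex p m \<omega>) \<partial>M) - (\<integral>\<omega>. \<phi> (W m 0 \<omega>) * f (W m 0 \<omega>) \<partial>M)\<bar> \<le>
        real (p * 2^m) * (K * \<sigma>^3)"
    proof (rule integral_exit_error[OF fm f \<phi>])
      fix w assume "w \<in> wedge q (eps p)"
      then have "Re w > eps p" using Re_gt_wedge[OF q, of "eps p" w] eps_pos[of p] by auto
      then show "\<bar>(\<integral>x. f (w + Complex (fst x) (snd x))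
        \<partial>(gauss (sqrt ((1/2)^m)) \<Otimes>\<^sub>M gauss (sqrt ((1/2)^m)))) - f w\<bar> \<le> K * \<sigma>^3"
        using K(2)[OF \<sigma>] by (simp add: \<sigma>_def)
    qed (use K \<sigma> in auto)
    also have "\<sigma>^3 = (1/2)^m * \<sigma>" by (simp add: \<sigma>_def power3_eq_cube)
    also have "real (p * 2^m) * (K * ((1/2)^m * \<sigma>)) = real p * K * \<sigma> * (2^m * (1/2)^m)" by simp
    also have "(2::real)^m * (1/2)^m = 1" by (simp add: power_mult_distrib[symmetric])
    also have "\<sigma> = sqrt (1/2) ^ m" by (simp add: \<sigma>_def real_sqrt_power)
    finally show "\<bar>(\<integral>\<omega>. \<phi> (W m 0 \<omega>) * f (ex p m \<omega>) \<partial>M) - (\<integral>\<omega>. \<phi> (W m 0 \<omega>) * f (W m 0 \<omega>) \<partial>M)\<bar>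
      \<le> real p * K * sqrt (1/2) ^ m" by simp
  qed
  have "(\<lambda>m. real p * K * sqrt (1/2) ^ m) \<longlonglongrightarrow> real p * K * 0"
    by (intro tendsto_mult tendsto_const LIMSEQ_power_zero) (auto simp: real_sqrt_lt_1_iff)
  then show "(\<lambda>m. real p * K * sqrt (1/2) ^ m) \<longlonglongrightarrow> 0" by simp
qed auto

lemma exit_tendsto:
  "AE \<omega> in M. wedge_dist q (w0 \<omega>) > 0 \<longrightarrow> wedge_dist q (wT \<omega>) = 0 \<and>
    (\<forall>\<eta>>0. \<exists>m0. \<forall>m\<ge>m0. cmod (W m 0 \<omega> - w0 \<omega>) < \<eta>) \<and>
    (\<forall>\<eta>>0. \<exists>p0. \<forall>p\<ge>p0. \<exists>m0. \<forall>m\<ge>m0. cmod (ex p m \<omega> - wT \<omega>) < \<eta> \<and>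
        wedge_dist q (ex p m \<omega>) > eps p / 2)"
  using approx
proof eventually_elim
  case (elim \<omega>)
  then show ?case
  proof (elim disjE)
    assume "wedge_dist q (w0 \<omega>) \<le> 0 \<and> (\<forall>e>0. \<exists>m0. \<forall>m\<ge>m0. wedge_dist q (W m 0 \<omega>) < e)"
    then show ?case by simp
  next
    assume "\<exists>w \<tau> \<theta> m1. continuous_on {0..} w \<and> w 0 = w0 \<omega> \<and> w \<tau> = wT \<omega> \<and> 0 < \<tau> \<and>
        wedge_dist q (w \<tau>) = 0 \<and>
         (\<forall>u. 0 \<le> u \<longrightarrow> u < \<tau> \<longrightarrow> wedge_dist q (w u) > 0) \<and>
         (\<forall>m\<ge>m1. 0 \<le> \<theta> m \<and> \<theta> m \<le> (1/2)^m \<and> (\<forall>i. W m i \<omega> = w (\<theta> m + real i * (1/2)^m)))"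
    then obtain w \<tau> \<theta> m1 where A: "continuous_on {0..} w \<and> w 0 = w0 \<omega> \<and> w \<tau> = wT \<omega> \<and> 0 < \<tau> \<and>
        wedge_dist q (w \<tau>) = 0 \<and>
         (\<forall>u. 0 \<le> u \<longrightarrow> u < \<tau> \<longrightarrow> wedge_dist q (w u) > 0) \<and>
         (\<forall>m\<ge>m1. 0 \<le> \<theta> m \<and> \<theta> m \<le> (1/2)^m \<and> (\<forall>i. W m i \<omega> = w (\<theta> m + real i * (1/2)^m)))"
      by (elim exE) (rule that)
    then have w: "continuous_on {0..} w" and ww: "w 0 = w0 \<omega>" "w \<tau> = wT \<omega>"
      and \<tau>: "0 < \<tau>" "wedge_dist q (w \<tau>) = 0" by blast+
    from A have pos: "\<And>u. 0 \<le> u \<Longrightarrow> u < \<tau> \<Longrightarrow> wedge_dist q (w u) > 0" by blast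
    from A have m1: "\<And>m. m \<ge> m1 \<Longrightarrow> 0 \<le> \<theta> m \<and> \<theta> m \<le> (1/2)^m \<and> (\<forall>i. W m i \<omega> = w (\<theta> m +
        real i * (1/2)^m))" by blast
    have 1: "\<exists>m0. \<forall>m\<ge>m0. cmod (W m 0 \<omega> - w0 \<omega>) < \<eta>" if \<eta>: "\<eta> > 0" for \<eta>
    proof -
      obtain r where r: "r > 0" "\<And>u. u \<in> {0..} \<Longrightarrow> dist u 0 < r \<Longrightarrow> dist (w u) (w 0) < \<eta>"
        using w \<eta> unfolding continuous_on_iff by (metis atLeast_iff order_refl)
      obtain m2 :: nat where m2: "(1/2)^m2 < r" using real_arch_pow_inv[of r "1/2"] r(1) by auto
      show ?thesis
      proof (rule exI[of _ "max m1 m2"], intro allI impI)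
        fix m assume m: "max m1 m2 \<le> m"
        have "(1/2::real)^m \<le> (1/2)^m2" using m by (intro power_decreasing) auto
        moreover have th: "0 \<le> \<theta> m" "\<theta> m \<le> (1/2)^m" using m1[of m] m by auto
        ultimately have "\<theta> m < r" using m2 by linarith
        then have "dist (\<theta> m) 0 < r" "\<theta> m \<in> {0..}" using th by auto
        with r(2)[of "\<theta> m"] m1[of m] m show "cmod (W m 0 \<omega> - w0 \<omega>) < \<eta>" by (simp add: dist_norm ww)
      qed
    qed
    have 2: "\<exists>p0. \<forall>p\<ge>p0. \<exists>m0. \<forall>m\<ge>m0. cmod (ex p m \<omega> - wT \<omega>) < \<eta> \<and>
        wedge_dist q (ex p m \<omega>) > eps p / 2"
      if \<eta>: "\<eta> > 0" for \<eta>
    proof -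
      obtain r where r: "r > 0" "\<And>u. u \<in> {0..} \<Longrightarrow> dist u \<tau> < r \<Longrightarrow> dist (w u) (w \<tau>) < \<eta>"
        using w \<eta> \<tau>(1) unfolding continuous_on_iff by (metis atLeast_iff less_imp_le)
      from exit_value_path_tendsto[where W = "\<lambda>m i. W m i \<omega>" and ?m1.0 = m1, OF w \<tau> pos m1 r(1)]
      obtain p0 where p0: "\<And>p. p \<ge> p0 \<Longrightarrow> \<exists>m0. \<forall>m\<ge>m0. \<exists>u. \<tau> - r < u \<and> u < \<tau> \<and> 0 \<le> u \<and>
         ex p m \<omega> = w u \<and> wedge_dist q (w u) > eps p / 2"
        unfolding ex_def eps_def by auto
      show ?thesis
      proof (rule exI[of _ p0], intro allI impI)
        fix p assume "p0 \<le> p"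
        from p0[OF this] obtain m0 where m0: "\<And>m. m \<ge> m0 \<Longrightarrow> \<exists>u. \<tau> - r < u \<and> u < \<tau> \<and> 0 \<le> u \<and>
         ex p m \<omega> = w u \<and> wedge_dist q (w u) > eps p / 2" by blast
        show "\<exists>m0. \<forall>m\<ge>m0. cmod (ex p m \<omega> - wT \<omega>) < \<eta> \<and> wedge_dist q (ex p m \<omega>) > eps p / 2"
        proof (rule exI[of _ m0], intro allI impI)
          fix m assume "m0 \<le> m"
          from m0[OF this] obtain u where u: "\<tau> - r < u" "u < \<tau>" "0 \<le> u" "ex p m \<omega> =
              w u" "wedge_dist q (w u) > eps p / 2"
            by blast
          have "dist u \<tau> < r" using u by (simp add: dist_real_def)
          with r(2)[of u] u show "cmod (ex p m \<omega> - wT \<omega>) < \<eta> \<and> wedge_dist q (ex p m \<omega>) > eps p / 2"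
            by (simp add: dist_norm ww)
        qed
      qed
    qed
    from 1 2 \<tau>(2) ww show ?case by simp
  qed
qed

lemma start_outside:
  "AE \<omega> in M. wedge_dist q (w0 \<omega>) \<le> 0 \<longrightarrow> (\<forall>e>0. \<exists>m0. \<forall>m\<ge>m0. wedge_dist q (W m 0 \<omega>) < e)"
  using approx
proof eventually_elim
  case (elim \<omega>)
  show ?case
  proof
    assume out: "wedge_dist q (w0 \<omega>) \<le> 0"
    have False if "w 0 = w0 \<omega>" "0 < \<tau>" "\<forall>u. 0 \<le> u \<longrightarrow> u < \<tau> \<longrightarrow> wedge_dist q (w u) > 0"
        for w :: "real \<Rightarrow> complex" and \<tau> :: real
      using that out spec[of _ 0, OF that(3)] by simp
    then show "\<forall>e>0. \<exists>m0. \<forall>m\<ge>m0. wedge_dist q (W m 0 \<omega>) < e" using elim by blast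
  qed
qed

definition cutoff :: "real \<Rightarrow> (complex \<Rightarrow> real) \<Rightarrow> bool" where
  "cutoff c \<phi> \<longleftrightarrow> continuous_on UNIV \<phi> \<and> (\<forall>w. 0 \<le> \<phi> w \<and> \<phi> w \<le> 1 \<and> \<phi> w \<le> c * max 0 (wedge_dist q w))"

lemma iterated_lim_product:
  assumes \<phi>: "cutoff c \<phi>" and c: "c \<ge> 0" and B: "\<And>p m. \<bar>g p m\<bar> \<le> B"
    and out: "wedge_dist q y \<le> 0 \<Longrightarrow> \<forall>e>0. \<exists>m0. \<forall>m\<ge>m0. wedge_dist q (x m) < e"
    and ins: "wedge_dist q y > 0 \<Longrightarrow> \<forall>\<eta>>0. \<exists>m0. \<forall>m\<ge>m0. cmod (x m - y) < \<eta>"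
    and g: "wedge_dist q y > 0 \<Longrightarrow> iterated_lim g H"
  shows "iterated_lim (\<lambda>p m. \<phi> (x m) * g p m) (\<phi> y * H)"
  unfolding iterated_lim_def
proof (intro allI impI)
  fix \<eta> :: real assume \<eta>: "\<eta> > 0"
  have \<phi>1: "0 \<le> \<phi> w" "\<phi> w \<le> 1" "\<phi> w \<le> c * max 0 (wedge_dist q w)" for w using \<phi>
    by (auto simp: cutoff_def)
  have B0: "B \<ge> 0" using B[of 0 0] by linarith
  show "\<exists>p0. \<forall>p\<ge>p0. \<exists>m0. \<forall>m\<ge>m0. \<bar>\<phi> (x m) * g p m - \<phi> y * H\<bar> < \<eta>"
  proof (cases "wedge_dist q y > 0")
    case False
    then have \<phi>0: "\<phi> y = 0" using \<phi>1(1,3)[of y] by (simp add: max_def split: if_splits)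
    define e where "e = \<eta> / ((c + 1) * (B + 1))"
    have e: "e > 0" using \<eta> c B0 by (simp add: e_def)
    obtain m0 where m0: "\<And>m. m \<ge> m0 \<Longrightarrow> wedge_dist q (x m) < e" using out False e by force
    have "\<bar>\<phi> (x m) * g p m - \<phi> y * H\<bar> < \<eta>" if m: "m \<ge> m0" for p m
    proof -
      have "max 0 (wedge_dist q (x m)) \<le> e" using m0[OF m] e by simp
      from mult_left_mono[OF this c] have "\<phi> (x m) \<le> c * e" using \<phi>1(3)[of "x m"] by linarith
      then have "\<bar>\<phi> (x m)\<bar> * \<bar>g p m\<bar> \<le> (c * e) * B"
        using \<phi>1 B c e by (intro mult_mono) auto
      also have "\<dots> < e * ((c + 1) * (B + 1))"
      proof -
        have "e * ((c + 1) * (B + 1)) - (c * e) * B = e * (c + B + 1)" by (simp add: algebra_simps)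
        moreover have "e * (c + B + 1) > 0" using e c B0 by (intro mult_pos_pos) auto
        ultimately show ?thesis by linarith
      qed
      also have "\<dots> = \<eta>" using c B0 by (simp add: e_def add_nonneg_pos)
      finally show ?thesis by (simp add: \<phi>0 abs_mult)
    qed
    then show ?thesis by blast
  next
    case True
    define e where "e = \<eta> / (B + 2)"
    have e: "e > 0" "e * (B + 2) = \<eta>" using \<eta> B0 by (auto simp: e_def)
    have "isCont \<phi> y" using \<phi> by (simp add: cutoff_def continuous_on_eq_continuous_at)
    then obtain r where r: "r > 0" "\<And>x. cmod (x - y) < r \<Longrightarrow> \<bar>\<phi> x - \<phi> y\<bar> < e"
      using e(1) unfolding continuous_at_eps_delta dist_norm real_norm_def by blast
    obtain m2 where m2: "\<And>m. m \<ge> m2 \<Longrightarrow> cmod (x m - y) < r" using ins[OF True] r(1) by blast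
    obtain p0 where p0: "\<And>p. p \<ge> p0 \<Longrightarrow> \<exists>m0. \<forall>m\<ge>m0. \<bar>g p m - H\<bar> < e"
      using g[OF True] e(1) unfolding iterated_lim_def by blast
    show ?thesis
    proof (rule exI[of _ p0], intro allI impI)
      fix p assume "p0 \<le> p"
      from p0[OF this] obtain m0 where m0: "\<And>m. m \<ge> m0 \<Longrightarrow> \<bar>g p m - H\<bar> < e" by blast
      show "\<exists>m0. \<forall>m\<ge>m0. \<bar>\<phi> (x m) * g p m - \<phi> y * H\<bar> < \<eta>"
      proof (rule exI[of _ "max m0 m2"], intro allI impI)
        fix m assume m: "max m0 m2 \<le> m"
        have a: "\<bar>\<phi> (x m) - \<phi> y\<bar> < e" using r(2) m2[of m] m by simp
        have b: "\<bar>g p m - H\<bar> < e" using m0[of m] m by simp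
        have "\<phi> (x m) * g p m - \<phi> y * H = (\<phi> (x m) - \<phi> y) * g p m + \<phi> y * (g p m - H)"
          by (simp add: algebra_simps)
        also have "\<bar>\<dots>\<bar> \<le> e * B + 1 * e"
        proof (rule order_trans[OF abs_triangle_ineq], rule add_mono)
          show "\<bar>(\<phi> (x m) - \<phi> y) * g p m\<bar> \<le> e * B"
            unfolding abs_mult using a B e(1) by (intro mult_mono) auto
          show "\<bar>\<phi> y * (g p m - H)\<bar> \<le> 1 * e"
            unfolding abs_mult using b \<phi>1 e(1) by (intro mult_mono) auto
        qed
        also have "\<dots> < \<eta>" using e by (simp add: algebra_simps)
        finally show "\<bar>\<phi> (x m) * g p m - \<phi> y * H\<bar> < \<eta>" .
      qed
    qed
  qed
qed

lemma iterated_lim_exit: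
  assumes \<phi>: "cutoff c \<phi>" and c: "c \<ge> 0"
    and B: "\<And>p x. \<bar>h p x\<bar> \<le> B"
    and h: "AE \<omega> in M. wedge_dist q (w0 \<omega>) > 0 \<longrightarrow> wedge_dist q (wT \<omega>) = 0 \<longrightarrow>
       (\<forall>\<eta>>0. \<exists>r>0. \<forall>p x. cmod (x - wT \<omega>) < r \<longrightarrow> wedge_dist q x > eps p / 2 \<longrightarrow> \<bar>h p x - H \<omega>\<bar> < \<eta>)"
  shows "AE \<omega> in M. iterated_lim (\<lambda>p m. \<phi> (W m 0 \<omega>) * h p (ex p m \<omega>)) (\<phi> (w0 \<omega>) * H \<omega>)"
  using exit_tendsto start_outside h
proof eventually_elim
  case (elim \<omega>)
  show ?case
  proof (rule iterated_lim_product[OF \<phi> c, where B = B])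
    assume pos: "wedge_dist q (w0 \<omega>) > 0"
    show "iterated_lim (\<lambda>p m. h p (ex p m \<omega>)) (H \<omega>)"
      unfolding iterated_lim_def
    proof (intro allI impI)
      fix \<eta> :: real assume \<eta>: "\<eta> > 0"
      obtain r where r: "r > 0" "\<And>p x. cmod (x - wT \<omega>) < r \<Longrightarrow> wedge_dist q x > eps p / 2 \<Longrightarrow>
          \<bar>h p x - H \<omega>\<bar> < \<eta>"
        using elim(1,3) pos \<eta> by blast
      obtain p0 where p0: "\<And>p. p \<ge> p0 \<Longrightarrow> \<exists>m0. \<forall>m\<ge>m0. cmod (ex p m \<omega> - wT \<omega>) < r \<and>
          wedge_dist q (ex p m \<omega>) > eps p / 2"
        using elim(1) pos r(1) by blast
      with r(2) show "\<exists>p0. \<forall>p\<ge>p0. \<exists>m0. \<forall>m\<ge>m0. \<bar>h p (ex p m \<omega>) - H \<omega>\<bar> < \<eta>" by meson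
    qed
  qed (use elim B in auto)
qed

end

lemma abs_arg_ext_le: "\<epsilon> > 0 \<Longrightarrow> \<bar>arg_ext \<epsilon> x\<bar> \<le> pi"
proof -
  assume \<epsilon>: "\<epsilon> > 0"
  show ?thesis
  proof (cases "Re x > \<epsilon> / 2")
    case True
    then have "x \<noteq> 0" using \<epsilon> by auto
    from mpi_less_Im_Ln[OF this] Im_Ln_le_pi[OF this] show ?thesis using True
      by (simp add: arg_ext_def)
  qed (simp add: arg_ext_def)
qed

lemma inv_ext_nonneg: "\<epsilon> > 0 \<Longrightarrow> 0 \<le> inv_ext \<epsilon> x"
  by (auto simp: inv_ext_def)

lemma abs_inv_ext_le: "\<epsilon> > 0 \<Longrightarrow> \<bar>inv_ext \<epsilon> x\<bar> \<le> 2 / \<epsilon>"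
proof -
  assume \<epsilon>: "\<epsilon> > 0"
  show ?thesis
  proof (cases "Re x > \<epsilon> / 2")
    case True
    have "\<bar>Re (inverse x)\<bar> \<le> cmod (inverse x)" by (rule abs_Re_le_cmod)
    also have "\<dots> \<le> 2 / \<epsilon>" using cmod_inverse_power_le[OF True \<epsilon>, of 1] by simp
    finally show ?thesis unfolding inv_ext_def by (simp only: True if_True)
  qed (use \<epsilon> in \<open>simp add: inv_ext_def\<close>)
qed

lemma inv_ext_le: "\<epsilon> > 0 \<Longrightarrow> inv_ext \<epsilon> x \<le> 1 / cmod x"
proof -
  assume \<epsilon>: "\<epsilon> > 0"
  have "Re (inverse x) \<le> 1 / cmod x"
    using complex_Re_le_cmod[of "inverse x"] unfolding norm_inverse
      by (simp only: inverse_eq_divide)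
  then show ?thesis unfolding inv_ext_def
    by (cases "Re x > \<epsilon> / 2") (simp_all only: if_True if_False, simp)
qed

lemma inv_ext_wedge_ge:
  assumes q: "q > 0" and \<epsilon>: "\<epsilon> > 0" and x: "wedge_dist q x > \<epsilon> / 2"
  shows "1 \<le> (1 + 1 / q) * cmod x * inv_ext \<epsilon> x"
proof -
  have Re: "Re x > \<epsilon> / 2" using Re_gt_wedge[OF q _ x] \<epsilon> by simp
  have Im: "Im x > 0" "q * Im x < Re x" using x \<epsilon> by (auto simp: wedge_dist_def)
  have "cmod x \<le> \<bar>Re x\<bar> + \<bar>Im x\<bar>" by (rule cmod_le)
  also have "\<dots> \<le> (1 + 1 / q) * Re x" using Im Re \<epsilon> q by (simp add: field_simps)
  finally have c: "cmod x \<le> (1 + 1 / q) * Re x" .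
  have x0: "cmod x > 0" using Re \<epsilon> by auto
  have "inv_ext \<epsilon> x = Re x / (cmod x)\<^sup>2" using Re by (simp add: inv_ext_def cmod_power2)
  then have "(1 + 1 / q) * cmod x * inv_ext \<epsilon> x = ((1 + 1 / q) * Re x) / cmod x"
    using x0 by (simp add: power2_eq_square)
  then show ?thesis using c x0 by (simp add: le_divide_eq)
qed

context wedge_approx
begin

lemma exit_not_apex: "AE \<omega> in M. wedge_dist q (w0 \<omega>) > 0 \<longrightarrow> wT \<omega> \<noteq> 0"
proof -
  define \<phi> where "\<phi> w = min 1 (max 0 (wedge_dist q w))" for w
  have \<phi>: "cutoff 1 \<phi>" unfolding cutoff_def \<phi>_def by (auto intro!: continuous_intros)
  have \<phi>1: "0 \<le> \<phi> x \<and> \<phi> x \<le> 1" for x by (auto simp: \<phi>_def)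
  have \<phi>m [measurable]: "\<phi> \<in> borel_measurable borel" unfolding \<phi>_def by measurable
  define c2 where "c2 = 1 + 1 / q"
  have c2: "c2 > 0" using q by (simp add: c2_def add_pos_pos)
  define r where "r k = 1 / (real k + 1)" for k :: nat
  have r: "r k > 0" for k by (simp add: r_def)
  define \<psi> where "\<psi> k x = max 0 (1 - cmod x / r k)" for k x
  have \<psi>1: "0 \<le> \<psi> k x" "\<psi> k x \<le> 1" for k x using r[of k] by (auto simp: \<psi>_def)
  define h where "h k p x = min (\<psi> k x) (r k * c2 * inv_ext (eps p) x)" for k p x
  have hm [measurable]: "h k p \<in> borel_measurable borel" for k p
    unfolding h_def \<psi>_def by measurable
  have h0: "0 \<le> h k p x" "h k p x \<le> 1" for k p x
    using \<psi>1[of k x] r[of k] c2 inv_ext_nonneg[OF eps_pos, of p x] by (auto simp: h_def min_def)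
  have h_eq: "h k p x = \<psi> k x" if x: "wedge_dist q x > eps p / 2" for k p x
  proof (cases "cmod x \<ge> r k")
    case True
    then have "\<psi> k x = 0" using r[of k] by (simp add: \<psi>_def)
    then show ?thesis using inv_ext_nonneg[OF eps_pos, of p x] r[of k] c2 by (simp add: h_def)
  next
    case False
    have "1 \<le> c2 * cmod x * inv_ext (eps p) x" unfolding c2_def
      by (rule inv_ext_wedge_ge[OF q eps_pos x])
    also have "\<dots> = cmod x * (c2 * inv_ext (eps p) x)" by simp
    also have "\<dots> \<le> r k * (c2 * inv_ext (eps p) x)"
      using False inv_ext_nonneg[OF eps_pos, of p x] c2 by (intro mult_right_mono) auto
    finally show ?thesis using \<psi>1(2)[of k x] by (simp add: h_def mult.assoc)
  qed
  have \<psi>_lip: "\<bar>\<psi> k x - \<psi> k y\<bar> \<le> cmod (x - y) / r k" for k x y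
  proof -
    have "\<bar>\<psi> k x - \<psi> k y\<bar> \<le> \<bar>cmod x / r k - cmod y / r k\<bar>" by (auto simp: \<psi>_def max_def)
    also have "\<dots> = \<bar>cmod x - cmod y\<bar> / r k" using r[of k]
      by (simp add: diff_divide_distrib[symmetric])
    also have "\<dots> \<le> cmod (x - y) / r k" using r[of k] norm_triangle_ineq3[of x y]
      by (intro divide_right_mono) auto
    finally show ?thesis .
  qed
  have ex_lim: "\<exists>A'\<in>borel_measurable M. (AE \<omega> in M. A' \<omega> = \<phi> (w0 \<omega>) * \<psi> k (wT \<omega>)) \<and>
      iterated_lim (\<lambda>p m. \<integral>\<omega>. \<phi> (W m 0 \<omega>) * h k p (ex p m \<omega>) \<partial>M) (\<integral>\<omega>. A' \<omega> \<partial>M)" for k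
  proof (rule iterated_lim_integral[where K = 1])
    show "\<bar>\<phi> (W m 0 \<omega>) * h k p (ex p m \<omega>)\<bar> \<le> 1" for p m \<omega>
      using \<phi>1[of "W m 0 \<omega>"] h0[of k p "ex p m \<omega>"] by (auto simp: abs_mult intro!: mult_le_one)
    show "AE \<omega> in M. iterated_lim (\<lambda>p m. \<phi> (W m 0 \<omega>) * h k p (ex p m \<omega>)) (\<phi> (w0 \<omega>) * \<psi> k (wT \<omega>))"
    proof (rule iterated_lim_exit[OF \<phi>, where B = 1])
      show "AE \<omega> in M. wedge_dist q (w0 \<omega>) > 0 \<longrightarrow> wedge_dist q (wT \<omega>) = 0 \<longrightarrow>
       (\<forall>\<eta>>0. \<exists>r>0. \<forall>p x. cmod (x - wT \<omega>) < r \<longrightarrow> wedge_dist q x > eps p / 2 \<longrightarrow>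
           \<bar>h k p x - \<psi> k (wT \<omega>)\<bar> < \<eta>)"
      proof (intro AE_I2 impI allI)
        fix \<omega> \<eta> assume \<eta>: "\<eta> > (0::real)"
        show "\<exists>r>0. \<forall>p x. cmod (x - wT \<omega>) < r \<longrightarrow> wedge_dist q x > eps p / 2 \<longrightarrow>
            \<bar>h k p x - \<psi> k (wT \<omega>)\<bar> < \<eta>"
        proof (intro exI[of _ "\<eta> * r k"] conjI allI impI)
          fix p x assume "cmod (x - wT \<omega>) < \<eta> * r k" "wedge_dist q x > eps p / 2"
          then have "cmod (x - wT \<omega>) / r k < \<eta>" "h k p x = \<psi> k x"
            using h_eq[of p x k] r[of k] by (auto simp: pos_divide_less_eq)
          then show "\<bar>h k p x - \<psi> k (wT \<omega>)\<bar> < \<eta>" using \<psi>_lip[of k x "wT \<omega>"] by linarith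
        qed (use \<eta> r in auto)
      qed
    next
      show "\<bar>h k p x\<bar> \<le> 1" for p x using h0[of k p x] by simp
    qed simp
  qed measurable
  have "\<exists>A. \<forall>k. A k \<in> borel_measurable M \<and> (AE \<omega> in M. A k \<omega> = \<phi> (w0 \<omega>) * \<psi> k (wT \<omega>)) \<and>
      iterated_lim (\<lambda>p m. \<integral>\<omega>. \<phi> (W m 0 \<omega>) * h k p (ex p m \<omega>) \<partial>M) (\<integral>\<omega>. A k \<omega> \<partial>M)"
    by (rule choice) (use ex_lim in blast)
  then obtain A where Am [measurable]: "\<And>k. A k \<in> borel_measurable M"
    and Aeq: "\<And>k. AE \<omega> in M. A k \<omega> = \<phi> (w0 \<omega>) * \<psi> k (wT \<omega>)"
    and Alim: "\<And>k. iterated_lim (\<lambda>p m. \<integral>\<omega>. \<phi> (W m 0 \<omega>) * h k p (ex p m \<omega>) \<partial>M) (\<integral>\<omega>. A k \<omega> \<partial>M)"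
    by blast
  have A_int: "(\<integral>\<omega>. A k \<omega> \<partial>M) \<le> r k * c2 * 2" for k
  proof (rule field_le_epsilon)
    fix e :: real assume e: "e > 0"
    then obtain p m0 where m0: "\<And>m. m \<ge> m0 \<Longrightarrow>
        \<bar>(\<integral>\<omega>. \<phi> (W m 0 \<omega>) * h k p (ex p m \<omega>) \<partial>M) - (\<integral>\<omega>. A k \<omega> \<partial>M)\<bar> < e"
      using Alim[of k] unfolding iterated_lim_def by blast
    obtain K where K: "K \<ge> 0" "\<And>\<sigma> w. \<sigma> > 0 \<Longrightarrow> Re w \<ge> eps p \<Longrightarrow>
      \<bar>(\<integral>x. inv_ext (eps p) (w +
          Complex (fst x) (snd x)) \<partial>(gauss \<sigma> \<Otimes>\<^sub>M gauss \<sigma>)) - inv_ext (eps p) w\<bar> \<le> K * \<sigma>^3"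
      using inv_ext_step[OF eps_pos, of p] by blast
    have "(\<lambda>m. (\<integral>\<omega>. \<phi> (W m 0 \<omega>) * inv_ext (eps p) (ex p m \<omega>) \<partial>M) - (\<integral>\<omega>. \<phi> (W m 0 \<omega>) * inv_ext (eps
        p) (W m 0 \<omega>) \<partial>M)) \<longlonglongrightarrow> 0"
      by (rule exit_error_tendsto[OF measurable_inv_ext \<phi>m abs_inv_ext_le[OF eps_pos] \<phi>1 K])
    from LIMSEQ_D[OF this, of 1] obtain m1 where m1: "\<And>m. m \<ge> m1 \<Longrightarrow>
      \<bar>(\<integral>\<omega>. \<phi> (W m 0 \<omega>) * inv_ext (eps p) (ex p m \<omega>) \<partial>M) - (\<integral>\<omega>. \<phi> (W m 0 \<omega>) * inv_ext (eps p) (W m 0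
          \<omega>) \<partial>M)\<bar> < 1"
      by auto
    define m where "m = max m0 m1"
    have bound: "\<bar>\<phi> y * inv_ext (eps p) x\<bar> \<le> 2 / eps p" for x y
    proof -
      have "\<bar>\<phi> y * inv_ext (eps p) x\<bar> \<le> 1 * (2 / eps p)"
        unfolding abs_mult using \<phi>1[of y] abs_inv_ext_le[OF eps_pos, of p x]
          by (intro mult_mono) auto
      then show ?thesis by simp
    qed
    have i1: "integrable M (\<lambda>\<omega>. \<phi> (W m 0 \<omega>) * inv_ext (eps p) (ex p m \<omega>))"
      and i2: "integrable M (\<lambda>\<omega>. \<phi> (W m 0 \<omega>) * inv_ext (eps p) (W m 0 \<omega>))"
      by (rule integrable_const_bound[where B = "2 / eps p"]; use bound in auto)+
    have "\<phi> x * inv_ext (eps p) x \<le> 1" for x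
    proof (cases "wedge_dist q x > 0")
      case True
      then have x: "cmod x > 0" "wedge_dist q x \<le> cmod x" using abs_Im_le_cmod[of x]
        by (auto simp: wedge_dist_def)
      have "\<phi> x * inv_ext (eps p) x \<le> cmod x * (1 / cmod x)"
        using x True inv_ext_le[OF eps_pos, of p x] inv_ext_nonneg[OF eps_pos, of p x]
          by (intro mult_mono) (auto simp: \<phi>_def)
      then show ?thesis using x by simp
    qed (simp add: \<phi>_def)
    then have "(\<integral>\<omega>. \<phi> (W m 0 \<omega>) * inv_ext (eps p) (W m 0 \<omega>) \<partial>M) \<le> (\<integral>\<omega>. 1 \<partial>M)"
      using i2 by (intro integral_mono) auto
    then have b1: "(\<integral>\<omega>. \<phi> (W m 0 \<omega>) * inv_ext (eps p) (ex p m \<omega>) \<partial>M) \<le> 2"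
      using m1[of m] by (simp add: m_def prob_space)
    have "(\<integral>\<omega>. \<phi> (W m 0 \<omega>) * h k p (ex p m \<omega>) \<partial>M) \<le>
        (\<integral>\<omega>. r k * c2 * (\<phi> (W m 0 \<omega>) * inv_ext (eps p) (ex p m \<omega>)) \<partial>M)"
    proof (rule integral_mono)
      show "integrable M (\<lambda>\<omega>. \<phi> (W m 0 \<omega>) * h k p (ex p m \<omega>))"
        by (rule integrable_const_bound[where B = 1]) (use \<phi>1 h0 in \<open>auto simp: abs_mult intro!:
            mult_le_one\<close>)
      show "\<phi> (W m 0 \<omega>) * h k p (ex p m \<omega>) \<le> r k * c2 * (\<phi> (W m 0 \<omega>) * inv_ext (eps p) (ex p m \<omega>))"
          for \<omega>
      proof -
        have "h k p (ex p m \<omega>) \<le> r k * c2 * inv_ext (eps p) (ex p m \<omega>)" by (simp add: h_def)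
        from mult_left_mono[OF this, of "\<phi> (W m 0 \<omega>)"] \<phi>1 show ?thesis by (simp add: mult_ac)
      qed
    qed (use i1 in auto)
    also have "\<dots> \<le> r k * c2 * 2" using b1 r[of k] c2 by simp
    finally show "(\<integral>\<omega>. A k \<omega> \<partial>M) \<le> r k * c2 * 2 + e" using m0[of m] by (simp add: m_def)
  qed
  have A0: "AE \<omega> in M. 0 \<le> A k \<omega> \<and> A k \<omega> \<le> 1" for k
    using Aeq[of k] by eventually_elim (use \<phi>1 \<psi>1 in \<open>auto intro!: mult_le_one\<close>)
  have "(\<integral>\<^sup>+\<omega>. liminf (\<lambda>k. ennreal (A k \<omega>)) \<partial>M) \<le> liminf (\<lambda>k. \<integral>\<^sup>+\<omega>. ennreal (A k \<omega>) \<partial>M)"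
    by (rule nn_integral_liminf) measurable
  also have "\<dots> \<le> liminf (\<lambda>k. ennreal (r k * c2 * 2))"
  proof (rule Liminf_mono, rule always_eventually, rule allI)
    fix k
    have "integrable M (A k)" by (rule integrable_const_bound[where B = 1]) (use A0[of k] in auto)
    then have "(\<integral>\<^sup>+\<omega>. ennreal (A k \<omega>) \<partial>M) = ennreal (\<integral>\<omega>. A k \<omega> \<partial>M)"
      using A0[of k] by (intro nn_integral_eq_integral) auto
    also have "\<dots> \<le> ennreal (r k * c2 * 2)" by (rule ennreal_leI[OF A_int])
    finally show "(\<integral>\<^sup>+\<omega>. ennreal (A k \<omega>) \<partial>M) \<le> ennreal (r k * c2 * 2)" .
  qed
  also have "\<dots> = 0"
  proof (rule lim_imp_Liminf)
    have "r \<longlonglongrightarrow> 0" unfolding r_def[abs_def] using LIMSEQ_inverse_real_of_nat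
      by (simp add: inverse_eq_divide add.commute)
    then have "(\<lambda>k. r k * c2 * 2) \<longlonglongrightarrow> 0 * c2 * 2" by (intro tendsto_mult tendsto_const)
    then have "(\<lambda>k. ennreal (r k * c2 * 2)) \<longlonglongrightarrow> ennreal (0 * c2 * 2)" by (rule tendsto_ennrealI)
    then show "(\<lambda>k. ennreal (r k * c2 * 2)) \<longlonglongrightarrow> 0" by simp
  qed simp
  finally have "AE \<omega> in M. liminf (\<lambda>k. ennreal (A k \<omega>)) = 0"
    by (subst (asm) le_zero_eq, subst (asm) nn_integral_0_iff_AE) auto
  moreover have "AE \<omega> in M. \<forall>k. A k \<omega> = \<phi> (w0 \<omega>) * \<psi> k (wT \<omega>)" using Aeq
    by (simp add: AE_all_countable)
  ultimately show ?thesis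
  proof eventually_elim
    case (elim \<omega>)
    show ?case
    proof (intro impI notI)
      assume pos: "wedge_dist q (w0 \<omega>) > 0" and "wT \<omega> = 0"
      then have "A k \<omega> = \<phi> (w0 \<omega>)" for k using elim(2) by (simp add: \<psi>_def)
      then have "ennreal (\<phi> (w0 \<omega>)) = 0" using elim(1) by (simp add: Liminf_const)
      then show False using pos by (simp add: \<phi>_def)
    qed
  qed
qed

lemma isCont_Im_Ln:
  assumes "Re x > 0" "\<eta> > 0"
  obtains r where "r > 0" "\<And>y. cmod (y - x) < r \<Longrightarrow> \<bar>Im (Ln y) - Im (Ln x)\<bar> < \<eta>"
proof -
  have "isCont (\<lambda>y. Im (Ln y)) x"
    by (rule isCont_Im, rule isCont_Ln') (use assms(1) in \<open>auto simp: complex_nonpos_Reals_iff\<close>)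
  then show ?thesis using assms(2) that unfolding continuous_at_eps_delta dist_norm real_norm_def
    by blast
qed

lemma exit_angle:
  assumes E [measurable]: "E \<in> sets M" and \<phi>: "cutoff c \<phi>" and c: "c \<ge> 0"
    and ang: "AE \<omega> in M. wedge_dist q (w0 \<omega>) > 0 \<longrightarrow> wT \<omega> \<noteq> 0 \<longrightarrow> Im (Ln (wT \<omega>)) = \<alpha> * indicator E \<omega>"
  shows "(\<integral>\<omega>. \<phi> (w0 \<omega>) * Im (Ln (w0 \<omega>)) \<partial>M) = (\<integral>\<omega>. \<phi> (w0 \<omega>) * (\<alpha> * indicator E \<omega>) \<partial>M)"
proof -
  have \<phi>1: "0 \<le> \<phi> x \<and> \<phi> x \<le> 1" "\<phi> x \<le> c * max 0 (wedge_dist q x)" for x using \<phi>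
    by (auto simp: cutoff_def)
  have \<phi>m [measurable]: "\<phi> \<in> borel_measurable borel"
    using \<phi> by (auto simp: cutoff_def intro: borel_measurable_continuous_onI)
  have em [measurable]: "arg_ext (eps p) \<in> borel_measurable borel" for p
    by (rule measurable_arg_ext[OF eps_pos])
  have bound: "\<bar>\<phi> y * arg_ext (eps p) x\<bar> \<le> pi" for p x y
  proof -
    have "\<bar>\<phi> y * arg_ext (eps p) x\<bar> \<le> 1 * pi"
      unfolding abs_mult using \<phi>1(1)[of y] abs_arg_ext_le[OF eps_pos, of p x]
        by (intro mult_mono) auto
    then show ?thesis by simp
  qed
  have ext_eq: "arg_ext (eps p) x = Im (Ln x)" if "wedge_dist q x > eps p / 2" for p x
  proof -
    have "Re x > eps p / 2" using Re_gt_wedge[OF q _ that] eps_pos[of p] by simp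
    then show ?thesis by (simp add: arg_ext_def)
  qed
  have 1: "AE \<omega> in M. iterated_lim (\<lambda>p m. \<phi> (W m 0 \<omega>) * arg_ext (eps p) (ex p m \<omega>)) (\<phi> (w0 \<omega>) * Im
      (Ln (wT \<omega>)))"
  proof (rule iterated_lim_exit[OF \<phi> c abs_arg_ext_le[OF eps_pos]])
    show "AE \<omega> in M. wedge_dist q (w0 \<omega>) > 0 \<longrightarrow> wedge_dist q (wT \<omega>) = 0 \<longrightarrow>
        (\<forall>\<eta>>0. \<exists>r>0. \<forall>p x. cmod (x - wT \<omega>) < r \<longrightarrow>
      wedge_dist q x > eps p / 2 \<longrightarrow> \<bar>arg_ext (eps p) x - Im (Ln (wT \<omega>))\<bar> < \<eta>)"
      using exit_not_apex
    proof eventually_elim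
      case (elim \<omega>)
      show ?case
      proof (intro impI allI)
        fix \<eta> :: real assume w: "wedge_dist q (w0 \<omega>) > 0" "wedge_dist q (wT \<omega>) = 0" and \<eta>: "\<eta> > 0"
        have Im: "Im (wT \<omega>) \<ge> 0" "Re (wT \<omega>) \<ge> q * Im (wT \<omega>)" using w(2)
          by (auto simp: wedge_dist_def min_def split: if_splits)
        have "Re (wT \<omega>) \<noteq> 0"
        proof
          assume R: "Re (wT \<omega>) = 0"
          then have "q * Im (wT \<omega>) \<le> 0" using Im by simp
          then have "Im (wT \<omega>) = 0" using Im(1) q by (simp add: mult_le_0_iff)
          with R elim w show False by (simp add: complex_eq_iff)
        qed
        moreover have "q * Im (wT \<omega>) \<ge> 0" using q Im by simp
        ultimately have "Re (wT \<omega>) > 0" using Im(2) by linarith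
        from isCont_Im_Ln[OF this \<eta>] obtain r where r: "r > 0" "\<And>y. cmod (y - wT \<omega>) < r \<Longrightarrow>
            \<bar>Im (Ln y) - Im (Ln (wT \<omega>))\<bar> < \<eta>"
          by blast
        then show "\<exists>r>0. \<forall>p x. cmod (x - wT \<omega>) < r \<longrightarrow> wedge_dist q x > eps p / 2 \<longrightarrow>
            \<bar>arg_ext (eps p) x - Im (Ln (wT \<omega>))\<bar> < \<eta>"
          using ext_eq by (intro exI[of _ r]) auto
      qed
    qed
  qed
  obtain A where Am [measurable]: "A \<in> borel_measurable M"
    and Aeq: "AE \<omega> in M. A \<omega> = \<phi> (w0 \<omega>) * Im (Ln (wT \<omega>))"
    and Alim: "iterated_lim (\<lambda>p m. \<integral>\<omega>. \<phi> (W m 0 \<omega>) * arg_ext (eps p) (ex p m \<omega>) \<partial>M) (\<integral>\<omega>. A \<omega> \<partial>M)"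
    using iterated_lim_integral[OF _ bound 1] by auto
  have 2: "AE \<omega> in M. iterated_lim (\<lambda>p m. \<phi> (W m 0 \<omega>) * arg_ext (eps p) (W m 0 \<omega>)) (\<phi> (w0 \<omega>) * Im
      (Ln (w0 \<omega>)))"
    using exit_tendsto start_outside
  proof eventually_elim
    case (elim \<omega>)
    show ?case
    proof (rule iterated_lim_product[OF \<phi> c abs_arg_ext_le[OF eps_pos]])
      assume pos: "wedge_dist q (w0 \<omega>) > 0"
      then have W0: "\<exists>m0. \<forall>m\<ge>m0. cmod (W m 0 \<omega> - w0 \<omega>) < \<eta>" if "\<eta> > 0" for \<eta> using elim(1) that
        by blast
      have R: "Re (w0 \<omega>) > 0" using Re_gt_wedge[OF q _ pos] by simp
      show "iterated_lim (\<lambda>p m. arg_ext (eps p) (W m 0 \<omega>)) (Im (Ln (w0 \<omega>)))"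
        unfolding iterated_lim_def
      proof (intro allI impI)
        fix \<eta> :: real assume "\<eta> > 0"
        from isCont_Im_Ln[OF R this] obtain r where r: "r > 0" "\<And>y. cmod (y - w0 \<omega>) < r \<Longrightarrow>
            \<bar>Im (Ln y) - Im (Ln (w0 \<omega>))\<bar> < \<eta>"
          by blast
        obtain m0 where m0: "\<And>m. m \<ge> m0 \<Longrightarrow> cmod (W m 0 \<omega> - w0 \<omega>) < min r (Re (w0 \<omega>) / 2)"
          using W0[of "min r (Re (w0 \<omega>) / 2)"] r(1) R by auto
        obtain p0 :: nat where p0: "1 / Re (w0 \<omega>) < real p0" using reals_Archimedean2 by blast
        have "\<bar>arg_ext (eps p) (W m 0 \<omega>) - Im (Ln (w0 \<omega>))\<bar> < \<eta>" if p: "p \<ge> p0" and m: "m \<ge> m0"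
            for p m
        proof -
          have "\<bar>Re (W m 0 \<omega> - w0 \<omega>)\<bar> < Re (w0 \<omega>) / 2"
            using m0[OF m] abs_Re_le_cmod[of "W m 0 \<omega> - w0 \<omega>"] by simp
          then have "\<bar>Re (W m 0 \<omega>) - Re (w0 \<omega>)\<bar> < Re (w0 \<omega>) / 2" by simp
          then have "Re (W m 0 \<omega>) > Re (w0 \<omega>) / 2" unfolding abs_less_iff by linarith
          moreover have "eps p < Re (w0 \<omega>)"
          proof -
            have "1 / Re (w0 \<omega>) < real p + 1" using p0 p by linarith
            then show ?thesis using R by (simp add: eps_def field_simps)
          qed
          ultimately have "arg_ext (eps p) (W m 0 \<omega>) = Im (Ln (W m 0 \<omega>))" by (simp add: arg_ext_def)
          then show ?thesis using r(2) m0[OF m] by simp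
        qed
        then show "\<exists>p0. \<forall>p\<ge>p0. \<exists>m0. \<forall>m\<ge>m0. \<bar>arg_ext (eps p) (W m 0 \<omega>) - Im (Ln (w0 \<omega>))\<bar> < \<eta>"
          by blast
      qed
    qed (use elim in auto)
  qed
  obtain A0 where A0m [measurable]: "A0 \<in> borel_measurable M"
    and A0eq: "AE \<omega> in M. A0 \<omega> = \<phi> (w0 \<omega>) * Im (Ln (w0 \<omega>))"
    and A0lim: "iterated_lim (\<lambda>p m. \<integral>\<omega>. \<phi> (W m 0 \<omega>) * arg_ext (eps p) (W m 0 \<omega>) \<partial>M) (\<integral>\<omega>. A0 \<omega> \<partial>M)"
    using iterated_lim_integral[OF _ bound 2] by auto
  have "\<bar>(\<integral>\<omega>. A \<omega> \<partial>M) - (\<integral>\<omega>. A0 \<omega> \<partial>M)\<bar> \<le> 0"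
  proof (rule field_le_epsilon)
    fix e :: real assume "e > 0"
    then have e: "e / 3 > 0" by simp
    obtain p1 where p1: "\<And>p. p \<ge> p1 \<Longrightarrow>
        \<exists>m0. \<forall>m\<ge>m0. \<bar>(\<integral>\<omega>. \<phi> (W m 0 \<omega>) * arg_ext (eps p) (ex p m \<omega>) \<partial>M) - (\<integral>\<omega>. A \<omega> \<partial>M)\<bar> < e / 3"
      using Alim e unfolding iterated_lim_def by blast
    obtain p2 where p2: "\<And>p. p \<ge> p2 \<Longrightarrow>
        \<exists>m0. \<forall>m\<ge>m0. \<bar>(\<integral>\<omega>. \<phi> (W m 0 \<omega>) * arg_ext (eps p) (W m 0 \<omega>) \<partial>M) - (\<integral>\<omega>. A0 \<omega> \<partial>M)\<bar> < e / 3"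
      using A0lim e unfolding iterated_lim_def by blast
    define p where "p = max p1 p2"
    obtain m1 where m1: "\<And>m. m \<ge> m1 \<Longrightarrow>
        \<bar>(\<integral>\<omega>. \<phi> (W m 0 \<omega>) * arg_ext (eps p) (ex p m \<omega>) \<partial>M) - (\<integral>\<omega>. A \<omega> \<partial>M)\<bar> < e / 3"
      using p1[of p] by (auto simp: p_def)
    obtain m2 where m2: "\<And>m. m \<ge> m2 \<Longrightarrow>
        \<bar>(\<integral>\<omega>. \<phi> (W m 0 \<omega>) * arg_ext (eps p) (W m 0 \<omega>) \<partial>M) - (\<integral>\<omega>. A0 \<omega> \<partial>M)\<bar> < e / 3"
      using p2[of p] by (auto simp: p_def)
    obtain K where K: "K \<ge> 0" "\<And>\<sigma> w. \<sigma> > 0 \<Longrightarrow> Re w \<ge> eps p \<Longrightarrow>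
      \<bar>(\<integral>x. arg_ext (eps p) (w +
          Complex (fst x) (snd x)) \<partial>(gauss \<sigma> \<Otimes>\<^sub>M gauss \<sigma>)) - arg_ext (eps p) w\<bar> \<le> K * \<sigma>^3"
      using arg_ext_step[OF eps_pos, of p] by blast
    have "(\<lambda>m. (\<integral>\<omega>. \<phi> (W m 0 \<omega>) * arg_ext (eps p) (ex p m \<omega>) \<partial>M) - (\<integral>\<omega>. \<phi> (W m 0 \<omega>) * arg_ext (eps
        p) (W m 0 \<omega>) \<partial>M)) \<longlonglongrightarrow> 0"
      by (rule exit_error_tendsto[OF em \<phi>m abs_arg_ext_le[OF eps_pos] \<phi>1(1) K])
    from LIMSEQ_D[OF this e] obtain m3 where m3: "\<And>m. m \<ge> m3 \<Longrightarrow>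
      \<bar>(\<integral>\<omega>. \<phi> (W m 0 \<omega>) * arg_ext (eps p) (ex p m \<omega>) \<partial>M) - (\<integral>\<omega>. \<phi> (W m 0 \<omega>) * arg_ext (eps p) (W m 0
          \<omega>) \<partial>M)\<bar> < e / 3"
      by auto
    define m where "m = max m1 (max m2 m3)"
    have "m \<ge> m1" "m \<ge> m2" "m \<ge> m3" by (auto simp: m_def)
    then show "\<bar>(\<integral>\<omega>. A \<omega> \<partial>M) - (\<integral>\<omega>. A0 \<omega> \<partial>M)\<bar> \<le> 0 + e"
      using m1[of m] m2[of m] m3[of m] by linarith
  qed
  then have eq: "(\<integral>\<omega>. A \<omega> \<partial>M) = (\<integral>\<omega>. A0 \<omega> \<partial>M)" by simp
  have Lm [measurable]: "(\<lambda>\<omega>. \<phi> (w0 \<omega>) * Im (Ln (w0 \<omega>))) \<in> borel_measurable M"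
  proof -
    have "(\<lambda>x. if x \<in> {x. Re x > 0} then Im (Ln x) else 0) \<in> borel_measurable borel"
      by (intro borel_measurable_continuous_on_if continuous_intros) (auto simp:
          complex_nonpos_Reals_iff)
    then have [measurable]: "(\<lambda>x. if Re x > 0 then Im (Ln x) else 0) \<in> borel_measurable borel"
      by simp
    have "\<phi> x * Im (Ln x) = \<phi> x * (if Re x > 0 then Im (Ln x) else 0)" for x
    proof (cases "wedge_dist q x > 0")
      case True then show ?thesis using Re_gt_wedge[OF q _ True] by simp
    next
      case False
      then have "\<phi> x = 0" using \<phi>1[of x] by (simp add: max_def split: if_splits)
      then show ?thesis by simp
    qed
    then have "(\<lambda>\<omega>. \<phi> (w0 \<omega>) * Im (Ln (w0 \<omega>))) =
        (\<lambda>\<omega>. \<phi> (w0 \<omega>) * (if Re (w0 \<omega>) > 0 then Im (Ln (w0 \<omega>)) else 0))" by blast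
    then show ?thesis by simp
  qed
  have "(\<integral>\<omega>. \<phi> (w0 \<omega>) * Im (Ln (w0 \<omega>)) \<partial>M) = (\<integral>\<omega>. A0 \<omega> \<partial>M)"
    by (rule integral_cong_AE) (use A0eq in auto)
  also have "\<dots> = (\<integral>\<omega>. A \<omega> \<partial>M)" using eq by simp
  also have "\<dots> = (\<integral>\<omega>. \<phi> (w0 \<omega>) * (\<alpha> * indicator E \<omega>) \<partial>M)"
  proof (rule integral_cong_AE)
    show "AE \<omega> in M. A \<omega> = \<phi> (w0 \<omega>) * (\<alpha> * indicator E \<omega>)"
      using Aeq ang exit_not_apex
    proof eventually_elim
      case (elim \<omega>)
      show ?case
      proof (cases "wedge_dist q (w0 \<omega>) > 0")
        case True then show ?thesis using elim by simp
      next
        case False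
        then have "\<phi> (w0 \<omega>) = 0" using \<phi>1[of "w0 \<omega>"] by (simp add: max_def split: if_splits)
        then show ?thesis using elim by simp
      qed
    qed
  qed measurable
  finally show ?thesis .
qed

end

lemma measurable_Im_Ln_right: "(\<lambda>x. if Re x > 0 then Im (Ln x) else 0) \<in> borel_measurable borel"
proof -
  have "(\<lambda>x. if x \<in> {x. Re x > 0} then Im (Ln x) else 0) \<in> borel_measurable borel"
    by (intro borel_measurable_continuous_on_if continuous_intros) (auto simp:
        complex_nonpos_Reals_iff)
  then show ?thesis by simp
qed

lemma Im_Ln_wedge: "q > 0 \<Longrightarrow> wedge_dist q x > 0 \<Longrightarrow> Re x > 0 \<and> 0 \<le> Im (Ln x) \<and> Im (Ln x) \<le> pi"
proof -
  assume q: "q > 0" and x: "wedge_dist q x > 0"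
  have R: "Re x > 0" using Re_gt_wedge[OF q _ x] by simp
  have "Im x > 0" using x by (simp add: wedge_dist_def)
  moreover have "x \<noteq> 0" using R by auto
  ultimately show ?thesis using R Im_Ln_le_pi[of x] Im_Ln_pos_le[of x] by auto
qed

context wedge_approx
begin

lemma exit_angle_measure:
  assumes E [measurable]: "E \<in> sets M" and \<alpha>: "\<alpha> \<ge> 0"
    and ang: "AE \<omega> in M. wedge_dist q (w0 \<omega>) > 0 \<longrightarrow> wT \<omega> \<noteq> 0 \<longrightarrow> Im (Ln (wT \<omega>)) = \<alpha> * indicator E \<omega>"
    and A: "A \<in> sets borel" "A \<subseteq> wedge q 0"
  shows "(\<integral>\<^sup>+\<omega>. indicator A (w0 \<omega>) * ennreal (Im (Ln (w0 \<omega>))) \<partial>M) =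
    (\<integral>\<^sup>+\<omega>. indicator A (w0 \<omega>) * ennreal (\<alpha> * indicator E \<omega>) \<partial>M)"
proof -
  define L where "L x = (if Re x > 0 then Im (Ln x) else 0)" for x
  have [measurable]: "L \<in> borel_measurable borel" unfolding L_def by (rule measurable_Im_Ln_right)
  have L: "L x = Im (Ln x)" "0 \<le> L x" "L x \<le> pi" if "wedge_dist q x > 0" for x
    using Im_Ln_wedge[OF q that] by (auto simp: L_def)
  define f1 where "f1 \<omega> = indicator (wedge q 0) (w0 \<omega>) * ennreal (L (w0 \<omega>))" for \<omega>
  define f2 where "f2 \<omega> = indicator (wedge q 0) (w0 \<omega>) * ennreal (\<alpha> * indicator E \<omega>)" for \<omega>
  have [measurable]: "f1 \<in> borel_measurable M" "f2 \<in> borel_measurable M" unfolding f1_def f2_def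
    by measurable
  define N1 where "N1 = distr (density M f1) borel w0"
  define N2 where "N2 = distr (density M f2) borel w0"
  have emN: "emeasure N1 B = (\<integral>\<^sup>+\<omega>. indicator B (w0 \<omega>) * f1 \<omega> \<partial>M)"
    "emeasure N2 B = (\<integral>\<^sup>+\<omega>. indicator B (w0 \<omega>) * f2 \<omega> \<partial>M)" if [measurable]: "B \<in> sets borel" for B
    unfolding N1_def N2_def
    by (subst emeasure_distr; (subst emeasure_density)?; auto simp: indicator_def intro!:
        nn_integral_cong)+
  have open_eq: "emeasure N1 U = emeasure N2 U" if U: "open U" for U
  proof -
    have Ub [measurable]: "U \<in> sets borel" using U by simp
    define dU where "dU x = (if U = UNIV then 1 else infdist x (- U))" for x
    have dU: "continuous_on UNIV dU" unfolding dU_def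
      by (cases "U = UNIV") (auto intro!: continuous_intros)
    have dU0: "dU x \<ge> 0" for x by (simp add: dU_def infdist_nonneg)
    have dUpos: "dU x > 0 \<longleftrightarrow> x \<in> U" for x
    proof (cases "U = UNIV")
      case False
      have "closed (- U)" using U by auto
      from in_closed_iff_infdist_zero[OF this, of x] False show ?thesis
        using infdist_nonneg[of x "- U"] by (auto simp: dU_def less_le)
    qed (simp add: dU_def)
    define \<phi> where "\<phi> n x = min 1 (real n * min (max 0 (wedge_dist q x)) (dU x))" for n :: nat and x
    have c\<phi>: "cutoff (real n) (\<phi> n)" for n
      unfolding cutoff_def
    proof (intro conjI allI)
      show "continuous_on UNIV (\<phi> n)" unfolding \<phi>_def by (intro continuous_intros dU)
      fix x
      have "min (max 0 (wedge_dist q x)) (dU x) \<ge> 0" using dU0[of x] by simp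
      then show "0 \<le> \<phi> n x" by (simp add: \<phi>_def)
      show "\<phi> n x \<le> 1" by (simp add: \<phi>_def)
      have "real n * min (max 0 (wedge_dist q x)) (dU x) \<le> real n * max 0 (wedge_dist q x)"
        by (intro mult_left_mono) auto
      then show "\<phi> n x \<le> real n * max 0 (wedge_dist q x)" unfolding \<phi>_def by linarith
    qed
    have \<phi>1: "0 \<le> \<phi> n x" "\<phi> n x \<le> 1" "wedge_dist q x \<le> 0 \<Longrightarrow> \<phi> n x = 0" for n x
      using c\<phi>[of n] dU0[of x] by (auto simp: cutoff_def \<phi>_def)
    have [measurable]: "\<phi> n \<in> borel_measurable borel" for n
      using c\<phi>[of n] by (auto simp: cutoff_def intro: borel_measurable_continuous_onI)
    have lim: "(\<lambda>n. \<phi> n x) \<longlonglongrightarrow> indicator (U \<inter> wedge q 0) x" for x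
    proof (cases "x \<in> U \<inter> wedge q 0")
      case True
      define y where "y = min (max 0 (wedge_dist q x)) (dU x)"
      have y: "y > 0" using True dUpos[of x] by (simp add: y_def)
      obtain n0 :: nat where n0: "1 / y < real n0" using reals_Archimedean2 by blast
      have "\<phi> n x = 1" if "n \<ge> n0" for n
      proof -
        have "1 / y < real n" using n0 that by linarith
        then have "1 < real n * y" using y by (simp add: field_simps)
        then show ?thesis by (simp add: \<phi>_def y_def[symmetric])
      qed
      then have "eventually (\<lambda>n. \<phi> n x = 1) sequentially" by (auto simp: eventually_sequentially)
      then show ?thesis using True by (simp add: tendsto_eventually)
    next
      case False
      then have "dU x = 0 \<or> wedge_dist q x \<le> 0" using dUpos[of x] dU0[of x] by force
      then have "min (max 0 (wedge_dist q x)) (dU x) = 0" using dU0[of x]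
        by (auto simp: min_def max_def)
      then have "\<phi> n x = 0" for n by (simp add: \<phi>_def)
      then show ?thesis using False by simp
    qed
    have eq: "(\<integral>\<^sup>+\<omega>. ennreal (\<phi> n (w0 \<omega>)) * f1 \<omega> \<partial>M) = (\<integral>\<^sup>+\<omega>. ennreal (\<phi> n (w0 \<omega>)) * f2 \<omega> \<partial>M)" for n
    proof -
      have a: "(\<integral>\<omega>. \<phi> n (w0 \<omega>) * L (w0 \<omega>) \<partial>M) = (\<integral>\<omega>. \<phi> n (w0 \<omega>) * Im (Ln (w0 \<omega>)) \<partial>M)"
        by (intro Bochner_Integration.integral_cong refl) (metis L(1) \<phi>1(3) mult_eq_0_iff not_less)
      have p1: "0 \<le> \<phi> n x * L x \<and> \<phi> n x * L x \<le> pi" for x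
      proof (cases "wedge_dist q x > 0")
        case True
        have "\<phi> n x * L x \<le> 1 * pi" using \<phi>1 L[OF True] by (intro mult_mono) auto
        then show ?thesis using \<phi>1 L[OF True] by simp
      qed (use \<phi>1(3)[of x n] in auto)
      have p2: "0 \<le> \<phi> n x * (\<alpha> * indicator E \<omega>) \<and> \<phi> n x * (\<alpha> * indicator E \<omega>) \<le> \<alpha>" for x \<omega>
      proof -
        have "\<phi> n x * (\<alpha> * indicator E \<omega>) \<le> 1 * (\<alpha> * 1)" using \<phi>1 \<alpha>
          by (intro mult_mono) (auto simp: indicator_def)
        then show ?thesis using \<phi>1 \<alpha> by simp
      qed
      have "(\<integral>\<^sup>+\<omega>. ennreal (\<phi> n (w0 \<omega>)) * f1 \<omega> \<partial>M) = (\<integral>\<^sup>+\<omega>. ennreal (\<phi> n (w0 \<omega>) * L (w0 \<omega>)) \<partial>M)"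
        using \<phi>1 by (intro nn_integral_cong) (auto simp: f1_def ennreal_mult' indicator_def
            not_less)
      also have "\<dots> = ennreal (\<integral>\<omega>. \<phi> n (w0 \<omega>) * L (w0 \<omega>) \<partial>M)"
        by (intro nn_integral_eq_integral integrable_const_bound[where B = pi]) (use p1 in auto)
      also have "\<dots> = ennreal (\<integral>\<omega>. \<phi> n (w0 \<omega>) * (\<alpha> * indicator E \<omega>) \<partial>M)"
        unfolding a using exit_angle[OF E c\<phi> _ ang] by simp
      also have "\<dots> = (\<integral>\<^sup>+\<omega>. ennreal (\<phi> n (w0 \<omega>) * (\<alpha> * indicator E \<omega>)) \<partial>M)"
        by (intro nn_integral_eq_integral[symmetric] integrable_const_bound[where B = \<alpha>]) (use p2 in
            auto)
      also have "\<dots> = (\<integral>\<^sup>+\<omega>. ennreal (\<phi> n (w0 \<omega>)) * f2 \<omega> \<partial>M)"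
        using \<phi>1 by (intro nn_integral_cong) (auto simp: f2_def ennreal_mult' indicator_def
            not_less)
      finally show ?thesis .
    qed
    have conv: "(\<lambda>n. \<integral>\<^sup>+\<omega>. ennreal (\<phi> n (w0 \<omega>)) * f \<omega> \<partial>M) \<longlonglongrightarrow> (\<integral>\<^sup>+\<omega>. indicator U (w0 \<omega>) * f \<omega> \<partial>M)"
      if [measurable]: "f \<in> borel_measurable M"
          and f: "\<And>\<omega>. f \<omega> \<le> ennreal K" "\<And>\<omega>. wedge_dist q (w0 \<omega>) \<le> 0 \<Longrightarrow> f \<omega> = 0" for f K
    proof (rule nn_integral_dominated_convergence[where w = "\<lambda>_. ennreal K"])
      show "AE \<omega> in M. ennreal (\<phi> n (w0 \<omega>)) * f \<omega> \<le> ennreal K" for n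
      proof (rule AE_I2)
        fix \<omega>
        have "ennreal (\<phi> n (w0 \<omega>)) * f \<omega> \<le> ennreal 1 * ennreal K" using \<phi>1 f
          by (intro mult_mono ennreal_leI) auto
        then show "ennreal (\<phi> n (w0 \<omega>)) * f \<omega> \<le> ennreal K" by simp
      qed
      show "AE \<omega> in M. (\<lambda>n. ennreal (\<phi> n (w0 \<omega>)) * f \<omega>) \<longlonglongrightarrow> indicator U (w0 \<omega>) * f \<omega>"
      proof (rule AE_I2)
        fix \<omega>
        have "f \<omega> < top" using f(1)[of \<omega>] by (rule order_le_less_trans) simp
        then have "(\<lambda>n. ennreal (\<phi> n (w0 \<omega>)) * f \<omega>) \<longlonglongrightarrow> ennreal (indicator (U \<inter> wedge q 0) (w0 \<omega>)) * f
            \<omega>"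
          by (intro tendsto_mult_ennreal tendsto_ennrealI lim tendsto_const) auto
        also have "ennreal (indicator (U \<inter> wedge q 0) (w0 \<omega>)) * f \<omega> = indicator U (w0 \<omega>) * f \<omega>"
          using f(2)[of \<omega>] by (auto simp: indicator_def not_less)
        finally show "(\<lambda>n. ennreal (\<phi> n (w0 \<omega>)) * f \<omega>) \<longlonglongrightarrow> indicator U (w0 \<omega>) * f \<omega>" .
      qed
      show "(\<integral>\<^sup>+\<omega>. ennreal K \<partial>M) < \<infinity>" by (simp add: emeasure_space_1)
    qed measurable
    have "(\<lambda>n. \<integral>\<^sup>+\<omega>. ennreal (\<phi> n (w0 \<omega>)) * f1 \<omega> \<partial>M) \<longlonglongrightarrow> (\<integral>\<^sup>+\<omega>. indicator U (w0 \<omega>) * f1 \<omega> \<partial>M)"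
      by (rule conv[of f1 pi]) (use L in \<open>auto simp: f1_def indicator_def intro!: ennreal_leI\<close>)
    moreover have "(\<lambda>n. \<integral>\<^sup>+\<omega>. ennreal (\<phi> n (w0 \<omega>)) * f2 \<omega> \<partial>M) \<longlonglongrightarrow> (\<integral>\<^sup>+\<omega>. indicator U (w0 \<omega>) * f2 \<omega>
        \<partial>M)"
      by (rule conv[of f2 \<alpha>]) (use \<alpha> in \<open>auto simp: f2_def indicator_def intro!: ennreal_leI\<close>)
    ultimately have "(\<integral>\<^sup>+\<omega>. indicator U (w0 \<omega>) * f1 \<omega> \<partial>M) = (\<integral>\<^sup>+\<omega>. indicator U (w0 \<omega>) * f2 \<omega> \<partial>M)"
      unfolding eq by (rule LIMSEQ_unique)
    then show ?thesis by (simp add: emN)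
  qed
  have "N1 = N2"
  proof (rule measure_eqI_generator_eq[where E = "{U. open U}" and \<Omega> = UNIV and A = "\<lambda>_. UNIV"])
    show "Int_stable {U :: complex set. open U}" by (auto simp: Int_stable_def)
    show "emeasure N1 X = emeasure N2 X" if "X \<in> {U. open U}" for X using open_eq that by simp
    show "sets N1 = sigma_sets UNIV {U. open U}" "sets N2 = sigma_sets UNIV {U. open U}"
      by (auto simp: N1_def N2_def borel_def)
    show "emeasure N1 UNIV \<noteq> \<infinity>" for i :: nat
    proof -
      have "emeasure N1 UNIV \<le> (\<integral>\<^sup>+\<omega>. ennreal pi \<partial>M)"
        unfolding emN(1)[OF borel_open[OF open_UNIV]]
        by (intro nn_integral_mono) (use L in \<open>auto simp: f1_def indicator_def intro!: ennreal_leI\<close>)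
      also have "\<dots> < \<infinity>" by (simp add: emeasure_space_1)
      finally show ?thesis by simp
    qed
  qed auto
  then have "emeasure N1 A = emeasure N2 A" by simp
  moreover have "indicator A (w0 \<omega>) * f1 \<omega> = indicator A (w0 \<omega>) * ennreal (Im (Ln (w0 \<omega>)))"
    "indicator A (w0 \<omega>) * f2 \<omega> = indicator A (w0 \<omega>) * ennreal (\<alpha> * indicator E \<omega>)" for \<omega>
    using A(2) L(1)[of "w0 \<omega>"] by (auto simp: f1_def f2_def indicator_def)
  ultimately show ?thesis by (simp add: emN[OF A(1)])
qed

end

section \<open>Excursions of the time-changed path\<close>

definition time_changed :: "real \<Rightarrow> real \<Rightarrow> (real \<Rightarrow> real) \<Rightarrow> real \<Rightarrow> real" where
  "time_changed \<sigma>p \<sigma>m w t =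
     (if bij_betw (clock \<sigma>p \<sigma>m w) {0..} {0..} then w (inv_into {0..} (clock \<sigma>p \<sigma>m w) t) else 0)"

lemma two_speed_eq: "two_speed \<sigma>p \<sigma>m B t \<omega> = time_changed \<sigma>p \<sigma>m (\<lambda>s. B s \<omega>) t"
  by (simp add: two_speed_def time_changed_def Let_def)

lemma neg_excursion_unique:
  assumes "neg_excursion g l r" "neg_excursion g l' r'" "t \<in> {l..<r}" "t \<in> {l'..<r'}"
  shows "l = l'" "r = r'"
proof -
  have e: "g l = 0" "g r = 0" "\<And>u. l < u \<Longrightarrow> u < r \<Longrightarrow> g u < 0"
    "g l' = 0" "g r' = 0" "\<And>u. l' < u \<Longrightarrow> u < r' \<Longrightarrow> g u < 0"
    using assms(1,2) by (auto simp: neg_excursion_def)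
  have t: "l \<le> t" "t < r" "l' \<le> t" "t < r'" using assms(3,4) by auto
  show l: "l = l'"
  proof (rule ccontr)
    assume "l \<noteq> l'"
    then consider "l < l'" | "l' < l" by linarith
    then show False using e(3)[of l'] e(6)[of l] e(1,4) t by cases auto
  qed
  show "r = r'"
  proof (rule ccontr)
    assume "r \<noteq> r'"
    then consider "r < r'" | "r' < r" by linarith
    then show False using e(3)[of r'] e(6)[of r] e(2,5) t by cases auto
  qed
qed

lemma neg_excursion_exists:
  assumes g: "continuous_on {0..} g" and g0: "g 0 = 0" and t0: "0 < t0" "g t0 < 0"
    and T: "T \<ge> t0" "g T \<ge> 0"
  shows "\<exists>l r. neg_excursion g l r \<and> l < t0 \<and> t0 < r"
proof -
  have cl: "compact {s \<in> {a..b}. 0 \<le> g s}" if "0 \<le> a" for a b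
  proof -
    have "continuous_on {a..b} g" using g by (rule continuous_on_subset) (use that in auto)
    then have "closed {s \<in> {a..b}. 0 \<le> g s}"
      using continuous_closed_preimage[of "{a..b}" g "{0..}"] by (simp add: vimage_def Int_def)
    then show ?thesis by (auto simp: compact_eq_bounded_closed intro: bounded_subset[of "{a..b}"])
  qed
  have "{s \<in> {0..t0}. 0 \<le> g s} \<noteq> {}" using t0 g0 by (auto intro!: exI[of _ 0])
  from compact_attains_sup[OF cl this] obtain l
    where l: "l \<in> {0..t0}" "0 \<le> g l" "\<And>s. s \<in> {0..t0} \<Longrightarrow> 0 \<le> g s \<Longrightarrow> s \<le> l" by auto
  have "{s \<in> {t0..T}. 0 \<le> g s} \<noteq> {}" using T by (auto intro!: exI[of _ T])
  from compact_attains_inf[OF cl this] t0 obtain r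
    where r: "r \<in> {t0..T}" "0 \<le> g r" "\<And>s. s \<in> {t0..T} \<Longrightarrow> 0 \<le> g s \<Longrightarrow> r \<le> s" by auto
  have lt: "l < t0" "t0 < r" using l r t0 by (auto simp: less_le)
  have neg: "g u < 0" if "l < u" "u < r" for u
    using l(3)[of u] r(3)[of u] that l(1) r(1) by (cases "u \<le> t0") force+
  have "g l = 0"
  proof (rule ccontr)
    assume "g l \<noteq> 0"
    then have "g l > 0" using l by simp
    have "\<exists>x\<ge>l. x \<le> t0 \<and> g x = 0"
      by (rule IVT2'[of g]) (use \<open>g l > 0\<close> t0 lt l in \<open>auto intro: continuous_on_subset[OF g]\<close>)
    then obtain x where x: "l \<le> x" "x \<le> t0" "g x = 0" by blast
    then show False using l(3)[of x] l(1) \<open>g l > 0\<close> by force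
  qed
  moreover have "g r = 0"
  proof (rule ccontr)
    assume "g r \<noteq> 0"
    then have "g r > 0" using r by simp
    have "\<exists>x\<ge>t0. x \<le> r \<and> g x = 0"
      by (rule IVT'[of g]) (use \<open>g r > 0\<close> t0 lt r in \<open>auto intro: continuous_on_subset[OF g]\<close>)
    then obtain x where x: "t0 \<le> x" "x \<le> r" "g x = 0" by blast
    then show False using r(3)[of x] r(1) \<open>g r > 0\<close> by force
  qed
  ultimately have "neg_excursion g l r" using neg l lt by (auto simp: neg_excursion_def)
  then show ?thesis using lt by blast
qed

locale clock_path =
  fixes \<sigma>p \<sigma>m :: real and w :: "real \<Rightarrow> real"
  assumes sp: "\<sigma>p > 0" and sm: "\<sigma>m > 0" and w: "continuous_on {0..} w" and w0: "w 0 = 0"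
begin

abbreviation "cl \<equiv> clock \<sigma>p \<sigma>m w"

definition occ_set :: "bool \<Rightarrow> real \<Rightarrow> real \<Rightarrow> real set" where
  "occ_set b s t = {u \<in> {s<..t}. (if b then w u > 0 else w u < 0)}"

definition occ :: "bool \<Rightarrow> real \<Rightarrow> real \<Rightarrow> real" where
  "occ b s t = measure lborel (occ_set b s t)"

lemma fmeasurable_ivl: "{s<..t::real} \<in> fmeasurable lborel"
  by (cases "s \<le> t") (auto simp: fmeasurable_def)

lemma fmeasurable_occ_set: "0 \<le> s \<Longrightarrow> occ_set b s t \<in> fmeasurable lborel"
proof -
  assume s: "0 \<le> s"
  have "continuous_on UNIV (\<lambda>u. w (max 0 u))"
    by (rule continuous_on_compose2[OF w]) (auto intro!: continuous_intros)
  then have [measurable]: "(\<lambda>u. w (max 0 u)) \<in> borel_measurable borel"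
    by (rule borel_measurable_continuous_onI)
  have "occ_set b s t =
      {u \<in> space borel. s < u \<and> u \<le> t \<and> (if b then w (max 0 u) > 0 else w (max 0 u) < 0)}"
    using s by (auto simp: occ_set_def)
  also have "\<dots> \<in> sets borel" by measurable
  finally have "occ_set b s t \<in> sets lborel" by simp
  then show ?thesis by (rule fmeasurableI2[OF fmeasurable_ivl[of s t], rotated]) (auto simp:
      occ_set_def)
qed

lemma occ_nonneg: "occ b s t \<ge> 0" by (simp add: occ_def)

lemma occ_le: "0 \<le> s \<Longrightarrow> s \<le> t \<Longrightarrow> occ b s t \<le> t - s"
proof -
  assume s: "0 \<le> s" "s \<le> t"
  have "occ b s t \<le> measure lborel {s<..t}" unfolding occ_def
    by (rule measure_mono_fmeasurable[OF _ fmeasurableD[OF fmeasurable_occ_set[OF s(1)]]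
        fmeasurable_ivl])
       (auto simp: occ_set_def)
  then show ?thesis using s by simp
qed

lemma occ_add: "0 \<le> s \<Longrightarrow> s \<le> t \<Longrightarrow> t \<le> v \<Longrightarrow> occ b s v = occ b s t + occ b t v"
proof -
  assume s: "0 \<le> s" "s \<le> t" "t \<le> v"
  then have t: "0 \<le> t" by simp
  have "occ_set b s v = occ_set b s t \<union> occ_set b t v" using s by (auto simp: occ_set_def)
  moreover have "measure lborel (occ_set b s t \<union> occ_set b t v) = measure lborel (occ_set b s t) +
      measure lborel (occ_set b t v)"
  proof (rule measure_Union)
    show "emeasure lborel (occ_set b s t) \<noteq> \<infinity>" "emeasure lborel (occ_set b t v) \<noteq> \<infinity>"
      using fmeasurableD2[OF fmeasurable_occ_set[OF s(1)]] fmeasurableD2[OF fmeasurable_occ_set[OF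
          t]] by auto
    show "occ_set b s t \<in> sets lborel" "occ_set b t v \<in> sets lborel"
      by (rule fmeasurableD[OF fmeasurable_occ_set[OF s(1)]], rule fmeasurableD[OF
          fmeasurable_occ_set[OF t]])
  qed (auto simp: occ_set_def)
  ultimately show ?thesis by (simp add: occ_def)
qed

lemma clock_eq: "t \<ge> 0 \<Longrightarrow> cl t = occ True 0 t / \<sigma>p\<^sup>2 + occ False 0 t / \<sigma>m\<^sup>2"
proof -
  assume t: "t \<ge> 0"
  have "occ_pos w t = measure lborel ({0..t} \<inter> {u. w u > 0})"
    unfolding occ_pos_def set_lebesgue_integral_def by (simp add: indicator_inter_arith[symmetric])
  also have "\<dots> = occ True 0 t" unfolding occ_def occ_set_def
    by (rule arg_cong[of _ _ "measure lborel"]) (use w0 in \<open>auto simp: less_le\<close>)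
  finally have 1: "occ_pos w t = occ True 0 t" .
  have "occ_neg w t = measure lborel ({0..t} \<inter> {u. w u < 0})"
    unfolding occ_neg_def set_lebesgue_integral_def by (simp add: indicator_inter_arith[symmetric])
  also have "\<dots> = occ False 0 t" unfolding occ_def occ_set_def
    by (rule arg_cong[of _ _ "measure lborel"]) (use w0 in \<open>auto simp: less_le\<close>)
  finally show ?thesis using 1 by (simp add: clock_def)
qed

lemma clock_diff: "0 \<le> s \<Longrightarrow> s \<le> t \<Longrightarrow> cl t - cl s = occ True s t / \<sigma>p\<^sup>2 + occ False s t / \<sigma>m\<^sup>2"
  using occ_add[of 0 s t True] occ_add[of 0 s t False] by (simp add: clock_eq add_divide_distrib)

lemma clock_mono: "0 \<le> s \<Longrightarrow> s \<le> t \<Longrightarrow> cl s \<le> cl t"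
  using clock_diff[of s t] occ_nonneg by (smt (verit) divide_nonneg_nonneg zero_le_power2)

lemma clock_lipschitz: "0 \<le> s \<Longrightarrow> s \<le> t \<Longrightarrow> cl t - cl s \<le> (1 / \<sigma>p\<^sup>2 + 1 / \<sigma>m\<^sup>2) * (t - s)"
proof -
  assume s: "0 \<le> s" "s \<le> t"
  have "occ True s t / \<sigma>p\<^sup>2 + occ False s t / \<sigma>m\<^sup>2 \<le> (t - s) / \<sigma>p\<^sup>2 + (t - s) / \<sigma>m\<^sup>2"
    by (intro add_mono divide_right_mono occ_le s) auto
  then show ?thesis using clock_diff[OF s] by (simp add: algebra_simps)
qed

lemma clock_0: "cl 0 = 0" by (simp add: clock_eq occ_def occ_set_def)

lemma clock_continuous: "continuous_on {0..} cl"
  unfolding continuous_on_iff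
proof (intro ballI allI impI)
  fix x e :: real assume x: "x \<in> {0..}" and e: "0 < e"
  define k where "k = 1 / \<sigma>p\<^sup>2 + 1 / \<sigma>m\<^sup>2"
  have k: "k > 0" using sp sm by (simp add: k_def add_pos_pos)
  show "\<exists>d>0. \<forall>x'\<in>{0..}. dist x' x < d \<longrightarrow> dist (cl x') (cl x) < e"
  proof (intro exI[of _ "e / k"] conjI ballI impI)
    fix y assume y: "y \<in> {0..}" "dist y x < e / k"
    have "\<bar>cl y - cl x\<bar> \<le> k * \<bar>y - x\<bar>"
      using clock_lipschitz[of x y] clock_lipschitz[of y x] clock_mono[of x y] clock_mono[of y x] x
          y
      unfolding k_def by (cases "x \<le> y") auto
    also have "\<dots> < e" using y k by (simp add: dist_real_def field_simps)
    finally show "dist (cl y) (cl x) < e" by (simp add: dist_real_def)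
  qed (use e k in auto)
qed

lemma clock_neg:
  assumes s: "0 \<le> s" "s \<le> t" and neg: "\<And>u. s < u \<Longrightarrow> u < t \<Longrightarrow> w u < 0"
  shows "cl t - cl s = (t - s) / \<sigma>m\<^sup>2"
proof -
  have "occ True s t \<le> measure lborel {t}" unfolding occ_def
    by (rule measure_mono_fmeasurable[OF _ fmeasurableD[OF fmeasurable_occ_set[OF s(1)]]])
       (use neg in \<open>force simp: occ_set_def fmeasurable_def\<close>)+
  then have 1: "occ True s t = 0" using occ_nonneg[of True s t] by simp
  have "measure lborel {s<..<t} \<le> occ False s t" unfolding occ_def
    by (rule measure_mono_fmeasurable[OF _ _ fmeasurable_occ_set[OF s(1)]]) (use neg in \<open>auto simp:
        occ_set_def\<close>)
  then have "occ False s t = t - s" using occ_le[OF s, of False] s by simp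
  with 1 show ?thesis using clock_diff[OF s] by simp
qed

lemma clock_bij:
  assumes null: "AE u in lborel. u \<ge> 0 \<longrightarrow> w u \<noteq> 0"
  shows "bij_betw cl {0..} {0..}"
proof -
  define k where "k = min (1 / \<sigma>p\<^sup>2) (1 / \<sigma>m\<^sup>2)"
  have k: "k > 0" "k \<le> 1 / \<sigma>p\<^sup>2" "k \<le> 1 / \<sigma>m\<^sup>2" using sp sm by (auto simp: k_def)
  have lower: "k * (t - s) \<le> cl t - cl s" if s: "0 \<le> s" "s \<le> t" for s t
  proof -
    let ?P = "occ_set True s t" and ?N = "occ_set False s t"
    note PN = fmeasurable_occ_set[OF s(1), of True t] fmeasurable_occ_set[OF s(1), of False t]
    have "emeasure lborel {s<..t} \<le> emeasure lborel (?P \<union> ?N)"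
    proof (rule emeasure_mono_AE)
      show "AE u in lborel. u \<in> {s<..t} \<longrightarrow> u \<in> ?P \<union> ?N" using null
        by eventually_elim (use s in \<open>auto simp: occ_set_def\<close>)
      show "?P \<union> ?N \<in> sets lborel" by (rule fmeasurableD[OF fmeasurable.Un[OF PN]])
    qed
    then have "measure lborel {s<..t} \<le> measure lborel (?P \<union> ?N)"
      unfolding measure_def by (rule enn2real_mono) (use fmeasurableD2[OF fmeasurable.Un[OF PN]] in
          \<open>simp add: less_top\<close>)
    also have "\<dots> \<le> occ True s t + occ False s t" unfolding occ_def
      by (rule measure_Un_le[OF fmeasurableD[OF PN(1)] fmeasurableD[OF PN(2)]])
    finally have "t - s \<le> occ True s t + occ False s t" using s by simp
    then have "k * (t - s) \<le> k * occ True s t + k * occ False s t"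
      using mult_left_mono[of "t - s" "occ True s t + occ False s t" k] k(1)
        by (simp add: distrib_left)
    also have "\<dots> \<le> (1 / \<sigma>p\<^sup>2) * occ True s t + (1 / \<sigma>m\<^sup>2) * occ False s t"
      by (intro add_mono mult_right_mono k occ_nonneg)
    finally show ?thesis using clock_diff[OF s] by simp
  qed
  have "inj_on cl {0..}"
  proof (rule linorder_inj_onI)
    fix x y :: real assume "x < y" "x \<in> {0..}" "y \<in> {0..}"
    then show "cl x \<noteq> cl y" using lower[of x y] k(1) by (smt (verit) atLeast_iff mult_pos_pos)
  qed auto
  moreover have "cl ` {0..} = {0..}"
  proof (intro equalityI subsetI)
    fix y assume "y \<in> cl ` {0..}"
    then show "y \<in> {0..}" using clock_mono[of 0] clock_0 by auto
  next
    fix y :: real assume y: "y \<in> {0..}"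
    have "k * (y / k - 0) \<le> cl (y / k) - cl 0" using y k by (intro lower) auto
    then have "y \<le> cl (y / k)" using k clock_0 by simp
    moreover have "continuous_on {0..y / k} cl"
      by (rule continuous_on_subset[OF clock_continuous]) auto
    ultimately have "\<exists>x\<ge>0. x \<le> y / k \<and> cl x = y" using y k clock_0 by (intro IVT') auto
    then show "y \<in> cl ` {0..}" by force
  qed
  ultimately show ?thesis by (simp add: bij_betw_def)
qed

abbreviation "g \<equiv> time_changed \<sigma>p \<sigma>m w"

context
  assumes bij: "bij_betw cl {0..} {0..}"
begin

definition ci :: "real \<Rightarrow> real" where "ci = inv_into {0..} cl"

lemma ci: "t \<ge> 0 \<Longrightarrow> ci t \<ge> 0" "t \<ge> 0 \<Longrightarrow> cl (ci t) = t" "u \<ge> 0 \<Longrightarrow> ci (cl u) = u"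
proof -
  show "t \<ge> 0 \<Longrightarrow> ci t \<ge> 0" using bij_betw_inv_into[OF bij] unfolding ci_def bij_betw_def by auto
  show "t \<ge> 0 \<Longrightarrow> cl (ci t) = t" unfolding ci_def by (rule bij_betw_inv_into_right[OF bij]) simp
  show "u \<ge> 0 \<Longrightarrow> ci (cl u) = u" unfolding ci_def by (rule bij_betw_inv_into_left[OF bij]) simp
qed

lemma clock_less_iff: "0 \<le> s \<Longrightarrow> 0 \<le> t \<Longrightarrow> cl s < cl t \<longleftrightarrow> s < t"
proof -
  assume st: "0 \<le> s" "0 \<le> t"
  have "cl s \<noteq> cl t" if "s \<noteq> t" using bij st that unfolding bij_betw_def inj_on_def by auto
  then show ?thesis using clock_mono[of s t] clock_mono[of t s] st by (smt (verit))
qed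

lemma ci_less_iff: "0 \<le> s \<Longrightarrow> 0 \<le> t \<Longrightarrow> ci s < ci t \<longleftrightarrow> s < t"
  using clock_less_iff[of "ci s" "ci t"] ci by simp

lemma ci_continuous: "continuous_on {0..} ci"
proof -
  have "continuous_on {0..T} ci" for T
  proof (cases "T \<ge> 0")
    case True
    have "continuous_on (cl ` {0..ci T}) ci"
    proof (rule continuous_on_inv)
      show "continuous_on {0..ci T} cl" by (rule continuous_on_subset[OF clock_continuous]) auto
      show "\<forall>x\<in>{0..ci T}. ci (cl x) = x" by (simp add: ci(3))
    qed simp
    moreover have "{0..T} \<subseteq> cl ` {0..ci T}"
    proof
      fix t assume t: "t \<in> {0..T}"
      then have "ci t \<le> ci T" using ci_less_iff[of T t] True by auto
      then show "t \<in> cl ` {0..ci T}" using ci[of t] t by (intro image_eqI[of _ _ "ci t"]) auto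
    qed
    ultimately show ?thesis by (rule continuous_on_subset)
  qed simp
  then show ?thesis
  proof -
    assume h: "\<And>T. continuous_on {0..T} ci"
    show ?thesis unfolding continuous_on_eq_continuous_within
    proof
      fix x :: real assume x: "x \<in> {0..}"
      have "continuous (at x within {0..x + 1}) ci" using h[of "x + 1"] x
        by (auto simp: continuous_on_eq_continuous_within)
      moreover have "at x within {0..} = at x within {0..x + 1}"
        by (rule at_within_nhd[of x "{x - 1<..<x + 1}"]) auto
      ultimately show "continuous (at x within {0..}) ci" by simp
    qed
  qed
qed

lemma g_eq: "g t = w (ci t)"
  using bij by (simp add: time_changed_def ci_def)

lemma neg_excursion_clock:
  assumes e: "neg_excursion g l r" and t0: "l \<le> t0" "t0 \<le> r"
  shows "\<And>t. l \<le> t \<Longrightarrow> t \<le> r \<Longrightarrow> ci t = ci t0 + \<sigma>m\<^sup>2 * (t - t0)"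
    and "\<And>u. ci l < u \<Longrightarrow> u < ci r \<Longrightarrow> w u < 0" and "w (ci l) = 0" "w (ci r) = 0"
proof -
  have l: "0 \<le> l" "l < r" "g l = 0" "g r = 0" "\<And>t. l < t \<Longrightarrow> t < r \<Longrightarrow> g t < 0"
    using e by (auto simp: neg_excursion_def)
  show neg: "w u < 0" if u: "ci l < u" "u < ci r" for u
  proof -
    have u0: "u \<ge> 0" using u ci(1)[of l] l by linarith
    have "l < cl u" "cl u < r"
      using clock_less_iff[of "ci l" u] clock_less_iff[of u "ci r"] u u0 ci l by auto
    from l(5)[OF this] show ?thesis using u0 ci by (simp add: g_eq)
  qed
  show "w (ci l) = 0" "w (ci r) = 0" using l by (auto simp: g_eq)
  have *: "t - s = (ci t - ci s) / \<sigma>m\<^sup>2" if "l \<le> s" "s \<le> t" "t \<le> r" for s t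
  proof -
    have st: "ci s \<le> ci t" "ci l \<le> ci s" "ci t \<le> ci r"
      using ci_less_iff[of t s] ci_less_iff[of s l] ci_less_iff[of r t] that l by force+
    have "cl (ci t) - cl (ci s) = (ci t - ci s) / \<sigma>m\<^sup>2"
      by (rule clock_neg) (use st that l ci(1)[of s] neg in auto)
    then show ?thesis using ci that l by simp
  qed
  show "ci t = ci t0 + \<sigma>m\<^sup>2 * (t - t0)" if t: "l \<le> t" "t \<le> r" for t
  proof (cases "t0 \<le> t")
    case True
    then show ?thesis using *[of t0 t] t0 t sm by (simp add: field_simps)
  next
    case False
    then have "t0 - t = (ci t0 - ci t) / \<sigma>m\<^sup>2" using *[of t t0] t0 t by simp
    then show ?thesis using sm by (simp add: field_simps)
  qed
qed

end

lemma g_0: "g 0 = 0"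
proof (cases "bij_betw cl {0..} {0..}")
  case True
  then show ?thesis using ci(3)[OF True, of 0] clock_0 w0 by (simp add: g_eq[OF True])
qed (simp add: time_changed_def)

lemma g_continuous: "continuous_on {0..} g"
proof (cases "bij_betw cl {0..} {0..}")
  case True
  have "continuous_on {0..} (\<lambda>t. w (ci t))"
    by (rule continuous_on_compose2[OF w ci_continuous[OF True]]) (use ci(1)[OF True] in auto)
  then show ?thesis by (simp add: g_eq[OF True])
next
  case False
  then have "g = (\<lambda>_. 0)" by (auto simp: time_changed_def)
  then show ?thesis by simp
qed

end

section \<open>The planar path after time \<open>t0\<close>\<close>

lemma (in prob_space) measurable_clock_past:
  assumes W: "brownian_motion M 1 W" and u: "0 \<le> u" "u \<le> T"
  shows "(\<lambda>\<omega>. clock \<sigma>p \<sigma>m (\<lambda>s. c * W s \<omega>) u) \<in> borel_measurable (past_algebra M W T)"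
proof -
  note D = brownian_motionD[OF W]
  let ?N = "past_algebra M W T"
  have V [measurable]: "(\<lambda>p. W (min (max 0 (snd p)) T) (fst p)) \<in> borel_measurable (?N \<Otimes>\<^sub>M lborel)"
  proof (rule measurable_continuous_process[where N = ?N and W = "\<lambda>u. W (min u T)"
      and f = "\<lambda>p. max 0 (snd p)" and g = fst])
    show "W (min u T) \<in> borel_measurable ?N" if "u \<ge> 0" for u
      using that u by (intro measurable_past_algebra) auto
    show "continuous_on {0..} (\<lambda>u. W (min u T) \<omega>)" if "\<omega> \<in> space ?N" for \<omega>
      by (rule continuous_on_compose2[OF D(3)]) (use that u in \<open>auto intro!: continuous_intros\<close>)
  qed auto
  have occ: "(\<integral>s. indicator {0..u} s *\<^sub>R indicator {s. P (c * W s \<omega>)} s \<partial>lborel) =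
      (\<integral>s. (if 0 \<le> s \<and> s \<le> u \<and> P (c * W (min (max 0 s) T) \<omega>) then 1 else 0) \<partial>lborel)"
          for P :: "real \<Rightarrow> bool" and \<omega>
    by (intro Bochner_Integration.integral_cong) (use u in \<open>auto simp: indicator_def min_def
        max_def\<close>)
  have "(\<lambda>\<omega>. \<integral>s. (if 0 \<le> s \<and> s \<le> u \<and>
      c * W (min (max 0 s) T) \<omega> > 0 then 1 else 0 :: real) \<partial>lborel) \<in> borel_measurable ?N"
    by (rule lborel.borel_measurable_lebesgue_integral) (simp add: split_beta')
  moreover have "(\<lambda>\<omega>. \<integral>s. (if 0 \<le> s \<and> s \<le> u \<and> c * W (min (max 0 s) T) \<omega> <
      0 then 1 else 0 :: real) \<partial>lborel) \<in> borel_measurable ?N"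
    by (rule lborel.borel_measurable_lebesgue_integral) (simp add: split_beta')
  ultimately show ?thesis
    unfolding clock_def occ_pos_def occ_neg_def set_lebesgue_integral_def occ[of "\<lambda>x. x > 0"] occ[of
        "\<lambda>x. x < 0"]
    by measurable
qed

definition last_zero :: "(real \<Rightarrow> real) \<Rightarrow> real \<Rightarrow> real" where
  "last_zero w T = Sup {u \<in> {0..T}. w u = 0}"

lemma last_zero_less_iff:
  assumes w: "continuous_on {0..} w" "w 0 = 0" and T: "0 \<le> T"
  shows "last_zero w T < x \<longleftrightarrow> 0 < x \<and> \<not> (\<exists>u\<in>{x..T}. w u = 0)"
proof -
  let ?Z = "{u \<in> {0..T}. w u = 0}"
  have "continuous_on {0..T} w" using w(1) by (rule continuous_on_subset) auto
  then have "closed ?Z" using continuous_closed_preimage[of "{0..T}" w "{0}"]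
    by (simp add: vimage_def Int_def)
  moreover have "?Z \<noteq> {}" using w T by auto
  moreover have bdd: "bdd_above ?Z" by (rule bdd_aboveI[of _ T]) auto
  ultimately have "Sup ?Z \<in> ?Z" by (intro closed_contains_Sup)
  then have mem: "0 \<le> last_zero w T" "last_zero w T \<le> T" "w (last_zero w T) = 0"
    by (auto simp: last_zero_def)
  have up: "u \<le> last_zero w T" if "0 \<le> u" "u \<le> T" "w u = 0" for u
    unfolding last_zero_def using that bdd by (intro cSup_upper) auto
  show ?thesis
  proof
    assume less: "last_zero w T < x"
    have False if "x \<le> u" "u \<le> T" "w u = 0" for u using up[of u] that less mem(1) by linarith
    then show "0 < x \<and> \<not> (\<exists>u\<in>{x..T}. w u = 0)" using less mem(1) by auto
  next
    assume "0 < x \<and> \<not> (\<exists>u\<in>{x..T}. w u = 0)"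
    then show "last_zero w T < x" using mem by force
  qed
qed

lemma last_zero_bounds:
  assumes w: "continuous_on {0..} w" "w 0 = 0" and T: "0 \<le> T"
  shows "0 \<le> last_zero w T" "last_zero w T \<le> T"
proof -
  show "0 \<le> last_zero w T" using last_zero_less_iff[OF w T, of 0] by simp
  show "last_zero w T \<le> T"
  proof (rule dense_ge)
    fix x assume "T < x"
    then show "last_zero w T \<le> x" using last_zero_less_iff[OF w T, of x] T by auto
  qed
qed

lemma last_zero_eq:
  assumes "0 \<le> a" "a \<le> T" "w a = 0" "\<And>u. a < u \<Longrightarrow> u \<le> T \<Longrightarrow> w u \<noteq> 0"
  shows "last_zero w T = a"
  unfolding last_zero_def by (rule cSup_eq_maximum) (use assms in \<open>auto simp: not_le[symmetric]\<close>)

lemma (in prob_space) measurable_last_zero_past: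
  assumes W: "brownian_motion M 1 W" and T: "0 \<le> T"
  shows "(\<lambda>\<omega>. last_zero (\<lambda>s. W s \<omega>) T) \<in> borel_measurable (past_algebra M W T)"
proof (rule borel_measurableI_less)
  note D = brownian_motionD[OF W]
  let ?N = "past_algebra M W T"
  fix x
  have "{\<omega> \<in> space ?N. last_zero (\<lambda>s. W s \<omega>) T < x} =
    {\<omega> \<in> space ?N. 0 < x \<and> \<not> (\<exists>u\<in>{x..T}. W u \<omega> = 0)}"
    using last_zero_less_iff[OF D(3) D(2) T] by auto
  also have "\<dots> \<in> sets ?N"
  proof (cases "0 < x \<and> x \<le> T")
    case True
    have c: "continuous_on {x..T} (\<lambda>u. W u \<omega>)" if "\<omega> \<in> space M" for \<omega>
      by (rule continuous_on_subset[OF D(3)[OF that]]) (use True in auto)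
    have "{\<omega> \<in> space ?N. 0 < x \<and> \<not> (\<exists>u\<in>{x..T}. W u \<omega> = 0)} =
      {\<omega> \<in> space ?N. \<not> (\<forall>n::nat. \<exists>q\<in>{0..1} \<inter> \<rat>. \<bar>W (x + (T - x) * q) \<omega>\<bar> < 1 / (real n + 1))}"
    proof (intro Collect_cong conj_cong refl)
      fix \<omega> assume "\<omega> \<in> space ?N"
      then show "(0 < x \<and> \<not> (\<exists>u\<in>{x..T}. W u \<omega> = 0)) =
        (\<not> (\<forall>n::nat. \<exists>q\<in>{0..1} \<inter> \<rat>. \<bar>W (x + (T - x) * q) \<omega>\<bar> < 1 / (real n + 1)))"
        using continuous_zero_iff[OF c, of \<omega>] True by simp
    qed
    also have "\<dots> \<in> sets ?N"
    proof (intro sets.sets_Collect_neg sets.sets_Collect_countable_All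
        sets.sets_Collect_countable_Ex')
      show "countable ({0..1} \<inter> \<rat> :: real set)" using countable_rat by auto
      fix n :: nat and q :: real assume q: "q \<in> {0..1} \<inter> \<rat>"
      have "(T - x) * q \<le> (T - x) * 1" using True q by (intro mult_left_mono) auto
      then have "W (x + (T - x) * q) \<in> borel_measurable ?N"
        using True q by (intro measurable_past_algebra) auto
      then show "{\<omega> \<in> space ?N. \<bar>W (x + (T - x) * q) \<omega>\<bar> < 1 / (real n + 1)} \<in> sets ?N"
        by (intro borel_measurable_less borel_measurable_abs) auto
    qed
    finally show ?thesis .
  next
    case False
    then consider "x \<le> 0" | "x > T" "x > 0" by linarith
    then show ?thesis using sets.top[of ?N] by cases auto
  qed
  finally show "{\<omega> \<in> space ?N. last_zero (\<lambda>s. W s \<omega>) T < x} \<in> sets ?N" .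
qed

text \<open>
  The process \<open>G\<close> and the normalised fluctuation \<open>C k\<close> live on the two factors of \<open>M \<Otimes>\<^sub>M M\<close>.
  The walk \<open>W m\<close> starts at the dyadic time \<open>jmp m\<close> of \<open>B\<close>, just after \<open>B\<close> has consumed the
  real time \<open>t0\<close>; the first component of \<open>start m\<close> is the age of the excursion of \<open>B\<close> at that time.
  The bound \<open>j = 4^m\<close> only makes \<open>jmp m\<close> well defined on every path.
\<close>

locale planar_setup = prob_space M for M :: "'a measure" +
  fixes \<sigma>p \<sigma>m :: real and B :: "real \<Rightarrow> 'a \<Rightarrow> real" and C :: "nat \<Rightarrow> real \<Rightarrow> 'a \<Rightarrow> real"
    and \<kappa> t0 :: real and kx :: "'a \<Rightarrow> nat"
  assumes \<sigma>p: "\<sigma>p > 0" and \<sigma>m: "\<sigma>m > 0" and B: "brownian_motion M 1 B"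
    and C: "\<And>k. brownian_motion M 1 (C k)" and t0: "t0 > 0"
    and kx [measurable]: "kx \<in> measurable M (count_space UNIV)"
begin

sublocale MM: pair_prob_space M M ..

lemma minus_B: "brownian_motion M 1 (\<lambda>u \<omega>. - B u \<omega>)"
  using brownian_motion_scale[OF B, of "-1" 1] by simp

definition jmp :: "nat \<Rightarrow> 'a \<Rightarrow> nat" where
  "jmp m \<omega> = (LEAST j. t0 < clock \<sigma>p \<sigma>m (\<lambda>s. B s \<omega>) (real j * (1/2)^m) \<or> j = 4^m)"

definition start :: "nat \<Rightarrow> nat \<Rightarrow> 'a \<Rightarrow> real \<times> real" where
  "start m j \<omega> = (real j * (1/2)^m - last_zero (\<lambda>s. - B s \<omega>) (real j * (1/2)^m), - B (real j *
      (1/2)^m) \<omega>)"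

definition W :: "nat \<Rightarrow> nat \<Rightarrow> 'a \<times> 'a \<Rightarrow> complex" where
  "W m i p = Complex (\<kappa> + C (kx (fst p)) (fst (start m (jmp m (fst p)) (fst p)) +
      real i * (1/2)^m) (snd p))
     (- B (real (jmp m (fst p)) * (1/2)^m + real i * (1/2)^m) (fst p))"

lemma start_measurable:
  "start m j \<in> measurable (past_algebra M (\<lambda>u \<omega>. - B u \<omega>) (real j * (1/2)^m)) (borel \<Otimes>\<^sub>M borel)"
proof -
  have [measurable]: "(\<lambda>\<omega>. last_zero (\<lambda>s. - B s \<omega>) (real j * (1/2)^m)) \<in> borel_measurable
      (past_algebra M (\<lambda>u \<omega>. - B u \<omega>) (real j * (1/2)^m))"
    by (rule measurable_last_zero_past[OF minus_B]) simp
  have [measurable]: "(\<lambda>\<omega>. - B (real j * (1/2)^m) \<omega>) \<in> borel_measurable (past_algebra M (\<lambda>u \<omega>. - B u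
      \<omega>) (real j * (1/2)^m))"
    using measurable_past_algebra[of "real j * (1/2)^m" "real j * (1/2)^m" "\<lambda>u \<omega>. - B u \<omega>" M]
      by simp
  show ?thesis unfolding start_def[abs_def] by (intro measurable_Pair) measurable
qed

lemma jmp_measurable:
  "{\<omega> \<in> space M. jmp m \<omega> = j} \<in> sets (past_algebra M (\<lambda>u \<omega>. - B u \<omega>) (real j * (1/2)^m))"
proof -
  let ?N = "past_algebra M (\<lambda>u \<omega>. - B u \<omega>) (real j * (1/2)^m)"
  define P where "P \<omega> i \<longleftrightarrow> t0 < clock \<sigma>p \<sigma>m (\<lambda>s. B s \<omega>) (real i * (1/2)^m) \<or> i = 4^m" for \<omega> i
  have PN: "{\<omega> \<in> space ?N. P \<omega> i} \<in> sets ?N" if "i \<le> j" for i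
  proof -
    have "(\<lambda>\<omega>. clock \<sigma>p \<sigma>m (\<lambda>s. (- 1) * - B s \<omega>) (real i * (1/2)^m)) \<in> borel_measurable ?N"
      by (rule measurable_clock_past[OF minus_B]) (use that in \<open>auto intro!: mult_right_mono\<close>)
    then have [measurable]: "(\<lambda>\<omega>. clock \<sigma>p \<sigma>m (\<lambda>s. B s \<omega>) (real i * (1/2)^m)) \<in> borel_measurable ?N"
      by simp
    show ?thesis unfolding P_def by measurable
  qed
  have "jmp m \<omega> = j \<longleftrightarrow> P \<omega> j \<and> (\<forall>i\<in>{..<j}. \<not> P \<omega> i)" for \<omega>
  proof
    have "P \<omega> (4^m)" by (simp add: P_def)
    then have "P \<omega> (jmp m \<omega>)" unfolding jmp_def P_def[symmetric] by (rule LeastI)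
    then show "jmp m \<omega> = j \<Longrightarrow> P \<omega> j \<and> (\<forall>i\<in>{..<j}. \<not> P \<omega> i)"
      using not_less_Least[of _ "P \<omega>"] unfolding jmp_def P_def[symmetric] by blast
    show "P \<omega> j \<and> (\<forall>i\<in>{..<j}. \<not> P \<omega> i) \<Longrightarrow> jmp m \<omega> = j"
      unfolding jmp_def P_def[symmetric]
        by (rule Least_equality) (blast, metis lessThan_iff not_less)
  qed
  then have "{\<omega> \<in> space M. jmp m \<omega> = j} = {\<omega> \<in> space ?N. P \<omega> j \<and> (\<forall>i\<in>{..<j}. \<not> P \<omega> i)}" by auto
  also have "\<dots> \<in> sets ?N"
    by (intro sets.sets_Collect_conj PN sets.sets_Collect_finite_All sets.sets_Collect_neg) auto
  finally show ?thesis .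
qed

lemma past_indep: "0 \<le> t \<Longrightarrow> \<delta> > 0 \<Longrightarrow> brownian_motion M 1 X \<Longrightarrow>
    indep_rv M (past_algebra M X t) (\<lambda>\<omega>. \<omega>) (PiM UNIV (\<lambda>_. borel)) (increments X t \<delta>)"
  unfolding past_algebra_def by (rule indep_rv_vimage_algebra[OF indep_rv_past_increments])

lemma distr_brownian_eq:
  assumes X: "brownian_motion M 1 X" and Y: "brownian_motion M 1 Y" and s: "s \<ge> 0"
  shows "distr M borel (X s) = distr M borel (Y s)"
proof (cases "s = 0")
  case True
  then show ?thesis using brownian_motionD(2)[OF X] brownian_motionD(2)[OF Y]
    by (intro distr_cong) auto
next
  case False
  have "distr M borel (Z s) = density lborel (\<lambda>x. ennreal (normal_density 0 (sqrt s) x))"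
      if Z: "brownian_motion M 1 Z" for Z
  proof -
    have d: "distributed M lborel (\<lambda>\<omega>. Z s \<omega> - Z 0 \<omega>) (normal_density 0 (sqrt (1 * (s - 0))))"
      using False s by (intro brownian_motionD(4)[OF Z]) auto
    have "distr M borel (Z s) = distr M lborel (\<lambda>\<omega>. Z s \<omega> - Z 0 \<omega>)"
      using brownian_motionD(2)[OF Z] by (intro distr_cong) auto
    then show ?thesis using distributed_distr_eq_density[OF d] by simp
  qed
  then show ?thesis using X Y by simp
qed

lemma start_nonneg: "\<omega> \<in> space M \<Longrightarrow> fst (start m j \<omega>) \<ge> 0"
  unfolding start_def using last_zero_bounds(2)[OF brownian_motionD(3,2)[OF minus_B], of \<omega>
      "real j * (1/2)^m"] by simp

lemma C_joint:
  assumes [measurable]: "g \<in> borel_measurable K" "h \<in> measurable K M"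
  shows "(\<lambda>x. C k (max 0 (g x)) (h x)) \<in> borel_measurable K"
  by (rule measurable_continuous_process[where N = M, OF brownian_motionD(1,3)[OF C]]) auto

lemma B_joint:
  assumes [measurable]: "g \<in> borel_measurable K" "h \<in> measurable K M"
  shows "(\<lambda>x. B (max 0 (g x)) (h x)) \<in> borel_measurable K"
  by (rule measurable_continuous_process[where N = M, OF brownian_motionD(1,3)[OF B]]) auto

lemma past_id: "0 \<le> t \<Longrightarrow> brownian_motion M 1 X \<Longrightarrow> (\<lambda>\<omega>. \<omega>) \<in> measurable M (past_algebra M X t)"
  using past_indep[of t 1 X] by (auto simp: indep_rv_def)

lemma jmp_measurable_M [measurable]: "jmp m \<in> measurable M (count_space UNIV)"
proof -
  have "{\<omega> \<in> space M. jmp m \<omega> = j} \<in> sets M" for j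
  proof -
    have "(\<lambda>\<omega>. \<omega>) -` {\<omega> \<in> space M. jmp m \<omega> = j} \<inter> space M = {\<omega> \<in> space M. jmp m \<omega> = j}" by auto
    with measurable_sets[OF past_id[OF _ minus_B] jmp_measurable, of j m] show ?thesis by simp
  qed
  then show ?thesis by (auto simp: measurable_count_space_eq2_countable vimage_def Int_def
      conj_commute)
qed

lemma start_measurable_M [measurable]: "(\<lambda>\<omega>. start m (jmp m \<omega>) \<omega>) \<in> measurable M (borel \<Otimes>\<^sub>M borel)"
proof -
  have "start m j \<in> measurable M (borel \<Otimes>\<^sub>M borel)" for j
    using measurable_compose[OF past_id[OF _ minus_B] start_measurable, of j m] by simp
  then show ?thesis by (rule measurable_compose_countable[where f = "start m"]) measurable
qed

lemma W_eq: "p \<in> space (M \<Otimes>\<^sub>M M) \<Longrightarrow> W m i p =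
    Complex (\<kappa> + C (kx (fst p)) (max 0 (fst (start m (jmp m (fst p)) (fst p)) +
        real i * (1/2)^m)) (snd p))
     (- B (max 0 (real (jmp m (fst p)) * (1/2)^m + real i * (1/2)^m)) (fst p))"
  using start_nonneg[of "fst p" m "jmp m (fst p)"] by (auto simp: W_def space_pair_measure max_def)

lemma W_measurable [measurable]: "W m i \<in> borel_measurable (M \<Otimes>\<^sub>M M)"
proof -
  have c: "(\<lambda>p. C (kx (fst p)) (max 0 (fst (start m (jmp m (fst p)) (fst p)) +
      real i * (1/2)^m)) (snd p)) \<in> borel_measurable (M \<Otimes>\<^sub>M M)"
    by (rule measurable_compose_countable[where g = "\<lambda>p. kx (fst p)" and
          f = "\<lambda>k p. C k (max 0 (fst (start m (jmp m (fst p)) (fst p)) +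
              real i * (1/2)^m)) (snd p)"])
       (auto intro!: C_joint)
  have b: "(\<lambda>p. B (max 0 (real (jmp m (fst p)) * (1/2)^m +
      real i * (1/2)^m)) (fst p)) \<in> borel_measurable (M \<Otimes>\<^sub>M M)"
    by (intro B_joint) measurable
  have "(\<lambda>p. Complex (\<kappa> + C (kx (fst p)) (max 0 (fst (start m (jmp m (fst p)) (fst p)) +
      real i * (1/2)^m)) (snd p))
     (- B (max 0 (real (jmp m (fst p)) * (1/2)^m +
         real i * (1/2)^m)) (fst p))) \<in> borel_measurable (M \<Otimes>\<^sub>M M)"
    using c b by measurable
  then show ?thesis by (subst measurable_cong[OF W_eq]) auto
qed

lemma measurable_into_seq:
  assumes "\<And>i. (\<lambda>x. g x i) \<in> borel_measurable K"
  shows "g \<in> measurable K (PiM (UNIV :: nat set) (\<lambda>_. borel :: real measure))"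
proof -
  have "(\<lambda>x. \<lambda>i\<in>UNIV. g x i) \<in> measurable K (PiM UNIV (\<lambda>_. borel))"
    by (rule measurable_restrict) (rule assms)
  then show ?thesis by (simp add: restrict_def)
qed

lemma W_law:
  assumes f [measurable]: "f \<in> borel_measurable (borel \<Otimes>\<^sub>M (PiM UNIV (\<lambda>_. borel) \<Otimes>\<^sub>M PiM UNIV (\<lambda>_.
      borel)))"
  shows "(\<integral>\<^sup>+p. f (W m 0 p, ((\<lambda>i. Re (W m (Suc i) p - W m i p)), (\<lambda>i. Im (W m (Suc i) p - W m i
      p)))) \<partial>(M \<Otimes>\<^sub>M M)) =
      (\<integral>\<^sup>+p. (\<integral>\<^sup>+z. f (W m 0 p, z) \<partial>(noise (sqrt ((1/2)^m)) \<Otimes>\<^sub>M noise (sqrt ((1/2)^m)))) \<partial>(M \<Otimes>\<^sub>M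
          M))"
proof -
  define \<delta> :: real where "\<delta> = (1/2)^m"
  have \<delta>: "\<delta> > 0" by (simp add: \<delta>_def)
  let ?T = "PiM (UNIV :: nat set) (\<lambda>_. borel :: real measure)" and ?S = "noise (sqrt \<delta>)"
  interpret S: prob_space ?S by (rule prob_space_noise) (use \<delta> in simp)
  interpret SS: pair_prob_space ?S ?S ..
  interpret SM: pair_prob_space ?S M ..
  interpret MS: pair_prob_space M ?S ..
  define Y where "Y u \<omega> = - B u \<omega>" for u \<omega>
  have Y: "brownian_motion M 1 Y" using minus_B by (simp add: Y_def[abs_def])
  define \<Psi> where "\<Psi> x = (\<integral>\<^sup>+\<omega>'. (\<integral>\<^sup>+\<xi>. f (Complex (\<kappa> +
      C 0 (max 0 (fst (fst x))) \<omega>') (snd (fst x)), (\<xi>, snd x)) \<partial>?S) \<partial>M)"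
    for x :: "(real \<times> real) \<times> (nat \<Rightarrow> real)"
  have Cm [measurable]: "(\<lambda>x. C 0 (max 0 (fst (fst (fst x)))) (snd x)) \<in> borel_measurable (((borel
      \<Otimes>\<^sub>M borel) \<Otimes>\<^sub>M ?T) \<Otimes>\<^sub>M M)"
    by (intro C_joint) measurable
  have \<Psi>m: "\<Psi> \<in> borel_measurable ((borel \<Otimes>\<^sub>M borel) \<Otimes>\<^sub>M ?T)" unfolding \<Psi>_def by measurable
  have inner: "(\<integral>\<^sup>+\<omega>'. f (Complex (\<kappa> + C k s \<omega>') y, (increments (C k) s \<delta> \<omega>', \<eta>)) \<partial>M) =
      \<Psi> ((s, y), \<eta>)"
    if s: "s \<ge> 0" for k s y \<eta>
  proof -
    let ?N = "past_algebra M (C k) s"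
    have Ck [measurable]: "C k s \<in> borel_measurable ?N"
      by (rule measurable_past_algebra) (use s in auto)
    have CkM [measurable]: "C k s \<in> borel_measurable M" "C 0 s \<in> borel_measurable M"
      using brownian_motionD(1)[OF C s] by auto
    have incC [measurable]: "increments (C k) s \<delta> \<in> measurable M ?T"
      using indep_rv_past_increments[OF C s \<delta>] by (auto simp: indep_rv_def)
    have \<eta> [measurable]: "\<eta> \<in> space ?T" by (simp add: space_PiM)
    have "(\<integral>\<^sup>+\<omega>'. f (Complex (\<kappa> + C k s \<omega>') y, (increments (C k) s \<delta> \<omega>', \<eta>)) \<partial>M) =
      (\<integral>\<^sup>+\<omega>'. (\<integral>\<^sup>+\<omega>''. f (Complex (\<kappa> + C k s \<omega>') y, (increments (C k) s \<delta> \<omega>'', \<eta>)) \<partial>M) \<partial>M)"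
      using indep_rv_nn_integral[OF past_indep[OF s \<delta> C], of "\<lambda>p. f (Complex (\<kappa> +
          C k s (fst p)) y, (snd p, \<eta>))" k] by simp
    also have "\<dots> = (\<integral>\<^sup>+\<omega>'. (\<integral>\<^sup>+\<xi>. f (Complex (\<kappa> + C k s \<omega>') y, (\<xi>, \<eta>)) \<partial>?S) \<partial>M)"
      unfolding distr_increments[OF C s \<delta>, of k, symmetric] by (subst nn_integral_distr) auto
    also have "\<dots> = (\<integral>\<^sup>+c. (\<integral>\<^sup>+\<xi>. f (Complex (\<kappa> + c) y, (\<xi>, \<eta>)) \<partial>?S) \<partial>distr M borel (C k s))"
      by (subst nn_integral_distr) auto
    also have "\<dots> = (\<integral>\<^sup>+\<omega>'. (\<integral>\<^sup>+\<xi>. f (Complex (\<kappa> + C 0 s \<omega>') y, (\<xi>, \<eta>)) \<partial>?S) \<partial>M)"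
      unfolding distr_brownian_eq[OF C C s, of k 0] by (subst nn_integral_distr) auto
    finally show ?thesis using s by (simp add: \<Psi>_def max_def)
  qed
  define X where "X \<omega> = start m (jmp m \<omega>) \<omega>" for \<omega>
  define \<eta> where "\<eta> \<omega> = increments Y (real (jmp m \<omega>) * \<delta>) \<delta> \<omega>" for \<omega>
  have X0: "fst (X \<omega>) \<ge> 0" if "\<omega> \<in> space M" for \<omega> using start_nonneg[OF that] by (simp add: X_def)
  have Xm [measurable]: "X \<in> measurable M (borel \<Otimes>\<^sub>M borel)" unfolding X_def[abs_def] by measurable
  have W0: "W m 0 (\<omega>, \<omega>') = Complex (\<kappa> + C (kx \<omega>) (fst (X \<omega>)) \<omega>') (snd (X \<omega>))" for \<omega> \<omega>'
    by (simp add: W_def X_def start_def)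
  have Re: "(\<lambda>i. Re (W m (Suc i) (\<omega>, \<omega>') - W m i (\<omega>, \<omega>'))) = increments (C (kx \<omega>)) (fst (X \<omega>)) \<delta> \<omega>'"
      for \<omega> \<omega>'
    by (auto simp: W_def X_def increments_def \<delta>_def algebra_simps)
  have Im: "(\<lambda>i. Im (W m (Suc i) (\<omega>, \<omega>') - W m i (\<omega>, \<omega>'))) = \<eta> \<omega>" for \<omega> \<omega>'
    by (auto simp: W_def \<eta>_def Y_def increments_def \<delta>_def algebra_simps)
  have [measurable]: "(\<lambda>p i. Re (W m (Suc i) p - W m i p)) \<in> measurable (M \<Otimes>\<^sub>M M) ?T"
    "(\<lambda>p i. Im (W m (Suc i) p - W m i p)) \<in> measurable (M \<Otimes>\<^sub>M M) ?T"
    by (intro measurable_into_seq; measurable)+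
  have "(\<integral>\<^sup>+p. f (W m 0 p, ((\<lambda>i. Re (W m (Suc i) p - W m i p)), (\<lambda>i. Im (W m (Suc i) p - W m i p))))
      \<partial>(M \<Otimes>\<^sub>M M)) =
    (\<integral>\<^sup>+\<omega>. (\<integral>\<^sup>+\<omega>'. f (W m 0 (\<omega>, \<omega>'), ((\<lambda>i. Re (W m (Suc i) (\<omega>, \<omega>') - W m i (\<omega>, \<omega>'))),
       (\<lambda>i. Im (W m (Suc i) (\<omega>, \<omega>') - W m i (\<omega>, \<omega>'))))) \<partial>M) \<partial>M)"
    by (rule nn_integral_fst[symmetric]) measurable
  also have "\<dots> = (\<integral>\<^sup>+\<omega>. \<Psi> (X \<omega>, \<eta> \<omega>) \<partial>M)"
    unfolding W0 Re Im
  proof (intro nn_integral_cong)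
    fix \<omega> assume "\<omega> \<in> space M"
    from inner[OF X0[OF this], of "kx \<omega>" "snd (X \<omega>)" "\<eta> \<omega>"]
    show "(\<integral>\<^sup>+\<omega>'. f (Complex (\<kappa> + C (kx \<omega>) (fst (X \<omega>)) \<omega>') (snd (X \<omega>)),
        (increments (C (kx \<omega>)) (fst (X \<omega>)) \<delta> \<omega>', \<eta> \<omega>)) \<partial>M) = \<Psi> (X \<omega>, \<eta> \<omega>)" by simp
  qed
  also have "\<dots> = (\<integral>\<^sup>+\<omega>. (\<integral>\<^sup>+z. \<Psi> (X \<omega>, z) \<partial>?S) \<partial>M)"
    unfolding X_def \<eta>_def
  proof (rule random_index_indep[where N = "\<lambda>j. past_algebra M Y (real j * \<delta>)"
      and Z = "\<lambda>j. increments Y (real j * \<delta>) \<delta>" and X = "start m"])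
    show "indep_rv M (past_algebra M Y (real j * \<delta>)) (\<lambda>\<omega>. \<omega>) ?T (increments Y (real j * \<delta>) \<delta>)" for j
      by (rule past_indep[OF _ \<delta> Y]) (use \<delta> in simp)
    show "{\<omega> \<in> space M. jmp m \<omega> = j} \<in> sets (past_algebra M Y (real j * \<delta>))" for j
      using jmp_measurable[of m j] by (simp add: Y_def[abs_def] \<delta>_def)
    show "start m j \<in> measurable (past_algebra M Y (real j * \<delta>)) (borel \<Otimes>\<^sub>M borel)" for j
      using start_measurable[of m j] by (simp add: Y_def[abs_def] \<delta>_def)
    show "distr M ?T (increments Y (real j * \<delta>) \<delta>) = ?S" for j
      by (rule distr_increments[OF Y _ \<delta>]) (use \<delta> in simp)
  qed (rule \<Psi>m)
  also have "\<dots> = (\<integral>\<^sup>+\<omega>. (\<integral>\<^sup>+\<omega>'. (\<integral>\<^sup>+z. f (W m 0 (\<omega>, \<omega>'), z) \<partial>(?S \<Otimes>\<^sub>M ?S)) \<partial>M) \<partial>M)"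
  proof (intro nn_integral_cong)
    fix \<omega> assume \<omega>: "\<omega> \<in> space M"
    define s y where "s = fst (X \<omega>)" and "y = snd (X \<omega>)"
    have s: "s \<ge> 0" using X0[OF \<omega>] by (simp add: s_def)
    have [measurable]: "C k s \<in> borel_measurable M" for k using brownian_motionD(1)[OF C s] .
    have "(\<integral>\<^sup>+z. \<Psi> (X \<omega>, z) \<partial>?S) =
      (\<integral>\<^sup>+\<eta>. (\<integral>\<^sup>+\<omega>'. (\<integral>\<^sup>+\<xi>. f (Complex (\<kappa> + C 0 s \<omega>') y, (\<xi>, \<eta>)) \<partial>?S) \<partial>M) \<partial>?S)"
      using s by (simp add: \<Psi>_def s_def y_def max_def)
    also have "\<dots> = (\<integral>\<^sup>+\<omega>'. (\<integral>\<^sup>+\<eta>. (\<integral>\<^sup>+\<xi>. f (Complex (\<kappa> + C 0 s \<omega>') y, (\<xi>, \<eta>)) \<partial>?S) \<partial>?S) \<partial>M)"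
      by (rule MS.Fubini') measurable
    also have "\<dots> = (\<integral>\<^sup>+\<omega>'. (\<integral>\<^sup>+z. f (Complex (\<kappa> + C 0 s \<omega>') y, z) \<partial>(?S \<Otimes>\<^sub>M ?S)) \<partial>M)"
      by (intro nn_integral_cong, subst SS.nn_integral_snd[symmetric]) (auto simp: split_beta')
    also have "\<dots> = (\<integral>\<^sup>+c. (\<integral>\<^sup>+z. f (Complex (\<kappa> + c) y, z) \<partial>(?S \<Otimes>\<^sub>M ?S)) \<partial>distr M borel (C 0 s))"
      by (subst nn_integral_distr) auto
    also have "\<dots> = (\<integral>\<^sup>+\<omega>'. (\<integral>\<^sup>+z. f (Complex (\<kappa> + C (kx \<omega>) s \<omega>') y, z) \<partial>(?S \<Otimes>\<^sub>M ?S)) \<partial>M)"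
      unfolding distr_brownian_eq[OF C C s, of 0 "kx \<omega>"] by (subst nn_integral_distr) auto
    finally show "(\<integral>\<^sup>+z. \<Psi> (X \<omega>, z) \<partial>?S) = (\<integral>\<^sup>+\<omega>'. (\<integral>\<^sup>+z. f (W m 0 (\<omega>, \<omega>'), z) \<partial>(?S \<Otimes>\<^sub>M ?S)) \<partial>M)"
      by (simp add: W0 s_def y_def)
  qed
  also have "\<dots> = (\<integral>\<^sup>+p. (\<integral>\<^sup>+z. f (W m 0 p, z) \<partial>(?S \<Otimes>\<^sub>M ?S)) \<partial>(M \<Otimes>\<^sub>M M))"
    by (subst nn_integral_fst[symmetric]) auto
  finally show ?thesis unfolding \<delta>_def .
qed

end

lemma Im_Ln_eq_arctan:
  assumes "Re z > 0"
  shows "Im (Ln z) = arctan (Im z / Re z)"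
  using assms by (metis Arg_eq_Im_Ln arg_conv_arctan order_less_irrefl zero_complex.simps(1))

lemma first_zero:
  fixes f :: "real \<Rightarrow> real"
  assumes f: "continuous_on {0..U} f" and U: "0 \<le> U" and f0: "f 0 > 0" and fU: "f U \<le> 0"
  defines "\<tau> \<equiv> Inf {u \<in> {0..U}. f u = 0}"
  shows "0 < \<tau>" "\<tau> \<le> U" "f \<tau> = 0" "\<And>u. 0 \<le> u \<Longrightarrow> u < \<tau> \<Longrightarrow> f u > 0"
proof -
  let ?Z = "{u \<in> {0..U}. f u = 0}"
  have "closed ?Z" using continuous_closed_preimage[OF f, of "{0}"]
    by (simp add: vimage_def Int_def)
  moreover have bdd: "bdd_below ?Z" by (rule bdd_belowI[of _ 0]) auto
  moreover have "\<exists>x\<ge>0. x \<le> U \<and> f x = 0" by (rule IVT2'[OF fU _ U f]) (use f0 in simp)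
  then have "?Z \<noteq> {}" by auto
  ultimately have "\<tau> \<in> ?Z" unfolding \<tau>_def by (intro closed_contains_Inf)
  then show \<tau>: "\<tau> \<le> U" "f \<tau> = 0" and "0 < \<tau>" using f0 by (auto simp: less_le)
  have low: "\<tau> \<le> u" if "u \<in> ?Z" for u unfolding \<tau>_def by (rule cInf_lower[OF that bdd])
  show "f u > 0" if u: "0 \<le> u" "u < \<tau>" for u
  proof (rule ccontr)
    assume "\<not> f u > 0"
    then have "\<exists>x\<ge>0. x \<le> u \<and> f x = 0"
      using u f0 \<tau> by (intro IVT2') (auto intro: continuous_on_subset[OF f])
    then obtain x where "0 \<le> x" "x \<le> u" "f x = 0" by blast
    then show False using low[of x] u \<tau> by auto
  qed
qed

lemma sets_zero_before:
  fixes z :: "'p \<Rightarrow> real \<Rightarrow> real"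
  assumes z: "\<And>h. h \<in> borel_measurable K \<Longrightarrow> (\<And>p. p \<in> space K \<Longrightarrow> h p \<ge> 0) \<Longrightarrow>
      (\<lambda>p. z p (h p)) \<in> borel_measurable K"
    and cont: "\<And>p. p \<in> space K \<Longrightarrow> continuous_on {0..} (z p)"
    and U [measurable]: "U \<in> borel_measurable K"
  shows "{p \<in> space K. \<exists>u. 0 \<le> u \<and> u < U p \<and> z p u = 0} \<in> sets K"
proof -
  define c where "c n = 1 - 1 / (real n + 2)" for n :: nat
  have c: "0 < c n" "c n < 1" for n by (auto simp: c_def field_simps)
  have "(\<exists>u. 0 \<le> u \<and> u < U p \<and> z p u = 0) \<longleftrightarrow>
    U p > 0 \<and> (\<exists>n. \<forall>k::nat. \<exists>q\<in>{0..1} \<inter> \<rat>. \<bar>z p (max 0 (U p) * c n * q)\<bar> < 1 / (real k + 1))"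
        if p: "p \<in> space K" for p
  proof (cases "U p > 0")
    case True
    have *: "(\<exists>u\<in>{0..U p * c n}. z p u = 0) \<longleftrightarrow> (\<forall>k::nat. \<exists>q\<in>{0..1} \<inter> \<rat>. \<bar>z p (0 +
        (U p * c n - 0) * q)\<bar> < 1 / (real k + 1))" for n
      by (rule continuous_zero_iff) (use True c[of n] in \<open>auto intro: continuous_on_subset[OF
          cont[OF p]]\<close>)
    have "(\<exists>u. 0 \<le> u \<and> u < U p \<and> z p u = 0) \<longleftrightarrow> (\<exists>n. \<exists>u\<in>{0..U p * c n}. z p u = 0)"
    proof
      assume "\<exists>u. 0 \<le> u \<and> u < U p \<and> z p u = 0"
      then obtain u where u: "0 \<le> u" "u < U p" "z p u = 0" by blast
      obtain n :: nat where n: "1 / (1 - u / U p) < real n" using reals_Archimedean2 by blast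
      have "1 - u / U p > 0" using u True by simp
      moreover have "1 / (1 - u / U p) < real n + 2" using n by simp
      ultimately have "1 < (real n + 2) * (1 - u / U p)" by (simp add: divide_less_eq)
      then have "1 / (real n + 2) < 1 - u / U p" by (simp add: divide_less_eq mult.commute)
      then have "u / U p \<le> c n" by (simp add: c_def)
      then have "u \<le> U p * c n" using True by (simp add: divide_le_eq mult.commute)
      then show "\<exists>n. \<exists>u\<in>{0..U p * c n}. z p u = 0" using u by (intro exI[of _ n] bexI[of _ u]) auto
    next
      assume "\<exists>n. \<exists>u\<in>{0..U p * c n}. z p u = 0"
      then obtain n u where u: "0 \<le> u" "u \<le> U p * c n" "z p u = 0" by auto
      moreover have "U p * c n < U p" using True c[of n] by simp
      ultimately show "\<exists>u. 0 \<le> u \<and> u < U p \<and> z p u = 0" by (intro exI[of _ u]) auto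
    qed
    then show ?thesis using * True by simp
  qed auto
  then have "{p \<in> space K. \<exists>u. 0 \<le> u \<and> u < U p \<and> z p u = 0} =
    {p \<in> space K. U p > 0 \<and> (\<exists>n. \<forall>k::nat. \<exists>q\<in>{0..1} \<inter> \<rat>. \<bar>z p (max 0 (U p) * c n * q)\<bar> <
        1 / (real k + 1))}"
    by (intro Collect_cong conj_cong refl)
  also have "\<dots> \<in> sets K"
  proof (intro sets.sets_Collect_conj sets.sets_Collect_countable_All sets.sets_Collect_countable_Ex
      sets.sets_Collect_countable_Ex')
    show "countable ({0..1} \<inter> \<rat> :: real set)" using countable_rat by auto
    fix n k :: nat and q :: real assume q: "q \<in> {0..1} \<inter> \<rat>"
    have "(\<lambda>p. z p (max 0 (U p) * c n * q)) \<in> borel_measurable K"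
      by (rule z) (use q c[of n] in auto)
    then show "{p \<in> space K. \<bar>z p (max 0 (U p) * c n * q)\<bar> < 1 / (real k + 1)} \<in> sets K"
      by (intro borel_measurable_less borel_measurable_abs) auto
  qed measurable
  finally show ?thesis .
qed

lemma two_speed_continuous:
  assumes "brownian_motion M 1 B" "\<sigma>p > 0" "\<sigma>m > 0" "\<omega> \<in> space M"
  shows "continuous_on {0..} (\<lambda>t. two_speed \<sigma>p \<sigma>m B t \<omega>)" "two_speed \<sigma>p \<sigma>m B 0 \<omega> = 0"
proof -
  interpret clock_path \<sigma>p \<sigma>m "\<lambda>s. B s \<omega>"
    by unfold_locales (use assms brownian_motionD(2,3)[OF assms(1)] in auto)
  show "continuous_on {0..} (\<lambda>t. two_speed \<sigma>p \<sigma>m B t \<omega>)" using g_continuous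
    by (simp add: two_speed_eq)
  show "two_speed \<sigma>p \<sigma>m B 0 \<omega> = 0" using g_0 by (simp add: two_speed_eq)
qed

locale planar_exit = planar_setup +
  fixes l r :: "'a \<Rightarrow> real" and q :: real
  assumes q: "q > 0"
    and l [measurable]: "l \<in> borel_measurable M" and r [measurable]: "r \<in> borel_measurable M"
    and G_meas: "\<And>t. t \<ge> 0 \<Longrightarrow> two_speed \<sigma>p \<sigma>m B t \<in> borel_measurable M"
    and exc: "AE \<omega> in M. two_speed \<sigma>p \<sigma>m B t0 \<omega> < 0 \<longrightarrow>
       neg_excursion (\<lambda>t. two_speed \<sigma>p \<sigma>m B t \<omega>) (l \<omega>) (r \<omega>) \<and> l \<omega> < t0 \<and> t0 < r \<omega>"
begin

abbreviation "G \<equiv> two_speed \<sigma>p \<sigma>m B"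

definition age :: "'a \<Rightarrow> real" where "age \<omega> = max 0 (\<sigma>m\<^sup>2 * (t0 - l \<omega>))"

definition life :: "'a \<Rightarrow> real" where "life \<omega> = \<sigma>m\<^sup>2 * (r \<omega> - t0)"

definition zeta :: "'a \<times> 'a \<Rightarrow> real \<Rightarrow> real" where
  "zeta p u = \<kappa> + C (kx (fst p)) (max 0 (age (fst p) + u)) (snd p) + q * G (max 0 (t0 +
      u / \<sigma>m\<^sup>2)) (fst p)"

definition pth :: "'a \<times> 'a \<Rightarrow> real \<Rightarrow> complex" where
  "pth p u = Complex (\<kappa> + C (kx (fst p)) (max 0 (age (fst p) + u)) (snd p)) (- G (max 0 (t0 +
      u / \<sigma>m\<^sup>2)) (fst p))"

definition hits :: "('a \<times> 'a) set" where
  "hits = {p \<in> space (M \<Otimes>\<^sub>M M). \<exists>u. 0 \<le> u \<and> u < life (fst p) \<and> zeta p u = 0}"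

definition exit_point :: "'a \<times> 'a \<Rightarrow> complex" where
  "exit_point p = pth p (Inf {u \<in> {0..life (fst p)}. wedge_dist q (pth p u) = 0})"

lemma age_measurable [measurable]: "age \<in> borel_measurable M"
  and life_measurable [measurable]: "life \<in> borel_measurable M"
  unfolding age_def[abs_def] life_def[abs_def] by measurable

lemma G_joint:
  assumes [measurable]: "g \<in> borel_measurable K" "h \<in> measurable K M"
  shows "(\<lambda>x. G (max 0 (g x)) (h x)) \<in> borel_measurable K"
  by (rule measurable_continuous_process[where N = M, OF G_meas two_speed_continuous(1)[OF B \<sigma>p
      \<sigma>m]]) auto

lemma Ck_joint:
  assumes g [measurable]: "g \<in> borel_measurable (M \<Otimes>\<^sub>M M)"
  shows "(\<lambda>p. C (kx (fst p)) (max 0 (g p)) (snd p)) \<in> borel_measurable (M \<Otimes>\<^sub>M M)"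
proof -
  have "(\<lambda>p. C k (max 0 (g p)) (snd p)) \<in> borel_measurable (M \<Otimes>\<^sub>M M)" for k
    by (intro C_joint g measurable_snd)
  then show ?thesis
    by (rule measurable_compose_countable[where f = "\<lambda>k p. C k (max 0 (g p)) (snd p)"
        and g = "\<lambda>p. kx (fst p)"]) measurable
qed

lemma pth_continuous:
  assumes p: "p \<in> space (M \<Otimes>\<^sub>M M)"
  shows "continuous_on {0..} (pth p)" "continuous_on {0..} (zeta p)"
proof -
  have p': "fst p \<in> space M" "snd p \<in> space M" using p by (auto simp: space_pair_measure)
  have 1: "continuous_on {0..} (\<lambda>u. C (kx (fst p)) (max 0 (age (fst p) + u)) (snd p))"
    by (rule continuous_on_compose2[OF brownian_motionD(3)[OF C p'(2)]]) (auto intro!: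
        continuous_intros)
  have 2: "continuous_on {0..} (\<lambda>u. G (max 0 (t0 + u / \<sigma>m\<^sup>2)) (fst p))"
    by (rule continuous_on_compose2[OF two_speed_continuous(1)[OF B \<sigma>p \<sigma>m p'(1)]])
       (use \<sigma>m in \<open>auto intro!: continuous_intros\<close>)
  show "continuous_on {0..} (pth p)" "continuous_on {0..} (zeta p)"
    unfolding pth_def[abs_def] zeta_def[abs_def] using 1 2 by (auto intro!: continuous_intros)
qed

lemma hits_sets [measurable]: "hits \<in> sets (M \<Otimes>\<^sub>M M)"
  unfolding hits_def
proof (rule sets_zero_before)
  fix h :: "'a \<times> 'a \<Rightarrow> real" assume [measurable]: "h \<in> borel_measurable (M \<Otimes>\<^sub>M M)"
  have [measurable]: "(\<lambda>p. G (max 0 (t0 + h p / \<sigma>m\<^sup>2)) (fst p)) \<in> borel_measurable (M \<Otimes>\<^sub>M M)"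
    by (intro G_joint) measurable
  have [measurable]: "(\<lambda>p. C (kx (fst p)) (max 0 (age (fst p) +
      h p)) (snd p)) \<in> borel_measurable (M \<Otimes>\<^sub>M M)"
    by (intro Ck_joint) measurable
  show "(\<lambda>p. zeta p (h p)) \<in> borel_measurable (M \<Otimes>\<^sub>M M)" unfolding zeta_def by measurable
qed (use pth_continuous in auto)

lemma pth_0_measurable [measurable]: "(\<lambda>p. pth p 0) \<in> borel_measurable (M \<Otimes>\<^sub>M M)"
proof -
  have [measurable]: "(\<lambda>p. G (max 0 (t0 + 0 / \<sigma>m\<^sup>2)) (fst p)) \<in> borel_measurable (M \<Otimes>\<^sub>M M)"
    by (intro G_joint) measurable
  have [measurable]: "(\<lambda>p. C (kx (fst p)) (max 0 (age (fst p) +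
      0)) (snd p)) \<in> borel_measurable (M \<Otimes>\<^sub>M M)"
    by (intro Ck_joint) measurable
  show ?thesis unfolding pth_def by measurable
qed

lemma exit_point_path:
  assumes p: "p \<in> space (M \<Otimes>\<^sub>M M)" and pos: "wedge_dist q (pth p 0) > 0"
    and e: "neg_excursion (\<lambda>t. G t (fst p)) (l (fst p)) (r (fst p))" "l (fst p) < t0" "t0 <
        r (fst p)"
  obtains \<tau> where "0 < \<tau>" "\<tau> \<le> life (fst p)" "exit_point p = pth p \<tau>" "wedge_dist q (pth p \<tau>) = 0"
    "\<And>u. 0 \<le> u \<Longrightarrow> u < \<tau> \<Longrightarrow> wedge_dist q (pth p u) > 0"
    "pth p \<tau> \<noteq> 0 \<Longrightarrow> Im (Ln (pth p \<tau>)) = arctan (1 / q) * indicator hits p"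
proof -
  define \<tau> where "\<tau> = Inf {u \<in> {0..life (fst p)}. wedge_dist q (pth p u) = 0}"
  define U where "U = life (fst p)"
  have U: "U > 0" using e(3) \<sigma>m by (simp add: U_def life_def)
  have tr: "t0 + U / \<sigma>m\<^sup>2 = r (fst p)" using \<sigma>m by (simp add: U_def life_def)
  have zeta: "zeta p u = Re (pth p u) - q * Im (pth p u)" for u by (simp add: zeta_def pth_def)
  have wd: "wedge_dist q (pth p u) = min (zeta p u) (Im (pth p u))" for u
    by (simp add: wedge_dist_def zeta)
  have ImU: "Im (pth p U) = 0" using e t0 by (simp add: pth_def tr neg_excursion_def)
  have Impos: "Im (pth p u) > 0" if "0 \<le> u" "u < U" for u
  proof -
    have "u / \<sigma>m\<^sup>2 < U / \<sigma>m\<^sup>2" using that \<sigma>m by (intro divide_strict_right_mono) auto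
    moreover have "0 \<le> u / \<sigma>m\<^sup>2" using that by simp
    ultimately have "l (fst p) < t0 + u / \<sigma>m\<^sup>2" "t0 + u / \<sigma>m\<^sup>2 < r (fst p)" "0 \<le> t0 + u / \<sigma>m\<^sup>2"
      using tr e(2) t0 by linarith+
    then show ?thesis using e(1) by (simp add: pth_def neg_excursion_def)
  qed
  have cont: "continuous_on {0..U} (\<lambda>u. wedge_dist q (pth p u))"
    by (intro continuous_intros continuous_on_subset[OF pth_continuous(1)[OF p]]) auto
  have "wedge_dist q (pth p U) \<le> 0" using wd ImU by simp
  note fz = first_zero[OF cont less_imp_le[OF U] pos this]
  have \<tau>: "0 < \<tau>" "\<tau> \<le> U" "wedge_dist q (pth p \<tau>) = 0" "\<And>u. 0 \<le> u \<Longrightarrow> u < \<tau> \<Longrightarrow>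
      wedge_dist q (pth p u) > 0"
    using fz unfolding \<tau>_def U_def by auto
  have "Im (Ln (pth p \<tau>)) = arctan (1 / q) * indicator hits p" if nz: "pth p \<tau> \<noteq> 0"
  proof (cases "\<tau> < U")
    case True
    have I: "Im (pth p \<tau>) > 0" using Impos[of \<tau>] True \<tau> by simp
    then have z: "zeta p \<tau> = 0" using \<tau>(3) wd[of \<tau>] by (simp add: min_def split: if_splits)
    then have "Re (pth p \<tau>) = q * Im (pth p \<tau>)" by (simp add: zeta)
    then have "Im (Ln (pth p \<tau>)) = arctan (1 / q)" using I q by (subst Im_Ln_eq_arctan) auto
    moreover have "p \<in> hits" using p z True \<tau>(1) by (auto simp: hits_def U_def intro!: exI[of _ \<tau>])
    ultimately show ?thesis by simp
  next
    case False
    then have \<tau>U: "\<tau> = U" using \<tau> by simp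
    have "Re (pth p \<tau>) \<noteq> 0" using nz ImU \<tau>U by (auto simp: complex_eq_iff)
    moreover have "Re (pth p \<tau>) \<ge> 0" using \<tau>(3) wd[of \<tau>] ImU \<tau>U
      by (simp add: zeta min_def split: if_splits)
    ultimately have "Im (Ln (pth p \<tau>)) = 0" using ImU \<tau>U by (subst Im_Ln_eq_arctan) auto
    moreover have "p \<notin> hits"
    proof
      assume "p \<in> hits"
      then obtain u where u: "0 \<le> u" "u < U" "zeta p u = 0" by (auto simp: hits_def U_def)
      then show False using \<tau>(4)[of u] wd[of u] \<tau>U by simp
    qed
    ultimately show ?thesis by simp
  qed
  then show ?thesis using that[of \<tau>] \<tau> by (simp add: exit_point_def \<tau>_def U_def)
qed

lemma jmp_bounds:
  assumes \<omega>: "\<omega> \<in> space M" and bij: "bij_betw (clock \<sigma>p \<sigma>m (\<lambda>s. B s \<omega>)) {0..} {0..}"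
    and S: "S = inv_into {0..} (clock \<sigma>p \<sigma>m (\<lambda>s. B s \<omega>)) t0" and m: "S < 2^m"
  shows "S < real (jmp m \<omega>) * (1/2)^m" "real (jmp m \<omega>) * (1/2)^m \<le> S + (1/2)^m"
proof -
  interpret clock_path \<sigma>p \<sigma>m "\<lambda>s. B s \<omega>"
    by unfold_locales (use \<sigma>p \<sigma>m brownian_motionD(2,3)[OF B \<omega>] in auto)
  define \<delta> :: real where "\<delta> = (1/2)^m"
  have \<delta>: "\<delta> > 0" by (simp add: \<delta>_def)
  have S0: "S \<ge> 0" "cl S = t0" using ci[OF bij, of t0] t0 unfolding S ci_def[OF bij] by auto
  have iff: "t0 < cl u \<longleftrightarrow> S < u" if "u \<ge> 0" for u
    using clock_less_iff[OF bij S0(1) that] S0 by simp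
  have four: "real (4^m) * \<delta> = 2^m"
  proof -
    have "(4::real)^m = 2^m * 2^m" by (simp add: power_mult_distrib[symmetric])
    then show ?thesis by (simp add: \<delta>_def power_divide)
  qed
  define P where "P j \<longleftrightarrow> t0 < cl (real j * \<delta>) \<or> j = 4^m" for j
  have Pd: "P j \<longleftrightarrow> S < real j * \<delta> \<or> j = 4^m" for j using iff[of "real j * \<delta>"] \<delta> by (simp add: P_def)
  have jmp: "jmp m \<omega> = (LEAST j. P j)" by (simp add: jmp_def P_def \<delta>_def)
  have "P (4^m)" by (simp add: P_def)
  then have "P (jmp m \<omega>)" unfolding jmp by (rule LeastI)
  then show "S < real (jmp m \<omega>) * (1/2)^m" using four m unfolding Pd \<delta>_def by auto
  define j1 where "j1 = nat \<lfloor>S / \<delta>\<rfloor> + 1"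
  have "real j1 = of_int \<lfloor>S / \<delta>\<rfloor> + 1" using S0 \<delta> by (simp add: j1_def)
  then have "S / \<delta> < real j1" "real j1 \<le> S / \<delta> + 1" by linarith+
  then have j1: "S < real j1 * \<delta>" "real j1 * \<delta> \<le> S + \<delta>" using \<delta> by (auto simp: field_simps)
  have "jmp m \<omega> \<le> j1" unfolding jmp by (rule Least_le) (use j1 Pd in auto)
  then have "real (jmp m \<omega>) * \<delta> \<le> real j1 * \<delta>" using \<delta> by (intro mult_right_mono) auto
  then show "real (jmp m \<omega>) * (1/2)^m \<le> S + (1/2)^m" using j1(2) unfolding \<delta>_def by linarith
qed

lemma approx_pointwise:
  assumes p: "p \<in> space (M \<Otimes>\<^sub>M M)" and bij: "bij_betw (clock \<sigma>p \<sigma>m (\<lambda>s. B s (fst p))) {0..} {0..}"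
    and e: "G t0 (fst p) < 0 \<longrightarrow> neg_excursion (\<lambda>t. G t (fst p)) (l (fst p)) (r (fst p)) \<and> l (fst p) <
        t0 \<and> t0 < r (fst p)"
  shows "(wedge_dist q (pth p 0) \<le> 0 \<and> (\<forall>e>0. \<exists>m0. \<forall>m\<ge>m0. wedge_dist q (W m 0 p) < e)) \<or>
      (\<exists>w \<tau> \<theta> m1. continuous_on {0..} w \<and> w 0 = pth p 0 \<and> w \<tau> = exit_point p \<and> 0 < \<tau> \<and>
          wedge_dist q (w \<tau>) = 0 \<and>
         (\<forall>u. 0 \<le> u \<longrightarrow> u < \<tau> \<longrightarrow> wedge_dist q (w u) > 0) \<and>
         (\<forall>m\<ge>m1. 0 \<le> \<theta> m \<and> \<theta> m \<le> (1/2)^m \<and> (\<forall>i. W m i p = w (\<theta> m + real i * (1/2)^m))))"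
proof -
  obtain \<omega> \<omega>' where p_eq: "p = (\<omega>, \<omega>')" by (cases p)
  have \<omega>: "\<omega> \<in> space M" "\<omega>' \<in> space M" using p by (auto simp: p_eq space_pair_measure)
  have bij: "bij_betw (clock \<sigma>p \<sigma>m (\<lambda>s. B s \<omega>)) {0..} {0..}" using bij by (simp add: p_eq)
  interpret clock_path \<sigma>p \<sigma>m "\<lambda>s. B s \<omega>"
    by unfold_locales (use \<sigma>p \<sigma>m brownian_motionD(2,3)[OF B \<omega>(1)] in auto)
  have Bc: "continuous_on {0..} (\<lambda>s. B s \<omega>)" by (rule brownian_motionD(3)[OF B \<omega>(1)])
  define S where "S = inv_into {0..} cl t0"
  have S: "S = ci t0" by (simp add: S_def ci_def[OF bij])
  have S0: "S \<ge> 0" using ci(1)[OF bij, of t0] t0 by (simp add: S)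
  have Gt: "G t \<omega> = B (ci t) \<omega>" for t using g_eq[OF bij, of t] by (simp add: two_speed_eq)
  obtain mS :: nat where "S < real mS" using reals_Archimedean2 by blast
  then have mS: "S < 2^m" if "m \<ge> mS" for m
  proof -
    have "real mS < 2^mS" by (rule of_nat_less_two_power)
    also have "(2::real)^mS \<le> 2^m" using that by (intro power_increasing) auto
    finally show ?thesis using \<open>S < real mS\<close> by linarith
  qed
  define \<theta> where "\<theta> m = real (jmp m \<omega>) * (1/2)^m - S" for m
  have \<theta>: "0 < \<theta> m" "\<theta> m \<le> (1/2)^m" if "m \<ge> mS" for m
    using jmp_bounds[OF \<omega>(1) bij S_def mS[OF that]] by (auto simp: \<theta>_def)
  have small: "\<exists>m0\<ge>mS. \<forall>m\<ge>m0. \<theta> m < d" if d: "d > 0" for d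
  proof -
    obtain k :: nat where k: "(1/2)^k < d" using real_arch_pow_inv[of d "1/2"] d by auto
    have "\<theta> m < d" if "m \<ge> max mS k" for m
    proof -
      have "(1/2::real)^m \<le> (1/2)^k" using that by (intro power_decreasing) auto
      then show ?thesis using \<theta>[of m] that k by linarith
    qed
    then show ?thesis by (intro exI[of _ "max mS k"]) auto
  qed
  have ImW: "Im (W m i p) = - B (S + (\<theta> m + real i * (1/2)^m)) \<omega>" for m i
    by (simp add: W_def p_eq \<theta>_def)
  have Im0: "Im (pth p 0) = - B S \<omega>" using t0 by (simp add: pth_def p_eq Gt S)
  show ?thesis
  proof (cases "G t0 \<omega> < 0")
    case False
    then have BS: "B S \<omega> \<ge> 0" by (simp add: Gt S)
    have "\<exists>m0. \<forall>m\<ge>m0. wedge_dist q (W m 0 p) < e" if e: "e > 0" for e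
    proof -
      obtain d where d: "d > 0" "\<And>u. u \<in> {0..} \<Longrightarrow> dist u S < d \<Longrightarrow> dist (B u \<omega>) (B S \<omega>) < e"
        using Bc e S0 unfolding continuous_on_iff by (metis atLeast_iff)
      obtain m0 where m0: "m0 \<ge> mS" "\<And>m. m \<ge> m0 \<Longrightarrow> \<theta> m < d" using small[OF d(1)] by blast
      have "wedge_dist q (W m 0 p) < e" if m: "m \<ge> m0" for m
      proof -
        have t: "0 < \<theta> m" "\<theta> m < d" using \<theta>(1)[of m] m0 m by auto
        then have "dist (B (S + \<theta> m) \<omega>) (B S \<omega>) < e" using S0
          by (intro d(2)) (auto simp: dist_real_def)
        then have "- B (S + \<theta> m) \<omega> < e" using BS by (simp add: dist_real_def)
        then show ?thesis using ImW[of m 0] by (simp add: wedge_dist_def min_less_iff_disj)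
      qed
      then show ?thesis by blast
    qed
    moreover have "wedge_dist q (pth p 0) \<le> 0" using Im0 BS
      by (simp add: wedge_dist_def min_le_iff_disj)
    ultimately show ?thesis by blast
  next
    case True
    then have ne: "neg_excursion (\<lambda>t. G t \<omega>) (l \<omega>) (r \<omega>)" and lr: "l \<omega> < t0" "t0 < r \<omega>" using e
      by (auto simp: p_eq)
    have ne': "neg_excursion g (l \<omega>) (r \<omega>)" using ne by (simp add: two_speed_eq)
    have l0: "l \<omega> \<ge> 0" using ne by (simp add: neg_excursion_def)
    note nc = neg_excursion_clock[OF bij ne' less_imp_le[OF lr(1)] less_imp_le[OF lr(2)]]
    define a b where "a = ci (l \<omega>)" and "b = ci (r \<omega>)"
    have ab: "a = S - age \<omega>" "b = S + life \<omega>"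
      using nc(1)[of "l \<omega>"] nc(1)[of "r \<omega>"] lr \<sigma>m
      by (auto simp: a_def b_def S age_def life_def max_def algebra_simps)
    have a0: "a \<ge> 0" unfolding a_def by (rule ci(1)[OF bij l0])
    have age0: "age \<omega> \<ge> 0" and life0: "life \<omega> > 0" using lr \<sigma>m by (auto simp: age_def life_def)
    define w where "w u = Complex (\<kappa> + C (kx \<omega>) (max 0 (age \<omega> + u)) \<omega>') (- B (max 0 (S + u)) \<omega>)"
        for u
    have w_cont: "continuous_on {0..} w"
    proof -
      have "continuous_on {0..} (\<lambda>u. C (kx \<omega>) (max 0 (age \<omega> + u)) \<omega>')"
        by (rule continuous_on_compose2[OF brownian_motionD(3)[OF C \<omega>(2)]]) (auto intro!:
            continuous_intros)
      moreover have "continuous_on {0..} (\<lambda>u. B (max 0 (S + u)) \<omega>)"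
        by (rule continuous_on_compose2[OF Bc]) (auto intro!: continuous_intros)
      ultimately show ?thesis unfolding w_def by (auto intro!: continuous_intros)
    qed
    have w_pth: "pth p u = w u" if u: "0 \<le> u" "u \<le> life \<omega>" for u
    proof -
      have "u / \<sigma>m\<^sup>2 \<le> life \<omega> / \<sigma>m\<^sup>2" using u \<sigma>m by (intro divide_right_mono) auto
      then have t: "t0 + u / \<sigma>m\<^sup>2 \<le> r \<omega>" "l \<omega> \<le> t0 + u / \<sigma>m\<^sup>2" "0 \<le> t0 + u / \<sigma>m\<^sup>2" using u lr \<sigma>m t0
        by (auto simp: life_def add_increasing2)
      have "ci (t0 + u / \<sigma>m\<^sup>2) = S + u" using nc(1)[OF t(2,1)] \<sigma>m by (simp add: S)
      then show ?thesis using t u S0 by (simp add: pth_def p_eq w_def Gt)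
    qed
    obtain m1 where m1: "m1 \<ge> mS" "\<And>m. m \<ge> m1 \<Longrightarrow> \<theta> m < life \<omega>" using small[OF life0] by blast
    have Wm: "W m i p = w (\<theta> m + real i * (1/2)^m)" if m: "m \<ge> m1" for m i
    proof -
      have t: "0 < \<theta> m" "\<theta> m < life \<omega>" using \<theta>(1)[of m] m1 m by auto
      have J: "real (jmp m \<omega>) * (1/2)^m = S + \<theta> m" by (simp add: \<theta>_def)
      have "last_zero (\<lambda>s. - B s \<omega>) (S + \<theta> m) = a"
      proof (rule last_zero_eq)
        show "a \<le> S + \<theta> m" using ab age0 t by simp
        show "- B a \<omega> = 0" using nc(3) by (simp add: a_def)
        fix u assume u: "a < u" "u \<le> S + \<theta> m"
        then have "u < b" using ab t by simp
        then show "- B u \<omega> \<noteq> 0" using nc(2)[of u] u by (simp add: a_def b_def)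
      qed (rule a0)
      then have "fst (start m (jmp m \<omega>) \<omega>) = age \<omega> + \<theta> m" unfolding start_def J using ab by simp
      then have "W m i p = Complex (\<kappa> + C (kx \<omega>) (age \<omega> + \<theta> m + real i * (1/2)^m) \<omega>') (- B (S +
          \<theta> m + real i * (1/2)^m) \<omega>)"
        by (simp add: W_def p_eq J)
      then show ?thesis using t age0 S0 by (simp add: w_def add.assoc max_def)
    qed
    show ?thesis
    proof (cases "wedge_dist q (pth p 0) > 0")
      case pos: True
      obtain \<tau> where \<tau>: "0 < \<tau>" "\<tau> \<le> life \<omega>" "exit_point p = pth p \<tau>" "wedge_dist q (pth p \<tau>) = 0"
        "\<And>u. 0 \<le> u \<Longrightarrow> u < \<tau> \<Longrightarrow> wedge_dist q (pth p u) > 0"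
        using exit_point_path[OF p pos] ne lr by (auto simp: p_eq)
      have "continuous_on {0..} w \<and> w 0 = pth p 0 \<and> w \<tau> = exit_point p \<and> 0 < \<tau> \<and>
          wedge_dist q (w \<tau>) = 0 \<and>
         (\<forall>u. 0 \<le> u \<longrightarrow> u < \<tau> \<longrightarrow> wedge_dist q (w u) > 0) \<and>
         (\<forall>m\<ge>m1. 0 \<le> \<theta> m \<and> \<theta> m \<le> (1/2)^m \<and> (\<forall>i. W m i p = w (\<theta> m + real i * (1/2)^m)))"
      proof (intro conjI allI impI)
        show "w 0 = pth p 0" "w \<tau> = exit_point p" using w_pth[of 0] w_pth[of \<tau>] \<tau> life0 by auto
        show "wedge_dist q (w \<tau>) = 0" using w_pth[of \<tau>] \<tau> by simp
        show "wedge_dist q (w u) > 0" if "0 \<le> u" "u < \<tau>" for u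
          using \<tau>(5)[OF that] w_pth[of u] \<tau>(2) that by simp
        show "0 \<le> \<theta> m" "\<theta> m \<le> (1/2)^m" if "m1 \<le> m" for m using \<theta>[of m] m1 that by auto
        show "W m i p = w (\<theta> m + real i * (1/2)^m)" if "m1 \<le> m" for m i by (rule Wm[OF that])
      qed (use w_cont \<tau> in auto)
      then show ?thesis by blast
    next
      case False
      have "\<exists>m0. \<forall>m\<ge>m0. wedge_dist q (W m 0 p) < e" if e: "e > 0" for e
      proof -
        have "continuous_on {0..} (\<lambda>u. wedge_dist q (w u))" by (intro continuous_intros w_cont)
        then obtain d where d: "d > 0" "\<And>u. u \<in> {0..} \<Longrightarrow> dist u 0 < d \<Longrightarrow>
            dist (wedge_dist q (w u)) (wedge_dist q (w 0)) < e"
          using e unfolding continuous_on_iff by (metis atLeast_iff order_refl)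
        obtain m0 where m0: "m0 \<ge> mS" "\<And>m. m \<ge> m0 \<Longrightarrow> \<theta> m < d" using small[OF d(1)] by blast
        have "wedge_dist q (W m 0 p) < e" if m: "m \<ge> max m0 m1" for m
        proof -
          have t: "0 < \<theta> m" "\<theta> m < d" using \<theta>(1)[of m] m0 m by auto
          then have "dist (wedge_dist q (w (\<theta> m))) (wedge_dist q (w 0)) < e"
            by (intro d(2)) (auto simp: dist_real_def)
          moreover have "wedge_dist q (w 0) \<le> 0" using False w_pth[of 0] life0 by simp
          ultimately show ?thesis using Wm[of m 0] m by (simp add: dist_real_def)
        qed
        then show ?thesis by blast
      qed
      then show ?thesis using False by auto
    qed
  qed
qed

lemma AE_fst:
  assumes "AE \<omega> in M. P \<omega>"
  shows "AE p in M \<Otimes>\<^sub>M M. P (fst p)"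
proof -
  have "AE \<omega> in distr (M \<Otimes>\<^sub>M M) M fst. P \<omega>" unfolding distr_pair_fst by (rule assms)
  then show ?thesis by (rule AE_distrD[OF measurable_fst])
qed

lemma AE_bij: "AE \<omega> in M. bij_betw (clock \<sigma>p \<sigma>m (\<lambda>s. B s \<omega>)) {0..} {0..}"
  using brownian_zero_set_null[OF B] AE_space
proof eventually_elim
  case (elim \<omega>)
  interpret clock_path \<sigma>p \<sigma>m "\<lambda>s. B s \<omega>"
    by unfold_locales (use \<sigma>p \<sigma>m brownian_motionD(2,3)[OF B elim(2)] in auto)
  show ?case by (rule clock_bij[OF elim(1)])
qed

sublocale wedge_approx "M \<Otimes>\<^sub>M M" q W "\<lambda>p. pth p 0" exit_point
proof unfold_locales
  show "AE p in M \<Otimes>\<^sub>M M. (wedge_dist q (pth p 0) \<le> 0 \<and> (\<forall>e>0. \<exists>m0. \<forall>m\<ge>m0. wedge_dist q (W m 0 p) <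
      e)) \<or>
      (\<exists>w \<tau> \<theta> m1. continuous_on {0..} w \<and> w 0 = pth p 0 \<and> w \<tau> = exit_point p \<and> 0 < \<tau> \<and>
          wedge_dist q (w \<tau>) = 0 \<and>
         (\<forall>u. 0 \<le> u \<longrightarrow> u < \<tau> \<longrightarrow> wedge_dist q (w u) > 0) \<and>
         (\<forall>m\<ge>m1. 0 \<le> \<theta> m \<and> \<theta> m \<le> (1/2)^m \<and> (\<forall>i. W m i p = w (\<theta> m + real i * (1/2)^m))))"
    using AE_fst[OF exc] AE_fst[OF AE_bij] AE_space
    by eventually_elim (rule approx_pointwise)
qed (use q W_law in auto)

lemma hits_measure:
  assumes A: "A \<in> sets borel" "A \<subseteq> wedge q 0"
  shows "(\<integral>\<^sup>+p. indicator A (pth p 0) * ennreal (Im (Ln (pth p 0))) \<partial>(M \<Otimes>\<^sub>M M)) =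
    (\<integral>\<^sup>+p. indicator A (pth p 0) * ennreal (arctan (1 / q) * indicator hits p) \<partial>(M \<Otimes>\<^sub>M M))"
proof (rule exit_angle_measure[OF hits_sets _ _ A])
  show "0 \<le> arctan (1 / q)" using q by simp
  show "AE p in M \<Otimes>\<^sub>M M. wedge_dist q (pth p 0) > 0 \<longrightarrow> exit_point p \<noteq> 0 \<longrightarrow>
      Im (Ln (exit_point p)) = arctan (1 / q) * indicator hits p"
    using AE_fst[OF exc] AE_space
  proof eventually_elim
    case (elim p)
    show ?case
    proof (intro impI)
      assume pos: "wedge_dist q (pth p 0) > 0" and nz: "exit_point p \<noteq> 0"
      then have "G t0 (fst p) < 0" using t0 by (simp add: wedge_dist_def pth_def)
      with elim have e: "neg_excursion (\<lambda>t. G t (fst p)) (l (fst p)) (r (fst p))" "l (fst p) <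
          t0" "t0 < r (fst p)" by auto
      from exit_point_path[OF elim(2) pos e] nz show "Im (Ln (exit_point p)) =
          arctan (1 / q) * indicator hits p"
        by metis
    qed
  qed
qed

end

lemma (in prob_space) transfer_single:
  assumes ind: "indep_rv M N1 (\<lambda>\<omega>. \<omega>) N2 (\<lambda>\<omega>. \<omega>)"
    and F: "F \<in> borel_measurable (N1 \<Otimes>\<^sub>M N2)"
  shows "(\<integral>\<^sup>+\<omega>. F (\<omega>, \<omega>) \<partial>M) = (\<integral>\<^sup>+\<omega>. (\<integral>\<^sup>+\<omega>'. F (\<omega>, \<omega>') \<partial>M) \<partial>M)"
  using indep_rv_nn_integral[OF ind F] .

text \<open>The diagonal of \<open>M \<Otimes>\<^sub>M M\<close> is the original experiment; independence makes it interchangeable with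
  the product for events measurable with respect to \<open>N1 \<Otimes>\<^sub>M N2 k\<close>.\<close>

locale planar_transfer = planar_exit +
  fixes N1 :: "'a measure" and N2 :: "nat \<Rightarrow> 'a measure"
  assumes space_N: "space N1 = space M" "\<And>k. space (N2 k) = space M"
    and indep: "\<And>k. indep_rv M N1 (\<lambda>\<omega>. \<omega>) (N2 k) (\<lambda>\<omega>. \<omega>)"
    and G_N1: "\<And>t. t \<ge> 0 \<Longrightarrow> G t \<in> borel_measurable N1"
    and C_N2: "\<And>k t. t \<ge> 0 \<Longrightarrow> C k t \<in> borel_measurable (N2 k)"
    and kx_N1 [measurable]: "kx \<in> measurable N1 (count_space UNIV)"
    and l_N1 [measurable]: "l \<in> borel_measurable N1"
        and r_N1 [measurable]: "r \<in> borel_measurable N1"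
begin

lemma transfer:
  assumes Fk: "\<And>k. Fk k \<in> borel_measurable (N1 \<Otimes>\<^sub>M N2 k)"
    and F: "\<And>p. p \<in> space (M \<Otimes>\<^sub>M M) \<Longrightarrow> F p = Fk (kx (fst p)) p"
  shows "(\<integral>\<^sup>+\<omega>. F (\<omega>, \<omega>) \<partial>M) = (\<integral>\<^sup>+p. F p \<partial>(M \<Otimes>\<^sub>M M))"
proof -
  have id1 [measurable]: "(\<lambda>\<omega>. \<omega>) \<in> measurable M N1"
      and id2 [measurable]: "(\<lambda>\<omega>. \<omega>) \<in> measurable M (N2 k)" for k
    using indep by (auto simp: indep_rv_def)
  have FkM: "Fk k \<in> borel_measurable (M \<Otimes>\<^sub>M M)" for k
  proof -
    have "(\<lambda>p. (fst p, snd p)) \<in> measurable (M \<Otimes>\<^sub>M M) (N1 \<Otimes>\<^sub>M N2 k)"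
      by (intro measurable_Pair measurable_compose[OF measurable_fst id1] measurable_compose[OF
          measurable_snd id2])
    from measurable_compose[OF this Fk] show ?thesis by simp
  qed
  have Fsel: "(\<lambda>p. Fk (kx (fst p)) p) \<in> borel_measurable (M \<Otimes>\<^sub>M M)"
    by (rule measurable_compose_countable[where f = Fk and g = "\<lambda>p. kx (fst p)", OF FkM]) measurable
  have FM [measurable]: "F \<in> borel_measurable (M \<Otimes>\<^sub>M M)"
    by (subst measurable_cong[OF F]) (use Fsel in auto)
  have sp: "\<omega> \<in> space M \<Longrightarrow> \<omega>' \<in> space M \<Longrightarrow> (\<omega>, \<omega>') \<in> space (M \<Otimes>\<^sub>M M)" for \<omega> \<omega>'
    by (simp add: space_pair_measure)
  have diag [measurable]: "(\<lambda>\<omega>. F (\<omega>, \<omega>)) \<in> borel_measurable M"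
    by (rule measurable_compose[OF _ FM]) measurable
  have "(\<integral>\<^sup>+\<omega>. F (\<omega>, \<omega>) \<partial>M) = (\<Sum>k. \<integral>\<^sup>+\<omega>. indicator {\<omega>. kx \<omega> = k} \<omega> * F (\<omega>, \<omega>) \<partial>M)"
    by (rule nn_integral_split_nat) measurable
  also have "\<dots> = (\<Sum>k. \<integral>\<^sup>+\<omega>. indicator {\<omega>. kx \<omega> = k} \<omega> * (\<integral>\<^sup>+\<omega>'. F (\<omega>, \<omega>') \<partial>M) \<partial>M)"
  proof (intro suminf_cong)
    fix k
    note Fk [measurable]
    have "(\<integral>\<^sup>+\<omega>. indicator {\<omega>. kx \<omega> = k} \<omega> * F (\<omega>, \<omega>) \<partial>M) =
      (\<integral>\<^sup>+\<omega>. (if kx (fst (\<omega>, \<omega>)) = k then Fk k (\<omega>, \<omega>) else 0) \<partial>M)"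
      by (intro nn_integral_cong) (auto simp: indicator_def F sp)
    also have "\<dots> = (\<integral>\<^sup>+\<omega>. (\<integral>\<^sup>+\<omega>'. (if kx (fst (\<omega>, \<omega>')) = k then Fk k (\<omega>, \<omega>') else 0) \<partial>M) \<partial>M)"
      by (rule transfer_single[OF indep, where F = "\<lambda>p. if kx (fst p) =
          k then Fk k p else 0"]) measurable
    also have "\<dots> = (\<integral>\<^sup>+\<omega>. indicator {\<omega>. kx \<omega> = k} \<omega> * (\<integral>\<^sup>+\<omega>'. F (\<omega>, \<omega>') \<partial>M) \<partial>M)"
      by (intro nn_integral_cong) (auto simp: indicator_def F sp intro!: nn_integral_cong)
    finally show "(\<integral>\<^sup>+\<omega>. indicator {\<omega>. kx \<omega> = k} \<omega> * F (\<omega>, \<omega>) \<partial>M) = \<dots>" .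
  qed
  also have "\<dots> = (\<integral>\<^sup>+\<omega>. (\<integral>\<^sup>+\<omega>'. F (\<omega>, \<omega>') \<partial>M) \<partial>M)"
    by (rule nn_integral_split_nat[symmetric]) measurable
  also have "\<dots> = (\<integral>\<^sup>+p. F p \<partial>(M \<Otimes>\<^sub>M M))" by (rule nn_integral_fst) measurable
  finally show ?thesis .
qed

lemma age_N1 [measurable]: "age \<in> borel_measurable N1"
  and life_N1 [measurable]: "life \<in> borel_measurable N1"
  unfolding age_def[abs_def] life_def[abs_def] by measurable

definition zeta_k :: "nat \<Rightarrow> 'a \<times> 'a \<Rightarrow> real \<Rightarrow> real" where
  "zeta_k k p u = \<kappa> + C k (max 0 (age (fst p) + u)) (snd p) + q * G (max 0 (t0 + u / \<sigma>m\<^sup>2)) (fst p)"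

definition pth_k :: "nat \<Rightarrow> 'a \<times> 'a \<Rightarrow> complex" where
  "pth_k k p = Complex (\<kappa> + C k (max 0 (age (fst p) + 0)) (snd p)) (- G (max 0 (t0 +
      0 / \<sigma>m\<^sup>2)) (fst p))"

lemma C_N2_joint:
  assumes [measurable]: "g \<in> borel_measurable K" "h \<in> measurable K (N2 k)"
  shows "(\<lambda>x. C k (max 0 (g x)) (h x)) \<in> borel_measurable K"
  by (rule measurable_continuous_process[where N = "N2 k", OF C_N2]) (simp_all add: space_N
      brownian_motionD(3)[OF C])

lemma G_N1_joint:
  assumes [measurable]: "g \<in> borel_measurable K" "h \<in> measurable K N1"
  shows "(\<lambda>x. G (max 0 (g x)) (h x)) \<in> borel_measurable K"
  by (rule measurable_continuous_process[where N = N1, OF G_N1])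
     (simp_all add: space_N two_speed_continuous(1)[OF B \<sigma>p \<sigma>m])

lemma zeta_k_measurable:
  assumes h [measurable]: "h \<in> borel_measurable (N1 \<Otimes>\<^sub>M N2 k)"
  shows "(\<lambda>p. zeta_k k p (h p)) \<in> borel_measurable (N1 \<Otimes>\<^sub>M N2 k)"
proof -
  have [measurable]: "(\<lambda>p. G (max 0 (t0 + h p / \<sigma>m\<^sup>2)) (fst p)) \<in> borel_measurable (N1 \<Otimes>\<^sub>M N2 k)"
    by (intro G_N1_joint) measurable
  have [measurable]: "(\<lambda>p. C k (max 0 (age (fst p) +
      h p)) (snd p)) \<in> borel_measurable (N1 \<Otimes>\<^sub>M N2 k)"
    by (intro C_N2_joint) measurable
  show ?thesis unfolding zeta_k_def by measurable
qed

lemma pth_k_measurable [measurable]: "pth_k k \<in> borel_measurable (N1 \<Otimes>\<^sub>M N2 k)"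
proof -
  have [measurable]: "(\<lambda>p. G (max 0 (t0 + 0 / \<sigma>m\<^sup>2)) (fst p)) \<in> borel_measurable (N1 \<Otimes>\<^sub>M N2 k)"
    by (intro G_N1_joint) measurable
  have [measurable]: "(\<lambda>p. C k (max 0 (age (fst p) + 0)) (snd p)) \<in> borel_measurable (N1 \<Otimes>\<^sub>M N2 k)"
    by (intro C_N2_joint) measurable
  show ?thesis unfolding pth_k_def[abs_def] by measurable
qed

definition hits_k :: "nat \<Rightarrow> ('a \<times> 'a) set" where
  "hits_k k = {p \<in> space (N1 \<Otimes>\<^sub>M N2 k). \<exists>u. 0 \<le> u \<and> u < life (fst p) \<and> zeta_k k p u = 0}"

lemma hits_k_sets [measurable]: "hits_k k \<in> sets (N1 \<Otimes>\<^sub>M N2 k)"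
  unfolding hits_k_def
proof (rule sets_zero_before)
  fix p assume p: "p \<in> space (N1 \<Otimes>\<^sub>M N2 k)"
  have p': "fst p \<in> space M" "snd p \<in> space M" using p by (auto simp: space_pair_measure space_N)
  have 1: "continuous_on {0..} (\<lambda>u. C k (max 0 (age (fst p) + u)) (snd p))"
    by (rule continuous_on_compose2[OF brownian_motionD(3)[OF C p'(2)]]) (auto intro!:
        continuous_intros)
  have 2: "continuous_on {0..} (\<lambda>u. G (max 0 (t0 + u / \<sigma>m\<^sup>2)) (fst p))"
    by (rule continuous_on_compose2[OF two_speed_continuous(1)[OF B \<sigma>p \<sigma>m p'(1)]])
       (use \<sigma>m in \<open>auto intro!: continuous_intros\<close>)
  show "continuous_on {0..} (zeta_k k p)" unfolding zeta_k_def[abs_def] using 1 2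
    by (auto intro!: continuous_intros)
qed (use zeta_k_measurable in auto)

lemma hits_diag:
  assumes A [measurable]: "A \<in> sets borel" and sub: "A \<subseteq> wedge q 0"
  shows "(\<integral>\<^sup>+\<omega>. indicator A (pth (\<omega>, \<omega>) 0) * ennreal (Im (Ln (pth (\<omega>, \<omega>) 0))) \<partial>M) =
    (\<integral>\<^sup>+\<omega>. indicator A (pth (\<omega>, \<omega>) 0) * ennreal (arctan (1 / q) * indicator hits (\<omega>, \<omega>)) \<partial>M)"
proof -
  note [measurable] = measurable_Im_Ln_right
  have pk: "pth p 0 = pth_k (kx (fst p)) p" for p by (simp add: pth_def pth_k_def)
  have zk: "zeta p u = zeta_k (kx (fst p)) p u" for p u by (simp add: zeta_def zeta_k_def)
  have hk: "indicator hits p = (indicator (hits_k (kx (fst p))) p :: real)" if "p \<in> space (M \<Otimes>\<^sub>M M)"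
      for p
    using that by (auto simp: hits_def hits_k_def zk indicator_def space_pair_measure space_N)
  have L: "(if Re x > 0 then Im (Ln x) else 0) = Im (Ln x)" if "x \<in> A" for x
    using Im_Ln_wedge[OF q, of x] that sub by auto
  have "(\<integral>\<^sup>+\<omega>. indicator A (pth (\<omega>, \<omega>) 0) * ennreal (Im (Ln (pth (\<omega>, \<omega>) 0))) \<partial>M) =
    (\<integral>\<^sup>+p. indicator A (pth p 0) * ennreal (Im (Ln (pth p 0))) \<partial>(M \<Otimes>\<^sub>M M))"
  proof (rule transfer)
    show "(\<lambda>p. indicator A (pth_k k p) * ennreal (if Re (pth_k k p) > 0 then Im (Ln (pth_k k p))
        else 0))
      \<in> borel_measurable (N1 \<Otimes>\<^sub>M N2 k)" for k
      using measurable_compose[OF pth_k_measurable measurable_Im_Ln_right, of k] by measurable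
    show "indicator A (pth p 0) * ennreal (Im (Ln (pth p 0))) =
        indicator A (pth_k (kx (fst p)) p) * ennreal (if Re (pth_k (kx (fst p)) p) > 0 then Im (Ln
            (pth_k (kx (fst p)) p)) else 0)" for p
      unfolding pk by (cases "pth_k (kx (fst p)) p \<in> A") (simp only: L, simp)
  qed
  also have "\<dots> = (\<integral>\<^sup>+p. indicator A (pth p 0) * ennreal (arctan (1 / q) * indicator hits p) \<partial>(M \<Otimes>\<^sub>M
      M))"
    by (rule hits_measure[OF A sub])
  also have "\<dots> = (\<integral>\<^sup>+\<omega>. indicator A (pth (\<omega>, \<omega>) 0) * ennreal (arctan (1 / q) * indicator hits (\<omega>,
      \<omega>)) \<partial>M)"
  proof (rule transfer[symmetric])
    show "(\<lambda>p. indicator A (pth_k k p) * ennreal (arctan (1 / q) * indicator (hits_k k) p))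
      \<in> borel_measurable (N1 \<Otimes>\<^sub>M N2 k)" for k
      by measurable
  qed (auto simp: pk hk)
  finally show ?thesis .
qed

end

lemma exceeds_rational_iff:
  fixes f :: "real \<Rightarrow> real"
  assumes f: "continuous_on {0..} f" and b: "0 \<le> b"
  shows "(\<exists>t\<in>{0..b}. \<bar>f t\<bar> > a) \<longleftrightarrow> (\<exists>q\<in>{0..1} \<inter> \<rat>. \<bar>f (b * q)\<bar> > a)"
proof
  assume "\<exists>t\<in>{0..b}. \<bar>f t\<bar> > a"
  then obtain t where t: "0 \<le> t" "t \<le> b" "\<bar>f t\<bar> > a" by auto
  show "\<exists>q\<in>{0..1} \<inter> \<rat>. \<bar>f (b * q)\<bar> > a"
  proof (cases "b = 0")
    case True
    then show ?thesis using t by (intro bexI[of _ 0]) auto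
  next
    case False
    define g where "g q = \<bar>f (b * q)\<bar>" for q
    define y where "y = t / b"
    have y: "y \<in> {0..1}" "g y > a" using t b False by (auto simp: y_def g_def)
    have "continuous_on {0..1} g" unfolding g_def
      by (intro continuous_on_rabs continuous_on_compose2[OF f]) (use b in \<open>auto intro!:
          continuous_intros\<close>)
    moreover have "g y - a > 0" using y by simp
    ultimately obtain d where d: "d > 0" "\<And>x. x \<in> {0..1} \<Longrightarrow> dist x y < d \<Longrightarrow> dist (g x) (g y) <
        g y - a"
      using y(1) unfolding continuous_on_iff by blast
    have "max 0 (y - d) < min 1 (y + d)" using y d by auto
    from Rats_dense_in_real[OF this] obtain q where q: "q \<in> \<rat>" "max 0 (y - d) < q" "q < min 1 (y +
        d)" by auto
    then have "dist (g q) (g y) < g y - a" by (intro d(2)) (auto simp: dist_real_def)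
    then have "g q > a" by (simp add: dist_real_def abs_less_iff)
    then show ?thesis using q by (intro bexI[of _ q]) (auto simp: g_def)
  qed
next
  assume "\<exists>q\<in>{0..1} \<inter> \<rat>. \<bar>f (b * q)\<bar> > a"
  then obtain q where q: "0 \<le> q" "q \<le> 1" "\<bar>f (b * q)\<bar> > a" by auto
  then have "b * q \<in> {0..b}" using b mult_left_le[of q b] by auto
  then show "\<exists>t\<in>{0..b}. \<bar>f t\<bar> > a" using q by blast
qed

lemma (in prob_space) random_maximal:
  assumes W: "brownian_motion M 1 W" and a: "a > 0"
    and sp: "space N1 = space M" "space N2 = space M"
    and ind: "indep_rv M N1 (\<lambda>\<omega>. \<omega>) N2 (\<lambda>\<omega>. \<omega>)"
    and WN: "\<And>t. t \<ge> 0 \<Longrightarrow> W t \<in> borel_measurable N2"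
    and h [measurable]: "h \<in> borel_measurable N1" and D [measurable]: "D \<in> sets N1"
  defines "E \<equiv> {\<omega> \<in> D. \<exists>t\<in>{0..max 0 (h \<omega>)}. \<bar>W t \<omega>\<bar> > a}"
  shows "E \<in> events" "emeasure M E \<le> (\<integral>\<^sup>+\<omega>. indicator D \<omega> * ennreal (max 0 (h \<omega>) / a\<^sup>2) \<partial>M)"
proof -
  define H where "H = {p \<in> space (N1 \<Otimes>\<^sub>M N2). fst p \<in> D \<and> (\<exists>q\<in>{0..1} \<inter> \<rat>. a <
      \<bar>W (max 0 (max 0 (h (fst p)) * q)) (snd p)\<bar>)}"
  have Wj [measurable]: "(\<lambda>p. W (max 0 (max 0 (h (fst p)) * q)) (snd p)) \<in> borel_measurable (N1 \<Otimes>\<^sub>M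
      N2)" for q
    by (rule measurable_continuous_process[where N = N2, OF WN]) (simp_all add: sp
        brownian_motionD(3)[OF W])
  have H [measurable]: "H \<in> sets (N1 \<Otimes>\<^sub>M N2)"
    unfolding H_def
  proof (intro sets.sets_Collect_conj sets.sets_Collect_countable_Ex')
    show "countable ({0..1} \<inter> \<rat> :: real set)" using countable_rat by auto
    show "{p \<in> space (N1 \<Otimes>\<^sub>M N2). a <
        \<bar>W (max 0 (max 0 (h (fst p)) * q)) (snd p)\<bar>} \<in> sets (N1 \<Otimes>\<^sub>M N2)" for q
      by measurable
    show "{p \<in> space (N1 \<Otimes>\<^sub>M N2). fst p \<in> D} \<in> sets (N1 \<Otimes>\<^sub>M N2)" by measurable
  qed
  have Heq: "(\<omega>, \<omega>') \<in> H \<longleftrightarrow> \<omega> \<in> D \<and> (\<exists>t\<in>{0..max 0 (h \<omega>)}. a < \<bar>W t \<omega>'\<bar>)"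
    if "\<omega> \<in> space M" "\<omega>' \<in> space M" for \<omega> \<omega>'
  proof -
    have "max 0 (max 0 (h \<omega>) * q) = max 0 (h \<omega>) * q" if "q \<in> {0..1} \<inter> \<rat>" for q
      using that by (auto simp: max_def)
    then show ?thesis
      using that exceeds_rational_iff[OF brownian_motionD(3)[OF W that(2)], of "max 0 (h \<omega>)" a]
      by (auto simp: H_def space_pair_measure sp)
  qed
  have DM: "D \<subseteq> space M" using sets.sets_into_space[OF D] sp by simp
  have id: "(\<lambda>\<omega>. \<omega>) \<in> measurable M N1" "(\<lambda>\<omega>. \<omega>) \<in> measurable M N2" using ind
    by (auto simp: indep_rv_def)
  have E: "E = (\<lambda>\<omega>. (\<omega>, \<omega>)) -` H \<inter> space M" using Heq DM by (auto simp: E_def)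
  have "(\<lambda>\<omega>. (\<omega>, \<omega>)) \<in> measurable M (N1 \<Otimes>\<^sub>M N2)" by (intro measurable_Pair id)
  from measurable_sets[OF this H] show Eev: "E \<in> events" by (simp add: E)
  have "emeasure M E = (\<integral>\<^sup>+\<omega>. indicator H (\<omega>, \<omega>) \<partial>M)"
    unfolding nn_integral_indicator[OF Eev, symmetric]
      by (intro nn_integral_cong) (simp add: E indicator_def)
  also have "\<dots> = (\<integral>\<^sup>+\<omega>. (\<integral>\<^sup>+\<omega>'. indicator H (\<omega>, \<omega>') \<partial>M) \<partial>M)"
    by (rule transfer_single[OF ind]) measurable
  also have "\<dots> \<le> (\<integral>\<^sup>+\<omega>. indicator D \<omega> * ennreal (max 0 (h \<omega>) / a\<^sup>2) \<partial>M)"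
  proof (intro nn_integral_mono)
    fix \<omega> assume \<omega>: "\<omega> \<in> space M"
    have h0: "max 0 (h \<omega>) \<ge> 0" by simp
    show "(\<integral>\<^sup>+\<omega>'. indicator H (\<omega>, \<omega>') \<partial>M) \<le> indicator D \<omega> * ennreal (max 0 (h \<omega>) / a\<^sup>2)"
    proof (cases "\<omega> \<in> D")
      case True
      have "(\<integral>\<^sup>+\<omega>'. indicator H (\<omega>, \<omega>') \<partial>M) =
          (\<integral>\<^sup>+\<omega>'. indicator {\<omega>' \<in> space M. \<exists>t\<in>{0..max 0 (h \<omega>)}. \<bar>W t \<omega>'\<bar> > a} \<omega>' \<partial>M)"
        by (intro nn_integral_cong) (use Heq[OF \<omega>] True in \<open>auto simp: indicator_def\<close>)
      also have "\<dots> = ennreal (prob {\<omega>' \<in> space M. \<exists>t\<in>{0..max 0 (h \<omega>)}. \<bar>W t \<omega>'\<bar> > a})"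
        using brownian_maximal(1)[OF W h0 a] by (simp add: emeasure_eq_measure)
      also have "\<dots> \<le> ennreal (max 0 (h \<omega>) / a\<^sup>2)"
        by (rule ennreal_leI[OF brownian_maximal(2)[OF W h0 a]])
      finally show ?thesis using True by simp
    next
      case False
      have "(\<integral>\<^sup>+\<omega>'. indicator H (\<omega>, \<omega>') \<partial>M) = (\<integral>\<^sup>+\<omega>'. 0 \<partial>M)"
        by (intro nn_integral_cong) (use Heq[OF \<omega>] False in \<open>auto simp: indicator_def\<close>)
      then show ?thesis by simp
    qed
  qed
  finally show "emeasure M E \<le> (\<integral>\<^sup>+\<omega>. indicator D \<omega> * ennreal (max 0 (h \<omega>) / a\<^sup>2) \<partial>M)" .
qed

section \<open>The bid process\<close>

lemma excursion_index_unique: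
  assumes bij: "bij_betw (\<lambda>k. (L k, R k)) (UNIV :: nat set) {(l, r). neg_excursion g l r}"
    and t: "t \<in> {L j..<R j}" "t \<in> {L k..<R k}"
  shows "j = k"
proof -
  have n: "neg_excursion g (L i) (R i)" for i using bij unfolding bij_betw_def by blast
  have "(L j, R j) = (L k, R k)" using neg_excursion_unique[OF n n t] by simp
  then show ?thesis using bij unfolding bij_betw_def inj_on_def by blast
qed

lemma bid_process_on_excursion:
  assumes bij: "bij_betw (\<lambda>k. (L k \<omega>, R k \<omega>)) UNIV {(l, r). neg_excursion g l r}"
    and t: "t \<in> {L k \<omega>..<R k \<omega>}"
  shows "bid_process \<kappa> c G L R C t \<omega> = \<kappa> + C k (t - L k \<omega>) \<omega> - c * G t \<omega>"
proof -
  have "(LEAST k. t \<in> {L k \<omega>..<R k \<omega>}) = k"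
  proof (rule Least_equality)
    fix j assume "t \<in> {L j \<omega>..<R j \<omega>}"
    then have "j = k" by (rule excursion_index_unique[OF bij _ t])
    then show "k \<le> j" by simp
  qed (rule t)
  moreover have "\<exists>k. t \<in> {L k \<omega>..<R k \<omega>}" using t by blast
  ultimately show ?thesis using t
    by (auto simp: bid_process_def stopped_bm_def excursion_def Let_def min_def)
qed

lemma bid_process_off_excursion:
  "\<nexists>k. t \<in> {L k \<omega>..<R k \<omega>} \<Longrightarrow> bid_process \<kappa> c G L R C t \<omega> = \<kappa>"
  unfolding bid_process_def by (rule if_not_P)

text \<open>Right after the end \<open>R k0 \<omega>\<close> of an excursion the bid stays close to \<open>\<kappa>\<close>, because only finitely many
  of the following excursions are large.\<close>

lemma bid_process_after_excursion:
  fixes L R :: "nat \<Rightarrow> 'a \<Rightarrow> real"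
  assumes bij: "bij_betw (\<lambda>k. (L k \<omega>, R k \<omega>)) UNIV {(l, r). neg_excursion (\<lambda>t. G t \<omega>) l r}"
    and G: "continuous_on {0..} (\<lambda>t. G t \<omega>)"
    and C: "\<And>k. continuous_on {0..} (\<lambda>t. C k t \<omega>)" "\<And>k. C k 0 \<omega> = 0"
    and \<kappa>: "\<kappa> > 0"
    and fin: "\<And>T::nat. finite {k. R k \<omega> \<le> real T \<and> (\<exists>t\<in>{0..R k \<omega> - L k \<omega>}. \<bar>C k t \<omega>\<bar> > \<kappa> / 2)}"
  shows "\<exists>\<eta>>0. \<forall>t. R k0 \<omega> \<le> t \<longrightarrow> t < R k0 \<omega> + \<eta> \<longrightarrow> bid_process \<kappa> c G L R C t \<omega> \<noteq> 0"
proof -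
  let ?V = "\<lambda>t. bid_process \<kappa> c G L R C t \<omega>"
  have n: "neg_excursion (\<lambda>t. G t \<omega>) (L i \<omega>) (R i \<omega>)" for i using bij unfolding bij_betw_def
    by blast
  have ne: "0 \<le> L i \<omega>" "L i \<omega> < R i \<omega>" "G (L i \<omega>) \<omega> = 0" "G (R i \<omega>) \<omega> = 0" for i
    using n[of i] by (auto simp: neg_excursion_def)
  have Vk: "?V t = \<kappa> + C k (t - L k \<omega>) \<omega> - c * G t \<omega>" if t: "t \<in> {L k \<omega>..<R k \<omega>}" for k t
  proof (rule bid_process_on_excursion)
    show "bij_betw (\<lambda>k. (L k \<omega>, R k \<omega>)) UNIV {(l, r). neg_excursion (\<lambda>t. G t \<omega>) l r}" by (rule bij)
    show "t \<in> {L k \<omega>..<R k \<omega>}" by (rule t)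
  qed
  define r where "r = R k0 \<omega>"
  have r: "r > 0" using ne[of k0] by (simp add: r_def)
  obtain T :: nat where T: "real T > r + 1" using reals_Archimedean2 by blast
  define big where "big = {k. R k \<omega> \<le> real T \<and> (\<exists>t\<in>{0..R k \<omega> - L k \<omega>}. \<bar>C k t \<omega>\<bar> > \<kappa> / 2)}"
  define cross where "cross = {k. L k \<omega> \<le> r + 1 \<and> real T < R k \<omega>}"
  have "finite cross"
  proof -
    have "j = k" if "j \<in> cross" "k \<in> cross" for j k
      using that T by (intro excursion_index_unique[OF bij, of "r + 1"]) (auto simp: cross_def)
    then have "cross \<subseteq> {k}" if "k \<in> cross" for k using that by blast
    then have "finite cross" if "k \<in> cross" for k using that finite_subset[of cross "{k}"] by blast
    then show ?thesis by (cases "cross = {}") auto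
  qed
  then have finB: "finite (big \<union> cross)" using fin[of T] by (simp add: big_def)
  have after: "r \<le> L k \<omega>" if t: "t \<in> {L k \<omega>..<R k \<omega>}" "r \<le> t" for k t
  proof (rule ccontr)
    assume "\<not> r \<le> L k \<omega>"
    then have "max (L k \<omega>) (L k0 \<omega>) \<in> {L k \<omega>..<R k \<omega>}" "max (L k \<omega>) (L k0 \<omega>) \<in> {L k0 \<omega>..<R k0 \<omega>}"
      using ne[of k0] ne[of k] t by (auto simp: r_def)
    then have "k = k0" by (rule excursion_index_unique[OF bij])
    then show False using t by (simp add: r_def)
  qed
  have Gsmall: "\<exists>d>0. \<forall>t. r \<le> t \<longrightarrow> t < r + d \<longrightarrow> \<bar>c * G t \<omega>\<bar> < e" if e: "e > 0" for e
  proof -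
    have "continuous_on {0..} (\<lambda>t. c * G t \<omega>)" by (intro continuous_intros G)
    moreover have "r \<in> {0..}" using r by simp
    ultimately obtain d where d: "d > 0" "\<And>t. t \<in> {0..} \<Longrightarrow> dist t r < d \<Longrightarrow>
        dist (c * G t \<omega>) (c * G r \<omega>) < e"
      using e unfolding continuous_on_iff by blast
    then show ?thesis using ne[of k0] r by (intro exI[of _ d]) (auto simp: r_def dist_real_def)
  qed
  have each: "\<exists>d>0. \<forall>t. t \<in> {L k \<omega>..<R k \<omega>} \<longrightarrow> r \<le> t \<longrightarrow> t < r + d \<longrightarrow> ?V t \<noteq> 0" for k
  proof (cases "L k \<omega> = r")
    case False
    show ?thesis
    proof (cases "r < L k \<omega>")
      case True
      then show ?thesis by (intro exI[of _ "L k \<omega> - r"]) auto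
    next
      case less: False
      have "\<not> (t \<in> {L k \<omega>..<R k \<omega>} \<and> r \<le> t)" for t using after[of t k] False less by auto
      then show ?thesis by (intro exI[of _ 1]) auto
    qed
  next
    case True
    obtain d1 where d1: "d1 > 0" "\<And>t. r \<le> t \<Longrightarrow> t < r + d1 \<Longrightarrow> \<bar>c * G t \<omega>\<bar> < \<kappa> / 2"
      using Gsmall[of "\<kappa> / 2"] \<kappa> by auto
    obtain d2 where d2: "d2 > 0" "\<And>t. t \<in> {0..} \<Longrightarrow> dist t 0 < d2 \<Longrightarrow> dist (C k t \<omega>) (C k 0 \<omega>) < \<kappa> / 2"
      using C(1)[of k] \<kappa> unfolding continuous_on_iff by (metis atLeast_iff half_gt_zero order_refl)
    have "?V t \<noteq> 0" if t: "t \<in> {L k \<omega>..<R k \<omega>}" "r \<le> t" "t < r + min d1 d2" for t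
    proof -
      have "\<bar>C k (t - L k \<omega>) \<omega>\<bar> < \<kappa> / 2" using d2(2)[of "t - L k \<omega>"] C(2)[of k] t True
        by (auto simp: dist_real_def)
      moreover have "\<bar>c * G t \<omega>\<bar> < \<kappa> / 2" using d1(2)[of t] t by simp
      ultimately show ?thesis unfolding Vk[OF t(1)] by linarith
    qed
    then show ?thesis using d1 d2 by (intro exI[of _ "min d1 d2"]) auto
  qed
  then obtain d where d: "\<And>k. d k > 0" "\<And>k t. t \<in> {L k \<omega>..<R k \<omega>} \<Longrightarrow> r \<le> t \<Longrightarrow> t < r + d k \<Longrightarrow> ?V t \<noteq> 0"
    by metis
  obtain d1 where d1: "d1 > 0" "\<And>t. r \<le> t \<Longrightarrow> t < r + d1 \<Longrightarrow> \<bar>c * G t \<omega>\<bar> < \<kappa> / 2"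
    using Gsmall[of "\<kappa> / 2"] \<kappa> by auto
  define \<eta> where "\<eta> = Min (insert 1 (insert d1 (d ` (big \<union> cross))))"
  have finS: "finite (insert 1 (insert d1 (d ` (big \<union> cross))))" using finB by simp
  then have "\<eta> > 0" unfolding \<eta>_def using d d1 by (subst Min_gr_iff) auto
  moreover have "\<eta> \<le> x" if "x \<in> insert 1 (insert d1 (d ` (big \<union> cross)))" for x
    unfolding \<eta>_def by (rule Min_le[OF finS that])
  ultimately have \<eta>: "\<eta> > 0" "\<eta> \<le> 1" "\<eta> \<le> d1" "\<And>k. k \<in> big \<union> cross \<Longrightarrow> \<eta> \<le> d k"
    by auto
  have "?V t \<noteq> 0" if t: "r \<le> t" "t < r + \<eta>" for t
  proof (cases "\<exists>k. t \<in> {L k \<omega>..<R k \<omega>}")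
    case False
    then show ?thesis using \<kappa> by (simp add: bid_process_off_excursion)
  next
    case True
    then obtain k where k: "t \<in> {L k \<omega>..<R k \<omega>}" by blast
    show ?thesis
    proof (cases "k \<in> big \<union> cross")
      case True
      then show ?thesis using d(2)[OF k t(1)] \<eta>(4)[OF True] t by simp
    next
      case False
      have "R k \<omega> \<le> real T" using False k t \<eta>(2) by (auto simp: cross_def)
      then have "\<bar>C k (t - L k \<omega>) \<omega>\<bar> \<le> \<kappa> / 2" using False k by (auto simp: big_def not_less)
      moreover have "\<bar>c * G t \<omega>\<bar> < \<kappa> / 2" using d1(2)[of t] t \<eta> by simp
      ultimately show ?thesis unfolding Vk[OF k] by linarith
    qed
  qed
  then show ?thesis using \<eta>(1) by (auto simp: r_def)
qed

lemma excursions_total_length: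
  assumes bij: "bij_betw (\<lambda>k. (L k, R k)) (UNIV :: nat set) {(l, r). neg_excursion g l r}"
      and T: "T \<ge> 0"
  shows "(\<Sum>k. indicator {k. R k \<le> T} k * ennreal (max 0 (R k - L k))) \<le> ennreal T"
proof -
  have n: "neg_excursion g (L i) (R i)" for i using bij unfolding bij_betw_def by blast
  have ne: "0 \<le> L i" "L i < R i" for i using n[of i] by (auto simp: neg_excursion_def)
  define A where "A k = (if R k \<le> T then {L k<..<R k} else {})" for k
  have "(\<Sum>k. indicator {k. R k \<le> T} k * ennreal (max 0 (R k - L k))) = (\<Sum>k. emeasure lborel (A k))"
    using ne by (intro suminf_cong) (auto simp: A_def indicator_def less_imp_le)
  also have "\<dots> = emeasure lborel (\<Union>k. A k)"
  proof (rule suminf_emeasure)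
    show "disjoint_family A" unfolding disjoint_family_on_def
    proof (intro ballI impI)
      fix j k :: nat assume "j \<noteq> k"
      then have "\<not> (t \<in> {L j..<R j} \<and> t \<in> {L k..<R k})" for t using excursion_index_unique[OF bij]
        by blast
      then show "A j \<inter> A k = {}" by (fastforce simp: A_def split: if_splits)
    qed
  qed (auto simp: A_def)
  also have "\<dots> \<le> emeasure lborel {0..T}"
    by (rule emeasure_mono) (use ne in \<open>auto simp: A_def split: if_splits intro: less_imp_le
        order_less_le_trans\<close>, fastforce intro: less_imp_le order.strict_trans1)
  finally show ?thesis using T by simp
qed

locale bid_ask = prob_space M for M :: "'a measure" +
  fixes \<sigma>p \<sigma>m \<rho> \<kappa> t0 :: real and B :: "real \<Rightarrow> 'a \<Rightarrow> real" and L R :: "nat \<Rightarrow> 'a \<Rightarrow> real"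
    and C :: "nat \<Rightarrow> real \<Rightarrow> 'a \<Rightarrow> real"
  assumes \<sigma>p: "\<sigma>p > 0" and \<sigma>m: "\<sigma>m > 0" and \<rho>: "-1 < \<rho>" "\<rho> < 0" and \<kappa>: "\<kappa> > 0" and t0: "t0 > 0"
    and B: "brownian_motion M 1 B"
    and LR: "neg_excursion_enumeration M (two_speed \<sigma>p \<sigma>m B) L R"
    and C: "\<And>k. brownian_motion M ((1 - \<rho>\<^sup>2) * \<sigma>p\<^sup>2) (C k)"
    and indepGC: "indep_vars (\<lambda>_. path_space)
                  (case_nat (sample_path (two_speed \<sigma>p \<sigma>m B)) (\<lambda>k. sample_path (C k))) (UNIV :: nat
                      set)"
begin

abbreviation "G \<equiv> two_speed \<sigma>p \<sigma>m B"
definition "N1 = vimage_algebra (space M) (sample_path G) path_space"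
definition "N2 k = vimage_algebra (space M) (sample_path (C k)) path_space"

lemma space_N: "space N1 = space M" "space (N2 k) = space M"
  by (simp_all add: N1_def N2_def)

lemma measurable_sample_path_algebra:
  assumes "t \<ge> 0"
  shows "W t \<in> borel_measurable (vimage_algebra (space M) (sample_path W) path_space)"
proof -
  have "sample_path W \<in> measurable (vimage_algebra (space M) (sample_path W) path_space) path_space"
    by (rule measurable_vimage_algebra1) (auto simp: space_PiM sample_path_def)
  from measurable_compose[OF this measurable_component_singleton[of t]] assms
  show ?thesis by (simp add: sample_path_def)
qed

lemma indep_N: "indep_rv M N1 (\<lambda>\<omega>. \<omega>) (N2 k) (\<lambda>\<omega>. \<omega>)"
proof -
  have i: "(\<forall>i. random_variable path_space (case_nat (sample_path G) (\<lambda>k. sample_path (C k)) i))"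
    "indep_sets (\<lambda>i. {case_nat (sample_path G) (\<lambda>k. sample_path (C k)) i -` A \<inter> space M |A. A \<in> sets
        path_space}) UNIV"
    using indepGC unfolding indep_vars_def2 by auto
  have "indep_rv M path_space (sample_path G) path_space (sample_path (C k))"
    unfolding indep_rv_def
  proof (intro conjI ballI)
    show "sample_path G \<in> measurable M path_space" using i(1)[rule_format, of 0] by simp
    show "sample_path (C k) \<in> measurable M path_space" using i(1)[rule_format, of "Suc k"] by simp
    fix A A' assume A: "A \<in> sets path_space" "A' \<in> sets path_space"
    define F where "F j = (if j =
        0 then sample_path G -` A \<inter> space M else sample_path (C k) -` A' \<inter> space M)" for j :: nat
    have "prob (\<Inter>j\<in>{0, Suc k}. F j) = (\<Prod>j\<in>{0, Suc k}. prob (F j))"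
      by (rule indep_setsD[OF i(2)]) (use A in \<open>auto simp: F_def\<close>)
    then show "prob ((sample_path G -` A \<inter> space M) \<inter> (sample_path (C k) -` A' \<inter> space M)) =
       prob (sample_path G -` A \<inter> space M) * prob (sample_path (C k) -` A' \<inter> space M)"
      by (simp add: F_def Int_commute)
  qed
  then have "indep_rv M N1 (\<lambda>\<omega>. \<omega>) path_space (sample_path (C k))"
    unfolding N1_def by (rule indep_rv_vimage_algebra)
  from indep_rv_vimage_algebra[OF indep_rv_sym[OF this]] show ?thesis unfolding N2_def
    by (rule indep_rv_sym)
qed

lemma LR_N1 [measurable]: "L k \<in> borel_measurable N1" "R k \<in> borel_measurable N1"
  using LR by (auto simp: neg_excursion_enumeration_def N1_def)

lemma N1_sub: "f \<in> measurable N1 K \<Longrightarrow> f \<in> measurable M K"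
proof -
  assume f: "f \<in> measurable N1 K"
  have "(\<lambda>\<omega>. \<omega>) \<in> measurable M N1" using indep_N[of 0] unfolding indep_rv_def by blast
  from measurable_compose[OF this f] show ?thesis .
qed

lemma G_N1: "t \<ge> 0 \<Longrightarrow> G t \<in> borel_measurable N1"
  unfolding N1_def by (rule measurable_sample_path_algebra)

lemma C_N2: "t \<ge> 0 \<Longrightarrow> C k t \<in> borel_measurable (N2 k)"
  unfolding N2_def by (rule measurable_sample_path_algebra)

lemma AE_enum: "AE \<omega> in M. bij_betw (\<lambda>k. (L k \<omega>, R k \<omega>)) UNIV {(l, r). neg_excursion (\<lambda>t. G t \<omega>) l
    r}"
  using LR by (simp add: neg_excursion_enumeration_def)

definition kx :: "'a \<Rightarrow> nat" where "kx \<omega> = (LEAST k. t0 \<in> {L k \<omega>..<R k \<omega>})"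

lemma kx_N1 [measurable]: "kx \<in> measurable N1 (count_space UNIV)"
  unfolding kx_def[abs_def] atLeastLessThan_iff by measurable

lemma start_excursion:
  "AE \<omega> in M. G t0 \<omega> < 0 \<longrightarrow> neg_excursion (\<lambda>t. G t \<omega>) (L (kx \<omega>) \<omega>) (R (kx \<omega>) \<omega>) \<and> L (kx \<omega>) \<omega> < t0 \<and>
      t0 < R (kx \<omega>) \<omega>"
  using AE_enum brownian_zero_set_null[OF B] brownian_recurrent[OF B] AE_space
proof eventually_elim
  case (elim \<omega>)
  show ?case
  proof
    assume neg: "G t0 \<omega> < 0"
    interpret clock_path \<sigma>p \<sigma>m "\<lambda>s. B s \<omega>"
      by unfold_locales (use \<sigma>p \<sigma>m brownian_motionD(2,3)[OF B elim(4)] in auto)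
    have bij: "bij_betw cl {0..} {0..}" by (rule clock_bij[OF elim(2)])
    have G: "G t \<omega> = g t" for t by (simp add: two_speed_eq)
    have S0: "ci t0 \<ge> 0" using ci(1)[OF bij, of t0] t0 by simp
    obtain u where u: "u \<ge> ci t0" "B u \<omega> \<ge> 0" using elim(3) by blast
    have u0: "u \<ge> 0" using u S0 by simp
    have "cl u \<ge> t0" using clock_mono[OF S0 u(1)] ci(2)[OF bij, of t0] t0 by simp
    moreover have "g (cl u) \<ge> 0" using u u0 ci(3)[OF bij, of u] by (simp add: g_eq[OF bij])
    moreover have "g t0 < 0" using neg by (simp add: G)
    ultimately have "\<exists>l r. neg_excursion g l r \<and> l < t0 \<and> t0 < r"
      by (intro neg_excursion_exists[OF g_continuous g_0 t0])
    then obtain l r where lr: "neg_excursion g l r" "l < t0" "t0 < r" by blast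
    have "(l, r) \<in> range (\<lambda>k. (L k \<omega>, R k \<omega>))"
      using elim(1) lr(1) unfolding bij_betw_def by (simp add: G)
    then obtain k where k: "L k \<omega> = l" "R k \<omega> = r" by auto
    have "t0 \<in> {L k \<omega>..<R k \<omega>}" using k lr by simp
    then have "t0 \<in> {L (kx \<omega>) \<omega>..<R (kx \<omega>) \<omega>}" unfolding kx_def by (rule LeastI)
    then have "kx \<omega> = k" by (rule excursion_index_unique[OF elim(1)]) (use k lr in simp)
    then show "neg_excursion (\<lambda>t. G t \<omega>) (L (kx \<omega>) \<omega>) (R (kx \<omega>) \<omega>) \<and> L (kx \<omega>) \<omega> < t0 \<and> t0 <
        R (kx \<omega>) \<omega>"
      using k lr by (simp add: G)
  qed
qed

lemma finitely_many_large:
  assumes a: "a > 0"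
  shows "AE \<omega> in M. \<forall>T::nat. finite {k. R k \<omega> \<le> real T \<and> (\<exists>t\<in>{0..R k \<omega> - L k \<omega>}. \<bar>C k t \<omega>\<bar> > a)}"
proof (subst AE_all_countable, intro allI)
  fix T :: nat
  define v where "v = (1 - \<rho>\<^sup>2) * \<sigma>p\<^sup>2"
  have "\<rho>\<^sup>2 < 1" using \<rho> by (simp add: abs_square_less_1)
  then have v: "v > 0" using \<sigma>p by (simp add: v_def)
  define W where "W k u \<omega> = 1 / sqrt v * C k (1 * u) \<omega>" for k u \<omega>
  have W: "brownian_motion M 1 (W k)" for k
    unfolding W_def[abs_def]
    by (rule brownian_motion_scale[OF C]) (use v in \<open>simp_all add: v_def[symmetric] power_divide\<close>)
  have W_N2: "W k t \<in> borel_measurable (N2 k)" if "t \<ge> 0" for k t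
    unfolding W_def[abs_def] using C_N2[OF that, of k] by simp
  define a' where "a' = a / sqrt v"
  have a': "a' > 0" using a v by (simp add: a'_def)
  have Wgt: "\<bar>W k t \<omega>\<bar> > a' \<longleftrightarrow> \<bar>C k t \<omega>\<bar> > a" for k t \<omega>
    using v by (simp add: W_def a'_def abs_mult divide_less_cancel)
  define D where "D k = {\<omega> \<in> space N1. R k \<omega> \<le> real T}" for k
  have [measurable]: "D k \<in> sets N1" for k unfolding D_def by measurable
  define h where "h k \<omega> = R k \<omega> - L k \<omega>" for k \<omega>
  have hm [measurable]: "h k \<in> borel_measurable N1" for k unfolding h_def[abs_def] by measurable
  define E where "E k = {\<omega> \<in> D k. \<exists>t\<in>{0..max 0 (h k \<omega>)}. \<bar>W k t \<omega>\<bar> > a'}" for k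
  note rm = random_maximal[OF W a' space_N indep_N W_N2 hm \<open>D _ \<in> sets N1\<close>]
  have E: "E k \<in> events" for k unfolding E_def by (rule rm(1))
  have E_le: "emeasure M (E k) \<le> (\<integral>\<^sup>+\<omega>. indicator (D k) \<omega> * ennreal (max 0 (h k \<omega>) / a'\<^sup>2) \<partial>M)"
      for k
    unfolding E_def by (rule rm(2))
  have DM [measurable]: "D k \<in> events" for k
  proof -
    have "R k \<in> borel_measurable M" by (rule N1_sub) (rule LR_N1)
    then show ?thesis unfolding D_def space_N by measurable
  qed
  have hM [measurable]: "h k \<in> borel_measurable M" for k by (rule N1_sub[OF hm])
  have "(\<Sum>k. emeasure M (E k)) \<le> (\<Sum>k. \<integral>\<^sup>+\<omega>. indicator (D k) \<omega> * ennreal (max 0 (h k \<omega>) / a'\<^sup>2) \<partial>M)"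
    by (intro suminf_le E_le) auto
  also have "\<dots> = (\<integral>\<^sup>+\<omega>. (\<Sum>k. indicator (D k) \<omega> * ennreal (max 0 (h k \<omega>) / a'\<^sup>2)) \<partial>M)"
    by (rule nn_integral_suminf[symmetric]) measurable
  also have "\<dots> \<le> (\<integral>\<^sup>+\<omega>. ennreal (1 / a'\<^sup>2) * ennreal (real T) \<partial>M)"
  proof (rule nn_integral_mono_AE)
    show "AE \<omega> in M. (\<Sum>k. indicator (D k) \<omega> * ennreal (max 0 (h k \<omega>) / a'\<^sup>2)) \<le>
        ennreal (1 / a'\<^sup>2) * ennreal (real T)"
      using AE_enum AE_space
    proof eventually_elim
      case (elim \<omega>)
      have m: "ennreal (max 0 y / a'\<^sup>2) = ennreal (1 / a'\<^sup>2) * ennreal (max 0 y)" for y :: real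
        by (subst ennreal_mult[symmetric]) auto
      have "(\<Sum>k. indicator (D k) \<omega> * ennreal (max 0 (h k \<omega>) / a'\<^sup>2)) =
        (\<Sum>k. ennreal (1 / a'\<^sup>2) * (indicator {k. R k \<omega> \<le>
            real T} k * ennreal (max 0 (R k \<omega> - L k \<omega>))))"
        by (intro suminf_cong) (use elim(2) in \<open>simp add: D_def h_def indicator_def space_N m\<close>)
      also have "\<dots> = ennreal (1 / a'\<^sup>2) * (\<Sum>k. indicator {k. R k \<omega> \<le>
          real T} k * ennreal (max 0 (R k \<omega> - L k \<omega>)))"
        by (rule ennreal_suminf_cmult)
      also have "\<dots> \<le> ennreal (1 / a'\<^sup>2) * ennreal (real T)"
        by (intro mult_left_mono excursions_total_length[OF elim(1)]) auto
      finally show ?case .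
    qed
  qed
  also have "\<dots> < top" by (simp add: emeasure_space_1 ennreal_mult_less_top)
  finally have "(\<Sum>k. ennreal (prob (E k))) < top" by (simp add: emeasure_eq_measure)
  then have "summable (\<lambda>k. prob (E k))" by (intro summable_suminf_not_top) auto
  then have "AE \<omega> in M. eventually (\<lambda>k. \<omega> \<in> space M - E k) sequentially"
    by (intro borel_cantelli_AE1 E) (auto simp: emeasure_eq_measure)
  then show "AE \<omega> in M. finite {k. R k \<omega> \<le> real T \<and> (\<exists>t\<in>{0..R k \<omega> - L k \<omega>}. \<bar>C k t \<omega>\<bar> > a)}"
    using AE_enum
  proof eventually_elim
    case (elim \<omega>)
    then obtain k0 where k0: "\<And>k. k \<ge> k0 \<Longrightarrow> \<omega> \<in> space M - E k"
      by (auto simp: eventually_sequentially)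
    have "{k. R k \<omega> \<le> real T \<and> (\<exists>t\<in>{0..R k \<omega> - L k \<omega>}. \<bar>C k t \<omega>\<bar> > a)} \<subseteq> {..<k0}"
    proof
      fix k assume k: "k \<in> {k. R k \<omega> \<le> real T \<and> (\<exists>t\<in>{0..R k \<omega> - L k \<omega>}. \<bar>C k t \<omega>\<bar> > a)}"
      show "k \<in> {..<k0}"
      proof (rule ccontr)
        assume "k \<notin> {..<k0}"
        then have "\<omega> \<in> space M" "\<omega> \<notin> E k" using k0[of k] by auto
        then show False using k Wgt by (auto simp: E_def D_def h_def space_N max_def)
      qed
    qed
    then show ?case by (rule finite_subset) simp
  qed
qed

end

section \<open>The conditional law\<close>

lemma hit_zero_eqI:
  assumes "t0 \<le> t" "W t \<omega> = 0" "\<And>u. t0 \<le> u \<Longrightarrow> u < t \<Longrightarrow> W u \<omega> \<noteq> 0"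
  shows "hit_zero t0 W \<omega> = ereal t"
  unfolding hit_zero_def
proof (rule Inf_eqI)
  fix y assume "y \<in> {ereal u |u. t0 \<le> u \<and> W u \<omega> = 0}"
  then show "ereal t \<le> y" using assms(3) by (force simp: not_less[symmetric])
qed (use assms in auto)

lemma hit_zero_le: "t0 \<le> t \<Longrightarrow> W t \<omega> = 0 \<Longrightarrow> hit_zero t0 W \<omega> \<le> ereal t"
  unfolding hit_zero_def by (rule Inf_lower) auto

lemma hit_zero_ge: "(\<And>u. t0 \<le> u \<Longrightarrow> W u \<omega> = 0 \<Longrightarrow> t \<le> u) \<Longrightarrow> ereal t \<le> hit_zero t0 W \<omega>"
  unfolding hit_zero_def by (rule Inf_greatest) auto

context bid_ask
begin

definition rs :: real where "rs = sqrt (1 - \<rho>\<^sup>2)"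
definition sc :: real where "sc = \<sigma>m / (rs * \<sigma>p)"
definition cot :: real where "cot = - \<rho> / rs"
definition Ch :: "nat \<Rightarrow> real \<Rightarrow> 'a \<Rightarrow> real" where "Ch k u \<omega> = sc * C k (1 / \<sigma>m\<^sup>2 * u) \<omega>"

abbreviation "V \<equiv> bid_process \<kappa> (\<rho> * \<sigma>p / \<sigma>m) G L R C"
abbreviation "X \<equiv> (\<lambda>t \<omega>. min (G t \<omega>) 0)"

lemma rs: "rs > 0" "rs\<^sup>2 = 1 - \<rho>\<^sup>2"
proof -
  have "\<rho>\<^sup>2 < 1" using \<rho> by (simp add: abs_square_less_1)
  then show "rs > 0" "rs\<^sup>2 = 1 - \<rho>\<^sup>2" by (simp_all add: rs_def)
qed

lemma sc: "sc > 0" using rs \<sigma>p \<sigma>m by (simp add: sc_def)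

lemma cot: "cot > 0" using rs \<rho> by (simp add: cot_def divide_neg_pos)

lemma sc_mult: "sc * (\<rho> * \<sigma>p / \<sigma>m) = - cot"
  using rs \<sigma>p \<sigma>m by (simp add: sc_def cot_def)

lemma Ch_brownian: "brownian_motion M 1 (Ch k)"
  unfolding Ch_def[abs_def]
proof (rule brownian_motion_scale[OF C])
  show "sc\<^sup>2 * ((1 - \<rho>\<^sup>2) * \<sigma>p\<^sup>2) * (1 / \<sigma>m\<^sup>2) = 1"
    using rs \<sigma>p \<sigma>m unfolding rs(2)[symmetric] by (simp add: sc_def power_divide power_mult_distrib)
qed (use sc \<sigma>m in auto)

lemma kx_M [measurable]: "kx \<in> measurable M (count_space UNIV)"
  by (rule N1_sub[OF kx_N1])

lemma l_N1: "(\<lambda>\<omega>. L (kx \<omega>) \<omega>) \<in> borel_measurable N1" "(\<lambda>\<omega>. R (kx \<omega>) \<omega>) \<in> borel_measurable N1"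
  by (rule measurable_compose_countable[where f = L, OF LR_N1(1) kx_N1],
      rule measurable_compose_countable[where f = R, OF LR_N1(2) kx_N1])

sublocale PT: planar_transfer M \<sigma>p \<sigma>m B Ch "sc * \<kappa>" t0 kx "\<lambda>\<omega>. L (kx \<omega>) \<omega>" "\<lambda>\<omega>. R (kx \<omega>) \<omega>" cot N1
    N2
proof unfold_locales
  show "Ch k t \<in> borel_measurable (N2 k)" if "t \<ge> 0" for k t
    unfolding Ch_def[abs_def] using C_N2[of "1 / \<sigma>m\<^sup>2 * t" k] that by simp
qed (use \<sigma>p \<sigma>m B Ch_brownian t0 kx_M cot N1_sub[OF l_N1(1)] N1_sub[OF l_N1(2)] N1_sub[OF G_N1]
    start_excursion
      space_N indep_N G_N1 kx_N1 l_N1 in auto)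

definition coord :: "real \<times> real \<Rightarrow> complex" where
  "coord y = Complex (sc * fst y - cot * snd y) (- snd y)"

definition coord_inv :: "complex \<Rightarrow> real \<times> real" where
  "coord_inv w = ((Re w - cot * Im w) / sc, - Im w)"

lemma coord_inv: "coord_inv (coord y) = y"
  using sc by (simp add: coord_def coord_inv_def)

lemma wedge_dist_coord: "wedge_dist cot (coord y) > 0 \<longleftrightarrow> fst y > 0 \<and> snd y < 0"
  using sc by (auto simp: wedge_dist_def coord_def zero_less_mult_iff)

lemma coord_diag:
  "AE \<omega> in M. G t0 \<omega> < 0 \<longrightarrow> PT.pth (\<omega>, \<omega>) 0 = coord (V t0 \<omega>, X t0 \<omega>) \<and>
     ((\<omega>, \<omega>) \<in> PT.hits \<longleftrightarrow> (\<exists>t. t0 \<le> t \<and> t < R (kx \<omega>) \<omega> \<and> V t \<omega> = 0))"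
  using AE_enum start_excursion AE_space
proof eventually_elim
  case (elim \<omega>)
  show ?case
  proof
    assume neg: "G t0 \<omega> < 0"
    define k where "k = kx \<omega>"
    have k: "L k \<omega> < t0" "t0 < R k \<omega>" using elim(2) neg by (auto simp: k_def)
    have Vt: "V t \<omega> = \<kappa> + C k (t - L k \<omega>) \<omega> - \<rho> * \<sigma>p / \<sigma>m * G t \<omega>" if "t0 \<le> t" "t < R k \<omega>" for t
      by (rule bid_process_on_excursion) (use elim(1) that k in auto)
    have age: "PT.age \<omega> = \<sigma>m\<^sup>2 * (t0 - L k \<omega>)" using k by (simp add: PT.age_def k_def)
    have Cu: "1 / \<sigma>m\<^sup>2 * max 0 (PT.age \<omega> + u) = t0 + u / \<sigma>m\<^sup>2 - L k \<omega>" if "0 \<le> u" for u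
    proof -
      have "0 \<le> PT.age \<omega> + u" using that by (simp add: PT.age_def)
      then show ?thesis using \<sigma>m by (simp add: age field_simps)
    qed
    have zeta: "PT.zeta (\<omega>, \<omega>) u = sc * V (t0 + u / \<sigma>m\<^sup>2) \<omega>" if u: "0 \<le> u" "u < PT.life \<omega>" for u
    proof -
      have "u / \<sigma>m\<^sup>2 < PT.life \<omega> / \<sigma>m\<^sup>2" using u \<sigma>m by (intro divide_strict_right_mono) auto
      then have t: "t0 + u / \<sigma>m\<^sup>2 < R k \<omega>" using \<sigma>m by (simp add: PT.life_def k_def)
      have t': "0 \<le> u / \<sigma>m\<^sup>2" using u by simp
      have "sc * (\<rho> * \<sigma>p / \<sigma>m * x) = - cot * x" for x using sc_mult by (metis mult.assoc)
      then have "sc * V (t0 + u / \<sigma>m\<^sup>2) \<omega> = sc * \<kappa> + sc * C k (t0 + u / \<sigma>m\<^sup>2 - L k \<omega>) \<omega> +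
          cot * G (t0 + u / \<sigma>m\<^sup>2) \<omega>"
        using Vt[of "t0 + u / \<sigma>m\<^sup>2"] t t' by (simp add: right_diff_distrib distrib_left)
      then show ?thesis using Cu[OF u(1)] t' t0 by (simp add: PT.zeta_def Ch_def k_def)
    qed
    have life: "PT.life \<omega> > 0" using k \<sigma>m by (simp add: PT.life_def k_def)
    have X: "X t0 \<omega> = G t0 \<omega>" using neg by simp
    have "Re (PT.pth (\<omega>, \<omega>) u) = PT.zeta (\<omega>, \<omega>) u + cot * Im (PT.pth (\<omega>, \<omega>) u)" for u
      by (simp add: PT.pth_def PT.zeta_def)
    from this[of 0] have "PT.pth (\<omega>, \<omega>) 0 = coord (V t0 \<omega>, X t0 \<omega>)"
      using zeta[of 0] life t0 by (simp add: complex_eq_iff coord_def X PT.pth_def)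
    moreover have "(\<omega>, \<omega>) \<in> PT.hits \<longleftrightarrow> (\<exists>t. t0 \<le> t \<and> t < R k \<omega> \<and> V t \<omega> = 0)"
    proof
      assume "(\<omega>, \<omega>) \<in> PT.hits"
      then obtain u where u: "0 \<le> u" "u < PT.life \<omega>" "PT.zeta (\<omega>, \<omega>) u = 0"
        by (auto simp: PT.hits_def)
      have "u / \<sigma>m\<^sup>2 < PT.life \<omega> / \<sigma>m\<^sup>2" using u \<sigma>m by (intro divide_strict_right_mono) auto
      then have "t0 + u / \<sigma>m\<^sup>2 < R k \<omega>" using \<sigma>m by (simp add: PT.life_def k_def)
      moreover have "V (t0 + u / \<sigma>m\<^sup>2) \<omega> = 0" using zeta[OF u(1,2)] u(3) sc by simp
      ultimately show "\<exists>t. t0 \<le> t \<and> t < R k \<omega> \<and> V t \<omega> = 0" using u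
        by (intro exI[of _ "t0 + u / \<sigma>m\<^sup>2"]) auto
    next
      assume "\<exists>t. t0 \<le> t \<and> t < R k \<omega> \<and> V t \<omega> = 0"
      then obtain t where t: "t0 \<le> t" "t < R k \<omega>" "V t \<omega> = 0" by blast
      define u where "u = \<sigma>m\<^sup>2 * (t - t0)"
      have u: "0 \<le> u" "u < PT.life \<omega>" using t \<sigma>m by (auto simp: u_def PT.life_def k_def)
      have "t0 + u / \<sigma>m\<^sup>2 = t" using \<sigma>m by (simp add: u_def)
      then have "PT.zeta (\<omega>, \<omega>) u = 0" using zeta[OF u] t by simp
      then show "(\<omega>, \<omega>) \<in> PT.hits" using u elim(3) by (auto simp: PT.hits_def space_pair_measure)
    qed
    ultimately show "PT.pth (\<omega>, \<omega>) 0 = coord (V t0 \<omega>, X t0 \<omega>) \<and>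
     ((\<omega>, \<omega>) \<in> PT.hits \<longleftrightarrow> (\<exists>t. t0 \<le> t \<and> t < R (kx \<omega>) \<omega> \<and> V t \<omega> = 0))" by (simp add: k_def)
  qed
qed

lemma compare_hitting:
  "AE \<omega> in M. X t0 \<omega> < 0 \<longrightarrow>
     ((\<omega>, \<omega>) \<in> PT.hits \<longleftrightarrow> hit_zero t0 V \<omega> < hit_zero t0 X \<omega>) \<and>
     ((\<omega>, \<omega>) \<notin> PT.hits \<longleftrightarrow> hit_zero t0 X \<omega> < hit_zero t0 V \<omega>)"
  using coord_diag AE_enum start_excursion finitely_many_large[OF half_gt_zero[OF \<kappa>]] AE_space
proof eventually_elim
  case (elim \<omega>)
  show ?case
  proof
    assume "X t0 \<omega> < 0"
    then have neg: "G t0 \<omega> < 0" by simp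
    define r where "r = R (kx \<omega>) \<omega>"
    have e: "neg_excursion (\<lambda>t. G t \<omega>) (L (kx \<omega>) \<omega>) r" "L (kx \<omega>) \<omega> < t0" "t0 < r"
      using elim(3) neg by (auto simp: r_def)
    have G_neg: "G u \<omega> < 0" if "t0 \<le> u" "u < r" for u
    proof -
      have "u \<in> {L (kx \<omega>) \<omega><..<r}" using e(2) that by simp
      then show ?thesis using e(1) unfolding neg_excursion_def by blast
    qed
    have "G r \<omega> = 0" using e(1) by (simp add: neg_excursion_def)
    then have hX: "hit_zero t0 X \<omega> = ereal r"
      by (intro hit_zero_eqI) (use e(3) G_neg in \<open>force simp: min_def\<close>)+
    have "(\<omega>, \<omega>) \<in> PT.hits \<Longrightarrow> hit_zero t0 V \<omega> < hit_zero t0 X \<omega>"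
    proof -
      assume "(\<omega>, \<omega>) \<in> PT.hits"
      then obtain t where t: "t0 \<le> t" "t < r" "V t \<omega> = 0" using elim(1) neg by (auto simp: r_def)
      have "hit_zero t0 V \<omega> \<le> ereal t" by (rule hit_zero_le[where W = V, OF t(1,3)])
      also have "\<dots> < ereal r" using t by simp
      finally show ?thesis by (simp add: hX)
    qed
    moreover have "(\<omega>, \<omega>) \<notin> PT.hits \<Longrightarrow> hit_zero t0 X \<omega> < hit_zero t0 V \<omega>"
    proof -
      assume "(\<omega>, \<omega>) \<notin> PT.hits"
      then have no: "V t \<omega> \<noteq> 0" if "t0 \<le> t" "t < r" for t using elim(1) neg that
        by (auto simp: r_def)
      have "\<exists>\<eta>>0. \<forall>t. R (kx \<omega>) \<omega> \<le> t \<longrightarrow> t < R (kx \<omega>) \<omega> + \<eta> \<longrightarrow> V t \<omega> \<noteq> 0"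
      proof (rule bid_process_after_excursion)
        show "bij_betw (\<lambda>k. (L k \<omega>, R k \<omega>)) UNIV {(l, r). neg_excursion (\<lambda>t. G t \<omega>) l r}"
          by (rule elim(2))
        show "continuous_on {0..} (\<lambda>t. G t \<omega>)" by (rule two_speed_continuous(1)[OF B \<sigma>p \<sigma>m elim(5)])
        show "continuous_on {0..} (\<lambda>t. C k t \<omega>)" "C k 0 \<omega> = 0" for k
          using brownian_motionD(3,2)[OF C elim(5)] by auto
        show "finite {k. R k \<omega> \<le> real T \<and> (\<exists>t\<in>{0..R k \<omega> - L k \<omega>}. \<kappa> / 2 < \<bar>C k t \<omega>\<bar>)}" for T :: nat
          using elim(4) by blast
      qed (rule \<kappa>)
      then obtain \<eta> where \<eta>: "\<eta> > 0" "\<And>t. r \<le> t \<Longrightarrow> t < r + \<eta> \<Longrightarrow> V t \<omega> \<noteq> 0" by (auto simp: r_def)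
      have "ereal (r + \<eta>) \<le> hit_zero t0 V \<omega>"
      proof (rule hit_zero_ge)
        fix u assume u: "t0 \<le> u" "V u \<omega> = 0"
        show "r + \<eta> \<le> u"
        proof (rule ccontr)
          assume "\<not> r + \<eta> \<le> u"
          then show False using u no[of u] \<eta>(2)[of u] by (cases "u < r") auto
        qed
      qed
      moreover have "ereal r < ereal (r + \<eta>)" using \<eta> by simp
      ultimately show ?thesis unfolding hX by order
    qed
    ultimately show "((\<omega>, \<omega>) \<in> PT.hits \<longleftrightarrow> hit_zero t0 V \<omega> < hit_zero t0 X \<omega>) \<and>
     ((\<omega>, \<omega>) \<notin> PT.hits \<longleftrightarrow> hit_zero t0 X \<omega> < hit_zero t0 V \<omega>)"
       by (cases "(\<omega>, \<omega>) \<in> PT.hits") (simp_all add: order_less_imp_not_less)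
  qed
qed

lemma coord_measurable: "coord \<in> borel_measurable borel" "coord_inv \<in> borel_measurable borel"
proof -
  have "coord \<in> borel_measurable (borel \<Otimes>\<^sub>M borel)" unfolding coord_def[abs_def] by measurable
  then show "coord \<in> borel_measurable borel" by (simp add: borel_prod)
  have "coord_inv \<in> measurable borel (borel \<Otimes>\<^sub>M borel)" unfolding coord_inv_def[abs_def]
    by measurable
  then show "coord_inv \<in> borel_measurable borel" by (simp add: borel_prod)
qed

lemma angle_identity:
  assumes A: "A \<in> sets borel" "A \<subseteq> {y. fst y > 0 \<and> snd y < 0}"
  shows "(\<integral>\<^sup>+\<omega>. indicator A (V t0 \<omega>, X t0 \<omega>) * ennreal (Im (Ln (coord (V t0 \<omega>, X t0 \<omega>)))) \<partial>M) =
    (\<integral>\<^sup>+\<omega>. indicator A (V t0 \<omega>, X t0 \<omega>) * ennreal (arctan (1 / cot) * indicator {\<omega>. hit_zero t0 V \<omega>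
        < hit_zero t0 X \<omega>} \<omega>) \<partial>M)"
proof -
  define A' where "A' = coord_inv -` A \<inter> wedge cot 0"
  have A': "A' \<in> sets borel" "A' \<subseteq> wedge cot 0"
    using measurable_sets[OF coord_measurable(2) A(1)] by (auto simp: A'_def)
  have mem: "coord y \<in> A' \<longleftrightarrow> y \<in> A" for y
    using A(2) wedge_dist_coord[of y] by (auto simp: A'_def coord_inv)
  have AE: "AE \<omega> in M. (PT.pth (\<omega>, \<omega>) 0 \<in> A' \<longleftrightarrow> (V t0 \<omega>, X t0 \<omega>) \<in> A) \<and>
    ((V t0 \<omega>, X t0 \<omega>) \<in> A \<longrightarrow> PT.pth (\<omega>, \<omega>) 0 = coord (V t0 \<omega>, X t0 \<omega>) \<and>
      ((\<omega>, \<omega>) \<in> PT.hits \<longleftrightarrow> hit_zero t0 V \<omega> < hit_zero t0 X \<omega>))"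
    using coord_diag compare_hitting
  proof eventually_elim
    case (elim \<omega>)
    show ?case
    proof (cases "G t0 \<omega> < 0")
      case True
      then show ?thesis using elim mem by auto
    next
      case False
      then have "PT.pth (\<omega>, \<omega>) 0 \<notin> A'" using t0 by (auto simp: A'_def wedge_dist_def PT.pth_def)
      moreover have "(V t0 \<omega>, X t0 \<omega>) \<notin> A" using A(2) False by auto
      ultimately show ?thesis by simp
    qed
  qed
  have "(\<integral>\<^sup>+\<omega>. indicator A (V t0 \<omega>, X t0 \<omega>) * ennreal (Im (Ln (coord (V t0 \<omega>, X t0 \<omega>)))) \<partial>M) =
    (\<integral>\<^sup>+\<omega>. indicator A' (PT.pth (\<omega>, \<omega>) 0) * ennreal (Im (Ln (PT.pth (\<omega>, \<omega>) 0))) \<partial>M)"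
    by (rule nn_integral_cong_AE) (use AE in eventually_elim, auto simp: indicator_def)
  also have "\<dots> = (\<integral>\<^sup>+\<omega>. indicator A' (PT.pth (\<omega>, \<omega>) 0) * ennreal (arctan (1 / cot) * indicator
      PT.hits (\<omega>, \<omega>)) \<partial>M)"
    by (rule PT.hits_diag[OF A'])
  also have "\<dots> = (\<integral>\<^sup>+\<omega>. indicator A (V t0 \<omega>, X t0 \<omega>) * ennreal (arctan (1 / cot) * indicator {\<omega>.
      hit_zero t0 V \<omega> < hit_zero t0 X \<omega>} \<omega>) \<partial>M)"
    by (rule nn_integral_cong_AE) (use AE in eventually_elim, auto simp: indicator_def)
  finally show ?thesis .
qed

lemma angle_coord:
  assumes "v > 0" "x < 0"
  shows "Im (Ln (coord (v, x))) = arctan (\<sigma>p * sqrt (1 - \<rho>\<^sup>2) * \<bar>x\<bar> / (\<sigma>m * v + \<sigma>p * \<rho> * x))"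
proof -
  have "wedge_dist cot (coord (v, x)) > 0" using assms by (simp add: wedge_dist_coord)
  then have Re: "Re (coord (v, x)) > 0" using Re_gt_wedge[OF cot, of 0] by simp
  have "rs * \<sigma>p * (sc * v - cot * x) = \<sigma>m * v + \<sigma>p * \<rho> * x"
    using rs \<sigma>p by (simp add: sc_def cot_def field_simps)
  then have "\<sigma>p * rs * \<bar>x\<bar> / (\<sigma>m * v + \<sigma>p * \<rho> * x) =
      (rs * \<sigma>p * - x) / (rs * \<sigma>p * (sc * v - cot * x))"
    using assms by (simp add: mult_ac)
  also have "\<dots> = - x / (sc * v - cot * x)" using rs \<sigma>p by (subst mult_divide_mult_cancel_left) auto
  also have "\<dots> = Im (coord (v, x)) / Re (coord (v, x))" by (simp add: coord_def)
  finally show ?thesis using Im_Ln_eq_arctan[OF Re] by (simp add: rs_def)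
qed

lemma conditional_exit_probability:
  assumes K: "regular_cond_distr M borel (\<lambda>\<omega>. (V t0 \<omega>, X t0 \<omega>)) borel (\<lambda>\<omega>. (hit_zero t0 V \<omega>,
      hit_zero t0 X \<omega>)) K"
  defines "\<alpha> \<equiv> arctan (- (sqrt (1 - \<rho>\<^sup>2) / \<rho>))"
  shows "AE (v, x) in distr M borel (\<lambda>\<omega>. (V t0 \<omega>, X t0 \<omega>)). v > 0 \<longrightarrow> x < 0 \<longrightarrow>
      (let \<theta> = arctan (\<sigma>p * sqrt (1 - \<rho>\<^sup>2) * \<bar>x\<bar> / (\<sigma>m * v + \<sigma>p * \<rho> * x))
       in measure (K (v, x)) {(\<tau>V, \<tau>X). \<tau>V < \<tau>X} = \<theta> / \<alpha> \<and> measure (K (v, x)) {(\<tau>V, \<tau>X). \<tau>X < \<tau>V} =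
           (\<alpha> - \<theta>) / \<alpha>)"
proof -
  define Y where "Y \<omega> = (V t0 \<omega>, X t0 \<omega>)" for \<omega>
  define Z where "Z \<omega> = (hit_zero t0 V \<omega>, hit_zero t0 X \<omega>)" for \<omega>
  define \<nu> where "\<nu> = distr M borel Y"
  have Ym [measurable]: "Y \<in> borel_measurable M" and Zm [measurable]: "Z \<in> borel_measurable M"
    and Km: "K \<in> measurable borel (prob_algebra borel)"
    and KE: "\<And>A B. A \<in> sets borel \<Longrightarrow> B \<in> sets borel \<Longrightarrow>
      emeasure M {\<omega> \<in> space M. Y \<omega> \<in> A \<and> Z \<omega> \<in> B} = (\<integral>\<^sup>+y\<in>A. emeasure (K y) B \<partial>\<nu>)"
    using K unfolding regular_cond_distr_def Y_def[symmetric] Z_def[symmetric] \<nu>_def by auto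
  interpret \<nu>: prob_space \<nu> unfolding \<nu>_def by (rule prob_space_distr[OF Ym])
  have \<nu>s [measurable_cong, simp]: "sets \<nu> = sets borel" by (simp add: \<nu>_def)
  have Kp: "prob_space (K y)" "sets (K y) = sets borel" for y
    using measurable_space[OF Km, of y] by (auto simp: space_prob_algebra)
  define B1 B2 :: "(ereal \<times> ereal) set" where "B1 = {(\<tau>V, \<tau>X). \<tau>V < \<tau>X}"
      and "B2 = {(\<tau>V, \<tau>X). \<tau>X < \<tau>V}"
  have B [measurable]: "B1 \<in> sets borel" "B2 \<in> sets borel"
  proof -
    have "open {p :: ereal \<times> ereal. fst p < snd p}" "open {p :: ereal \<times> ereal. snd p < fst p}"
      by (intro open_Collect_less continuous_intros)+
    moreover have "B1 = {p. fst p < snd p}" "B2 = {p. snd p < fst p}" by (auto simp: B1_def B2_def)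
    ultimately show "B1 \<in> sets borel" "B2 \<in> sets borel" by auto
  qed
  have KBm [measurable]: "(\<lambda>y. emeasure (K y) B) \<in> borel_measurable borel" if "B \<in> sets borel" for B
    by (rule measurable_emeasure_kernel[OF measurable_prob_algebraD[OF Km] that])
  define Q where "Q = {y :: real \<times> real. fst y > 0 \<and> snd y < 0}"
  have [measurable]: "Q \<in> sets borel"
  proof -
    have "open Q" unfolding Q_def by (intro open_Collect_conj open_Collect_less continuous_intros)
    then show ?thesis by simp
  qed
  have \<alpha>: "\<alpha> = arctan (1 / cot)" using rs \<rho> by (simp add: \<alpha>_def cot_def rs_def)
  have \<alpha>0: "\<alpha> > 0" unfolding \<alpha> using cot by simp
  define \<Theta> where "\<Theta> y = Im (Ln (coord y))" for y
  have \<Theta>: "\<Theta> y \<ge> 0" if "y \<in> Q" for y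
    using Im_Ln_wedge[OF cot, of "coord y"] wedge_dist_coord[of y] that by (simp add: Q_def \<Theta>_def)
  define \<Theta>' where "\<Theta>' y = (if Re (coord y) > 0 then Im (Ln (coord y)) else 0)" for y
  have \<Theta>'m [measurable]: "\<Theta>' \<in> borel_measurable borel"
    unfolding \<Theta>'_def[abs_def]
      using measurable_compose[OF coord_measurable(1) measurable_Im_Ln_right] .
  have \<Theta>'_eq: "\<Theta>' y = \<Theta> y" if "y \<in> Q" for y
    using Im_Ln_wedge[OF cot, of "coord y"] wedge_dist_coord[of y] that
      by (simp add: Q_def \<Theta>_def \<Theta>'_def)
  have hit_ind: "indicator {\<omega>. hit_zero t0 V \<omega> < hit_zero t0 X \<omega>} \<omega> = (indicator B1 (Z \<omega>) :: real)"
      for \<omega>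
    by (auto simp: B1_def Z_def indicator_def)
  have int_Y: "(\<integral>\<^sup>+y\<in>A. f y \<partial>\<nu>) = (\<integral>\<^sup>+\<omega>. f (Y \<omega>) * indicator A (Y \<omega>) \<partial>M)"
    if [measurable]: "f \<in> borel_measurable borel" "A \<in> sets borel" for f A
    unfolding \<nu>_def by (subst nn_integral_distr) auto
  have em: "emeasure M {\<omega> \<in> space M. Y \<omega> \<in> A \<and> Z \<omega> \<in> B} =
      (\<integral>\<^sup>+\<omega>. indicator A (Y \<omega>) * indicator B (Z \<omega>) \<partial>M)"
    if [measurable]: "A \<in> sets borel" "B \<in> sets borel" for A B
  proof -
    have "{\<omega> \<in> space M. Y \<omega> \<in> A \<and> Z \<omega> \<in> B} \<in> events" by measurable
    from nn_integral_indicator[OF this] have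
      "emeasure M {\<omega> \<in> space M. Y \<omega> \<in> A \<and> Z \<omega> \<in> B} = (\<integral>\<^sup>+\<omega>. indicator {\<omega> \<in> space M. Y \<omega> \<in> A \<and>
          Z \<omega> \<in> B} \<omega> \<partial>M)"
      by (rule sym)
    also have "\<dots> = (\<integral>\<^sup>+\<omega>. indicator A (Y \<omega>) * indicator B (Z \<omega>) \<partial>M)"
      by (intro nn_integral_cong) (auto simp: indicator_def)
    finally show ?thesis .
  qed
  have 1: "AE y in \<nu>. indicator Q y * emeasure (K y) B1 = indicator Q y * ennreal (\<Theta>' y / \<alpha>)"
  proof (rule \<nu>.density_unique)
    show "density \<nu> (\<lambda>y. indicator Q y * emeasure (K y) B1) =
        density \<nu> (\<lambda>y. indicator Q y * ennreal (\<Theta>' y / \<alpha>))"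
    proof (rule measure_eqI)
      fix A assume "A \<in> sets (density \<nu> (\<lambda>y. indicator Q y * emeasure (K y) B1))"
      then have A [measurable]: "A \<in> sets borel" by simp
      have AQ [measurable]: "A \<inter> Q \<in> sets borel" by measurable
      have "emeasure (density \<nu> (\<lambda>y. indicator Q y * emeasure (K y) B1)) A =
          (\<integral>\<^sup>+y\<in>A \<inter> Q. emeasure (K y) B1 \<partial>\<nu>)"
        by (subst emeasure_density) (auto intro!: nn_integral_cong simp: indicator_def)
      also have "\<dots> = (\<integral>\<^sup>+\<omega>. indicator (A \<inter> Q) (Y \<omega>) * indicator B1 (Z \<omega>) \<partial>M)"
        by (simp only: KE[OF AQ B(1), symmetric] em[OF AQ B(1)])
      also have "\<dots> = (\<integral>\<^sup>+\<omega>. ennreal (1 / \<alpha>) * (indicator (A \<inter> Q) (Y \<omega>) * ennreal (arctan (1 / cot) *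
          indicator B1 (Z \<omega>))) \<partial>M)"
        using \<alpha>0 by (intro nn_integral_cong) (auto simp: indicator_def \<alpha>[symmetric]
            ennreal_mult[symmetric] simp flip: ennreal_1)
      also have "\<dots> = ennreal (1 / \<alpha>) * (\<integral>\<^sup>+\<omega>. indicator (A \<inter> Q) (Y \<omega>) * ennreal (arctan (1 / cot) *
          indicator B1 (Z \<omega>)) \<partial>M)"
        by (rule nn_integral_cmult) measurable
      also have "(\<integral>\<^sup>+\<omega>. indicator (A \<inter> Q) (Y \<omega>) * ennreal (arctan (1 / cot) * indicator B1 (Z \<omega>))
          \<partial>M) =
        (\<integral>\<^sup>+\<omega>. indicator (A \<inter> Q) (Y \<omega>) * ennreal (\<Theta> (Y \<omega>)) \<partial>M)"
        using angle_identity[OF AQ] unfolding hit_ind Y_def[symmetric] \<Theta>_def[symmetric]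
          by (simp add: Q_def)
      also have "\<dots> = (\<integral>\<^sup>+\<omega>. indicator (A \<inter> Q) (Y \<omega>) * ennreal (\<Theta>' (Y \<omega>)) \<partial>M)"
        by (intro nn_integral_cong) (auto simp: indicator_def \<Theta>'_eq)
      also have "ennreal (1 / \<alpha>) * \<dots> =
          (\<integral>\<^sup>+\<omega>. ennreal (1 / \<alpha>) * (indicator (A \<inter> Q) (Y \<omega>) * ennreal (\<Theta>' (Y \<omega>))) \<partial>M)"
        by (rule nn_integral_cmult[symmetric]) measurable
      also have "\<dots> = (\<integral>\<^sup>+\<omega>. ennreal (\<Theta>' (Y \<omega>) / \<alpha>) * indicator (A \<inter> Q) (Y \<omega>) \<partial>M)"
        using \<alpha>0 \<Theta> by (intro nn_integral_cong) (auto simp: indicator_def \<Theta>'_eq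
            ennreal_mult[symmetric])
      also have "\<dots> = (\<integral>\<^sup>+y\<in>A \<inter> Q. ennreal (\<Theta>' y / \<alpha>) \<partial>\<nu>)" by (rule int_Y[symmetric]) measurable
      also have "\<dots> = emeasure (density \<nu> (\<lambda>y. indicator Q y * ennreal (\<Theta>' y / \<alpha>))) A"
        by (subst emeasure_density) (auto intro!: nn_integral_cong simp: indicator_def)
      finally show "emeasure (density \<nu> (\<lambda>y. indicator Q y * emeasure (K y) B1)) A =
        emeasure (density \<nu> (\<lambda>y. indicator Q y * ennreal (\<Theta>' y / \<alpha>))) A" .
    qed simp
  qed measurable
  have 2: "AE y in \<nu>. indicator Q y * (emeasure (K y) B1 + emeasure (K y) B2) = indicator Q y"
  proof (rule \<nu>.density_unique)
    show "density \<nu> (\<lambda>y. indicator Q y * (emeasure (K y) B1 + emeasure (K y) B2)) =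
        density \<nu> (indicator Q)"
    proof (rule measure_eqI)
      fix A assume "A \<in> sets (density \<nu> (\<lambda>y. indicator Q y * (emeasure (K y) B1 +
          emeasure (K y) B2)))"
      then have A [measurable]: "A \<in> sets borel" by simp
      have AQ [measurable]: "A \<inter> Q \<in> sets borel" by measurable
      have "emeasure (density \<nu> (\<lambda>y. indicator Q y * (emeasure (K y) B1 + emeasure (K y) B2))) A =
        (\<integral>\<^sup>+y. emeasure (K y) B1 * indicator (A \<inter> Q) y +
            emeasure (K y) B2 * indicator (A \<inter> Q) y \<partial>\<nu>)"
        by (subst emeasure_density) (auto intro!: nn_integral_cong simp: indicator_def)
      also have "\<dots> = (\<integral>\<^sup>+y\<in>A \<inter> Q. emeasure (K y) B1 \<partial>\<nu>) + (\<integral>\<^sup>+y\<in>A \<inter> Q. emeasure (K y) B2 \<partial>\<nu>)"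
        by (rule nn_integral_add) measurable
      also have "\<dots> = (\<integral>\<^sup>+\<omega>. indicator (A \<inter> Q) (Y \<omega>) * indicator B1 (Z \<omega>) \<partial>M) +
          (\<integral>\<^sup>+\<omega>. indicator (A \<inter> Q) (Y \<omega>) * indicator B2 (Z \<omega>) \<partial>M)"
        by (simp only: KE[OF AQ B(1), symmetric] KE[OF AQ B(2), symmetric] em[OF AQ B(1)] em[OF AQ
            B(2)])
      also have "\<dots> = (\<integral>\<^sup>+\<omega>. indicator (A \<inter> Q) (Y \<omega>) * indicator B1 (Z \<omega>) +
          indicator (A \<inter> Q) (Y \<omega>) * indicator B2 (Z \<omega>) \<partial>M)"
        by (rule nn_integral_add[symmetric]) measurable
      also have "\<dots> = (\<integral>\<^sup>+\<omega>. 1 * indicator (A \<inter> Q) (Y \<omega>) \<partial>M)"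
      proof (rule nn_integral_cong_AE)
        show "AE \<omega> in M. indicator (A \<inter> Q) (Y \<omega>) * indicator B1 (Z \<omega>) +
            indicator (A \<inter> Q) (Y \<omega>) * indicator B2 (Z \<omega>) =
          (1 * indicator (A \<inter> Q) (Y \<omega>) :: ennreal)"
          using compare_hitting
        proof eventually_elim
          case (elim \<omega>)
          show ?case
          proof (cases "Y \<omega> \<in> A \<inter> Q")
            case True
            then have "X t0 \<omega> < 0" by (simp add: Q_def Y_def)
            with elim show ?thesis using True
              by (cases "(\<omega>, \<omega>) \<in> PT.hits") (auto simp: B1_def B2_def Z_def indicator_def)
          qed simp
        qed
      qed
      also have "\<dots> = (\<integral>\<^sup>+y\<in>A \<inter> Q. 1 \<partial>\<nu>)" by (rule int_Y[symmetric]) measurable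
      also have "\<dots> = emeasure (density \<nu> (indicator Q)) A"
        by (subst emeasure_density) (auto intro!: nn_integral_cong simp: indicator_def)
      finally show "emeasure (density \<nu> (\<lambda>y. indicator Q y * (emeasure (K y) B1 +
          emeasure (K y) B2))) A =
        emeasure (density \<nu> (indicator Q)) A" .
    qed simp
  qed measurable
  from 1 2 have "AE y in \<nu>. y \<in> Q \<longrightarrow> measure (K y) B1 = \<Theta> y / \<alpha> \<and> measure (K y) B2 = (\<alpha> - \<Theta> y) / \<alpha>"
  proof eventually_elim
    case (elim y)
    show ?case
    proof
      assume y: "y \<in> Q"
      interpret Ky: prob_space "K y" by (rule Kp)
      have "ennreal (measure (K y) B1) = ennreal (\<Theta> y / \<alpha>)"
        using elim(1) y by (simp add: Ky.emeasure_eq_measure \<Theta>'_eq)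
      then have m1: "measure (K y) B1 = \<Theta> y / \<alpha>" using \<Theta>[OF y] \<alpha>0 by simp
      have "ennreal (measure (K y) B1 + measure (K y) B2) = ennreal 1"
        using elim(2) y by (simp add: Ky.emeasure_eq_measure ennreal_plus)
      then have "measure (K y) B1 + measure (K y) B2 = 1" by (subst (asm) ennreal_inj) auto
      then show "measure (K y) B1 = \<Theta> y / \<alpha> \<and> measure (K y) B2 = (\<alpha> - \<Theta> y) / \<alpha>"
        using m1 \<alpha>0 by (simp add: diff_divide_distrib)
    qed
  qed
  then show ?thesis unfolding \<nu>_def Y_def[abs_def]
  proof eventually_elim
    case (elim y)
    obtain v x where y: "y = (v, x)" by (cases y)
    show ?case unfolding y prod.case
    proof (intro impI)
      assume vx: "v > 0" "x < 0"
      then have "y \<in> Q" by (simp add: Q_def y)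
      with elim angle_coord[OF vx] show "let \<theta> = arctan (\<sigma>p * sqrt (1 - \<rho>\<^sup>2) * \<bar>x\<bar> / (\<sigma>m * v +
          \<sigma>p * \<rho> * x))
       in measure (K (v, x)) {(\<tau>V, \<tau>X). \<tau>V < \<tau>X} = \<theta> / \<alpha> \<and> measure (K (v, x)) {(\<tau>V, \<tau>X). \<tau>X < \<tau>V} =
           (\<alpha> - \<theta>) / \<alpha>"
        by (simp add: Let_def y B1_def B2_def \<Theta>_def)
    qed
  qed
qed

end

lemma correlation_bounds:
  fixes a b lam0 lam1 mu0 mu1 :: real
  assumes ab: "a > 1" "b > 1" "a + b > a * b" and pos: "lam0 > 0" "mu0 > 0"
    and eq: "a * lam0 = b * mu0" and lam1: "lam1 = (a - 1) * lam0" and mu1: "mu1 = (b - 1) * mu0"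
  defines "sp \<equiv> sqrt (2 * (lam0 + b * lam1))" and "sm \<equiv> sqrt (2 * (mu0 + a * mu1))"
  defines "\<rho> \<equiv> - (2 * (lam1 + mu1) / (sp * sm))"
  shows "sp > 0" "sm > 0" "-1 < \<rho>" "\<rho> < 0"
proof -
  define p q where "p = a - 1" and "q = b - 1"
  have pq: "p > 0" "q > 0" "p * q < 1" using ab by (auto simp: p_def q_def algebra_simps)
  have a: "a = 1 + p" and b: "b = 1 + q" by (auto simp: p_def q_def)
  have l: "lam1 > 0" "mu1 > 0" using ab pos lam1 mu1 by auto
  show sp: "sp > 0" and sm: "sm > 0" using l pos ab
    by (auto simp: sp_def sm_def intro!: add_pos_pos)
  show "\<rho> < 0" using l sp sm by (simp add: \<rho>_def)
  define u w where "u = p + p * q" and "w = q + p * q"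
  have uw: "u > 0" "w > 0" using pq by (auto simp: u_def w_def intro!: add_pos_pos)
  define k where "k = mu0 / a"
  have k: "mu0 = a * k" "lam0 = b * k" "k > 0" using eq ab pos by (auto simp: k_def field_simps)
  have s1: "lam1 + mu1 = k * (u + w)" unfolding lam1 mu1 k(1,2) a b u_def w_def
    by (simp add: algebra_simps)
  have s2: "lam0 + b * lam1 = k * (b * (1 + u))" unfolding lam1 k(1,2) a b u_def
    by (simp add: algebra_simps)
  have s3: "mu0 + a * mu1 = k * (a * (1 + w))" unfolding mu1 k(1,2) a b w_def
    by (simp add: algebra_simps)
  have ab1: "a * b > u + w" using pq unfolding a b u_def w_def by (simp add: algebra_simps)
  have "(1 + u) * (1 + w) > u + w" using uw by (simp add: algebra_simps add_pos_pos)
  with ab1 have "(u + w) * (u + w) < (a * b) * ((1 + u) * (1 + w))"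
    using uw by (intro mult_strict_mono) auto
  then have *: "k * k * ((u + w) * (u + w)) < k * k * ((a * b) * ((1 + u) * (1 + w)))"
    using k by (intro mult_strict_left_mono) auto
  have "(2 * (lam1 + mu1))\<^sup>2 < (2 * (lam0 + b * lam1)) * (2 * (mu0 + a * mu1))"
  proof -
    have "(2 * (k * (u + w)))\<^sup>2 = 4 * (k * k * ((u + w) * (u + w)))" by (simp add: power2_eq_square)
    moreover have "(2 * (k * (b * (1 + u)))) * (2 * (k * (a * (1 + w)))) =
        4 * (k * k * ((a * b) * ((1 + u) * (1 + w))))"
      by (simp only: mult_ac)
    ultimately show "(2 * (lam1 + mu1))\<^sup>2 < (2 * (lam0 + b * lam1)) * (2 * (mu0 + a * mu1))"
      unfolding s1 s2 s3 using * by linarith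
  qed
  also have "\<dots> = (sp * sm)\<^sup>2" using l pos ab
    by (simp add: sp_def sm_def power_mult_distrib add_nonneg_nonneg less_imp_le)
  finally have "2 * (lam1 + mu1) < sp * sm" by (rule power_less_imp_less_base) (use sp sm in simp)
  then show "-1 < \<rho>" using sp sm by (simp add: \<rho>_def divide_less_eq)
qed

theorem theorem7p2:
  fixes a b lam0 lam1 lam2 mu0 mu1 mu2 \<theta>b :: real
    and \<sigma>p \<sigma>m \<rho> \<kappa>L \<alpha> t0 :: real
    and M :: "'a measure"
    and B G X V :: "real \<Rightarrow> 'a \<Rightarrow> real"
    and L R :: "nat \<Rightarrow> 'a \<Rightarrow> real"
    and C :: "nat \<Rightarrow> real \<Rightarrow> 'a \<Rightarrow> real"
    and K :: "real \<times> real \<Rightarrow> (ereal \<times> ereal) measure"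
  assumes "a > 1" "b > 1" "a + b > a * b"
    and "lam0 > 0" "lam1 > 0" "lam2 > 0" "mu0 > 0" "mu1 > 0" "mu2 > 0"
    and "a * lam0 = b * mu0"
    and "lam1 = (a - 1) * lam0" "lam2 = (a + b - a * b) * lam0"
    and "mu1 = (b - 1) * mu0" "mu2 = (a + b - a * b) * mu0"
    and "\<theta>b > 0"
    and \<sigma>p: "\<sigma>p = sqrt (2 * (lam0 + b * lam1))"
    and \<sigma>m: "\<sigma>m = sqrt (2 * (mu0 + a * mu1))"
    and \<rho>: "\<rho> = - (2 * (lam1 + mu1) / (\<sigma>p * \<sigma>m))"
    and \<kappa>L: "\<kappa>L = lam2 * mu1 / (\<theta>b * lam1)"
    and \<alpha>: "\<alpha> = arctan (- (sqrt (1 - \<rho>\<^sup>2) / \<rho>))"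
    and M: "prob_space M"
    and B: "brownian_motion M 1 B"
    and G: "G = two_speed \<sigma>p \<sigma>m B"
    and X: "X = (\<lambda>t \<omega>. min (G t \<omega>) 0)"
    and LR: "neg_excursion_enumeration M G L R"
    and C: "\<And>k. brownian_motion M ((1 - \<rho>\<^sup>2) * \<sigma>p\<^sup>2) (C k)"
    and indep: "prob_space.indep_vars M (\<lambda>_. path_space)
                  (case_nat (sample_path G) (\<lambda>k. sample_path (C k))) (UNIV :: nat set)"
    and V: "V = bid_process \<kappa>L (\<rho> * \<sigma>p / \<sigma>m) G L R C"
    and t0: "t0 > 0"
    and K: "regular_cond_distr M borel (\<lambda>\<omega>. (V t0 \<omega>, X t0 \<omega>))
              borel (\<lambda>\<omega>. (hit_zero t0 V \<omega>, hit_zero t0 X \<omega>)) K"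
  shows "0 < \<alpha> \<and> \<alpha> < pi / 2 \<and>
    (AE (v1, x1) in distr M borel (\<lambda>\<omega>. (V t0 \<omega>, X t0 \<omega>)).
       v1 > 0 \<longrightarrow> x1 < 0 \<longrightarrow>
       (let \<theta>0 = arctan (\<sigma>p * sqrt (1 - \<rho>\<^sup>2) * \<bar>x1\<bar> / (\<sigma>m * v1 + \<sigma>p * \<rho> * x1))
        in measure (K (v1, x1)) {(\<tau>V, \<tau>X). \<tau>V < \<tau>X} = \<theta>0 / \<alpha> \<and>
           measure (K (v1, x1)) {(\<tau>V, \<tau>X). \<tau>X < \<tau>V} = (\<alpha> - \<theta>0) / \<alpha>))"
proof -
  interpret prob_space M by (rule M)
  note bounds = correlation_bounds[OF \<open>a > 1\<close> \<open>b > 1\<close> \<open>a + b > a * b\<close> \<open>lam0 > 0\<close> \<open>mu0 > 0\<close>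
      \<open>a * lam0 = b * mu0\<close> \<open>lam1 = (a - 1) * lam0\<close> \<open>mu1 = (b - 1) * mu0\<close>, folded \<sigma>p \<sigma>m, folded \<rho>]
  have \<kappa>: "\<kappa>L > 0" using \<open>lam1 > 0\<close> \<open>lam2 > 0\<close> \<open>mu1 > 0\<close> \<open>\<theta>b > 0\<close> by (simp add: \<kappa>L)
  interpret bid_ask M \<sigma>p \<sigma>m \<rho> \<kappa>L t0 B L R C
    using bounds \<kappa> t0 B LR C indep by unfold_locales (auto simp: G)
  have "\<rho>\<^sup>2 < 1" using bounds by (simp add: abs_square_less_1)
  then have "- (sqrt (1 - \<rho>\<^sup>2) / \<rho>) > 0" using bounds(4) by (simp add: divide_pos_neg)
  then have "0 < \<alpha> \<and> \<alpha> < pi / 2" using arctan_ubound by (simp add: \<alpha> del: neg_0_less_iff_less)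
  moreover note conditional_exit_probability[OF K[unfolded V X G], folded \<alpha>]
  ultimately show ?thesis unfolding V X G by blast
qed

end
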